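(* Let $X$ be a compact connected manifold without boundary of real dimension $2n$, with an almost complex structure $J$ (not necessarily integrable), and let $g$ be an almost Hermitian metric on $X$ with associated form $\omega$. Let $p>2n$, $\gamma>0$, $K>0$. Then there is a constant $C$ depending only on $n,\omega,\gamma,p,K$ with the following property. Let $f:\Gamma\to\mathbb{R}_+$ satisfy the structural conditions (1)--(4) (listed in the context) with constant $\gamma$, let $F$ be a smooth real function on $X$ with $\|e^{2nF}\|_{L^1(\log L)^p(X,\omega^n)}\le K$, and let $\varphi\in C^\infty(X)$ be a solution of $$f(\lambda[h_\varphi])=e^F,\qquad\lambda[h_\varphi]\in\Gamma\quad\text{on }X,$$ normalized by $\sup_X\varphi=0$. Then $$\sup_X|\varphi|\le C.$$
   Context: $\mathbb{R}_+=(0,\infty)$. Structural conditions on $f:\Gamma\to\mathbb{R}_+$: (1) $\Gamma\subset\mathbb{R}^n$ is an (open) cone, symmetric under permutations of the coordinates, with $\Gamma_n\subset\Gamma\subset\Gamma_1$, where $\Gamma_k=\{\lambda\in\mathbb{R}^n:\sigma_j(\lambda)>0 \text{ for } 1\le j\le k\}$ and $\sigma_j$ is the $j$-th elementary symmetric polynomial; (2) $f$ is a ($C^1$) symmetric function of $\lambda=(\lambda_1,\dots,\lambda_n)\in\Gamma$, homogeneous of degree one; (3) $\partial f/\partial\lambda_j>0$ on $\Gamma$ for every $j$; (4) $\prod_{j=1}^n \frac{\partial f}{\partial\lambda_j}\ge\gamma$ for all $\lambda\in\Gamma$. An almost complex structure is an endomorphism $J$ of $TX$ with $J^2=-\mathrm{id}$;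 $T^{(1,0)}X$ and $T^{(0,1)}X$ are its $\sqrt{-1}$ and $-\sqrt{-1}$ eigenbundles in $T_{\mathbb{C}}X$. An almost Hermitian metric is a Riemannian metric $g$ with $g(JY,JZ)=g(Y,Z)$; its associated real positive $(1,1)$-form is $\omega(Y,Z)=g(JY,Z)$. For a smooth function $\varphi$, $$i\partial\bar\partial\varphi=\tfrac12\,(d(Jd\varphi))^{(1,1)},$$ the $(1,1)$-part of the 2-form $\frac12 d(Jd\varphi)$, with the sign convention for the action of $J$ on 1-forms being the one for which this is the usual $i\partial\bar\partial\varphi$ when $J$ is integrable, i.e. $(J\alpha)(Y)=-\alpha(JY)$. Put $\omega_\varphi=\omega+i\partial\bar\partial\varphi$; $h_\varphi=\omega^{-1}\cdot\omega_\varphi$ is the endomorphism of $T^{(1,0)}X$ determined by $\omega_\varphi$ and $\omega$, and $\lambda[h_\varphi]$ is the unordered vector of its $n$ eigenvalues. $\|e^{2nF}\|_{L^1(\log L)^p(X,\omega^n)}=\int_X(1+|F|^p)\,e^{2nF}\,\omega^n$. *)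

theory Defs
  imports "HOL-Analysis.Analysis"
begin

section \<open>Smooth functions between vector spaces\<close>

text \<open>Only used on open sets, where \<^term>\<open>at x\<close> is the right filter.\<close>

fun Ck_on :: "nat \<Rightarrow> ('e::real_normed_vector \<Rightarrow> 'b::real_normed_vector) \<Rightarrow> 'e set \<Rightarrow> bool" where
  "Ck_on 0 f U \<longleftrightarrow> continuous_on U f"
| "Ck_on (Suc k) f U \<longleftrightarrow>
     (\<forall>x\<in>U. f differentiable (at x)) \<and> (\<forall>v. Ck_on k (\<lambda>x. frechet_derivative f (at x) v) U)"

definition smooth_on :: "('e::real_normed_vector \<Rightarrow> 'b::real_normed_vector) \<Rightarrow> 'e set \<Rightarrow> bool" where
  "smooth_on f U \<longleftrightarrow> (\<forall>k. Ck_on k f U)"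


section \<open>Manifolds of real dimension \<open>2n\<close>\<close>

text \<open>
  The complex dimension \<open>n\<close> is \<open>CARD('n)\<close>; the model space \<open>real ^ ('n + 'n)\<close> is
  \<open>\<real>\<^sup>2\<^sup>n\<close>. A chart is a pair of its domain and the coordinate map, whose values outside
  the domain are irrelevant.
\<close>

type_synonym 'n coords = "real ^ ('n + 'n)"
type_synonym ('a, 'n) chart = "'a set \<times> ('a \<Rightarrow> 'n coords)"

definition chart_dom :: "('a, 'n::finite) chart \<Rightarrow> 'a set" where
  "chart_dom c = fst c"

definition chart_map :: "('a, 'n::finite) chart \<Rightarrow> 'a \<Rightarrow> 'n coords" where
  "chart_map c = snd c"

definition chart_img :: "('a, 'n::finite) chart \<Rightarrow> 'n coords set" where
  "chart_img c = chart_map c ` chart_dom c"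

definition chart_inv :: "('a, 'n::finite) chart \<Rightarrow> 'n coords \<Rightarrow> 'a" where
  "chart_inv c = inv_into (chart_dom c) (chart_map c)"

definition transition :: "('a, 'n::finite) chart \<Rightarrow> ('a, 'n) chart \<Rightarrow> 'n coords \<Rightarrow> 'n coords" where
  "transition c c' = chart_map c' \<circ> chart_inv c"

definition is_chart :: "'a topology \<Rightarrow> ('a, 'n::finite) chart \<Rightarrow> bool" where
  "is_chart X c \<longleftrightarrow>
     openin X (chart_dom c) \<and> open (chart_img c) \<and>
     homeomorphic_map (subtopology X (chart_dom c)) (top_of_set (chart_img c)) (chart_map c)"

definition smooth_atlas :: "'a topology \<Rightarrow> ('a, 'n::finite) chart set \<Rightarrow> bool" where
  "smooth_atlas X A \<longleftrightarrow>
     (\<forall>c\<in>A. is_chart X c) \<and> (\<Union>c\<in>A. chart_dom c) = topspace X \<and>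
     (\<forall>c\<in>A. \<forall>c'\<in>A. smooth_on (transition c c') (chart_map c ` (chart_dom c \<inter> chart_dom c')))"

definition compact_connected_manifold :: "'a topology \<Rightarrow> ('a, 'n::finite) chart set \<Rightarrow> bool" where
  "compact_connected_manifold X A \<longleftrightarrow>
     topspace X \<noteq> {} \<and> Hausdorff_space X \<and> second_countable X \<and>
     compact_space X \<and> connected_space X \<and> smooth_atlas X A"

definition smooth_function :: "('a, 'n::finite) chart set \<Rightarrow> ('a \<Rightarrow> real) \<Rightarrow> bool" where
  "smooth_function A u \<longleftrightarrow> (\<forall>c\<in>A. smooth_on (u \<circ> chart_inv c) (chart_img c))"


section \<open>Almost Hermitian structures\<close>

text \<open>
  Tensor fields on the manifold are given by their coordinate expressions: for each chart \<open>c\<close>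
  of the atlas and each \<open>y\<close> in \<open>chart_img c\<close>, the tensor \<open>J c y\<close> (or \<open>g c y\<close>) on the tangent
  space at the point with coordinates \<open>y\<close>, identified by the chart with \<open>\<real>\<^sup>2\<^sup>n\<close>. The
  expressions in two charts are related by the differential of the transition map.
\<close>

type_synonym ('a, 'n) endo_field =
  "('a, 'n) chart \<Rightarrow> 'n coords \<Rightarrow> 'n coords \<Rightarrow> 'n coords"
type_synonym ('a, 'n) bilin_field =
  "('a, 'n) chart \<Rightarrow> 'n coords \<Rightarrow> 'n coords \<Rightarrow> 'n coords \<Rightarrow> real"

definition almost_complex_structure ::
    "('a, 'n::finite) chart set \<Rightarrow> ('a, 'n) endo_field \<Rightarrow> bool" where
  "almost_complex_structure A J \<longleftrightarrow>
     (\<forall>c\<in>A. \<forall>y\<in>chart_img c. linear (J c y) \<and> (\<forall>v. J c y (J c y v) = - v)) \<and>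
     (\<forall>c\<in>A. \<forall>v. smooth_on (\<lambda>y. J c y v) (chart_img c)) \<and>
     (\<forall>c\<in>A. \<forall>c'\<in>A. \<forall>x\<in>chart_dom c \<inter> chart_dom c'. \<forall>v.
        let T = frechet_derivative (transition c c') (at (chart_map c x))
        in J c' (chart_map c' x) (T v) = T (J c (chart_map c x) v))"

definition riemannian_metric ::
    "('a, 'n::finite) chart set \<Rightarrow> ('a, 'n) bilin_field \<Rightarrow> bool" where
  "riemannian_metric A g \<longleftrightarrow>
     (\<forall>c\<in>A. \<forall>y\<in>chart_img c.
        bilinear (g c y) \<and> (\<forall>v w. g c y v w = g c y w v) \<and> (\<forall>v. v \<noteq> 0 \<longrightarrow> g c y v v > 0)) \<and>
     (\<forall>c\<in>A. \<forall>v w. smooth_on (\<lambda>y. g c y v w) (chart_img c)) \<and>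
     (\<forall>c\<in>A. \<forall>c'\<in>A. \<forall>x\<in>chart_dom c \<inter> chart_dom c'. \<forall>v w.
        let T = frechet_derivative (transition c c') (at (chart_map c x))
        in g c' (chart_map c' x) (T v) (T w) = g c (chart_map c x) v w)"

definition almost_hermitian_metric ::
    "('a, 'n::finite) chart set \<Rightarrow> ('a, 'n) endo_field \<Rightarrow> ('a, 'n) bilin_field \<Rightarrow> bool" where
  "almost_hermitian_metric A J g \<longleftrightarrow>
     riemannian_metric A g \<and>
     (\<forall>c\<in>A. \<forall>y\<in>chart_img c. \<forall>v w. g c y (J c y v) (J c y w) = g c y v w)"

definition assoc_form ::
    "('a, 'n::finite) endo_field \<Rightarrow> ('a, 'n) bilin_field \<Rightarrow> ('a, 'n) bilin_field" where
  "assoc_form J g c y v w = g c y (J c y v) w"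


section \<open>The complexified tangent space\<close>

type_synonym 'n ccoords = "complex ^ ('n + 'n)"

definition Re_vec :: "'n::finite ccoords \<Rightarrow> 'n coords" where
  "Re_vec v = (\<chi> k. Re (v $ k))"

definition Im_vec :: "'n::finite ccoords \<Rightarrow> 'n coords" where
  "Im_vec v = (\<chi> k. Im (v $ k))"

definition cnj_vec :: "'n::finite ccoords \<Rightarrow> 'n ccoords" where
  "cnj_vec v = (\<chi> k. cnj (v $ k))"

definition complexify_endo :: "('n::finite coords \<Rightarrow> 'n coords) \<Rightarrow> 'n ccoords \<Rightarrow> 'n ccoords" where
  "complexify_endo L v = (\<chi> k. Complex (L (Re_vec v) $ k) (L (Im_vec v) $ k))"

definition complexify_form ::
    "('n::finite coords \<Rightarrow> 'n coords \<Rightarrow> real) \<Rightarrow> 'n ccoords \<Rightarrow> 'n ccoords \<Rightarrow> complex" where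
  "complexify_form B v w =
     Complex (B (Re_vec v) (Re_vec w) - B (Im_vec v) (Im_vec w))
             (B (Re_vec v) (Im_vec w) + B (Im_vec v) (Re_vec w))"

text \<open>In this section \<open>J\<close> is the almost complex structure at a single point.\<close>

definition T10 :: "('n::finite coords \<Rightarrow> 'n coords) \<Rightarrow> 'n ccoords set" where
  "T10 J = {v. complexify_endo J v = \<i> *s v}"

definition proj10 :: "('n::finite coords \<Rightarrow> 'n coords) \<Rightarrow> 'n ccoords \<Rightarrow> 'n ccoords" where
  "proj10 J v = (1/2) *s (v - \<i> *s complexify_endo J v)"

definition proj01 :: "('n::finite coords \<Rightarrow> 'n coords) \<Rightarrow> 'n ccoords \<Rightarrow> 'n ccoords" where
  "proj01 J v = (1/2) *s (v + \<i> *s complexify_endo J v)"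

definition part11 ::
    "('n::finite coords \<Rightarrow> 'n coords) \<Rightarrow> ('n ccoords \<Rightarrow> 'n ccoords \<Rightarrow> complex)
      \<Rightarrow> 'n ccoords \<Rightarrow> 'n ccoords \<Rightarrow> complex" where
  "part11 J B v w = B (proj10 J v) (proj01 J w) + B (proj01 J v) (proj10 J w)"


section \<open>The form \<open>\<omega>\<^sub>\<phi>\<close> and the endomorphism \<open>h\<^sub>\<phi>\<close>\<close>

definition J_d ::
    "('a, 'n::finite) endo_field \<Rightarrow> ('a \<Rightarrow> real) \<Rightarrow> ('a, 'n) chart
      \<Rightarrow> 'n coords \<Rightarrow> 'n coords \<Rightarrow> real" where
  "J_d J \<phi> c y v = - frechet_derivative (\<phi> \<circ> chart_inv c) (at y) (J c y v)"

text \<open>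
  Exterior derivative of a coordinate 1-form, normalised by
  \<open>d\<alpha>(Y,Z) = Y(\<alpha>(Z)) - Z(\<alpha>(Y)) - \<alpha>([Y,Z])\<close>; for the constant fields
  \<open>Y = v\<close>, \<open>Z = w\<close> the bracket vanishes.
\<close>

definition ext_deriv ::
    "('n::finite coords \<Rightarrow> 'n coords \<Rightarrow> real) \<Rightarrow> 'n coords \<Rightarrow> 'n coords \<Rightarrow> 'n coords \<Rightarrow> real" where
  "ext_deriv \<alpha> y v w =
     frechet_derivative (\<lambda>z. \<alpha> z w) (at y) v - frechet_derivative (\<lambda>z. \<alpha> z v) (at y) w"

definition i_ddbar ::
    "('a, 'n::finite) endo_field \<Rightarrow> ('a \<Rightarrow> real) \<Rightarrow> ('a, 'n) chart
      \<Rightarrow> 'n coords \<Rightarrow> 'n ccoords \<Rightarrow> 'n ccoords \<Rightarrow> complex" where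
  "i_ddbar J \<phi> c y v w =
     1/2 * part11 (J c y) (complexify_form (ext_deriv (J_d J \<phi> c) y)) v w"

definition omega_phi ::
    "('a, 'n::finite) endo_field \<Rightarrow> ('a, 'n) bilin_field \<Rightarrow> ('a \<Rightarrow> real) \<Rightarrow> ('a, 'n) chart
      \<Rightarrow> 'n coords \<Rightarrow> 'n ccoords \<Rightarrow> 'n ccoords \<Rightarrow> complex" where
  "omega_phi J g \<phi> c y v w =
     complexify_form (assoc_form J g c y) v w + i_ddbar J \<phi> c y v w"

text \<open>
  \<open>h\<^sub>\<phi> = \<omega>\<^sup>-\<^sup>1 \<cdot> \<omega>\<^sub>\<phi>\<close> on \<open>T\<^sup>1\<^sup>,\<^sup>0\<close>: the unique \<open>h\<close> with
  \<open>\<omega>(h v, cnj w) = \<omega>\<^sub>\<phi>(v, cnj w)\<close> for all \<open>v\<close>, \<open>w\<close> of type (1,0).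
\<close>

definition h_endo ::
    "('a, 'n::finite) endo_field \<Rightarrow> ('a, 'n) bilin_field \<Rightarrow> ('a \<Rightarrow> real) \<Rightarrow> ('a, 'n) chart
      \<Rightarrow> 'n coords \<Rightarrow> 'n ccoords \<Rightarrow> 'n ccoords" where
  "h_endo J g \<phi> c y v =
     (THE u. u \<in> T10 (J c y) \<and>
        (\<forall>w\<in>T10 (J c y).
           complexify_form (assoc_form J g c y) u (cnj_vec w) = omega_phi J g \<phi> c y v (cnj_vec w)))"

text \<open>
  \<open>l\<close> lists, in some order, the eigenvalues with (algebraic) multiplicity of the endomorphism
  \<open>h\<close> of the \<open>n\<close>-dimensional complex subspace \<open>V\<close>, i.e. the roots of the characteristic
  polynomial of the matrix of \<open>h\<close> in a basis of \<open>V\<close>.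
\<close>

definition eigenvalue_vector ::
    "'n::finite ccoords set \<Rightarrow> ('n ccoords \<Rightarrow> 'n ccoords) \<Rightarrow> real ^ 'n \<Rightarrow> bool" where
  "eigenvalue_vector V h l \<longleftrightarrow>
     (\<exists>(e :: 'n \<Rightarrow> 'n ccoords) (H :: complex ^ 'n ^ 'n).
        inj e \<and> vec.independent (range e) \<and> vec.span (range e) = V \<and>
        (\<forall>j. h (e j) = (\<Sum>i\<in>UNIV. H $ i $ j *s e i)) \<and>
        (\<forall>t. det (mat t - H) = (\<Prod>i\<in>UNIV. t - complex_of_real (l $ i))))"


section \<open>Integration against \<open>\<omega>\<^sup>n\<close>\<close>

text \<open>
  The \<open>n\<close>-fold wedge power of a 2-form \<open>B\<close> on \<open>\<real>\<^sup>2\<^sup>n\<close>, evaluated on the standard basis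
  in the order \<open>Inl i\<^sub>1, Inr i\<^sub>1, Inl i\<^sub>2, Inr i\<^sub>2, \<dots>\<close> (which does not depend on the
  enumeration of \<open>'n\<close>). The wedge product is normalised by \<open>(\<alpha> \<and> \<beta>)(Y,Z) =
  \<alpha>(Y)\<beta>(Z) - \<alpha>(Z)\<beta>(Y)\<close> for 1-forms.
\<close>

definition top_power :: "('n::finite coords \<Rightarrow> 'n coords \<Rightarrow> real) \<Rightarrow> real" where
  "top_power B =
     (\<Sum>\<pi> | \<pi> permutes (UNIV :: ('n + 'n) set).
        of_int (sign \<pi>) * (\<Prod>i\<in>UNIV. B (axis (\<pi> (Inl i)) 1) (axis (\<pi> (Inr i)) 1))) / 2 ^ CARD('n)"

text \<open>
  Integration of \<open>u \<omega>\<^sup>n\<close> over the manifold, oriented so that \<open>\<omega>\<^sup>n > 0\<close>, is integration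
  of \<open>u\<close> against the Borel measure that in each chart has density the absolute value of the
  coefficient of \<open>\<omega>\<^sup>n\<close>.
\<close>

definition volume_measure ::
    "'a topology \<Rightarrow> ('a, 'n::finite) chart set \<Rightarrow> ('a, 'n) endo_field \<Rightarrow> ('a, 'n) bilin_field
      \<Rightarrow> 'a measure" where
  "volume_measure X A J g =
     (THE M. sets M = sets (sigma (topspace X) {U. openin X U}) \<and>
        (\<forall>c\<in>A. \<forall>B\<in>sets M. B \<subseteq> chart_dom c \<longrightarrow>
           emeasure M B =
             (\<integral>\<^sup>+ y\<in>chart_map c ` B. ennreal \<bar>top_power (assoc_form J g c y)\<bar> \<partial>lborel)))"

text \<open>\<open>\<integral> (1 + |F|\<^sup>p) e\<^sup>2\<^sup>n\<^sup>F \<omega>\<^sup>n\<close>\<close>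

definition entropy_norm ::
    "'a topology \<Rightarrow> ('a, 'n::finite) chart set \<Rightarrow> ('a, 'n) endo_field \<Rightarrow> ('a, 'n) bilin_field
      \<Rightarrow> real \<Rightarrow> ('a \<Rightarrow> real) \<Rightarrow> ennreal" where
  "entropy_norm X A J g p F =
     (\<integral>\<^sup>+ x. ennreal ((1 + \<bar>F x\<bar> powr p) * exp (2 * real CARD('n) * F x)) \<partial>volume_measure X A J g)"


section \<open>Structural conditions on the operator\<close>

definition elem_sym :: "nat \<Rightarrow> real ^ 'n::finite \<Rightarrow> real" where
  "elem_sym j l = (\<Sum>S | S \<subseteq> UNIV \<and> card S = j. \<Prod>i\<in>S. l $ i)"

definition Gamma_cone :: "nat \<Rightarrow> (real ^ 'n::finite) set" where
  "Gamma_cone k = {l. \<forall>j. 1 \<le> j \<and> j \<le> k \<longrightarrow> elem_sym j l > 0}"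

definition permute_vec :: "('n \<Rightarrow> 'n) \<Rightarrow> real ^ 'n::finite \<Rightarrow> real ^ 'n" where
  "permute_vec \<pi> l = (\<chi> i. l $ \<pi> i)"

definition partial_deriv :: "(real ^ 'n::finite \<Rightarrow> real) \<Rightarrow> 'n \<Rightarrow> real ^ 'n \<Rightarrow> real" where
  "partial_deriv f j l = frechet_derivative f (at l) (axis j 1)"

text \<open>Cones here are open and need not contain the origin, unlike the library's \<^const>\<open>cone\<close>.\<close>

definition structural_conditions ::
    "(real ^ 'n::finite) set \<Rightarrow> (real ^ 'n \<Rightarrow> real) \<Rightarrow> real \<Rightarrow> bool" where
  "structural_conditions \<Gamma> f \<gamma> \<longleftrightarrow>
     open \<Gamma> \<and> (\<forall>l\<in>\<Gamma>. \<forall>t>0. t *\<^sub>R l \<in> \<Gamma>) \<and>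
     (\<forall>\<pi>. \<pi> permutes UNIV \<longrightarrow> (\<forall>l\<in>\<Gamma>. permute_vec \<pi> l \<in> \<Gamma>)) \<and>
     Gamma_cone CARD('n) \<subseteq> \<Gamma> \<and> \<Gamma> \<subseteq> Gamma_cone 1 \<and>
     (\<forall>l\<in>\<Gamma>. f l > 0) \<and>
     Ck_on 1 f \<Gamma> \<and>
     (\<forall>\<pi>. \<pi> permutes UNIV \<longrightarrow> (\<forall>l\<in>\<Gamma>. f (permute_vec \<pi> l) = f l)) \<and>
     (\<forall>l\<in>\<Gamma>. \<forall>t>0. f (t *\<^sub>R l) = t * f l) \<and>
     (\<forall>l\<in>\<Gamma>. \<forall>j. partial_deriv f j l > 0) \<and>
     (\<forall>l\<in>\<Gamma>. (\<Prod>j\<in>UNIV. partial_deriv f j l) \<ge> \<gamma>)"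

text \<open>
  \<open>f(\<lambda>[h\<^sub>\<phi>]) = e\<^sup>F\<close> and \<open>\<lambda>[h\<^sub>\<phi>] \<in> \<Gamma>\<close> on the whole manifold. Since \<open>\<Gamma>\<close> and \<open>f\<close> are
  symmetric, the ordering chosen for the eigenvalues does not matter.
\<close>

definition solves_equation ::
    "('a, 'n::finite) chart set \<Rightarrow> ('a, 'n) endo_field \<Rightarrow> ('a, 'n) bilin_field
      \<Rightarrow> (real ^ 'n) set \<Rightarrow> (real ^ 'n \<Rightarrow> real) \<Rightarrow> ('a \<Rightarrow> real) \<Rightarrow> ('a \<Rightarrow> real) \<Rightarrow> bool" where
  "solves_equation A J g \<Gamma> f F \<phi> \<longleftrightarrow>
     (\<forall>c\<in>A. \<forall>x\<in>chart_dom c. \<exists>l.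
        eigenvalue_vector (T10 (J c (chart_map c x))) (h_endo J g \<phi> c (chart_map c x)) l \<and>
        l \<in> \<Gamma> \<and> f l = exp (F x))"

end

theory Submission
  imports Defs
begin

text \<open>
  The argument is of Alexandrov--Bakelman--Pucci type in coordinate balls. Around a minimum point
  \<open>x\<^sub>1\<close> of \<open>\<phi>\<close>, every small slope is the gradient of \<open>\<phi> + \<epsilon>\<bar>x - x\<^sub>1\<bar>\<^sup>2\<close> at a contact point where
  \<open>D\<^sup>2\<phi> \<ge> -2\<epsilon>\<close>, so all \<open>\<lambda>\<^sub>j\<close> are positive there. Euler's relation \<open>\<Sum>\<^sub>j \<lambda>\<^sub>j \<partial>\<^sub>jf = f\<close>, the arithmetic-geometric
  mean inequality and condition (4) give \<open>\<Prod>\<^sub>j \<lambda>\<^sub>j \<le> e\<^sup>n\<^sup>F/\<gamma>\<close>, so that the gradient map has Jacobian at most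
  \<open>C e\<^sup>2\<^sup>n\<^sup>F\<close>. As \<open>e\<^sup>2\<^sup>n\<^sup>F\<close> is uniformly integrable, the set \<open>{\<phi> \<le> inf \<phi> + 1}\<close> has volume bounded below.

  At the maximum the same argument, using only \<open>\<Sum>\<^sub>j \<lambda>\<^sub>j > 0\<close> (that is, \<open>\<Gamma> \<subseteq> \<Gamma>\<^sub>1\<close>), bounds the volume of
  \<open>{\<phi> \<ge> -1}\<close> from below. The inequality \<open>\<Sum>\<^sub>j \<lambda>\<^sub>j > 0\<close> tested against \<open>\<zeta>\<^sup>2/(1 - \<phi>)\<close> moreover bounds
  \<open>D log(1 - \<phi>)\<close> locally in \<open>L\<^sup>2\<close>; by the Poincare inequality on balls and the connectedness of \<open>X\<close>, the set
  \<open>{1 - \<phi> \<ge> s}\<close> has small volume for large \<open>s\<close>. Hence it cannot contain \<open>{\<phi> \<le> inf \<phi> + 1}\<close>, which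
  bounds \<open>-inf \<phi>\<close>.
\<close>

text \<open>For a non-integrable J the form i d dbar u contains first-order terms; in a chart they
  are du applied to the field \<open>E\<close>. They are harmless on the contact set, because du is
  there the sum of a slope of size eps r and a paraboloid gradient of size 2 eps r: choosing eps
  small in terms of bounds for g, J and \<open>E\<close> makes half of g absorb them.

  The exponent 2n arises because the real Hessian has twice as many diagonal entries as there are
  \<lambda>_j: each \<lambda>_j controls two of them, so the Jacobian is bounded by the square of
  their product.

  The logarithm serves two purposes. Dividing by 1 - \<phi> >= 1 leaves the constants in the trace
  inequality independent of \<phi>, and differentiating D\<phi>/(1 - \<phi>) yields a quadratic term
  of good sign that absorbs everything linear in the gradient.

  The final constant has to precede \<Gamma>, f, F and \<phi>, while the positions of the extrema
  depend on \<phi>. Therefore X is covered by finitely many coordinate balls and a constant is found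
  for every pair of balls that may contain a maximum and a minimum point.\<close>

section \<open>Change of variables\<close>

text \<open>
  The library states the change of variables formula only for index types of class
  \<open>wellorder\<close>; \<open>wo\<close> equips an arbitrary finite index type with a wellorder.
\<close>

typedef 'a wo = "UNIV :: 'a set" morphisms un_wo mk_wo ..

lemma bij_un_wo: "bij un_wo"
  by (metis bijI' mk_wo_inverse un_wo_inject UNIV_I)

instance wo :: (finite) finite
proof
  show "finite (UNIV :: 'a wo set)"
    using bij_un_wo by (metis bij_betw_finite finite)
qed

definition wo_idx :: "'a::finite wo \<Rightarrow> nat" where
  "wo_idx = (SOME f. inj f)"

lemma inj_wo_idx: "inj wo_idx"
proof -
  have "\<exists>f::'a wo \<Rightarrow> nat. inj f"
    using finite_imp_inj_to_nat_seg[of "UNIV :: 'a wo set"] by auto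
  then show ?thesis
    unfolding wo_idx_def by (rule someI_ex)
qed

instantiation wo :: (finite) linorder
begin
definition "x \<le> y \<longleftrightarrow> wo_idx x \<le> wo_idx y"
definition "x < y \<longleftrightarrow> wo_idx x < wo_idx y"
instance
proof
  fix x y z :: "'a wo"
  show "x < y \<longleftrightarrow> x \<le> y \<and> \<not> y \<le> x"
    unfolding less_eq_wo_def less_wo_def by (rule less_le_not_le)
  show "x \<le> x"
    unfolding less_eq_wo_def by (rule order_refl)
  show "x \<le> z" if "x \<le> y" "y \<le> z"
    using that unfolding less_eq_wo_def by (rule order_trans)
  show "x = y" if "x \<le> y" "y \<le> x"
    using that unfolding less_eq_wo_def by (intro injD[OF inj_wo_idx] antisym)
  show "x \<le> y \<or> y \<le> x"
    unfolding less_eq_wo_def by (rule linear)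
qed
end

instance wo :: (finite) wellorder
proof
  fix P :: "'a wo \<Rightarrow> bool" and a
  assume *: "\<And>x. (\<And>y. y < x \<Longrightarrow> P y) \<Longrightarrow> P x"
  show "P a"
  proof (induction "wo_idx a" arbitrary: a rule: less_induct)
    case less
    show ?case
      by (rule *) (rule less, simp add: less_wo_def)
  qed
qed

text \<open>Transport along \<open>h\<close> is a sign-preserving bijection between the permutations
  of the two index types, so the two Leibniz sums agree term by term.\<close>

lemma det_reindex:
  fixes A :: "'c::comm_ring_1 ^ 'a::finite ^ 'a" and h :: "'b::finite \<Rightarrow> 'a"
  assumes h: "bij h"
  shows "det (\<chi> i j. A $ h i $ h j) = det A"
proof -
  have inv: "bij (inv h)" using h by (rule bij_imp_bij_inv)
  have *: "inv h (h x) = x" "h (inv h y) = y" for x y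
    using h by (simp_all add: bij_is_inj bij_is_surj surj_f_inv_f)
  have bb: "bij_betw (map_permutation UNIV h) {p. p permutes UNIV} {p. p permutes UNIV}"
  proof (rule bij_betw_byWitness[where f'="map_permutation UNIV (inv h)"])
    show "\<forall>a\<in>{p. p permutes UNIV}. map_permutation UNIV (inv h) (map_permutation UNIV h a) = a"
      using h inv by (auto intro!: map_permutation_compose_inv simp: * bij_betw_def)
    show "\<forall>a'\<in>{p. p permutes UNIV}. map_permutation UNIV h (map_permutation UNIV (inv h) a') = a'"
      using h inv by (auto intro!: map_permutation_compose_inv simp: * bij_betw_def)
  qed (use h inv in \<open>auto intro!: map_permutation_permutes\<close>)
  have "det A = (\<Sum>p | p permutes UNIV. of_int (sign (map_permutation UNIV h p)) *
          (\<Prod>i\<in>UNIV. A $ i $ map_permutation UNIV h p i))"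
    unfolding det_def by (rule sum.reindex_bij_betw[OF bb, symmetric])
  also have "\<dots> = (\<Sum>p | p permutes UNIV. of_int (sign p) * (\<Prod>i\<in>UNIV. A $ h i $ h (p i)))"
  proof (rule sum.cong[OF refl])
    fix p :: "'b \<Rightarrow> 'b" assume "p \<in> {p. p permutes UNIV}"
    then have p: "p permutes UNIV" by simp
    have "(\<Prod>i\<in>UNIV. A $ i $ map_permutation UNIV h p i) =
        (\<Prod>i\<in>UNIV. A $ h i $ map_permutation UNIV h p (h i))"
      by (rule prod.reindex_bij_betw[OF h, symmetric])
    also have "\<dots> = (\<Prod>i\<in>UNIV. A $ h i $ h (p i))"
      using h by (simp add: map_permutation_apply bij_is_inj)
    finally show "of_int (sign (map_permutation UNIV h p)) * (\<Prod>i\<in>UNIV. A $ i $ map_permutation UNIV h p i) =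
         of_int (sign p) * (\<Prod>i\<in>UNIV. A $ h i $ h (p i))"
      using sign_map_permutation[of h UNIV p] h p by (simp add: bij_is_inj)
  qed
  finally show ?thesis by (simp add: det_def)
qed

definition to_wo :: "real ^ 'm::finite \<Rightarrow> real ^ 'm wo" where
  "to_wo x = (\<chi> i. x $ un_wo i)"

definition of_wo :: "real ^ 'm::finite wo \<Rightarrow> real ^ 'm" where
  "of_wo x = (\<chi> i. x $ mk_wo i)"

lemma to_of_wo [simp]: "to_wo (of_wo x) = x" and of_to_wo [simp]: "of_wo (to_wo y) = y"
  by (simp_all add: to_wo_def of_wo_def vec_eq_iff mk_wo_inverse un_wo_inverse)

lemma linear_to_wo: "linear to_wo" and linear_of_wo: "linear of_wo"
  by (auto intro!: linearI simp: to_wo_def of_wo_def vec_eq_iff)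

lemma bounded_linear_to_wo: "bounded_linear to_wo" and bounded_linear_of_wo: "bounded_linear of_wo"
  by (simp_all add: linear_conv_bounded_linear[symmetric] linear_to_wo linear_of_wo)

lemma measurable_to_wo [measurable]: "to_wo \<in> borel_measurable borel"
  and measurable_of_wo [measurable]: "of_wo \<in> borel_measurable borel"
  by (auto intro!: borel_measurable_continuous_onI linear_continuous_on
      bounded_linear_to_wo bounded_linear_of_wo)

lemma prod_Basis_vec: "(\<Prod>b\<in>Basis. (x :: real ^ 'k::finite) \<bullet> b) = (\<Prod>i\<in>UNIV. x $ i)"
proof -
  have *: "(Basis :: (real ^ 'k) set) = (\<lambda>i. axis i 1) ` UNIV"
    by (auto simp: Basis_vec_def)
  show ?thesis
    unfolding * by (subst prod.reindex) (auto simp: inj_on_def axis_eq_axis inner_axis)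
qed

text \<open>Lebesgue measure is determined by its values on boxes, and relabelling coordinates maps
  a box to a box with the same edge lengths.\<close>

lemma distr_of_wo: "distr lborel borel of_wo = (lborel :: (real ^ 'm::finite) measure)"
proof (rule lborel_eqI[symmetric])
  fix l u :: "real ^ 'm" assume le: "\<And>b. b \<in> Basis \<Longrightarrow> l \<bullet> b \<le> u \<bullet> b"
  have le': "l $ i \<le> u $ i" for i
    using le[of "axis i 1"] by (auto simp: axis_in_Basis_iff inner_axis)
  have vim: "of_wo -` box l u = box (to_wo l) (to_wo u)"
    by (auto simp: mem_box_cart of_wo_def to_wo_def) (metis mk_wo_inverse UNIV_I un_wo_inverse)+
  have "emeasure (distr lborel borel of_wo) (box l u) = emeasure lborel (box (to_wo l) (to_wo u))"
    by (subst emeasure_distr) (auto simp: vim)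
  also have "\<dots> = ennreal (\<Prod>b\<in>Basis. (to_wo u - to_wo l) \<bullet> b)"
    by (rule emeasure_lborel_box) (auto simp: Basis_vec_def to_wo_def inner_axis le')
  also have "(\<Prod>b\<in>Basis. (to_wo u - to_wo l) \<bullet> b) = (\<Prod>i\<in>UNIV. (u - l) $ un_wo i)"
    by (subst prod_Basis_vec) (simp add: to_wo_def)
  also have "\<dots> = (\<Prod>i\<in>UNIV. (u - l) $ i)"
    by (rule prod.reindex_bij_betw[OF bij_un_wo])
  also have "\<dots> = (\<Prod>b\<in>Basis. (u - l) \<bullet> b)"
    by (simp only: prod_Basis_vec)
  finally show "emeasure (distr lborel borel of_wo) (box l u) = ennreal (\<Prod>b\<in>Basis. (u - l) \<bullet> b)" .
qed simp

lemma emeasure_image_le_wo: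
  fixes f :: "real ^ 'm::{finite,wellorder} \<Rightarrow> real ^ 'm::_"
  assumes S: "S \<in> sets borel" and B: "B \<in> sets borel" "B \<subseteq> f ` S"
    and der: "\<And>x. x \<in> S \<Longrightarrow> (f has_derivative f' x) (at x within S)"
    and meas: "(\<lambda>x. indicator S x * \<bar>det (matrix (f' x))\<bar>) \<in> borel_measurable borel"
  shows "emeasure lborel B \<le> (\<integral>\<^sup>+x. ennreal (indicator S x * \<bar>det (matrix (f' x))\<bar>) \<partial>lborel)"
    (is "_ \<le> ?I")
proof (cases "?I = \<infinity>")
  case False
  then have fin: "?I < \<infinity>" by (simp add: top.not_eq_extremum)
  have nn: "indicator S x * \<bar>det (matrix (f' x))\<bar> \<ge> 0" for x by simp
  obtain r where r: "r \<ge> 0" "?I = ennreal r"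
    using fin by (cases ?I) auto
  have "((\<lambda>x. indicator S x * \<bar>det (matrix (f' x))\<bar>) has_integral r) UNIV"
    by (rule nn_integral_has_integral[OF meas nn r(2) r(1)])
  moreover have "(\<lambda>x. indicator S x * \<bar>det (matrix (f' x))\<bar>) = (\<lambda>x. if x \<in> S then \<bar>det (matrix (f' x))\<bar> else 0)"
    by (auto simp: indicator_def)
  ultimately have hi: "((\<lambda>x. \<bar>det (matrix (f' x))\<bar>) has_integral r) S"
    by (simp add: has_integral_restrict_UNIV)
  have SL: "S \<in> sets lebesgue" using S by simp
  have m: "f ` S \<in> lmeasurable" "measure lebesgue (f ` S) \<le> r"
    using measurable_differentiable_image[OF SL der] measure_differentiable_image[OF SL der] hi
    by (auto simp: has_integral_iff)
  have "emeasure lborel B = emeasure lebesgue B"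
    using B by simp
  also have "\<dots> \<le> emeasure lebesgue (f ` S)"
    using B m by (intro emeasure_mono) (auto simp: fmeasurable_def)
  also have "\<dots> = ennreal (measure lebesgue (f ` S))"
    by (rule emeasure_eq_measure2[OF m(1)])
  also have "\<dots> \<le> ennreal r" using m(2) by (rule ennreal_leI)
  finally show ?thesis using r by simp
qed simp

text \<open>Conjugating f with the relabelling of coordinates preserves Lebesgue measure
  (\<open>distr_of_wo\<close>) and the determinant of the derivative
  (\<open>det_reindex\<close>).\<close>

lemma emeasure_image_le:
  fixes f :: "real ^ 'm::finite \<Rightarrow> real ^ 'm"
  assumes S: "S \<in> sets borel" and B: "B \<in> sets borel" "B \<subseteq> f ` S"
    and der: "\<And>x. x \<in> S \<Longrightarrow> (f has_derivative f' x) (at x within S)"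
    and meas: "(\<lambda>x. indicator S x * \<bar>det (matrix (f' x))\<bar>) \<in> borel_measurable borel"
  shows "emeasure lborel B \<le> (\<integral>\<^sup>+x. ennreal (indicator S x * \<bar>det (matrix (f' x))\<bar>) \<partial>lborel)"
proof -
  define S' where "S' = of_wo -` S"
  define B' where "B' = of_wo -` B"
  define F where "F = to_wo \<circ> f \<circ> of_wo"
  define F' where "F' x = to_wo \<circ> f' (of_wo x) \<circ> of_wo" for x
  have pre: "of_wo -` T = to_wo ` T" for T :: "(real ^ 'm) set"
  proof (intro equalityI subsetI)
    fix x assume "x \<in> of_wo -` T"
    then have "of_wo x \<in> T" by simp
    then have "to_wo (of_wo x) \<in> to_wo ` T" by (rule imageI)
    then show "x \<in> to_wo ` T" by simp
  qed auto
  have S'eq: "S' = to_wo ` S" and B'eq: "B' = to_wo ` B"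
    unfolding S'_def B'_def by (simp_all add: pre)
  have ofS: "of_wo ` S' = S" unfolding S'eq by force
  have b: "S' \<in> sets borel" "B' \<in> sets borel"
    unfolding S'_def B'_def using S B measurable_sets_borel[OF measurable_of_wo] by auto
  have sub: "B' \<subseteq> F ` S'"
  proof
    fix y assume "y \<in> B'"
    then obtain z where "z \<in> B" "y = to_wo z" by (auto simp: B'eq)
    then obtain x where "x \<in> S" "y = to_wo (f x)" using B by auto
    then show "y \<in> F ` S'" by (auto simp: F_def S'eq image_iff)
  qed
  have derF: "(F has_derivative F' x) (at x within S')" if "x \<in> S'" for x
  proof -
    have x: "of_wo x \<in> S" using that by (simp add: S'_def)
    have 1: "(of_wo has_derivative of_wo) (at x within S')"
      by (rule bounded_linear_imp_has_derivative[OF bounded_linear_of_wo])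
    have 2: "(f has_derivative f' (of_wo x)) (at (of_wo x) within of_wo ` S')"
      unfolding ofS by (rule der[OF x])
    have 3: "(f \<circ> of_wo has_derivative f' (of_wo x) \<circ> of_wo) (at x within S')"
      using diff_chain_within[OF 1 2] .
    have 4: "(to_wo \<circ> (f \<circ> of_wo) has_derivative to_wo \<circ> (f' (of_wo x) \<circ> of_wo)) (at x within S')"
      by (rule diff_chain_within[OF 3 bounded_linear_imp_has_derivative[OF bounded_linear_to_wo]])
    then show ?thesis by (simp add: F_def F'_def o_assoc)
  qed
  have ax: "of_wo (axis j 1) = axis (un_wo j) 1" for j :: "'m wo"
    by (auto simp: of_wo_def vec_eq_iff axis_def mk_wo_inverse un_wo_inverse)

  have detF: "det (matrix (F' x)) = det (matrix (f' (of_wo x)))" for x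
  proof -
    have "matrix (F' x) = (\<chi> i j. matrix (f' (of_wo x)) $ un_wo i $ un_wo j)"
      by (simp add: F'_def matrix_def vec_eq_iff ax to_wo_def)
    then show ?thesis using det_reindex[OF bij_un_wo] by metis
  qed
  have eq: "indicator S' x * \<bar>det (matrix (F' x))\<bar> =
      indicator S (of_wo x) * \<bar>det (matrix (f' (of_wo x)))\<bar>" for x
    by (simp add: detF S'_def indicator_def)
  have le: "emeasure lborel B' \<le> (\<integral>\<^sup>+x. ennreal (indicator S' x * \<bar>det (matrix (F' x))\<bar>) \<partial>lborel)"
    by (rule emeasure_image_le_wo[OF b sub derF]) (auto simp: eq intro!: measurable_compose[OF measurable_of_wo meas])
  have "emeasure lborel B = emeasure (distr lborel borel of_wo) B" by (simp add: distr_of_wo)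
  also have "\<dots> = emeasure lborel B'"
    using B by (subst emeasure_distr) (auto simp: B'_def)
  also note le
  also have "(\<integral>\<^sup>+x. ennreal (indicator S' x * \<bar>det (matrix (F' x))\<bar>) \<partial>lborel) =
      (\<integral>\<^sup>+x. ennreal (indicator S x * \<bar>det (matrix (f' x))\<bar>) \<partial>distr lborel borel of_wo)"
    unfolding eq by (subst nn_integral_distr) (use meas in auto)
  finally show ?thesis by (simp add: distr_of_wo)
qed

text \<open>An inequality is what a possibly non-injective g allows; for transition maps, equality
  follows by using it in both directions. Indicators are the case of
  \<open>emeasure_image_le\<close> for the part of S mapped into the set, and the general case is
  the standard induction over measurable functions.\<close>

lemma nn_integral_image_le:
  fixes g :: "real ^ 'm::finite \<Rightarrow> real ^ 'm" and \<rho> :: "real ^ 'm \<Rightarrow> ennreal"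
  assumes S: "S \<in> sets borel" and gS: "g ` S \<in> sets borel"
    and gm: "g \<in> borel_measurable (restrict_space borel S)"
    and der: "\<And>x. x \<in> S \<Longrightarrow> (g has_derivative g' x) (at x within S)"
    and meas: "(\<lambda>x. indicator S x * \<bar>det (matrix (g' x))\<bar>) \<in> borel_measurable borel"
    and \<rho>: "\<rho> \<in> borel_measurable borel"
  shows "(\<integral>\<^sup>+y\<in>g ` S. \<rho> y \<partial>lborel) \<le> (\<integral>\<^sup>+x\<in>S. \<rho> (g x) * ennreal \<bar>det (matrix (g' x))\<bar> \<partial>lborel)"
proof -
  define D where "D x = ennreal (indicator S x * \<bar>det (matrix (g' x))\<bar>)" for x
  have Dm [measurable]: "D \<in> borel_measurable borel" unfolding D_def using meas by measurable
  have comp: "(\<lambda>x. \<rho> (g x) * D x) \<in> borel_measurable borel" if \<rho>: "\<rho> \<in> borel_measurable borel" for \<rho> :: "real ^ 'm \<Rightarrow> ennreal"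
  proof -
    have "(\<lambda>x. \<rho> (g x)) \<in> borel_measurable (restrict_space borel S)"
      by (rule measurable_compose[OF gm \<rho>])
    then have "(\<lambda>x. \<rho> (g x) * indicator S x) \<in> borel_measurable borel"
      using S by (subst (asm) borel_measurable_restrict_space_iff_ennreal) auto
    then have "(\<lambda>x. (\<rho> (g x) * indicator S x) * D x) \<in> borel_measurable borel"
      by measurable
    moreover have "(\<rho> (g x) * indicator S x) * D x = \<rho> (g x) * D x" for x
      by (simp add: D_def indicator_def)
    ultimately show ?thesis by simp
  qed
  have "(\<integral>\<^sup>+y\<in>g ` S. \<rho> y \<partial>lborel) \<le> (\<integral>\<^sup>+x. \<rho> (g x) * D x \<partial>lborel)"
    using \<rho>
  proof (induction rule: borel_measurable_induct)
    case (cong f g')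
    then show ?case by (simp add: space_borel fun_eq_iff cong: nn_integral_cong)
  next
    case (set A)
    define S' where "S' = S \<inter> g -` A"
    have "g -` A \<inter> space (restrict_space borel S) \<in> sets (restrict_space borel S)"
      using gm set by (rule measurable_sets)
    then have S': "S' \<in> sets borel"
      unfolding S'_def using S by (auto simp: space_restrict_space sets_restrict_space_iff Int_commute)
    have i: "indicator A y * indicator (g ` S) y = (indicator (A \<inter> g ` S) y :: ennreal)" for y
      by (simp add: indicator_def)
    have j: "indicator A (g x) * D x = ennreal (indicator S' x * \<bar>det (matrix (g' x))\<bar>)" for x
      by (auto simp: D_def S'_def indicator_def)
    have jm: "(\<lambda>x. indicator S' x * \<bar>det (matrix (g' x))\<bar>) \<in> borel_measurable borel"
    proof -
      have "(\<lambda>x. indicator S' x * (indicator S x * \<bar>det (matrix (g' x))\<bar>)) \<in> borel_measurable borel"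
        using meas S' by measurable
      moreover have "indicator S' x * (indicator S x * \<bar>det (matrix (g' x))\<bar>) = indicator S' x * \<bar>det (matrix (g' x))\<bar>" for x
        by (auto simp: S'_def indicator_def)
      ultimately show ?thesis by simp
    qed
    have "(\<integral>\<^sup>+y. indicator A y * indicator (g ` S) y \<partial>lborel) = emeasure lborel (A \<inter> g ` S)"
      unfolding i using set gS by simp
    also have "\<dots> \<le> (\<integral>\<^sup>+x. ennreal (indicator S' x * \<bar>det (matrix (g' x))\<bar>) \<partial>lborel)"
      using set gS by (intro emeasure_image_le[OF S' _ _ _ jm, where f=g])
        (auto simp: S'_def intro: has_derivative_subset[OF der])
    finally show ?case by (simp add: j)
  next
    case (mult u c)
    then show ?case
      using comp[of u] gS by (simp add: mult.assoc nn_integral_cmult mult_left_mono)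
  next
    case (add u v)
    then show ?case
      using comp[of u] comp[of v] gS by (simp add: distrib_right nn_integral_add add_mono)
  next
    case (seq U)
    have "(\<integral>\<^sup>+y. (SUP i. U i) y * indicator (g ` S) y \<partial>lborel) =
        (\<integral>\<^sup>+y. (SUP i. U i y * indicator (g ` S) y) \<partial>lborel)"
      by (simp add: SUP_apply SUP_mult_right_ennreal image_comp)
    also have "\<dots> = (SUP i. \<integral>\<^sup>+y. U i y * indicator (g ` S) y \<partial>lborel)"
      using seq gS by (intro nn_integral_monotone_convergence_SUP)
        (auto simp: mono_def le_fun_def incseq_def intro!: mult_right_mono)
    also have "\<dots> \<le> (\<integral>\<^sup>+x. (SUP i. U i) (g x) * D x \<partial>lborel)"
    proof (rule SUP_least)
      fix i
      have "(\<integral>\<^sup>+y. U i y * indicator (g ` S) y \<partial>lborel) \<le> (\<integral>\<^sup>+x. U i (g x) * D x \<partial>lborel)"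
        using seq by auto
      also have "\<dots> \<le> (\<integral>\<^sup>+x. (SUP i. U i) (g x) * D x \<partial>lborel)"
        by (intro nn_integral_mono mult_right_mono) (auto intro!: SUP_upper2 simp: image_comp)
      finally show "(\<integral>\<^sup>+y. U i y * indicator (g ` S) y \<partial>lborel) \<le> (\<integral>\<^sup>+x. (SUP i. U i) (g x) * D x \<partial>lborel)" .
    qed
    finally show ?case .
  qed
  also have "\<dots> = (\<integral>\<^sup>+x\<in>S. \<rho> (g x) * ennreal \<bar>det (matrix (g' x))\<bar> \<partial>lborel)"
    by (intro nn_integral_cong) (auto simp: D_def indicator_def)
  finally show ?thesis .
qed

section \<open>The Alexandrov--Bakelman--Pucci argument\<close>

definition dd1 :: "('e::real_normed_vector \<Rightarrow> real) \<Rightarrow> 'e \<Rightarrow> 'e \<Rightarrow> real" where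
  "dd1 u x v = frechet_derivative u (at x) v"

definition dd2 :: "('e::real_normed_vector \<Rightarrow> real) \<Rightarrow> 'e \<Rightarrow> 'e \<Rightarrow> 'e \<Rightarrow> real" where
  "dd2 u x v w = frechet_derivative (\<lambda>z. dd1 u z w) (at x) v"

lemma smooth_on_Ck_on: "smooth_on f U \<Longrightarrow> Ck_on k f U"
  by (simp add: smooth_on_def)

lemma Ck_on_2_iff:
  "Ck_on 2 u U \<longleftrightarrow> (\<forall>x\<in>U. u differentiable (at x)) \<and>
     (\<forall>w. (\<forall>x\<in>U. (\<lambda>z. dd1 u z w) differentiable (at x)) \<and> (\<forall>v. continuous_on U (\<lambda>x. dd2 u x v w)))"
  by (simp add: numeral_2_eq_2 dd1_def dd2_def)

lemma dd1_has_derivative: "Ck_on 2 u U \<Longrightarrow> x \<in> U \<Longrightarrow> (u has_derivative dd1 u x) (at x)"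
  unfolding Ck_on_2_iff dd1_def[abs_def] by (auto simp: frechet_derivative_works)

lemma dd2_has_derivative:
  "Ck_on 2 u U \<Longrightarrow> x \<in> U \<Longrightarrow> ((\<lambda>z. dd1 u z w) has_derivative (\<lambda>v. dd2 u x v w)) (at x)"
  unfolding Ck_on_2_iff dd2_def by (auto simp: frechet_derivative_works)

lemma continuous_on_dd2: "Ck_on 2 u U \<Longrightarrow> continuous_on U (\<lambda>x. dd2 u x v w)"
  by (simp add: Ck_on_2_iff)

lemma linear_dd1: "Ck_on 2 u U \<Longrightarrow> x \<in> U \<Longrightarrow> linear (dd1 u x)"
  using has_derivative_linear[OF dd1_has_derivative] .

lemma linear_dd2_left: "Ck_on 2 u U \<Longrightarrow> x \<in> U \<Longrightarrow> linear (\<lambda>v. dd2 u x v w)"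
  using has_derivative_linear[OF dd2_has_derivative] .

lemma continuous_on_dd1: "Ck_on 2 u U \<Longrightarrow> continuous_on U (\<lambda>x. dd1 u x w)"
  by (intro continuous_at_imp_continuous_on ballI has_derivative_continuous) (rule dd2_has_derivative)

lemma continuous_on_Ck_on_2: "Ck_on 2 u U \<Longrightarrow> continuous_on U u"
  for u :: "_ \<Rightarrow> real"
  by (intro continuous_at_imp_continuous_on ballI has_derivative_continuous) (rule dd1_has_derivative)

lemma dd1_has_real_derivative:
  assumes "Ck_on 2 u U" "x + t *\<^sub>R v \<in> U"
  shows "((\<lambda>t. u (x + t *\<^sub>R v)) has_real_derivative dd1 u (x + t *\<^sub>R v) v) (at t)"
proof -
  have 1: "((\<lambda>t. x + t *\<^sub>R v) has_derivative (\<lambda>h. h *\<^sub>R v)) (at t)"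
    by (auto intro!: derivative_eq_intros)
  have "(u \<circ> (\<lambda>t. x + t *\<^sub>R v) has_derivative dd1 u (x + t *\<^sub>R v) \<circ> (\<lambda>h. h *\<^sub>R v)) (at t)"
    by (rule diff_chain_at[OF 1 dd1_has_derivative[OF assms]])
  moreover have "dd1 u (x + t *\<^sub>R v) \<circ> (\<lambda>h. h *\<^sub>R v) = (*) (dd1 u (x + t *\<^sub>R v) v)"
    using linear_dd1[OF assms] by (auto simp: linear_cmul)
  ultimately show ?thesis by (simp add: has_field_derivative_def o_def)
qed

lemma dd2_has_real_derivative:
  assumes "Ck_on 2 u U" "x + t *\<^sub>R v \<in> U"
  shows "((\<lambda>t. dd1 u (x + t *\<^sub>R v) w) has_real_derivative dd2 u (x + t *\<^sub>R v) v w) (at t)"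
proof -
  have 1: "((\<lambda>t. x + t *\<^sub>R v) has_derivative (\<lambda>h. h *\<^sub>R v)) (at t)"
    by (auto intro!: derivative_eq_intros)
  have "((\<lambda>z. dd1 u z w) \<circ> (\<lambda>t. x + t *\<^sub>R v) has_derivative (\<lambda>h. dd2 u (x + t *\<^sub>R v) h w) \<circ> (\<lambda>h. h *\<^sub>R v)) (at t)"
    by (rule diff_chain_at[OF 1 dd2_has_derivative[OF assms]])
  moreover have "(\<lambda>h. dd2 u (x + t *\<^sub>R v) h w) \<circ> (\<lambda>h. h *\<^sub>R v) = (*) (dd2 u (x + t *\<^sub>R v) v w)"
    using linear_cmul[OF linear_dd2_left[OF assms, of w]] by auto
  ultimately show ?thesis by (simp add: has_field_derivative_def o_def)
qed

text \<open>Two applications of the mean value theorem, first in the direction v to the increment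
  along w, then in the direction w to the derivative along v. This order determines the order of
  arguments of \<open>dd2\<close>.\<close>

lemma second_difference_eq_dd2:
  assumes C: "Ck_on 2 u U" and t: "t > 0"
    and sub: "\<And>a b. 0 \<le> a \<Longrightarrow> a \<le> t \<Longrightarrow> 0 \<le> b \<Longrightarrow> b \<le> t \<Longrightarrow> x + a *\<^sub>R v + b *\<^sub>R w \<in> U"
  shows "\<exists>a b. 0 \<le> a \<and> a \<le> t \<and> 0 \<le> b \<and> b \<le> t \<and>
    u (x + t *\<^sub>R v + t *\<^sub>R w) - u (x + t *\<^sub>R v) - u (x + t *\<^sub>R w) + u x = t\<^sup>2 * dd2 u (x + a *\<^sub>R v + b *\<^sub>R w) w v"
proof -
  define g where "g s = u (x + s *\<^sub>R v + t *\<^sub>R w) - u (x + s *\<^sub>R v)" for s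
  have g': "(g has_real_derivative dd1 u (x + s *\<^sub>R v + t *\<^sub>R w) v - dd1 u (x + s *\<^sub>R v) v) (at s)"
    if "0 \<le> s" "s \<le> t" for s
  proof -
    have "((\<lambda>s. u ((x + t *\<^sub>R w) + s *\<^sub>R v)) has_real_derivative dd1 u ((x + t *\<^sub>R w) + s *\<^sub>R v) v) (at s)"
      using sub[of s t] that t by (intro dd1_has_real_derivative[OF C]) (simp add: algebra_simps)
    moreover have "((\<lambda>s. u (x + s *\<^sub>R v)) has_real_derivative dd1 u (x + s *\<^sub>R v) v) (at s)"
      using sub[of s 0] that t by (intro dd1_has_real_derivative[OF C]) simp
    ultimately show ?thesis
      unfolding g_def by (auto intro!: derivative_eq_intros simp: algebra_simps)
  qed
  obtain a where a: "0 < a" "a < t"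
    and ga: "g t - g 0 = (t - 0) * (dd1 u (x + a *\<^sub>R v + t *\<^sub>R w) v - dd1 u (x + a *\<^sub>R v) v)"
    using MVT2[OF t g'] by auto
  have h': "((\<lambda>b. dd1 u (x + a *\<^sub>R v + b *\<^sub>R w) v) has_real_derivative dd2 u (x + a *\<^sub>R v + b *\<^sub>R w) w v) (at b)"
    if "0 \<le> b" "b \<le> t" for b
    using sub[of a b] that a by (intro dd2_has_real_derivative[OF C]) simp
  obtain b where b: "0 < b" "b < t"
    and hb: "dd1 u (x + a *\<^sub>R v + t *\<^sub>R w) v - dd1 u (x + a *\<^sub>R v + 0 *\<^sub>R w) v = (t - 0) * dd2 u (x + a *\<^sub>R v + b *\<^sub>R w) w v"
    using MVT2[OF t h'] by auto
  have "u (x + t *\<^sub>R v + t *\<^sub>R w) - u (x + t *\<^sub>R v) - u (x + t *\<^sub>R w) + u x = g t - g 0"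
    by (simp add: g_def)
  also have "\<dots> = t\<^sup>2 * dd2 u (x + a *\<^sub>R v + b *\<^sub>R w) w v"
    using ga hb by (simp add: power2_eq_square)
  finally show ?thesis using a b by (intro exI[of _ a] exI[of _ b]) auto
qed

text \<open>The second difference does not change when v and w are exchanged. It therefore equals
  t^2 times either mixed derivative, taken at two points near x, and both are close to their values
  at x by continuity.\<close>

lemma dd2_symmetric:
  assumes C: "Ck_on 2 u U" and U: "open U" "x \<in> U"
  shows "dd2 u x v w = dd2 u x w v"
proof (rule ccontr)
  assume ne: "dd2 u x v w \<noteq> dd2 u x w v"
  define e where "e = \<bar>dd2 u x v w - dd2 u x w v\<bar> / 2"
  have e: "e > 0" using ne by (simp add: e_def)
  obtain d0 where d0: "d0 > 0" "ball x d0 \<subseteq> U" using U open_contains_ball by blast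
  have "isCont (\<lambda>x. dd2 u x v w) x" "isCont (\<lambda>x. dd2 u x w v) x"
    using continuous_on_dd2[OF C] U continuous_on_eq_continuous_at by blast+
  then obtain d1 d2 where d12: "d1 > 0" "\<And>y. dist y x < d1 \<Longrightarrow> \<bar>dd2 u y v w - dd2 u x v w\<bar> < e"
     "d2 > 0" "\<And>y. dist y x < d2 \<Longrightarrow> \<bar>dd2 u y w v - dd2 u x w v\<bar> < e"
    using e unfolding continuous_at_eps_delta dist_real_def by metis
  define d where "d = Min {d0, d1, d2}"
  have d: "d > 0" "d \<le> d0" "d \<le> d1" "d \<le> d2" using d0 d12 by (auto simp: d_def)
  \<comment> \<open>With this t the whole parallelogram spanned by t v and t w stays strictly inside
    the ball of radius d; the 1 covers v = w = 0.\<close>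
  define t where "t = d / (norm v + norm w + 1)"
  have t: "t > 0" using d by (simp add: t_def add_nonneg_pos)
  have near: "dist (x + a *\<^sub>R v + b *\<^sub>R w) x < d" if "0 \<le> a" "a \<le> t" "0 \<le> b" "b \<le> t" for a b
  proof -
    have "dist (x + a *\<^sub>R v + b *\<^sub>R w) x = norm (a *\<^sub>R v + b *\<^sub>R w)" by (simp add: dist_norm add.assoc)
    also have "\<dots> \<le> a * norm v + b * norm w" using that norm_triangle_ineq[of "a *\<^sub>R v" "b *\<^sub>R w"] by simp
    also have "\<dots> \<le> t * norm v + t * norm w" using that by (intro add_mono mult_right_mono) auto
    also have "\<dots> < t * (norm v + norm w + 1)" using t by (simp add: algebra_simps)
    also have "\<dots> = d" by (simp add: t_def add_nonneg_pos less_imp_neq[symmetric])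
    finally show ?thesis .
  qed
  have sub1: "x + a *\<^sub>R v + b *\<^sub>R w \<in> U" if "0 \<le> a" "a \<le> t" "0 \<le> b" "b \<le> t" for a b
    using near[OF that] d d0 by (auto simp: dist_commute)
  have sub2: "x + a *\<^sub>R w + b *\<^sub>R v \<in> U" if "0 \<le> a" "a \<le> t" "0 \<le> b" "b \<le> t" for a b
    using sub1[of b a] that by (simp add: algebra_simps)
  obtain a b where ab: "0 \<le> a" "a \<le> t" "0 \<le> b" "b \<le> t"
     "u (x + t *\<^sub>R v + t *\<^sub>R w) - u (x + t *\<^sub>R v) - u (x + t *\<^sub>R w) + u x = t\<^sup>2 * dd2 u (x + a *\<^sub>R v + b *\<^sub>R w) w v"
    using second_difference_eq_dd2[OF C t sub1] by blast
  obtain a' b' where ab': "0 \<le> a'" "a' \<le> t" "0 \<le> b'" "b' \<le> t"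
     "u (x + t *\<^sub>R w + t *\<^sub>R v) - u (x + t *\<^sub>R w) - u (x + t *\<^sub>R v) + u x = t\<^sup>2 * dd2 u (x + a' *\<^sub>R w + b' *\<^sub>R v) v w"
    using second_difference_eq_dd2[OF C t sub2] by blast
  have "t\<^sup>2 * dd2 u (x + a *\<^sub>R v + b *\<^sub>R w) w v = t\<^sup>2 * dd2 u (x + a' *\<^sub>R w + b' *\<^sub>R v) v w"
    using ab(5) ab'(5) by (simp add: algebra_simps)
  then have eq: "dd2 u (x + a *\<^sub>R v + b *\<^sub>R w) w v = dd2 u (x + a' *\<^sub>R w + b' *\<^sub>R v) v w"
    using t by simp
  have "\<bar>dd2 u (x + a *\<^sub>R v + b *\<^sub>R w) w v - dd2 u x w v\<bar> < e"
    using near[OF ab(1-4)] d by (intro d12) simp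
  moreover have "\<bar>dd2 u (x + a' *\<^sub>R w + b' *\<^sub>R v) v w - dd2 u x v w\<bar> < e"
    using near[OF ab'(3,4,1,2)] d by (intro d12) (simp add: algebra_simps)
  ultimately have "\<bar>dd2 u x v w - dd2 u x w v\<bar> < 2 * e" unfolding eq by linarith
  then show False by (simp add: e_def)
qed

lemma linear_dd2_right: "Ck_on 2 u U \<Longrightarrow> open U \<Longrightarrow> x \<in> U \<Longrightarrow> linear (dd2 u x v)"
  using linear_dd2_left[of u U x v] dd2_symmetric[of u U x v] by (metis (no_types, lifting) ext)

text \<open>With a negative second derivative, h' would be negative immediately to the right of 0,
  and h would fall below its value at 0.\<close>

lemma second_derivative_nonneg_at_min:
  fixes h h' :: "real \<Rightarrow> real"
  assumes d: "d > 0" and h: "\<And>t. \<bar>t\<bar> < d \<Longrightarrow> (h has_real_derivative h' t) (at t)"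
    and h'': "(h' has_real_derivative h2) (at 0)"
    and min: "\<And>t. \<bar>t\<bar> < d \<Longrightarrow> h 0 \<le> h t" and z: "h' 0 = 0"
  shows "h2 \<ge> 0"
proof (rule ccontr)
  assume "\<not> h2 \<ge> 0"
  then obtain e where e: "e > 0" "\<And>k. k > 0 \<Longrightarrow> k < e \<Longrightarrow> h' (0 + k) < h' 0"
    using DERIV_neg_dec_right[OF h''] by (auto simp: not_le)
  define t where "t = min d e / 2"
  have t: "t > 0" "t < d" "t < e" using d e by (auto simp: t_def min_def)
  obtain s where s: "0 < s" "s < t" "h t - h 0 = (t - 0) * h' s"
    using MVT2[of 0 t h h'] h t by auto
  have "h' s < 0" using e(2)[of s] s t z by simp
  then have "h t - h 0 < 0" using s t by (simp add: mult_pos_neg)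
  then show False using min[of t] t by simp
qed

text \<open>The order of i and j makes this literally the Jacobian matrix of the gradient map, as
  produced by \<open>matrix\<close>.\<close>

definition hess_matrix :: "(real ^ 'm::finite \<Rightarrow> real) \<Rightarrow> real ^ 'm \<Rightarrow> real ^ 'm ^ 'm" where
  "hess_matrix u x = (\<chi> i j. dd2 u x (axis j 1) (axis i 1))"

text \<open>Not the set of contact points itself but a closed, hence Borel, set containing them: it
  records what a contact with a paraboloid of opening eps and a slope below eps r implies for
  Hessian, gradient and value. The 3 is 1 from the slope plus 2 from the gradient of the
  paraboloid.\<close>

definition contact_set :: "(real ^ 'm::finite \<Rightarrow> real) \<Rightarrow> real ^ 'm \<Rightarrow> real \<Rightarrow> real \<Rightarrow> (real ^ 'm) set" where
  "contact_set u x0 r \<epsilon> = {x \<in> cball x0 r. (\<forall>w. dd2 u x w w + 2 * \<epsilon> * (norm w)\<^sup>2 \<ge> 0) \<and>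
     (\<forall>w. \<bar>dd1 u x w\<bar> \<le> 3 * \<epsilon> * r * norm w) \<and> u x \<le> u x0 + \<epsilon> * r\<^sup>2}"

lemma closed_sublevel_cball:
  fixes f g :: "'a::euclidean_space \<Rightarrow> real"
  assumes "continuous_on U f" "continuous_on U g" "cball x0 r \<subseteq> U"
  shows "closed {x \<in> cball x0 r. f x \<le> g x}"
proof -
  have "closed {x \<in> cball x0 r. f x - g x \<in> {..0}}"
    by (rule continuous_closed_preimage[unfolded vimage_def Int_def, simplified])
      (use assms in \<open>auto intro!: continuous_intros intro: continuous_on_subset\<close>)
  then show ?thesis by simp
qed

lemma closed_contact_set:
  assumes C: "Ck_on 2 u U" and sub: "cball x0 r \<subseteq> U"
  shows "closed (contact_set u x0 r \<epsilon>)"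
proof -
  have "contact_set u x0 r \<epsilon> =
     (\<Inter>w. {x \<in> cball x0 r. 0 \<le> dd2 u x w w + 2 * \<epsilon> * (norm w)\<^sup>2}) \<inter>
     (\<Inter>w. {x \<in> cball x0 r. \<bar>dd1 u x w\<bar> \<le> 3 * \<epsilon> * r * norm w}) \<inter>
     {x \<in> cball x0 r. u x \<le> u x0 + \<epsilon> * r\<^sup>2}"
    by (auto simp: contact_set_def)
  moreover have "closed \<dots>"
    by (intro closed_Int closed_INT ballI closed_sublevel_cball[OF _ _ sub] continuous_intros
        continuous_on_dd1[OF C] continuous_on_dd2[OF C] continuous_on_Ck_on_2[OF C])
  ultimately show ?thesis by simp
qed

lemma continuous_on_det [continuous_intros]:
  fixes M :: "'a::topological_space \<Rightarrow> real ^ 'm::finite ^ 'm"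
  assumes "\<And>i j. continuous_on S (\<lambda>x. M x $ i $ j)"
  shows "continuous_on S (\<lambda>x. det (M x))"
  unfolding det_def by (intro continuous_intros assms)

text \<open>
  The Alexandrov--Bakelman--Pucci argument: every slope of norm below \<open>\<epsilon> r\<close> is the
  gradient of \<open>u + \<epsilon>\<bar>x - x0\<bar>\<^sup>2\<close> at some point of the contact set.
\<close>

lemma abp_contact_set:
  fixes u :: "real ^ 'm::finite \<Rightarrow> real"
  assumes C: "Ck_on 2 u U" and U: "open U" and sub: "cball x0 r \<subseteq> U" and r: "r > 0" and \<epsilon>: "\<epsilon> > 0"
    and min: "\<And>x. x \<in> cball x0 r \<Longrightarrow> u x0 \<le> u x"
  shows "emeasure lborel (ball (0 :: real ^ 'm) (\<epsilon> * r)) \<le>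
    (\<integral>\<^sup>+x. ennreal (indicator (contact_set u x0 r \<epsilon>) x * \<bar>det (hess_matrix u x + (2 * \<epsilon>) *\<^sub>R mat 1)\<bar>) \<partial>lborel)"
proof -
  define P where "P = contact_set u x0 r \<epsilon>"
  define G where "G x = (\<chi> i. dd1 u x (axis i 1) + 2 * \<epsilon> * (x - x0) $ i)" for x
  define G' where "G' x v = (\<chi> i. dd2 u x v (axis i 1) + 2 * \<epsilon> * v $ i)" for x v
  have mG: "matrix (G' x) = hess_matrix u x + (2 * \<epsilon>) *\<^sub>R mat 1" for x
    by (simp add: matrix_def G'_def hess_matrix_def mat_def vec_eq_iff axis_def)
  have clP: "closed P" unfolding P_def by (rule closed_contact_set[OF C sub])
  have PU: "P \<subseteq> U" using sub by (auto simp: P_def contact_set_def)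
  have der: "(G has_derivative G' x) (at x within P)" if "x \<in> P" for x
  proof -
    have "(G has_derivative G' x) (at x)"
    proof (subst has_derivative_componentwise_within, intro ballI)
      fix b :: "real ^ 'm" assume "b \<in> Basis"
      then obtain i where b: "b = axis i 1" by (auto simp: Basis_vec_def)
      have "((\<lambda>z. dd1 u z (axis i 1) + 2 * \<epsilon> * (z - x0) $ i) has_derivative
          (\<lambda>v. dd2 u x v (axis i 1) + 2 * \<epsilon> * v $ i)) (at x)"
        using that PU by (auto intro!: derivative_eq_intros dd2_has_derivative[OF C]
            bounded_linear.has_derivative[OF bounded_linear_vec_nth])
      then show "((\<lambda>x. G x \<bullet> b) has_derivative (\<lambda>v. G' x v \<bullet> b)) (at x)"
        by (simp add: b inner_axis G_def G'_def)
    qed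
    then show ?thesis by (rule has_derivative_at_withinI)
  qed
  have meas: "(\<lambda>x. indicator P x * \<bar>det (matrix (G' x))\<bar>) \<in> borel_measurable borel"
  proof -
    have "continuous_on P (\<lambda>x. \<bar>det (matrix (G' x))\<bar>)"
      unfolding mG
      by (intro continuous_intros)
        (auto simp: hess_matrix_def intro!: continuous_intros continuous_on_subset[OF continuous_on_dd2[OF C] PU])
    from borel_measurable_continuous_on_indicator[OF _ this] clP show ?thesis by simp
  qed
  have "ball 0 (\<epsilon> * r) \<subseteq> G ` P"
  proof
    fix q :: "real ^ 'm" assume "q \<in> ball 0 (\<epsilon> * r)"
    then have q: "norm q < \<epsilon> * r" by simp
    \<comment> \<open>A minimum of m in the interior is a point where the gradient of u + eps |x -
      x0|^2 equals q.\<close>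
    define m where "m x = u x + \<epsilon> * ((x - x0) \<bullet> (x - x0)) - q \<bullet> (x - x0)" for x
    have "continuous_on (cball x0 r) m"
      unfolding m_def by (intro continuous_intros continuous_on_subset[OF continuous_on_Ck_on_2[OF C] sub])
    then obtain y where y: "y \<in> cball x0 r" "\<And>z. z \<in> cball x0 r \<Longrightarrow> m y \<le> m z"
      using continuous_attains_inf[of "cball x0 r" m] r by auto
    have myx: "m y \<le> u x0" using y(2)[of x0] r by (simp add: m_def)
    have qy: "q \<bullet> (y - x0) \<le> norm q * norm (y - x0)" by (rule norm_cauchy_schwarz)
    have dy: "norm (y - x0) \<le> r" using y(1) by (simp add: dist_norm norm_minus_commute)
    \<comment> \<open>On the boundary sphere the paraboloid adds eps r^2, which exceeds the linear
      term |q| r, whereas u is nowhere below u x0. So the minimum is attained inside.\<close>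
    have yb: "norm (y - x0) < r"
    proof (rule ccontr)
      assume "\<not> norm (y - x0) < r"
      then have e: "norm (y - x0) = r" using dy by simp
      have "(y - x0) \<bullet> (y - x0) = r\<^sup>2" using e by (simp add: power2_norm_eq_inner[symmetric])
      then have "u y + \<epsilon> * r\<^sup>2 - norm q * r \<le> u x0" using myx qy e by (simp add: m_def)
      moreover have "norm q * r < \<epsilon> * r\<^sup>2" using q r by (simp add: power2_eq_square)
      ultimately show False using min[OF y(1)] by simp
    qed
    define s where "s = r - norm (y - x0)"
    have s: "s > 0" using yb by (simp add: s_def)
    have ball: "z \<in> cball x0 r" if "norm (z - y) < s" for z
      using that norm_triangle_ineq[of "z - y" "y - x0"] by (simp add: s_def dist_norm norm_minus_commute)
    have yU: "y \<in> U" using y sub by auto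
    have 1: "((\<lambda>t. m (y + t *\<^sub>R w)) has_real_derivative
        dd1 u (y + t *\<^sub>R w) w + 2 * \<epsilon> * ((y + t *\<^sub>R w - x0) \<bullet> w) - q \<bullet> w) (at t)"
      if "y + t *\<^sub>R w \<in> U" for t w
      unfolding m_def using that
      by (auto intro!: derivative_eq_intros dd1_has_real_derivative[OF C]
          simp: inner_diff_left inner_diff_right inner_add_left inner_add_right inner_commute algebra_simps)
    have tw: "y + t *\<^sub>R w \<in> cball x0 r" if "\<bar>t\<bar> < s / (norm w + 1)" for t w
    proof -
      have "\<bar>t\<bar> * (norm w + 1) < s" using that by (simp add: pos_less_divide_eq add_nonneg_pos)
      then have "\<bar>t\<bar> * norm w < s" using abs_ge_zero[of t] unfolding distrib_left by linarith
      then show ?thesis by (intro ball) simp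
    qed
    have g0: "dd1 u y w + 2 * \<epsilon> * ((y - x0) \<bullet> w) - q \<bullet> w = 0" for w
    proof -
      have "((\<lambda>t. m (y + t *\<^sub>R w)) has_real_derivative dd1 u y w + 2 * \<epsilon> * ((y - x0) \<bullet> w) - q \<bullet> w) (at 0)"
        using 1[of 0 w] yU by simp
      moreover have "s / (norm w + 1) > 0" using s by (simp add: add_nonneg_pos)
      moreover have "\<forall>t. \<bar>0 - t\<bar> < s / (norm w + 1) \<longrightarrow> m (y + 0 *\<^sub>R w) \<le> m (y + t *\<^sub>R w)"
        using tw y(2) by simp
      ultimately show ?thesis by (rule DERIV_local_min)
    qed
    have h0: "dd2 u y w w + 2 * \<epsilon> * (norm w)\<^sup>2 \<ge> 0" for w
    proof (rule second_derivative_nonneg_at_min)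
      show "s / (norm w + 1) > 0" using s by (simp add: add_nonneg_pos)
      show "((\<lambda>t. m (y + t *\<^sub>R w)) has_real_derivative
        dd1 u (y + t *\<^sub>R w) w + 2 * \<epsilon> * ((y + t *\<^sub>R w - x0) \<bullet> w) - q \<bullet> w) (at t)" if "\<bar>t\<bar> < s / (norm w + 1)" for t
        using tw[OF that] sub by (intro 1) auto
      show "((\<lambda>t. dd1 u (y + t *\<^sub>R w) w + 2 * \<epsilon> * ((y + t *\<^sub>R w - x0) \<bullet> w) - q \<bullet> w)
          has_real_derivative dd2 u y w w + 2 * \<epsilon> * (norm w)\<^sup>2) (at 0)"
      proof -
        have "(y + t *\<^sub>R w - x0) \<bullet> w = (y - x0) \<bullet> w + t * (norm w)\<^sup>2" for t
          by (simp add: inner_diff_left inner_add_left power2_norm_eq_inner)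
        then show ?thesis
          using yU by (auto intro!: derivative_eq_intros dd2_has_real_derivative[OF C, of y 0 w w, simplified])
      qed
    qed (use tw y(2) g0 in auto)
    have "\<bar>dd1 u y w\<bar> \<le> 3 * \<epsilon> * r * norm w" for w
    proof -
      have "\<bar>dd1 u y w\<bar> \<le> \<bar>q \<bullet> w\<bar> + 2 * \<epsilon> * \<bar>(y - x0) \<bullet> w\<bar>"
        using g0[of w] \<epsilon> abs_mult[of "2 * \<epsilon>" "(y - x0) \<bullet> w"] by simp
      also have "\<dots> \<le> norm q * norm w + 2 * \<epsilon> * (norm (y - x0) * norm w)"
        using \<epsilon> by (intro add_mono mult_left_mono Cauchy_Schwarz_ineq2) auto
      also have "\<dots> \<le> (\<epsilon> * r) * norm w + 2 * \<epsilon> * (r * norm w)"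
        using \<epsilon> q dy by (intro add_mono mult_left_mono mult_right_mono) auto
      finally show ?thesis by (simp add: algebra_simps)
    qed
    moreover have "u y \<le> u x0 + \<epsilon> * r\<^sup>2"
    proof -
      have "norm q * norm (y - x0) \<le> (\<epsilon> * r) * r" using q dy r \<epsilon> by (intro mult_mono) auto
      moreover have "0 \<le> \<epsilon> * ((y - x0) \<bullet> (y - x0))" using \<epsilon> by simp
      ultimately show ?thesis using myx qy unfolding m_def power2_eq_square by linarith
    qed
    ultimately have "y \<in> P" using y h0 by (auto simp: P_def contact_set_def)
    moreover have "G y = q"
      using g0[of "axis i 1" for i] by (simp add: G_def vec_eq_iff inner_axis algebra_simps)
    ultimately show "q \<in> G ` P" by blast
  qed
  then show ?thesis
    using emeasure_image_le[OF _ _ _ der meas, of "ball 0 (\<epsilon> * r)"] clP by (simp add: mG P_def)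
qed

section \<open>Simultaneous diagonalisation\<close>

text \<open>In the Leibniz formula every term is bounded by the product of the s i s (p i), which
  for a permutation p is the product of the squares; there are m! terms.\<close>

lemma abs_det_le_of_entry_bound:
  fixes M :: "real ^ 'm::finite ^ 'm"
  assumes "\<And>i j. \<bar>M $ i $ j\<bar> \<le> s i * s j"
  shows "\<bar>det M\<bar> \<le> fact CARD('m) * (\<Prod>i\<in>UNIV. (s i)\<^sup>2)"
proof -
  have "\<bar>det M\<bar> \<le> (\<Sum>p | p permutes (UNIV::'m set). \<bar>of_int (sign p) * (\<Prod>i\<in>UNIV. M $ i $ p i)\<bar>)"
    unfolding det_def by (rule sum_abs)
  also have "\<dots> \<le> (\<Sum>p | p permutes (UNIV::'m set). (\<Prod>i\<in>UNIV. (s i)\<^sup>2))"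
  proof (rule sum_mono)
    fix p :: "'m \<Rightarrow> 'm" assume "p \<in> {p. p permutes UNIV}"
    then have p: "p permutes UNIV" by simp
    have "\<bar>of_int (sign p) * (\<Prod>i\<in>UNIV. M $ i $ p i)\<bar> = (\<Prod>i\<in>UNIV. \<bar>M $ i $ p i\<bar>)"
      by (simp add: abs_mult abs_prod sign_def)
    also have "\<dots> \<le> (\<Prod>i\<in>UNIV. s i * s (p i))"
      using assms by (intro prod_mono) auto
    also have "\<dots> = (\<Prod>i\<in>UNIV. s i) * (\<Prod>i\<in>UNIV. s (p i))" by (simp add: prod.distrib)
    also have "(\<Prod>i\<in>UNIV. s (p i)) = (\<Prod>i\<in>UNIV. s i)"
      using prod.permute[OF p, of s] by (simp add: o_def)
    finally show "\<bar>of_int (sign p) * (\<Prod>i\<in>UNIV. M $ i $ p i)\<bar> \<le> (\<Prod>i\<in>UNIV. (s i)\<^sup>2)"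
      by (simp add: power2_eq_square prod.distrib)
  qed
  also have "\<dots> = fact CARD('m) * (\<Prod>i\<in>UNIV. (s i)\<^sup>2)"
    by (simp add: card_permutations[of "UNIV::'m set" "CARD('m)"])
  finally show ?thesis .
qed

text \<open>Cauchy-Schwarz for a form that may be degenerate, obtained from H(v + t w, v + t w) >=
  0. If H w w = 0 this expression is affine in t, which forces its slope to vanish.\<close>

lemma psd_form_bound:
  fixes H :: "'v::real_vector \<Rightarrow> 'v \<Rightarrow> real"
  assumes b: "bilinear H" and s: "\<And>v w. H v w = H w v" and p: "\<And>v. H v v \<ge> 0"
  shows "\<bar>H v w\<bar> \<le> sqrt (H v v) * sqrt (H w w)"
proof -
  have q: "H v v + 2 * t * H v w + t\<^sup>2 * H w w \<ge> 0" for t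
  proof -
    have "H (v + t *\<^sub>R w) (v + t *\<^sub>R w) = H v v + 2 * t * H v w + t\<^sup>2 * H w w"
      using s[of w v] by (simp add: bilinear_ladd[OF b] bilinear_radd[OF b] bilinear_lmul[OF b] bilinear_rmul[OF b]
          power2_eq_square algebra_simps)
    then show ?thesis using p[of "v + t *\<^sub>R w"] by simp
  qed
  have "(H v w)\<^sup>2 \<le> H v v * H w w"
  proof (cases "H w w = 0")
    case True
    have "H v w = 0"
    proof (rule ccontr)
      assume ne: "H v w \<noteq> 0"
      \<comment> \<open>This t would give the affine expression the value -1.\<close>
      have "H v v + 2 * (- (H v v + 1) / (2 * H v w)) * H v w \<ge> 0"
        using q[of "- (H v v + 1) / (2 * H v w)"] True by simp
      then show False using ne by (simp add: field_simps)
    qed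
    then show ?thesis using p by simp
  next
    case False
    then have w: "H w w > 0" using p[of w] by simp
    have "H v v + 2 * (- H v w / H w w) * H v w + (- H v w / H w w)\<^sup>2 * H w w \<ge> 0" by (rule q)
    also have "H v v + 2 * (- H v w / H w w) * H v w + (- H v w / H w w)\<^sup>2 * H w w = H v v - (H v w)\<^sup>2 / H w w"
      using w by (simp add: power2_eq_square field_simps)
    finally show ?thesis using w by (simp add: field_simps)
  qed
  then have "sqrt ((H v w)\<^sup>2) \<le> sqrt (H v v * H w w)" by (rule real_sqrt_le_mono)
  then show ?thesis by (simp add: real_sqrt_mult)
qed

definition form_matrix :: "(real ^ 'm::finite \<Rightarrow> real ^ 'm \<Rightarrow> real) \<Rightarrow> real ^ 'm ^ 'm" where
  "form_matrix H = (\<chi> i j. H (axis i 1) (axis j 1))"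

lemma bilinear_expand:
  fixes H :: "real ^ 'm::finite \<Rightarrow> real ^ 'm \<Rightarrow> real"
  assumes b: "bilinear H"
  shows "H v w = (\<Sum>i\<in>UNIV. \<Sum>j\<in>UNIV. v $ i * w $ j * H (axis i 1) (axis j 1))"
proof -
  have e: "v = (\<Sum>i\<in>UNIV. v $ i *\<^sub>R axis i 1)" for v :: "real ^ 'm"
    using basis_expansion[of v] by (simp add: scalar_mult_eq_scaleR)
  have l: "H (sum f A) x = (\<Sum>i\<in>A. H (f i) x)" for f :: "'m \<Rightarrow> _" and A x
    using b linear_sum[of "\<lambda>v. H v x" f A] by (simp add: bilinear_def)
  have r: "H x (sum f A) = (\<Sum>i\<in>A. H x (f i))" for f :: "'m \<Rightarrow> _" and A x
    using b linear_sum[of "H x" f A] by (simp add: bilinear_def)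
  show ?thesis
    by (subst (1) e[of v], subst l, subst (1) e[of w], subst r)
      (simp add: bilinear_lmul[OF b] bilinear_rmul[OF b] sum_distrib_left mult.assoc mult.left_commute)
qed

lemma form_matrix_frame:
  fixes H :: "real ^ 'm::finite \<Rightarrow> real ^ 'm \<Rightarrow> real" and f :: "'m \<Rightarrow> real ^ 'm"
  assumes b: "bilinear H"
  shows "(\<chi> i j. H (f i) (f j)) = (\<chi> i j. f i $ j) ** form_matrix H ** transpose (\<chi> i j. f i $ j)"
proof -
  define F :: "real ^ 'm ^ 'm" where "F = (\<chi> i j. f i $ j)"
  have "H (f i) (f j) = (F ** form_matrix H ** transpose F) $ i $ j" for i j
  proof -
    have "(F ** form_matrix H ** transpose F) $ i $ j =
        (\<Sum>k\<in>UNIV. \<Sum>l\<in>UNIV. f i $ l * f j $ k * H (axis l 1) (axis k 1))"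
      by (simp add: matrix_matrix_mult_def transpose_def F_def form_matrix_def sum_distrib_right
          sum_distrib_left mult.commute mult.left_commute)
    also have "\<dots> = H (f i) (f j)"
      by (subst sum.swap) (rule bilinear_expand[OF b, symmetric])
    finally show ?thesis by simp
  qed
  then show ?thesis
    by (simp add: vec_eq_iff F_def)
qed

lemma det_form_matrix_frame:
  fixes H :: "real ^ 'm::finite \<Rightarrow> real ^ 'm \<Rightarrow> real" and f :: "'m \<Rightarrow> real ^ 'm"
  assumes b: "bilinear H"
  shows "det (\<chi> i j. H (f i) (f j)) = (det (\<chi> i j. f i $ j))\<^sup>2 * det (form_matrix H)"
  unfolding form_matrix_frame[OF b] by (simp add: det_mul power2_eq_square mult.commute)

text \<open>The inequality replaces Hadamard's; the constant is irrelevant below.\<close>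

lemma abs_det_le_frame:
  fixes H g :: "real ^ 'm::finite \<Rightarrow> real ^ 'm \<Rightarrow> real" and f :: "'m \<Rightarrow> real ^ 'm"
  assumes H: "bilinear H" "\<And>v w. H v w = H w v" "\<And>v. H v v \<ge> 0"
    and g: "bilinear g" "\<And>v w. g v w = g w v" "\<And>v. g v v \<ge> 0"
    and f: "\<And>i j. g (f i) (f j) = (if i = j then 1 else 0)"
    and G: "\<And>i. g (axis i 1) (axis i 1) \<le> G" and c: "\<And>i. H (f i) (f i) \<le> c i"
  shows "\<bar>det (form_matrix H)\<bar> \<le> (fact CARD('m))\<^sup>2 * G ^ CARD('m) * (\<Prod>i\<in>UNIV. c i)"
proof -
  define D where "D = (det (\<chi> i j. f i $ j))\<^sup>2"
  have D0: "D \<ge> 0" by (simp add: D_def)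
  have G0: "G \<ge> 0" using G g(3) order_trans by blast
  have c0: "c i \<ge> 0" for i using c H(3) order_trans by blast
  \<comment> \<open>Orthonormality makes \<open>D\<close> the reciprocal of det g, so an upper bound
    for the Gram determinant of g in the standard basis is a lower bound for
    \<open>D\<close>.\<close>
  have "1 = D * det (form_matrix g)"
  proof -
    have "(\<chi> i j. g (f i) (f j)) = mat 1" by (simp add: f mat_def vec_eq_iff)
    then show ?thesis using det_form_matrix_frame[OF g(1), of f] by (simp add: D_def)
  qed
  moreover have "\<bar>det (form_matrix g)\<bar> \<le> fact CARD('m) * (\<Prod>i\<in>(UNIV::'m set). (sqrt G)\<^sup>2)"
  proof (rule abs_det_le_of_entry_bound)
    fix i j :: 'm
    have "\<bar>g (axis i 1) (axis j 1)\<bar> \<le> sqrt (g (axis i 1) (axis i 1)) * sqrt (g (axis j 1) (axis j 1))"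
      by (rule psd_form_bound[OF g])
    also have "\<dots> \<le> sqrt G * sqrt G"
      using G0 by (intro mult_mono real_sqrt_le_mono G) (auto intro: g(3))
    finally show "\<bar>form_matrix g $ i $ j\<bar> \<le> sqrt G * sqrt G" by (simp add: form_matrix_def)
  qed
  ultimately have D: "1 \<le> D * (fact CARD('m) * G ^ CARD('m))"
    using D0 G0 by (simp add: abs_le_iff) (smt (verit) mult_left_mono)
  have "\<bar>det (\<chi> i j. H (f i) (f j))\<bar> \<le> fact CARD('m) * (\<Prod>i\<in>(UNIV::'m set). (sqrt (c i))\<^sup>2)"
  proof (rule abs_det_le_of_entry_bound)
    fix i j :: 'm
    have "\<bar>H (f i) (f j)\<bar> \<le> sqrt (H (f i) (f i)) * sqrt (H (f j) (f j))"
      by (rule psd_form_bound[OF H])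
    also have "\<dots> \<le> sqrt (c i) * sqrt (c j)"
      using c0 by (intro mult_mono real_sqrt_le_mono c) (auto intro: H(3))
    finally show "\<bar>(\<chi> i j. H (f i) (f j)) $ i $ j\<bar> \<le> sqrt (c i) * sqrt (c j)" by simp
  qed
  then have 1: "D * \<bar>det (form_matrix H)\<bar> \<le> fact CARD('m) * (\<Prod>i\<in>UNIV. c i)"
    using c0 unfolding det_form_matrix_frame[OF H(1)] D_def by (simp add: abs_mult)
  have "\<bar>det (form_matrix H)\<bar> \<le> D * (fact CARD('m) * G ^ CARD('m)) * \<bar>det (form_matrix H)\<bar>"
    using mult_right_mono[OF D abs_ge_zero[of "det (form_matrix H)"]] by simp
  also have "\<dots> = (fact CARD('m) * G ^ CARD('m)) * (D * \<bar>det (form_matrix H)\<bar>)"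
    by (simp add: algebra_simps)
  also have "\<dots> \<le> (fact CARD('m) * G ^ CARD('m)) * (fact CARD('m) * (\<Prod>i\<in>UNIV. c i))"
    using 1 G0 by (intro mult_left_mono) auto
  finally show ?thesis by (simp add: power2_eq_square algebra_simps)
qed

section \<open>Metric and almost complex structure at one point\<close>

locale hermitian_point =
  fixes J :: "'n::finite coords \<Rightarrow> 'n coords" and g :: "'n coords \<Rightarrow> 'n coords \<Rightarrow> real"
  assumes J_linear: "linear J" and J_square: "\<And>v. J (J v) = - v"
    and g_bilinear: "bilinear g" and g_sym: "\<And>v w. g v w = g w v"
    and g_pos: "\<And>v. v \<noteq> 0 \<Longrightarrow> g v v > 0" and g_J: "\<And>v w. g (J v) (J w) = g v w"
begin

lemma g_nonneg: "g v v \<ge> 0"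
  using g_pos[of v] bilinear_lzero[OF g_bilinear] by (cases "v = 0") auto

lemma J_skew:
  fixes B :: "'n coords \<Rightarrow> 'n coords \<Rightarrow> real"
  assumes "\<And>v w. B (J v) (J w) = B v w" "bilinear B"
  shows "B (J v) w = - B v (J w)"
proof -
  have "B (J v) (J (J w)) = B v (J w)" by (rule assms(1))
  then have "- B (J v) w = B v (J w)" by (simp add: J_square bilinear_rneg[OF assms(2)])
  then show ?thesis by linarith
qed

lemma g_J_self: "g v (J v) = 0"
  using J_skew[of g v v] g_sym[of "J v" v] g_J g_bilinear by simp

lemmas g_linear = bilinear_ladd[OF g_bilinear] bilinear_radd[OF g_bilinear]
  bilinear_lmul[OF g_bilinear] bilinear_rmul[OF g_bilinear]
  bilinear_lneg[OF g_bilinear] bilinear_rneg[OF g_bilinear]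
  bilinear_lzero[OF g_bilinear] bilinear_rzero[OF g_bilinear]
  bilinear_lsub[OF g_bilinear] bilinear_rsub[OF g_bilinear]

text \<open>The map L has range in the span of T and is thus not onto, so it has a nonzero kernel
  vector w. Pairing L w = 0 with w gives the sum of the squares of the g w t.\<close>

lemma exists_orthogonal:
  assumes T: "finite T" "card T < DIM('n coords)"
  shows "\<exists>w. w \<noteq> 0 \<and> (\<forall>t\<in>T. g w t = 0)"
proof -
  define L where "L w = (\<Sum>t\<in>T. g w t *\<^sub>R t)" for w
  have lin: "linear L"
    unfolding L_def by (intro linearI)
      (auto simp: g_linear scaleR_add_left sum.distrib scaleR_sum_right)
  have "\<not> surj L"
  proof
    assume "surj L"
    moreover have "range L \<subseteq> span T"
      unfolding L_def by (auto intro!: span_sum span_scale intro: span_base)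
    ultimately have "span T = UNIV" by auto
    then have "DIM('n coords) = dim T" by (metis dim_UNIV dim_span)
    then show False using dim_le_card'[OF T(1)] T(2) by simp
  qed
  then have "\<not> inj L" using linear_injective_imp_surjective[OF lin] by blast
  then obtain w where w: "w \<noteq> 0" "L w = 0" using linear_injective_0[OF lin] by blast
  have "(\<Sum>t\<in>T. (g w t)\<^sup>2) = g w (L w)"
  proof -
    have "linear (g w)" using g_bilinear by (simp add: bilinear_def)
    then show ?thesis unfolding L_def by (simp add: linear_sum linear_cmul power2_eq_square)
  qed
  then have "(\<Sum>t\<in>T. (g w t)\<^sup>2) = 0" using w by (simp add: g_linear)
  then show ?thesis using w T by (auto simp: sum_nonneg_eq_0_iff)
qed

lemma continuous_on_bilinear_diag:
  fixes B :: "'n coords \<Rightarrow> 'n coords \<Rightarrow> real"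
  assumes "bilinear B"
  shows "continuous_on S (\<lambda>v. B v v)"
proof -
  have "bounded_bilinear B" using assms by (simp add: bilinear_conv_bounded_bilinear)
  from bounded_bilinear.continuous_on[OF this continuous_on_id continuous_on_id] show ?thesis .
qed

text \<open>The Rayleigh quotient B v v / g v v attains its maximum d on the unit sphere of V, at y.
  Then d g - B is nonnegative on V and vanishes at y, so its first variation at y is zero.\<close>

lemma exists_eigenvector:
  fixes B :: "'n coords \<Rightarrow> 'n coords \<Rightarrow> real"
  assumes B: "bilinear B" "\<And>v w. B v w = B w v"
    and V: "subspace V" and ne: "w0 \<in> V" "w0 \<noteq> 0"
  shows "\<exists>x d. x \<in> V \<and> g x x = 1 \<and> (\<forall>w\<in>V. B x w = d * g x w)"
proof -
  define K where "K = sphere 0 1 \<inter> V"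
  have K: "compact K" unfolding K_def by (intro compact_Int_closed compact_sphere closed_subspace V)
  have "K \<noteq> {}"
  proof -
    have "(1 / norm w0) *\<^sub>R w0 \<in> K" using ne V by (auto simp: K_def subspace_scale)
    then show ?thesis by blast
  qed
  moreover have "continuous_on K (\<lambda>v. B v v / g v v)"
  proof (intro continuous_on_divide continuous_on_bilinear_diag[OF B(1)] continuous_on_bilinear_diag[OF g_bilinear] ballI)
    fix v assume "v \<in> K"
    then have "v \<noteq> 0" by (auto simp: K_def)
    then show "g v v \<noteq> 0" using g_pos[of v] by simp
  qed
  ultimately obtain y where y: "y \<in> K" "\<And>v. v \<in> K \<Longrightarrow> B v v / g v v \<le> B y y / g y y"
    using continuous_attains_sup[OF K] by blast
  have yV: "y \<in> V" "y \<noteq> 0" using y by (auto simp: K_def)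
  have gy: "g y y > 0" using yV g_pos by blast
  define d where "d = B y y / g y y"
  have le: "B v v \<le> d * g v v" if "v \<in> V" for v
  proof (cases "v = 0")
    case False
    define c where "c = 1 / norm v"
    have c: "c > 0" using False by (simp add: c_def)
    have "c *\<^sub>R v \<in> K" using False that V by (auto simp: K_def c_def subspace_scale)
    from y(2)[OF this] have "B (c *\<^sub>R v) (c *\<^sub>R v) / g (c *\<^sub>R v) (c *\<^sub>R v) \<le> d" by (simp add: d_def)
    then have "B v v / g v v \<le> d"
      using c by (simp add: g_linear bilinear_lmul[OF B(1)] bilinear_rmul[OF B(1)])
    then show ?thesis using g_pos[OF False] by (simp add: pos_divide_le_eq)
  qed (simp add: g_linear bilinear_lzero[OF B(1)])
  have eig: "B y w = d * g y w" if w: "w \<in> V" for w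
  proof -
    define a where "a = d * g y w - B y w"
    define q where "q = d * g w w - B w w"
    have "H_ge": "2 * t * a + t\<^sup>2 * q \<ge> 0" for t
    proof -
      have "y + t *\<^sub>R w \<in> V" using V w yV by (simp add: subspace_add subspace_scale)
      from le[OF this] have "B (y + t *\<^sub>R w) (y + t *\<^sub>R w) \<le> d * g (y + t *\<^sub>R w) (y + t *\<^sub>R w)" .
      moreover have "B (y + t *\<^sub>R w) (y + t *\<^sub>R w) = B y y + 2 * t * B y w + t\<^sup>2 * B w w"
        using B(2)[of w y] by (simp add: bilinear_ladd[OF B(1)] bilinear_radd[OF B(1)] bilinear_lmul[OF B(1)]
            bilinear_rmul[OF B(1)] power2_eq_square algebra_simps)
      moreover have "g (y + t *\<^sub>R w) (y + t *\<^sub>R w) = g y y + 2 * t * g y w + t\<^sup>2 * g w w"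
        using g_sym[of w y] by (simp add: g_linear power2_eq_square algebra_simps)
      moreover have "B y y = d * g y y" using gy by (simp add: d_def)
      ultimately show ?thesis by (simp add: a_def q_def algebra_simps)
    qed
    have q0: "q \<ge> 0" using le[OF w] by (simp add: q_def)
    have "a = 0"
    proof (rule ccontr)
      assume a: "a \<noteq> 0"
      \<comment> \<open>For a nonzero a this t makes the quadratic negative; q + 1 instead of q
        keeps the denominator positive.\<close>
      have "2 * (- a / (q + 1)) * a + (- a / (q + 1))\<^sup>2 * q \<ge> 0" by (rule H_ge)
      also have "2 * (- a / (q + 1)) * a + (- a / (q + 1))\<^sup>2 * q = - (a\<^sup>2 * (q + 2)) / (q + 1)\<^sup>2"
        using q0 by (simp add: power2_eq_square divide_simps) (simp add: algebra_simps)
      finally have "a\<^sup>2 * (q + 2) / (q + 1)\<^sup>2 \<le> 0" by simp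
      moreover have "a\<^sup>2 * (q + 2) / (q + 1)\<^sup>2 > 0" using a q0 by (intro divide_pos_pos mult_pos_pos) auto
      ultimately show False by simp
    qed
    then show ?thesis by (simp add: a_def)
  qed
  define c where "c = 1 / sqrt (g y y)"
  have "g (c *\<^sub>R y) (c *\<^sub>R y) = 1" using gy by (simp add: g_linear c_def)
  moreover have "c *\<^sub>R y \<in> V" using V yV by (simp add: subspace_scale)
  moreover have "B (c *\<^sub>R y) w = d * g (c *\<^sub>R y) w" if "w \<in> V" for w
    using eig[OF that] by (simp add: g_linear bilinear_lmul[OF B(1)])
  ultimately show ?thesis by blast
qed

text \<open>The J-invariant complement V of the vectors found so far is nonzero, since these are at
  most 2 |I| < 2n in number, and it contains an eigenvector y relative to V. The relation extends to
  all w because both B y and g y vanish on the earlier frame vectors and their images under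
  J.\<close>

lemma exists_eigenframe_on:
  fixes B :: "'n coords \<Rightarrow> 'n coords \<Rightarrow> real" and I :: "'n set"
  assumes B: "bilinear B" "\<And>v w. B v w = B w v" "\<And>v w. B (J v) (J w) = B v w"
  shows "\<exists>x d. (\<forall>i\<in>I. \<forall>j\<in>I. g (x i) (x j) = (if i = j then 1 else 0) \<and> g (x i) (J (x j)) = 0) \<and>
     (\<forall>i\<in>I. \<forall>w. B (x i) w = d i * g (x i) w)"
proof -
  have "finite I" by simp
  then show ?thesis
  proof (induction I rule: finite_induct)
    case (insert k I)
    then obtain x d where
      x: "\<And>i j. i \<in> I \<Longrightarrow> j \<in> I \<Longrightarrow> g (x i) (x j) = (if i = j then 1 else 0)"
         "\<And>i j. i \<in> I \<Longrightarrow> j \<in> I \<Longrightarrow> g (x i) (J (x j)) = 0"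
      and d: "\<And>i w. i \<in> I \<Longrightarrow> B (x i) w = d i * g (x i) w" by blast
    define V where "V = {w. \<forall>i\<in>I. g w (x i) = 0 \<and> g w (J (x i)) = 0}"
    have V: "subspace V" by (auto simp: V_def subspace_def g_linear)
    have "card (x ` I \<union> (J \<circ> x) ` I) \<le> card I + card I"
      using card_Un_le[of "x ` I" "(J \<circ> x) ` I"] card_image_le[of I x] card_image_le[of I "J \<circ> x"] by simp
    also have "card I < CARD('n)" using insert(2) by (intro psubset_card_mono) auto
    finally have "card (x ` I \<union> (J \<circ> x) ` I) < DIM('n coords)" by simp
    with exists_orthogonal obtain w0 where w0: "w0 \<noteq> 0" "\<And>t. t \<in> x ` I \<union> (J \<circ> x) ` I \<Longrightarrow> g w0 t = 0"
      by (metis finite_Un finite_imageI insert(1))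
    then have w0V: "w0 \<in> V" by (auto simp: V_def)
    obtain y e where y: "y \<in> V" "g y y = 1" "\<And>w. w \<in> V \<Longrightarrow> B y w = e * g y w"
      using exists_eigenvector[OF B(1,2) V w0V w0(1)] by blast
    have yI: "g y (x i) = 0" "g y (J (x i)) = 0" "g (J y) (x i) = 0" "g (x i) (J y) = 0" "g (x i) y = 0" if "i \<in> I" for i
      using y(1) that J_skew[OF g_J g_bilinear, of y "x i"] g_sym[of "x i"] by (auto simp: V_def)
    have By: "B y w = e * g y w" for w
    proof -
      \<comment> \<open>The g-orthogonal projection of w to the span of the earlier frame, so that w
        - p lies in V.\<close>
      define p where "p = (\<Sum>i\<in>I. g w (x i) *\<^sub>R x i + g w (J (x i)) *\<^sub>R J (x i))"
      have lin: "linear (g u)" "linear (\<lambda>v. g v u)" "linear (B u)" for u using g_bilinear B(1) by (auto simp: bilinear_def)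
      have gx: "g p (x j) = g w (x j)" "g p (J (x j)) = g w (J (x j))" if "j \<in> I" for j
      proof -
        have jx: "g (J (x i)) (x j) = 0" if "i \<in> I" for i
          using x(2)[OF \<open>j \<in> I\<close> that] g_sym by simp
        have "g p (x j) = (\<Sum>i\<in>I. g w (x i) * g (x i) (x j) + g w (J (x i)) * g (J (x i)) (x j))"
          unfolding p_def by (simp add: linear_sum[OF lin(2)] g_linear)
        also have "\<dots> = (\<Sum>i\<in>I. if i = j then g w (x j) else 0)"
          using that jx x(1) by (intro sum.cong) auto
        finally show "g p (x j) = g w (x j)" using that insert(1) by simp
        have "g p (J (x j)) = (\<Sum>i\<in>I. g w (x i) * g (x i) (J (x j)) + g w (J (x i)) * g (J (x i)) (J (x j)))"
          unfolding p_def by (simp add: linear_sum[OF lin(2)] g_linear)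
        also have "\<dots> = (\<Sum>i\<in>I. if i = j then g w (J (x j)) else 0)"
          using that x by (intro sum.cong) (auto simp: g_J)
        finally show "g p (J (x j)) = g w (J (x j))" using that insert(1) by simp
      qed
      have "w - p \<in> V" using gx by (auto simp: V_def g_linear)
      then have 1: "B y (w - p) = e * g y (w - p)" by (rule y(3))
      have "B y (x i) = 0" "B y (J (x i)) = 0" if "i \<in> I" for i
      proof -
        show "B y (x i) = 0" using B(2)[of y "x i"] d[OF that] yI[OF that] by simp
        have "B y (J (x i)) = - B (J y) (x i)" using J_skew[OF B(3) B(1), of y "x i"] by simp
        also have "\<dots> = - B (x i) (J y)" using B(2) by simp
        finally show "B y (J (x i)) = 0" using d[OF that] yI[OF that] by simp
      qed
      then have 2: "B y p = 0"
        unfolding p_def by (simp add: linear_sum[OF lin(3)] bilinear_radd[OF B(1)] bilinear_rmul[OF B(1)])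
      have 3: "g y p = 0"
        unfolding p_def using yI by (simp add: linear_sum[OF lin(1)] g_linear)
      show ?thesis using 1 2 3 by (simp add: g_linear bilinear_rsub[OF B(1)])
    qed
    have g1: "g y (J y) = 0" by (rule g_J_self)
    show ?case
      by (rule exI[of _ "x(k := y)"], rule exI[of _ "d(k := e)"])
        (use insert(2) x d y(2) yI By g1 in auto)
  qed simp
qed

lemma exists_eigenframe:
  fixes B :: "'n coords \<Rightarrow> 'n coords \<Rightarrow> real"
  assumes B: "bilinear B" "\<And>v w. B v w = B w v" "\<And>v w. B (J v) (J w) = B v w"
  obtains x :: "'n \<Rightarrow> 'n coords" and d :: "'n \<Rightarrow> real" where
    "\<And>i j. g (x i) (x j) = (if i = j then 1 else 0)" "\<And>i j. g (x i) (J (x j)) = 0"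
    "\<And>i w. B (x i) w = d i * g (x i) w"
  using exists_eigenframe_on[OF B, of UNIV] by auto

end

section \<open>From a real eigenframe to the spectrum on (1,0)-vectors\<close>

lemma prod_linear_factors_eqD:
  fixes l d :: "'n::finite \<Rightarrow> complex"
  assumes "\<And>t. (\<Prod>i\<in>UNIV. t - l i) = (\<Prod>i\<in>UNIV. t - d i)"
  shows "image_mset l (mset_set UNIV) = image_mset d (mset_set UNIV)"
proof -
  have pr: "proots (\<Prod>i\<in>UNIV. [:- f i, 1:]) = image_mset f (mset_set UNIV)" for f :: "'n \<Rightarrow> complex"
    by (subst proots_prod) (auto simp: sum_unfold_sum_mset)
  have "(\<Prod>i\<in>UNIV. [:- l i, 1:]) = (\<Prod>i\<in>UNIV. [:- d i, 1:])"
    unfolding poly_eq_poly_eq_iff[symmetric] fun_eq_iff using assms by (simp add: poly_prod)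
  then show ?thesis using pr by metis
qed

lemma eq_if_add_neg_eq_0: "v + (-1) *s w = 0 \<Longrightarrow> v = w" for v w :: "complex ^ 'k"
  by (simp add: vec_eq_iff)

lemma matrix_diff_ldistrib: "A ** (B - C) = A ** B - A ** C"
  and matrix_diff_rdistrib: "(B - C) ** A = B ** A - C ** A"
  for A B C :: "'a::comm_ring_1 ^ 'k::finite ^ 'k"
  by (simp_all add: matrix_matrix_mult_def vec_eq_iff algebra_simps sum_subtractf)

text \<open>The vector x - i J x: the vector of type (1,0) with real part x.\<close>

definition cvec :: "('n::finite coords \<Rightarrow> 'n coords) \<Rightarrow> 'n coords \<Rightarrow> 'n ccoords" where
  "cvec J x = (\<chi> k. Complex (x $ k) (- (J x $ k)))"

lemma Re_cvec [simp]: "Re_vec (cvec J x) = x" and Im_cvec [simp]: "Im_vec (cvec J x) = - J x"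
  by (simp_all add: cvec_def Re_vec_def Im_vec_def vec_eq_iff)

lemma Re_cnj_vec [simp]: "Re_vec (cnj_vec z) = Re_vec z" and Im_cnj_vec [simp]: "Im_vec (cnj_vec z) = - Im_vec z"
  by (simp_all add: cnj_vec_def Re_vec_def Im_vec_def vec_eq_iff)

lemma Re_vec_simps: "Re_vec (z + w) = Re_vec z + Re_vec w" "Re_vec (c *s z) = Re c *\<^sub>R Re_vec z - Im c *\<^sub>R Im_vec z"
  "Im_vec (z + w) = Im_vec z + Im_vec w" "Im_vec (c *s z) = Re c *\<^sub>R Im_vec z + Im c *\<^sub>R Re_vec z"
  "Re_vec 0 = 0" "Im_vec 0 = 0"
  by (simp_all add: Re_vec_def Im_vec_def vec_eq_iff)

lemma complexify_form_linear_left: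
  assumes "bilinear B"
  shows "complexify_form B (z + z') w = complexify_form B z w + complexify_form B z' w"
    "complexify_form B (c *s z) w = c * complexify_form B z w"
    "complexify_form B 0 w = 0"
  by (simp_all add: complexify_form_def Re_vec_simps bilinear_ladd[OF assms] bilinear_lmul[OF assms]
      bilinear_lsub[OF assms] bilinear_lzero[OF assms] complex_eq_iff algebra_simps)

lemma complexify_form_sum_left:
  assumes "bilinear B"
  shows "complexify_form B (\<Sum>k\<in>I. c k *s z k) w = (\<Sum>k\<in>I. c k * complexify_form B (z k) w)"
  by (induction I rule: infinite_finite_induct) (simp_all add: complexify_form_linear_left[OF assms])

context hermitian_point
begin

lemma cvec_mem_T10: "cvec J x \<in> T10 J"
  by (simp add: T10_def complexify_endo_def cvec_def Re_vec_def Im_vec_def vec_eq_iff complex_eq_iff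
      linear_neg[OF J_linear] flip: Im_vec_def)
    (simp add: J_square linear_neg[OF J_linear] flip: cvec_def Re_vec_def Im_vec_def)

lemma T10_eq_cvec: "z \<in> T10 J \<Longrightarrow> z = cvec J (Re_vec z)"
  by (auto simp: T10_def complexify_endo_def cvec_def Im_vec_def Re_vec_def vec_eq_iff complex_eq_iff)

lemma T10_subspace: "z \<in> T10 J \<Longrightarrow> w \<in> T10 J \<Longrightarrow> z + w \<in> T10 J" "z \<in> T10 J \<Longrightarrow> c *s z \<in> T10 J" "0 \<in> T10 J"
proof -
  have add: "complexify_endo J (z + w) = complexify_endo J z + complexify_endo J w" for z w
    by (simp add: complexify_endo_def Re_vec_simps linear_add[OF J_linear] vec_eq_iff complex_eq_iff)
  have scl: "complexify_endo J (c *s z) = c *s complexify_endo J z" for z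
    by (simp add: complexify_endo_def Re_vec_simps linear_add[OF J_linear] linear_diff[OF J_linear]
        linear_cmul[OF J_linear] vec_eq_iff complex_eq_iff)
  show "z \<in> T10 J \<Longrightarrow> w \<in> T10 J \<Longrightarrow> z + w \<in> T10 J" "z \<in> T10 J \<Longrightarrow> c *s z \<in> T10 J"
    by (auto simp: T10_def add scl vec_eq_iff algebra_simps)
  show "0 \<in> T10 J"
    by (simp add: T10_def complexify_endo_def Re_vec_simps linear_0[OF J_linear] vec_eq_iff complex_eq_iff)
qed

lemma T10_sum: "(\<And>k. k \<in> I \<Longrightarrow> z k \<in> T10 J) \<Longrightarrow> (\<Sum>k\<in>I. c k *s z k) \<in> T10 J"
  by (induction I rule: infinite_finite_induct) (auto intro: T10_subspace)

definition omega :: "'n coords \<Rightarrow> 'n coords \<Rightarrow> real" where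
  "omega v w = g (J v) w"

lemma omega_bilinear: "bilinear omega"
  unfolding omega_def[abs_def] bilinear_def
  by (auto intro!: linearI simp: g_linear linear_add[OF J_linear] linear_cmul[OF J_linear])

lemma complexify_omega_cvec:
  "complexify_form omega (cvec J x) (cnj_vec (cvec J y)) = 2 * Complex (g (J x) y) (g x y)"
  using g_J[of x y] J_skew[OF g_J g_bilinear, of x y]
  by (simp add: complexify_form_def omega_def g_linear J_square linear_neg[OF J_linear] complex_eq_iff)

text \<open>For z = x - i J x the pairing is 2 i g x x, so the Hermitian pairing on (1,0)-vectors is
  definite. This is what makes \<open>h\<close> well defined as a definite description.\<close>

lemma T10_eq_0:
  assumes z: "z \<in> T10 J" and "complexify_form omega z (cnj_vec z) = 0"
  shows "z = 0"
proof -
  have "g (Re_vec z) (Re_vec z) = 0"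
    using assms(2) T10_eq_cvec[OF z] complexify_omega_cvec[of "Re_vec z" "Re_vec z"]
    by (metis complex_eq_iff complex.sel(2) zero_complex.sel(2) mult_eq_0_iff zero_neq_numeral)
  then have "Re_vec z = 0" using g_pos by force
  then have "z = cvec J 0" using T10_eq_cvec[OF z] by simp
  then show ?thesis by (simp add: cvec_def linear_0[OF J_linear] vec_eq_iff complex_eq_iff)
qed

end

text \<open>
  With \<open>\<beta> = dJd\<phi>\<close>, \<open>B(v,w)\<close> below is the \<open>J\<close>-invariant symmetric form \<open>\<omega>\<^sub>\<phi>(v, Jw)\<close>.
\<close>

locale hermitian_point_form = hermitian_point J g
  for J :: "'n::finite coords \<Rightarrow> 'n coords" and g +
  fixes \<beta> :: "'n coords \<Rightarrow> 'n coords \<Rightarrow> real"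
  assumes \<beta>_bilinear: "bilinear \<beta>" and \<beta>_skew: "\<And>v w. \<beta> v w = - \<beta> w v"
begin

text \<open>The factor 1/4 is the 1/2 of i d dbar times the 1/2 of the (1,1)-part, which on real
  vectors is (\<beta>(v, w) + \<beta>(Jv, Jw)) / 2.\<close>

definition B :: "'n coords \<Rightarrow> 'n coords \<Rightarrow> real" where
  "B v w = g v w + (\<beta> v (J w) - \<beta> (J v) w) / 4"

definition omega_c :: "'n ccoords \<Rightarrow> 'n ccoords \<Rightarrow> complex" where
  "omega_c v w = complexify_form omega v w + 1/2 * part11 J (complexify_form \<beta>) v w"

definition h :: "'n ccoords \<Rightarrow> 'n ccoords" where
  "h v = (THE u. u \<in> T10 J \<and> (\<forall>w\<in>T10 J. complexify_form omega u (cnj_vec w) = omega_c v (cnj_vec w)))"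

lemmas \<beta>_linear = bilinear_ladd[OF \<beta>_bilinear] bilinear_radd[OF \<beta>_bilinear]
  bilinear_lmul[OF \<beta>_bilinear] bilinear_rmul[OF \<beta>_bilinear]
  bilinear_lneg[OF \<beta>_bilinear] bilinear_rneg[OF \<beta>_bilinear]
  bilinear_lzero[OF \<beta>_bilinear] bilinear_rzero[OF \<beta>_bilinear]
  bilinear_lsub[OF \<beta>_bilinear] bilinear_rsub[OF \<beta>_bilinear]

lemma B_bilinear: "bilinear B"
  unfolding B_def[abs_def] bilinear_def
  by (auto intro!: linearI simp: g_linear \<beta>_linear linear_add[OF J_linear] linear_cmul[OF J_linear]
      field_simps)

lemma B_sym: "B v w = B w v"
  using \<beta>_skew[of v "J w"] \<beta>_skew[of "J v" w] g_sym[of v w] by (simp add: B_def)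

lemma B_J: "B (J v) (J w) = B v w"
  by (simp add: B_def g_J J_square \<beta>_linear)

lemma omega_c_T10:
  assumes z: "z \<in> T10 J" and w: "w \<in> T10 J"
  shows "omega_c z (cnj_vec w) = complexify_form omega z (cnj_vec w) + 1/2 * complexify_form \<beta> z (cnj_vec w)"
proof -
  have Jz: "complexify_endo J z = \<i> *s z" using z by (simp add: T10_def)
  have "complexify_endo J (cnj_vec w) = cnj_vec (complexify_endo J w)"
    by (simp add: complexify_endo_def linear_neg[OF J_linear] vec_eq_iff complex_eq_iff)
      (simp add: cnj_vec_def)
  also have "\<dots> = - \<i> *s cnj_vec w" using w by (simp add: T10_def cnj_vec_def vec_eq_iff)
  finally have Jw: "complexify_endo J (cnj_vec w) = - \<i> *s cnj_vec w" .
  have "proj10 J z = z" "proj01 J z = 0" "proj01 J (cnj_vec w) = cnj_vec w"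
    unfolding proj10_def proj01_def Jz Jw by (simp_all add: vec_eq_iff)
  then show ?thesis
    by (simp add: omega_c_def part11_def complexify_form_linear_left(3)[OF \<beta>_bilinear])
qed

lemma omega_c_cvec:
  "omega_c (cvec J x) (cnj_vec (cvec J y)) = 2 * Complex (B (J x) y) (B x y)"
  unfolding omega_c_T10[OF cvec_mem_T10 cvec_mem_T10] complexify_omega_cvec
  by (simp add: complexify_form_def B_def J_square \<beta>_linear linear_neg[OF J_linear] complex_eq_iff)

lemma h_eqI:
  assumes u: "u \<in> T10 J" and "\<And>w. w \<in> T10 J \<Longrightarrow> complexify_form omega u (cnj_vec w) = omega_c v (cnj_vec w)"
  shows "h v = u"
  unfolding h_def
proof (rule the_equality)
  fix u' assume u': "u' \<in> T10 J \<and> (\<forall>w\<in>T10 J. complexify_form omega u' (cnj_vec w) = omega_c v (cnj_vec w))"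
  have "u' + (-1) *s u \<in> T10 J" using u u' by (intro T10_subspace) auto
  moreover from this have "complexify_form omega (u' + (-1) *s u) (cnj_vec (u' + (-1) *s u)) = 0"
    using assms u' unfolding complexify_form_linear_left[OF omega_bilinear] by auto
  ultimately have "u' + (-1) *s u = 0" by (rule T10_eq_0)
  then show "u' = u" by (rule eq_if_add_neg_eq_0)
qed (use assms in auto)

text \<open>The vectors x_k - i J x_k form a basis of the (1,0)-space in which h is diagonal with
  entries d k. In any other basis its matrix is conjugate to this diagonal matrix, so the
  characteristic polynomials coincide.\<close>

lemma eigenvalues_of_frame:
  assumes x: "\<And>i j. g (x i) (x j) = (if i = j then 1 else 0)" "\<And>i j. g (x i) (J (x j)) = 0"
    and d: "\<And>i w. B (x i) w = d i * g (x i) w"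
    and l: "eigenvalue_vector (T10 J) h l"
  shows "image_mset (\<lambda>i. l $ i) (mset_set UNIV) = image_mset d (mset_set (UNIV :: 'n set))"
proof -
  define z where "z i = cvec J (x i)" for i
  have zT: "z i \<in> T10 J" for i by (simp add: z_def cvec_mem_T10)
  have zz: "complexify_form omega (z i) (cnj_vec (z j)) = (if i = j then 2 * \<i> else 0)" for i j
    using x(2)[of j i] g_sym[of "J (x i)" "x j"]
    by (simp add: z_def complexify_omega_cvec x complex_eq_iff)
  have inj_z: "a = b" if "(\<Sum>k\<in>UNIV. a k *s z k) = (\<Sum>k\<in>UNIV. b k *s z k)" for a b
  proof
    fix j
    have co: "complexify_form omega (\<Sum>k\<in>UNIV. a k *s z k) (cnj_vec (z j)) = 2 * \<i> * a j" for a
      by (subst complexify_form_sum_left[OF omega_bilinear]) (simp add: zz mult_delta_right if_distrib sum.delta cong: if_cong)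
    show "a j = b j" using co[of a] co[of b] that by simp
  qed
  \<comment> \<open>The coefficients are the ones dictated by pairing with the conjugates of the z
    k; the remainder r is orthogonal to all of them and has to be shown to vanish.\<close>
  have spanz: "v = (\<Sum>k\<in>UNIV. Complex (g (Re_vec v) (x k)) (g (Re_vec v) (J (x k))) *s z k)" if v: "v \<in> T10 J" for v
  proof -
    define r where "r = v + (-1) *s (\<Sum>k\<in>UNIV. Complex (g (Re_vec v) (x k)) (g (Re_vec v) (J (x k))) *s z k)"
    have rT: "r \<in> T10 J" unfolding r_def by (intro T10_subspace T10_sum v zT)
    define y where "y = Re_vec r"
    have vz: "v = cvec J (Re_vec v)" by (rule T10_eq_cvec[OF v])
    have r0: "complexify_form omega r (cnj_vec (z j)) = 0" for j
    proof -
      have "complexify_form omega v (cnj_vec (z j)) = 2 * Complex (g (J (Re_vec v)) (x j)) (g (Re_vec v) (x j))"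
        by (subst vz) (simp add: z_def complexify_omega_cvec)
      moreover have "g (J (Re_vec v)) (x j) = - g (Re_vec v) (J (x j))" by (rule J_skew[OF g_J g_bilinear])
      ultimately show ?thesis
        unfolding r_def complexify_form_linear_left[OF omega_bilinear] complexify_form_sum_left[OF omega_bilinear] zz
        by (simp add: mult_delta_right if_distrib sum.delta complex_eq_iff cong: if_cong)
    qed
    have gy: "g y (x j) = 0" "g y (J (x j)) = 0" for j
    proof -
      have "complexify_form omega r (cnj_vec (z j)) = 2 * Complex (g (J y) (x j)) (g y (x j))"
        by (subst T10_eq_cvec[OF rT]) (simp add: z_def complexify_omega_cvec y_def)
      then have "g (J y) (x j) = 0 \<and> g y (x j) = 0" using r0[of j] by (simp add: complex_eq_iff)
      then show "g y (x j) = 0" "g y (J (x j)) = 0" using J_skew[OF g_J g_bilinear, of y "x j"] by auto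
    qed
    \<comment> \<open>The x_k and J x_k are 2n orthonormal vectors and therefore span the real
      tangent space, so nothing but 0 is orthogonal to all of them.\<close>
    have y0: "y = 0"
    proof (rule ccontr)
      assume y: "y \<noteq> 0"
      define f where "f = case_sum x (J \<circ> x)"
      have fo: "g (f i) (f j) = (if i = j then 1 else 0)" for i j
        by (cases i; cases j) (auto simp: f_def x g_J g_sym[of "J _" "x _"])
      have lin: "linear (g y)" using g_bilinear by (simp add: bilinear_def)
      have inj: "inj f"
        by (rule injI) (metis fo zero_neq_one)
      have ind: "independent (range f)"
      proof (rule real_vector.independent_if_scalars_zero)
        fix c t assume c: "(\<Sum>t\<in>range f. c t *\<^sub>R t) = 0" and "t \<in> range f"
        then obtain i where t: "t = f i" by blast
        have "linear (\<lambda>v. g v t)" using g_bilinear by (simp add: bilinear_def)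
        then have "g (\<Sum>t\<in>range f. c t *\<^sub>R t) t = (\<Sum>t'\<in>range f. g (c t' *\<^sub>R t') t)"
          using linear_sum[of "\<lambda>v. g v t" "\<lambda>t. c t *\<^sub>R t" "range f"] by simp
        then have "0 = (\<Sum>t'\<in>range f. c t' * g t' t)"
          unfolding c by (simp add: g_linear)
        also have "\<dots> = (\<Sum>j\<in>UNIV. c (f j) * g (f j) t)" using inj by (simp add: sum.reindex)
        also have "\<dots> = c t" by (simp add: t fo mult_delta_right if_distrib sum.delta cong: if_cong)
        finally show "c t = 0" by simp
      qed simp
      have "card (range f) = DIM('n coords)" using inj by (simp add: card_image)
      then have "span (range f) = UNIV" using ind by (simp add: card_eq_dim independent_span_bound dim_eq_full[symmetric] dim_eq_card_independent)
      then have "y \<in> span (range f)" by simp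
      moreover have "subspace {w. g y w = 0}" by (auto simp: subspace_def g_linear)
      moreover have "range f \<subseteq> {w. g y w = 0}" using gy by (auto simp: f_def split: sum.splits)
      ultimately have "g y y = 0" using span_minimal by blast
      then show False using g_pos[OF y] by simp
    qed
    have "r = cvec J 0" using T10_eq_cvec[OF rT] y0 unfolding y_def by simp
    also have "\<dots> = 0" by (simp add: cvec_def linear_0[OF J_linear] vec_eq_iff complex_eq_iff)
    finally show ?thesis unfolding r_def by (rule eq_if_add_neg_eq_0)
  qed
  have hz: "h (\<Sum>k\<in>UNIV. c k *s z k) = (\<Sum>k\<in>UNIV. (complex_of_real (d k) * c k) *s z k)" for c
  proof (rule h_eqI)
    fix w assume w: "w \<in> T10 J"
    have zk: "complexify_form omega (z k) (cnj_vec w) * complex_of_real (d k) =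
       complexify_form omega (z k) (cnj_vec w) + 1/2 * complexify_form \<beta> (z k) (cnj_vec w)" for k
    proof -
      have "B (J (x k)) y = d k * g (J (x k)) y" for y
        using d[of k "J y"] J_skew[OF B_J B_bilinear, of "x k" y] J_skew[OF g_J g_bilinear, of "x k" y] by simp
      then have "omega_c (z k) (cnj_vec (cvec J y)) = complexify_form omega (z k) (cnj_vec (cvec J y)) * complex_of_real (d k)" for y
        unfolding z_def omega_c_cvec complexify_omega_cvec by (simp add: d complex_eq_iff)
      then show ?thesis
        using T10_eq_cvec[OF w] omega_c_T10[OF zT w, of k] by metis
    qed
    have "(\<Sum>k\<in>UNIV. c k *s z k) \<in> T10 J" by (rule T10_sum[OF zT])
    then show "complexify_form omega (\<Sum>k\<in>UNIV. (complex_of_real (d k) * c k) *s z k) (cnj_vec w) =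
        omega_c (\<Sum>k\<in>UNIV. c k *s z k) (cnj_vec w)"
      unfolding omega_c_T10[OF \<open>(\<Sum>k\<in>UNIV. c k *s z k) \<in> T10 J\<close> w]
        complexify_form_sum_left[OF omega_bilinear] complexify_form_sum_left[OF \<beta>_bilinear]
        sum_distrib_left sum.distrib[symmetric]
      by (intro sum.cong refl) (use zk in \<open>simp add: algebra_simps\<close>)
  qed (intro T10_sum zT)
  obtain e :: "'n \<Rightarrow> 'n ccoords" and H :: "complex ^ 'n ^ 'n" where
    e: "inj e" "vec.independent (range e)" "vec.span (range e) = T10 J"
    and H: "\<And>j. h (e j) = (\<Sum>i\<in>UNIV. H $ i $ j *s e i)"
    and ch: "\<And>t. det (mat t - H) = (\<Prod>i\<in>UNIV. t - complex_of_real (l $ i))"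
    using l unfolding eigenvalue_vector_def by blast
  have eT: "e j \<in> T10 J" for j using e(3) vec.span_base[of "e j" "range e"] by auto
  \<comment> \<open>Column j holds the coordinates of e j in the basis z, so Q is the change of
    basis that conjugates H into the diagonal matrix D.\<close>
  define Q :: "complex ^ 'n ^ 'n" where
    "Q = (\<chi> k j. Complex (g (Re_vec (e j)) (x k)) (g (Re_vec (e j)) (J (x k))))"
  define D :: "complex ^ 'n ^ 'n" where "D = (\<chi> i j. if i = j then complex_of_real (d i) else 0)"
  have eQ: "e j = (\<Sum>k\<in>UNIV. Q $ k $ j *s z k)" for j
    using spanz[OF eT[of j]] by (simp add: Q_def)
  have QH: "Q ** H = D ** Q"
  proof -
    have "(Q ** H) $ k $ j = (D ** Q) $ k $ j" for k j
    proof -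
      have "(\<Sum>k\<in>UNIV. (complex_of_real (d k) * Q $ k $ j) *s z k) = h (e j)"
        by (subst eQ) (rule hz[symmetric])
      also have "\<dots> = (\<Sum>i\<in>UNIV. H $ i $ j *s (\<Sum>k\<in>UNIV. Q $ k $ i *s z k))"
        unfolding H by (subst eQ) simp
      also have "\<dots> = (\<Sum>k\<in>UNIV. (\<Sum>i\<in>UNIV. Q $ k $ i * H $ i $ j) *s z k)"
        by (simp add: vec.scale_sum_right vec.scale_sum_left, subst sum.swap) (simp add: mult.commute)
      finally have "(\<lambda>k. complex_of_real (d k) * Q $ k $ j) = (\<lambda>k. \<Sum>i\<in>UNIV. Q $ k $ i * H $ i $ j)"
        by (rule inj_z)
      then show ?thesis
        by (simp add: fun_eq_iff matrix_matrix_mult_def D_def if_distrib[of "\<lambda>c. c * _"] sum.delta cong: if_cong)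
    qed
    then show ?thesis by (simp add: vec_eq_iff)
  qed
  have detQ: "det Q \<noteq> 0"
  proof -
    have "c = 0" if c: "Q *v c = 0" for c
    proof -
      have "(\<Sum>j\<in>UNIV. c $ j *s e j) = (\<Sum>j\<in>UNIV. c $ j *s (\<Sum>k\<in>UNIV. Q $ k $ j *s z k))"
        by (subst eQ) simp
      also have "\<dots> = (\<Sum>k\<in>UNIV. (Q *v c) $ k *s z k)"
        by (simp add: vec.scale_sum_right vec.scale_sum_left matrix_vector_mult_def, subst sum.swap) (simp add: mult.commute)
      finally have "(\<Sum>j\<in>UNIV. c $ j *s e j) = 0" by (simp add: c)
      then have "(\<Sum>t\<in>range e. c $ (inv e t) *s t) = 0"
        using e(1) by (simp add: sum.reindex)
      then have "c $ (inv e (e j)) = 0" for j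
        using vec.independentD[OF e(2), of "range e" "\<lambda>t. c $ (inv e t)" "e j"] by auto
      then show "c = 0" using e(1) by (simp add: vec_eq_iff)
    qed
    then have "\<exists>P. P ** Q = mat 1" by (simp add: matrix_left_invertible_ker)
    then obtain P where "P ** Q = mat 1" ..
    then have "det P * det Q = 1" by (metis det_I det_mul)
    then show ?thesis by auto
  qed
  have "(\<Prod>i\<in>UNIV. t - complex_of_real (l $ i)) = (\<Prod>i\<in>UNIV. t - complex_of_real (d i))" for t
  proof -
    have "Q ** mat t = mat t ** Q"
      by (simp add: vec_eq_iff matrix_matrix_mult_def mat_def if_distrib[of "\<lambda>c. c * _"] if_distrib[of "\<lambda>c. _ * c"] sum.delta mult.commute cong: if_cong)
    then have "Q ** (mat t - H) = (mat t - D) ** Q"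
      using QH by (simp add: matrix_diff_ldistrib matrix_diff_rdistrib)
    then have "det Q * det (mat t - H) = det (mat t - D) * det Q"
      by (metis det_mul)
    then have "det (mat t - H) = det (mat t - D)" using detQ by simp
    also have "\<dots> = (\<Prod>i\<in>UNIV. t - complex_of_real (d i))"
      by (subst det_diagonal) (auto simp: mat_def D_def)
    finally show ?thesis by (simp add: ch)
  qed
  then have "image_mset (\<lambda>i. complex_of_real (l $ i)) (mset_set UNIV) = image_mset (\<lambda>i. complex_of_real (d i)) (mset_set UNIV)"
    by (rule prod_linear_factors_eqD)
  then have "image_mset Re (image_mset (\<lambda>i. complex_of_real (l $ i)) (mset_set UNIV)) =
     image_mset Re (image_mset (\<lambda>i. complex_of_real (d i)) (mset_set UNIV))" by simp
  then show ?thesis by (simp add: multiset.map_comp o_def)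
qed

text \<open>The lists d and l agree up to order, hence the symmetric quantities: sum, product and
  set of values.\<close>

lemma exists_frame_eigenvalues:
  assumes l: "eigenvalue_vector (T10 J) h l"
  obtains x :: "'n \<Rightarrow> 'n coords" and d :: "'n \<Rightarrow> real" where
    "\<And>i j. g (x i) (x j) = (if i = j then 1 else 0)" "\<And>i j. g (x i) (J (x j)) = 0"
    "\<And>i. B (x i) (x i) = d i"
    "(\<Sum>i\<in>UNIV. d i) = (\<Sum>i\<in>UNIV. l $ i)" "(\<Prod>i\<in>UNIV. d i) = (\<Prod>i\<in>UNIV. l $ i)"
    "range d = range (\<lambda>i. l $ i)"
proof -
  obtain x :: "'n \<Rightarrow> 'n coords" and d where x: "\<And>i j. g (x i) (x j) = (if i = j then 1 else 0)" "\<And>i j. g (x i) (J (x j)) = 0"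
    "\<And>i w. B (x i) w = d i * g (x i) w"
    by (rule exists_eigenframe[OF B_bilinear B_sym B_J], rule that, assumption+)
  have m: "image_mset (\<lambda>i. l $ i) (mset_set UNIV) = image_mset d (mset_set (UNIV :: 'n set))"
    by (rule eigenvalues_of_frame[OF x l])
  have "(\<Sum>i\<in>UNIV. d i) = (\<Sum>i\<in>UNIV. l $ i)"
    unfolding sum_unfold_sum_mset m ..
  moreover have "(\<Prod>i\<in>UNIV. d i) = (\<Prod>i\<in>UNIV. l $ i)"
    unfolding prod_unfold_prod_mset m ..
  moreover have "range d = range (\<lambda>i. l $ i)"
    using arg_cong[OF m, of set_mset] by simp
  moreover have "B (x i) (x i) = d i" for i using x(1)[of i i] x(3)[of i "x i"] by simp
  ultimately show ?thesis by (intro that[OF x(1,2)])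
qed

end

section \<open>The volume form\<close>

text \<open>Expanding each factor B (L e) (L e) bilinearly amounts to choosing an index pair for
  every i. For a fixed choice q the sum over permutations is the determinant of the rows of
  \<open>T\<close> selected by q: zero if a row is repeated, and sign times det T if the selection
  is a permutation.\<close>

lemma top_power_compose:
  fixes B :: "'n::finite coords \<Rightarrow> 'n coords \<Rightarrow> real"
  assumes b: "bilinear B" and L: "linear L"
  shows "top_power (\<lambda>v w. B (L v) (L w)) = det (matrix L) * top_power B"
proof -
  define T where "T = matrix L"
  define e :: "'n + 'n \<Rightarrow> 'n coords" where "e k = axis k 1" for k
  \<comment> \<open>Flattens a choice of one index pair for each i into a single self-map of the 2n
    indices, i.e. a selection of rows.\<close>
  define qh :: "('n \<Rightarrow> ('n + 'n) \<times> ('n + 'n)) \<Rightarrow> 'n + 'n \<Rightarrow> 'n + 'n"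
    where "qh q = case_sum (fst \<circ> q) (snd \<circ> q)" for q
  define W where "W q = (\<Prod>i\<in>UNIV. B (e (fst (q i))) (e (snd (q i))))" for q :: "'n \<Rightarrow> ('n + 'n) \<times> ('n + 'n)"
  have split_prod: "(\<Prod>a\<in>UNIV. F a) = (\<Prod>i\<in>UNIV. F (Inl i) * F (Inr i))" for F :: "'n + 'n \<Rightarrow> real"
  proof -
    have "(\<Prod>a\<in>(UNIV :: ('n + 'n) set). F a) = prod F (UNIV <+> UNIV)" by simp
    also have "\<dots> = prod F (range Inl) * prod F (range Inr)"
      unfolding Plus_def by (rule prod.union_disjoint) auto
    also have "\<dots> = (\<Prod>i\<in>UNIV. F (Inl i)) * (\<Prod>i\<in>UNIV. F (Inr i))"
      by (simp add: prod.reindex)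
    finally show ?thesis by (simp add: prod.distrib)
  qed
  have Le: "L (e a) $ j = T $ j $ a" for a j
    by (simp add: T_def matrix_def e_def)
  have BL: "B (L (e a)) (L (e c)) = (\<Sum>p\<in>UNIV. T $ fst p $ a * T $ snd p $ c * B (e (fst p)) (e (snd p)))" for a c
    unfolding bilinear_expand[OF b, of "L (e a)"] Le
    by (subst sum.cartesian_product) (simp add: e_def case_prod_beta)
  have term_eq: "(\<Prod>i\<in>UNIV. B (L (e (\<pi> (Inl i)))) (L (e (\<pi> (Inr i))))) = (\<Sum>q\<in>UNIV. W q * (\<Prod>a\<in>UNIV. T $ qh q a $ \<pi> a))" for \<pi>
  proof -
    have "(\<Prod>i\<in>UNIV. B (L (e (\<pi> (Inl i)))) (L (e (\<pi> (Inr i))))) =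
       (\<Sum>q\<in>Pi\<^sub>E UNIV (\<lambda>_. UNIV). \<Prod>i\<in>UNIV. T $ fst (q i) $ \<pi> (Inl i) * T $ snd (q i) $ \<pi> (Inr i) * B (e (fst (q i))) (e (snd (q i))))"
      unfolding BL by (rule prod_sum_PiE) auto
    also have "\<dots> = (\<Sum>q\<in>UNIV. W q * (\<Prod>a\<in>UNIV. T $ qh q a $ \<pi> a))"
    proof (rule sum.cong)
      fix q :: "'n \<Rightarrow> ('n + 'n) \<times> ('n + 'n)"
      show "(\<Prod>i\<in>UNIV. T $ fst (q i) $ \<pi> (Inl i) * T $ snd (q i) $ \<pi> (Inr i) * B (e (fst (q i))) (e (snd (q i)))) =
          W q * (\<Prod>a\<in>UNIV. T $ qh q a $ \<pi> a)"
        unfolding split_prod W_def qh_def prod.distrib[symmetric] by (intro prod.cong) auto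
    qed (simp add: PiE_UNIV_domain)
    finally show ?thesis .
  qed
  have detq: "(\<Sum>\<pi> | \<pi> permutes UNIV. of_int (sign \<pi>) * (\<Prod>a\<in>UNIV. T $ qh q a $ \<pi> a)) =
      (if qh q permutes UNIV then of_int (sign (qh q)) * det T else 0)" for q
  proof -
    have "(\<Sum>\<pi> | \<pi> permutes UNIV. of_int (sign \<pi>) * (\<Prod>a\<in>UNIV. T $ qh q a $ \<pi> a)) = det (\<chi> a. T $ qh q a)"
      by (simp add: det_def)
    also have "\<dots> = (if qh q permutes UNIV then of_int (sign (qh q)) * det T else 0)"
    proof (cases "qh q permutes UNIV")
      case True
      then show ?thesis using det_permute_rows[of "qh q" T] by simp
    next
      case False
      then have "\<not> inj (qh q)"
        by (metis UNIV_I bij_imp_permutes finite_UNIV_inj_surj bij_def finite)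
      then obtain a c where ac: "a \<noteq> c" "qh q a = qh q c" by (auto simp: inj_def)
      have "det (\<chi> a. T $ qh q a) = 0"
        by (rule det_identical_rows[OF ac(1)]) (simp add: row_def ac(2))
      then show ?thesis using False by simp
    qed
    finally show ?thesis .
  qed
  have bij: "bij_betw qh {q. qh q permutes UNIV} {\<pi>. \<pi> permutes UNIV}"
  proof (rule bij_betw_byWitness[where f'="\<lambda>\<pi> i. (\<pi> (Inl i), \<pi> (Inr i))"])
    have 1: "qh (\<lambda>i. (\<pi> (Inl i), \<pi> (Inr i))) = \<pi>" for \<pi>
      by (auto simp: qh_def fun_eq_iff split: sum.split)
    show "\<forall>a\<in>{q. qh q permutes UNIV}. (\<lambda>i. (qh a (Inl i), qh a (Inr i))) = a"
      by (simp add: qh_def)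
    show "\<forall>a'\<in>{\<pi>. \<pi> permutes UNIV}. qh (\<lambda>i. (a' (Inl i), a' (Inr i))) = a'" using 1 by simp
    show "(\<lambda>\<pi> i. (\<pi> (Inl i), \<pi> (Inr i))) ` {\<pi>. \<pi> permutes UNIV} \<subseteq> {q. qh q permutes UNIV}" using 1 by auto
  qed auto
  have "(\<Sum>\<pi> | \<pi> permutes UNIV. of_int (sign \<pi>) * (\<Prod>i\<in>UNIV. B (L (e (\<pi> (Inl i)))) (L (e (\<pi> (Inr i)))))) =
     (\<Sum>q\<in>UNIV. \<Sum>\<pi> | \<pi> permutes UNIV. W q * (of_int (sign \<pi>) * (\<Prod>a\<in>UNIV. T $ qh q a $ \<pi> a)))"
    unfolding term_eq sum_distrib_left by (subst sum.swap) (simp add: mult.left_commute)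
  also have "\<dots> = (\<Sum>q\<in>UNIV. if qh q permutes UNIV then W q * (of_int (sign (qh q)) * det T) else 0)"
    unfolding sum_distrib_left[symmetric] detq by (simp add: if_distrib cong: if_cong)
  also have "\<dots> = (\<Sum>q | qh q permutes UNIV. W q * (of_int (sign (qh q)) * det T))"
    by (simp add: sum.If_cases)
  also have "\<dots> = (\<Sum>q | qh q permutes UNIV. (of_int (sign (qh q)) * (\<Prod>i\<in>UNIV. B (e (qh q (Inl i))) (e (qh q (Inr i))))) * det T)"
    by (simp add: W_def qh_def mult.commute mult.left_commute mult.assoc)
  also have "\<dots> = (\<Sum>\<pi> | \<pi> permutes UNIV. (of_int (sign \<pi>) * (\<Prod>i\<in>UNIV. B (e (\<pi> (Inl i))) (e (\<pi> (Inr i))))) * det T)"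
    by (rule sum.reindex_bij_betw[OF bij])
  finally show ?thesis
    by (simp add: top_power_def e_def T_def sum_distrib_right[symmetric])
qed

lemma map_sum_transpose:
  "map_sum (Transposition.transpose a b) (Transposition.transpose a b) =
    Transposition.transpose (Inl a) (Inl b) \<circ> Transposition.transpose (Inr a) (Inr b)"
proof
  fix x
  show "map_sum (Transposition.transpose a b) (Transposition.transpose a b) x =
    (Transposition.transpose (Inl a) (Inl b) \<circ> Transposition.transpose (Inr a) (Inr b)) x"
    by (cases x) (simp_all add: Transposition.transpose_def)
qed

text \<open>A transposition acting on both copies of the index set is a product of two
  transpositions, hence even; the general case is induction over transpositions.\<close>

lemma sign_map_sum:
  assumes "\<sigma> permutes (UNIV :: 'n::finite set)"
  shows "sign (map_sum \<sigma> \<sigma>) = 1" and "map_sum \<sigma> \<sigma> permutes UNIV"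
proof -
  have "sign (map_sum \<sigma> \<sigma>) = 1 \<and> map_sum \<sigma> \<sigma> permutes UNIV"
    using finite assms
  proof (induction rule: permutes_rev_induct)
    case id
    have "map_sum id id = (id :: 'n + 'n \<Rightarrow> 'n + 'n)" by (rule map_sum.id)
    then show ?case by (simp only: sign_id permutes_id simp_thms)
  next
    case (swap a b p)
    have eq: "map_sum (p \<circ> Transposition.transpose a b) (p \<circ> Transposition.transpose a b) =
       map_sum p p \<circ> (Transposition.transpose (Inl a) (Inl b) \<circ> Transposition.transpose (Inr a) (Inr b))"
      by (simp add: map_sum_transpose[symmetric] map_sum.comp)
    have t: "Transposition.transpose x y permutes (UNIV :: ('n + 'n) set)" for x y
      by (rule permutes_swap_id) auto
    have perm: "permutation q" if "q permutes (UNIV :: ('n + 'n) set)" for q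
      using that by (auto simp: permutation_permutes intro: finite)
    have sg: "sign (Transposition.transpose (Inl a :: 'n + 'n) (Inl b) \<circ> Transposition.transpose (Inr a) (Inr b)) = 1"
      using swap(3) by (subst sign_compose) (auto simp: sign_swap_id intro: perm t)
    have pe: "(Transposition.transpose (Inl a :: 'n + 'n) (Inl b) \<circ> Transposition.transpose (Inr a) (Inr b)) permutes UNIV"
      by (rule permutes_compose[OF t t])
    have IH: "sign (map_sum p p) = 1" "map_sum p p permutes UNIV" using swap.IH by blast+
    have "sign (map_sum (p \<circ> Transposition.transpose a b) (p \<circ> Transposition.transpose a b)) = 1"
      unfolding eq by (subst sign_compose[OF perm[OF IH(2)] perm[OF pe]]) (simp only: sg IH(1) mult_1_right)
    moreover have "map_sum (p \<circ> Transposition.transpose a b) (p \<circ> Transposition.transpose a b) permutes UNIV"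
      unfolding eq by (rule permutes_compose[OF pe IH(2)])
    ultimately show ?case ..
  qed
  then show "sign (map_sum \<sigma> \<sigma>) = 1" "map_sum \<sigma> \<sigma> permutes UNIV" by auto
qed

text \<open>
  In a frame \<open>x\<^sub>i, Jx\<^sub>i\<close> every nonzero term of the sum defining \<open>\<omega>\<^sup>n\<close> equals 1: swapping the
  two entries of a pair changes both the sign of the permutation and the sign of the factor.
\<close>

definition std_pairing :: "'n + 'n \<Rightarrow> 'n + 'n \<Rightarrow> real" where
  "std_pairing a b = (case a of Inl i \<Rightarrow> (case b of Inl _ \<Rightarrow> 0 | Inr j \<Rightarrow> if i = j then 1 else 0)
     | Inr i \<Rightarrow> (case b of Inr _ \<Rightarrow> 0 | Inl j \<Rightarrow> if i = j then -1 else 0))"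

lemma std_pairing_skew: "std_pairing b a = - std_pairing a b"
  by (auto simp: std_pairing_def split: sum.splits)

lemma std_pairing_term_nonneg:
  assumes "\<pi> permutes (UNIV :: ('n::finite + 'n) set)"
  shows "of_int (sign \<pi>) * (\<Prod>i\<in>UNIV. std_pairing (\<pi> (Inl i)) (\<pi> (Inr i))) \<ge> 0"
  using assms
\<comment> \<open>The induction counts the pairs whose first entry is sent to the second copy.
  Swapping such a pair lowers the count by one; if there is none, a nonzero term comes from a
  permutation acting in the same way on both copies, which is even.\<close>
proof (induction "card {i. \<pi> (Inl i) \<in> range Inr}" arbitrary: \<pi>)
  case 0
  then have no: "\<pi> (Inl i) \<notin> range Inr" for i by auto
  show ?case
  proof (cases "\<exists>i. std_pairing (\<pi> (Inl i)) (\<pi> (Inr i)) = 0")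
    case True
    then have "(\<Prod>i\<in>UNIV. std_pairing (\<pi> (Inl i)) (\<pi> (Inr i))) = 0" by auto
    then show ?thesis by (simp only: mult_zero_right order_refl)
  next
    case False
    define \<sigma> where "\<sigma> i = projl (\<pi> (Inl i))" for i
    have l: "\<pi> (Inl i) = Inl (\<sigma> i)" for i
      using no[of i] by (cases "\<pi> (Inl i)") (auto simp: \<sigma>_def)
    have r: "\<pi> (Inr i) = Inr (\<sigma> i)" for i
    proof -
      have "std_pairing (Inl (\<sigma> i)) (\<pi> (Inr i)) \<noteq> 0" using False l[of i] by metis
      then show ?thesis by (cases "\<pi> (Inr i)") (auto simp: std_pairing_def split: if_splits)
    qed
    have "\<pi> = map_sum \<sigma> \<sigma>"
    proof
      fix x show "\<pi> x = map_sum \<sigma> \<sigma> x" by (cases x) (simp_all add: l r)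
    qed
    moreover have "inj \<sigma>"
      using permutes_inj[OF 0(2)] l by (metis injI injD sum.inject(1))
    then have "\<sigma> permutes UNIV" by (metis bij_imp_permutes finite_UNIV_inj_surj bij_def finite UNIV_I)
    ultimately have "sign \<pi> = 1" using sign_map_sum by metis
    moreover have "std_pairing (\<pi> (Inl i)) (\<pi> (Inr i)) = 1" for i by (simp add: l r std_pairing_def)
    ultimately show ?thesis by simp
  qed
next
  case (Suc m)
  then obtain k where k: "\<pi> (Inl k) \<in> range Inr" by (metis (mono_tags, lifting) card.empty empty_Collect_eq nat.distinct(1))
  define t :: "'n + 'n \<Rightarrow> 'n + 'n" where "t = Transposition.transpose (Inl k) (Inr k)"
  have t: "t permutes UNIV" unfolding t_def by (rule permutes_swap_id) auto
  have perm: "permutation q" if "q permutes (UNIV :: ('n + 'n) set)" for q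
    using that by (auto simp: permutation_permutes intro: finite)
  have pt: "(\<pi> \<circ> t) permutes UNIV" by (rule permutes_compose[OF t Suc(3)])
  have st: "sign (\<pi> \<circ> t) = - sign \<pi>"
    using perm[OF t] perm[OF Suc(3)] by (simp add: sign_compose) (simp add: t_def sign_swap_id)
  have ti: "t (Inl i) = (if i = k then Inr k else Inl i)" "t (Inr i) = (if i = k then Inl k else Inr i)" for i
    by (auto simp: t_def Transposition.transpose_def)
  have flip: "(\<Prod>i\<in>UNIV. std_pairing ((\<pi> \<circ> t) (Inl i)) ((\<pi> \<circ> t) (Inr i))) = - (\<Prod>i\<in>UNIV. std_pairing (\<pi> (Inl i)) (\<pi> (Inr i)))"
  proof -
    have "(\<Prod>i\<in>UNIV. std_pairing ((\<pi> \<circ> t) (Inl i)) ((\<pi> \<circ> t) (Inr i))) =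
       (\<Prod>i\<in>UNIV. (if i = k then -1 else 1) * std_pairing (\<pi> (Inl i)) (\<pi> (Inr i)))"
      by (intro prod.cong) (auto simp: ti std_pairing_skew[of "\<pi> (Inr k)" "\<pi> (Inl k)"])
    then show ?thesis by (simp add: prod.distrib prod.delta)
  qed
  show ?case
  proof (cases "\<exists>i. std_pairing (\<pi> (Inl i)) (\<pi> (Inr i)) = 0")
    case True
    then have "(\<Prod>i\<in>UNIV. std_pairing (\<pi> (Inl i)) (\<pi> (Inr i))) = 0" by auto
    then show ?thesis by (simp only: mult_zero_right order_refl)
  next
    case False
    then have kk: "\<pi> (Inr k) \<notin> range Inr" using k by (metis (no_types, lifting) imageE std_pairing_def sum.case(2))
    have "{i. (\<pi> \<circ> t) (Inl i) \<in> range Inr} = {i. \<pi> (Inl i) \<in> range Inr} - {k}"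
      using kk by (auto simp: ti)
    then have "m = card {i. (\<pi> \<circ> t) (Inl i) \<in> range Inr}" using Suc(2) k by simp
    from Suc(1)[OF this pt] show ?thesis unfolding st flip by simp
  qed
qed

context hermitian_point
begin

text \<open>In an orthonormal frame no term is negative and the identity contributes 1. Returning to
  the standard basis multiplies by a determinant, which cannot turn zero into something
  positive.\<close>

lemma top_power_omega_nonzero: "top_power omega \<noteq> 0"
proof -
  obtain x :: "'n \<Rightarrow> 'n coords" and d where x: "\<And>i j. g (x i) (x j) = (if i = j then 1 else 0)" "\<And>i j. g (x i) (J (x j)) = 0"
    by (rule exists_eigenframe[OF g_bilinear g_sym g_J], rule that, assumption+)
  define f where "f = case_sum x (J \<circ> x)"
  define L :: "'n coords \<Rightarrow> 'n coords" where "L v = (\<Sum>k\<in>UNIV. v $ k *\<^sub>R f k)" for v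
  have L: "linear L"
    unfolding L_def by (auto intro!: linearI simp: scaleR_add_left sum.distrib scaleR_sum_right)
  have Le: "L (axis k 1) = f k" for k
    by (simp add: L_def axis_def if_distrib[of "\<lambda>c. c *\<^sub>R _"] sum.delta cong: if_cong)
  have om: "omega (f a) (f b) = std_pairing a b" for a b
    using x g_sym[of "J _" "x _"]
    by (cases a; cases b) (auto simp: f_def omega_def std_pairing_def g_J J_square g_linear)
  have "top_power (\<lambda>v w. omega (L v) (L w)) =
     (\<Sum>\<pi> | \<pi> permutes (UNIV :: ('n + 'n) set). of_int (sign \<pi>) * (\<Prod>i\<in>UNIV. std_pairing (\<pi> (Inl i)) (\<pi> (Inr i)))) / 2 ^ CARD('n)"
    by (simp add: top_power_def Le om)
  moreover have "(\<Sum>\<pi> | \<pi> permutes (UNIV :: ('n + 'n) set). of_int (sign \<pi>) * (\<Prod>i\<in>UNIV. std_pairing (\<pi> (Inl i)) (\<pi> (Inr i)))) \<ge>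
      of_int (sign (id :: 'n + 'n \<Rightarrow> 'n + 'n)) * (\<Prod>i\<in>UNIV. std_pairing (id (Inl i :: 'n + 'n)) (id (Inr i)))"
    by (rule member_le_sum) (auto simp: id_def[symmetric] permutes_id intro: std_pairing_term_nonneg finite_permutations)
  moreover have "of_int (sign (id :: 'n + 'n \<Rightarrow> 'n + 'n)) * (\<Prod>i\<in>UNIV. std_pairing (id (Inl i :: 'n + 'n)) (id (Inr i))) = 1"
    by (simp add: std_pairing_def)
  ultimately have "top_power (\<lambda>v w. omega (L v) (L w)) > 0" by simp
  then show ?thesis using top_power_compose[OF omega_bilinear L] by auto
qed

end

section \<open>The equation in coordinates\<close>

lemma Ck_on_1_D:
  assumes "Ck_on 1 f U"
  shows "x \<in> U \<Longrightarrow> (f has_derivative frechet_derivative f (at x)) (at x)"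
    and "continuous_on U (\<lambda>x. frechet_derivative f (at x) v)"
  using assms by (auto simp: frechet_derivative_works)

lemma linear_expand:
  fixes L :: "real ^ 'm::finite \<Rightarrow> real"
  assumes "linear L"
  shows "L w = (\<Sum>k\<in>UNIV. w $ k * L (axis k 1))"
proof -
  have "w = (\<Sum>k\<in>UNIV. w $ k *\<^sub>R axis k 1)"
    using basis_expansion[of w] by (simp add: scalar_mult_eq_scaleR)
  then have "L w = (\<Sum>k\<in>UNIV. L (w $ k *\<^sub>R axis k 1))"
    using linear_sum[OF assms, of "\<lambda>k. w $ k *\<^sub>R axis k 1" UNIV] by simp
  then show ?thesis by (simp add: linear_cmul[OF assms])
qed

locale local_hermitian =
  fixes U :: "'n::finite coords set" and J :: "'n coords \<Rightarrow> 'n coords \<Rightarrow> 'n coords"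
    and g :: "'n coords \<Rightarrow> 'n coords \<Rightarrow> 'n coords \<Rightarrow> real"
  assumes open_U: "open U" and point: "\<And>y. y \<in> U \<Longrightarrow> hermitian_point (J y) (g y)"
    and J_C1: "\<And>v. Ck_on 1 (\<lambda>y. J y v) U" and g_C1: "\<And>v w. Ck_on 1 (\<lambda>y. g y v w) U"
begin

definition DJ :: "'n coords \<Rightarrow> 'n coords \<Rightarrow> 'n coords \<Rightarrow> 'n coords" where
  "DJ y v w = frechet_derivative (\<lambda>z. J z w) (at y) v"

text \<open>Where the derivatives of J end up when dJdu is evaluated on (v, Jv): they contribute du
  (E v), see \<open>B_diag\<close>. The field is quadratic in v.\<close>

definition E :: "'n coords \<Rightarrow> 'n coords \<Rightarrow> 'n coords" where
  "E y v = DJ y (J y v) v - DJ y v (J y v)"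

definition \<alpha> :: "('n coords \<Rightarrow> real) \<Rightarrow> 'n coords \<Rightarrow> 'n coords \<Rightarrow> real" where
  "\<alpha> u y w = - dd1 u y (J y w)"

lemma DJ_has_derivative: "y \<in> U \<Longrightarrow> ((\<lambda>z. J z w) has_derivative (\<lambda>v. DJ y v w)) (at y)"
  unfolding DJ_def using Ck_on_1_D(1)[OF J_C1] by simp

lemma DJ_linear_left: "y \<in> U \<Longrightarrow> linear (\<lambda>v. DJ y v w)"
  by (rule has_derivative_linear[OF DJ_has_derivative])

lemma DJ_linear_right:
  assumes y: "y \<in> U"
  shows "linear (DJ y v)"
proof (rule linearI)
  fix w w' c
  have lin: "\<And>z. z \<in> U \<Longrightarrow> linear (J z)" using point by (simp add: hermitian_point_def)
  have "((\<lambda>z. J z w + J z w') has_derivative (\<lambda>v. DJ y v w + DJ y v w')) (at y)"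
    by (intro has_derivative_add DJ_has_derivative y)
  then have "((\<lambda>z. J z (w + w')) has_derivative (\<lambda>v. DJ y v w + DJ y v w')) (at y)"
    by (rule has_derivative_transform_within_open[OF _ open_U y]) (simp add: linear_add[OF lin])
  from has_derivative_unique[OF DJ_has_derivative[OF y] this]
  show "DJ y v (w + w') = DJ y v w + DJ y v w'" by meson
  have "((\<lambda>z. c *\<^sub>R J z w) has_derivative (\<lambda>v. c *\<^sub>R DJ y v w)) (at y)"
    by (intro has_derivative_scaleR_right DJ_has_derivative y)
  then have "((\<lambda>z. J z (c *\<^sub>R w)) has_derivative (\<lambda>v. c *\<^sub>R DJ y v w)) (at y)"
    by (rule has_derivative_transform_within_open[OF _ open_U y]) (simp add: linear_cmul[OF lin])
  from has_derivative_unique[OF DJ_has_derivative[OF y] this]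
  show "DJ y v (c *\<^sub>R w) = c *\<^sub>R DJ y v w" by meson
qed

text \<open>Both the covector and the vector J w vary with the point, so du (J w) is expanded in the
  standard basis and differentiated by the product rule.\<close>

lemma \<alpha>_has_derivative:
  assumes u: "Ck_on 2 u U" and y: "y \<in> U"
  shows "((\<lambda>z. \<alpha> u z w) has_derivative (\<lambda>v. - dd2 u y v (J y w) - dd1 u y (DJ y v w))) (at y)"
proof -
  have "((\<lambda>z. - (\<Sum>k\<in>UNIV. J z w $ k * dd1 u z (axis k 1))) has_derivative
      (\<lambda>v. - (\<Sum>k\<in>UNIV. J y w $ k * dd2 u y v (axis k 1) + DJ y v w $ k * dd1 u y (axis k 1)))) (at y)"
    by (intro has_derivative_minus has_derivative_sum has_derivative_mult dd2_has_derivative[OF u y]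
        bounded_linear.has_derivative[OF bounded_linear_vec_nth] DJ_has_derivative[OF y])
  also have "(\<lambda>v. - (\<Sum>k\<in>UNIV. J y w $ k * dd2 u y v (axis k 1) + DJ y v w $ k * dd1 u y (axis k 1))) =
      (\<lambda>v. - dd2 u y v (J y w) - dd1 u y (DJ y v w))"
    using linear_expand[OF linear_dd2_right[OF u open_U y], of _ "J y w"]
      linear_expand[OF linear_dd1[OF u y], of "DJ y _ w"]
    by (simp add: sum.distrib fun_eq_iff)
  finally show ?thesis
    by (rule has_derivative_transform_within_open[OF _ open_U y])
      (simp add: \<alpha>_def linear_expand[OF linear_dd1[OF u], of _ "J _ w"])
qed

lemma ext_deriv_\<alpha>:
  assumes u: "Ck_on 2 u U" and y: "y \<in> U"
  shows "ext_deriv (\<alpha> u) y v w =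
    dd2 u y w (J y v) + dd1 u y (DJ y w v) - dd2 u y v (J y w) - dd1 u y (DJ y v w)"
proof -
  have "frechet_derivative (\<lambda>z. \<alpha> u z w) (at y) = (\<lambda>v. - dd2 u y v (J y w) - dd1 u y (DJ y v w))" for w
    using frechet_derivative_at[OF \<alpha>_has_derivative[OF u y]] by simp
  then show ?thesis by (simp add: ext_deriv_def)
qed

lemma hermitian_point_form_\<alpha>:
  assumes u: "Ck_on 2 u U" and y: "y \<in> U"
  shows "hermitian_point_form (J y) (g y) (ext_deriv (\<alpha> u) y)"
proof -
  interpret hermitian_point "J y" "g y" using point[OF y] .
  have "bilinear (ext_deriv (\<alpha> u) y)"
    unfolding bilinear_def ext_deriv_\<alpha>[OF u y]
    by (auto intro!: linearI simp: linear_add[OF J_linear] linear_cmul[OF J_linear]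
       linear_add[OF linear_dd1[OF u y]] linear_cmul[OF linear_dd1[OF u y]]
       linear_add[OF linear_dd2_right[OF u open_U y]] linear_cmul[OF linear_dd2_right[OF u open_U y]]
       linear_add[OF linear_dd2_left[OF u y]] linear_cmul[OF linear_dd2_left[OF u y]]
       linear_add[OF DJ_linear_left[OF y]] linear_cmul[OF DJ_linear_left[OF y]]
       linear_add[OF DJ_linear_right[OF y]] linear_cmul[OF DJ_linear_right[OF y]] algebra_simps)
  then show ?thesis by unfold_locales (simp_all add: ext_deriv_\<alpha>[OF u y])
qed

text \<open>Skewness of dJdu combines the two quarters in \<open>B\<close> into one half, and J (J
  v) = - v turns the Hessian term in the direction J (J v) into \<open>dd2 u y v v\<close>. Thus B
  is g plus half the sum of the Hessian over v and Jv, up to a first-order term.\<close>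

lemma B_diag:
  assumes u: "Ck_on 2 u U" and y: "y \<in> U"
  shows "hermitian_point_form.B (J y) (g y) (ext_deriv (\<alpha> u) y) v v =
    g y v v + (dd2 u y v v + dd2 u y (J y v) (J y v) + dd1 u y (E y v)) / 2"
proof -
  interpret hermitian_point_form "J y" "g y" "ext_deriv (\<alpha> u) y"
    by (rule hermitian_point_form_\<alpha>[OF u y])
  have "B v v = g y v v + ext_deriv (\<alpha> u) y v (J y v) / 2"
    unfolding B_def using \<beta>_skew[of "J y v" v] by simp
  also have "ext_deriv (\<alpha> u) y v (J y v) = dd2 u y v v + dd2 u y (J y v) (J y v) + dd1 u y (E y v)"
    unfolding ext_deriv_\<alpha>[OF u y] E_def linear_diff[OF linear_dd1[OF u y]] J_square
      linear_neg[OF linear_dd2_right[OF u open_U y]] by simp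
  finally show ?thesis .
qed

text \<open>Formulated for a function on coordinate space, so that the local estimates do not
  mention the manifold; \<open>eigen_of_eigenvalue_vector\<close> makes the connection with
  \<open>h_endo\<close>.\<close>

definition eigen :: "('n coords \<Rightarrow> real) \<Rightarrow> 'n coords \<Rightarrow> real ^ 'n \<Rightarrow> bool" where
  "eigen u y l \<longleftrightarrow> eigenvalue_vector (T10 (J y)) (hermitian_point_form.h (J y) (g y) (ext_deriv (\<alpha> u) y)) l"

definition frame :: "'n coords \<Rightarrow> ('n + 'n \<Rightarrow> 'n coords) \<Rightarrow> bool" where
  "frame y f \<longleftrightarrow> (\<forall>a b. g y (f a) (f b) = (if a = b then 1 else 0)) \<and> (\<forall>i. f (Inr i) = J y (f (Inl i)))"

lemma exists_frame:
  assumes u: "Ck_on 2 u U" and y: "y \<in> U" and l: "eigen u y l"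
  obtains f d where "frame y f"
    "\<And>i. d i = 1 + (dd2 u y (f (Inl i)) (f (Inl i)) + dd2 u y (f (Inr i)) (f (Inr i)) + dd1 u y (E y (f (Inl i)))) / 2"
    "(\<Sum>i\<in>UNIV. d i) = (\<Sum>i\<in>UNIV. l $ i)" "(\<Prod>i\<in>UNIV. d i) = (\<Prod>i\<in>UNIV. l $ i)"
    "range d = range (\<lambda>i. l $ i)"
proof -
  interpret hermitian_point_form "J y" "g y" "ext_deriv (\<alpha> u) y"
    by (rule hermitian_point_form_\<alpha>[OF u y])
  obtain x :: "'n \<Rightarrow> 'n coords" and d where
    x: "\<And>i j. g y (x i) (x j) = (if i = j then 1 else 0)" "\<And>i j. g y (x i) (J y (x j)) = 0"
    and d: "\<And>i. B (x i) (x i) = d i"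
    and s: "(\<Sum>i\<in>UNIV. d i) = (\<Sum>i\<in>UNIV. l $ i)" "(\<Prod>i\<in>UNIV. d i) = (\<Prod>i\<in>UNIV. l $ i)"
    "range d = range (\<lambda>i. l $ i)"
    by (rule exists_frame_eigenvalues[OF l[unfolded eigen_def]], rule that, assumption+)
  define f where "f = case_sum x (J y \<circ> x)"
  have x': "g y (J y (x i)) (x j) = 0" for i j using g_sym x(2) by metis
  have "g y (f a) (f b) = (if a = b then 1 else 0)" for a b
    by (cases a; cases b) (simp_all add: f_def x x' g_J)
  then have "frame y f" by (simp add: frame_def f_def)
  moreover have "d i = 1 + (dd2 u y (f (Inl i)) (f (Inl i)) + dd2 u y (f (Inr i)) (f (Inr i)) + dd1 u y (E y (f (Inl i)))) / 2" for i
    unfolding d[symmetric] B_diag[OF u y] by (simp add: f_def x)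
  ultimately show ?thesis using s by (rule that)
qed

end

section \<open>Consequences of the structural conditions\<close>

lemma Euler_homogeneous:
  assumes "structural_conditions \<Gamma> f \<gamma>" and l: "l \<in> \<Gamma>"
  shows "(\<Sum>j\<in>UNIV. partial_deriv f j l * l $ j) = f l"
proof -
  have hom: "\<And>t. t > 0 \<Longrightarrow> f (t *\<^sub>R l) = t * f l" and C1: "Ck_on 1 f \<Gamma>"
    using assms by (auto simp: structural_conditions_def)
  have "f differentiable (at l)" using C1 l by simp
  then have D: "(f has_derivative frechet_derivative f (at l)) (at l)" by (simp add: frechet_derivative_works)
  have 1: "((\<lambda>t. t *\<^sub>R l) has_derivative (\<lambda>h. h *\<^sub>R l)) (at (1::real))" by (auto intro!: derivative_eq_intros)
  have "(f \<circ> (\<lambda>t. t *\<^sub>R l) has_derivative frechet_derivative f (at l) \<circ> (\<lambda>h. h *\<^sub>R l)) (at 1)"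
    by (rule diff_chain_at[OF 1]) (use D in simp)
  then have "((\<lambda>t. t * f l) has_derivative frechet_derivative f (at l) \<circ> (\<lambda>h. h *\<^sub>R l)) (at 1)"
    by (rule has_derivative_transform_within_open[of _ _ _ _ "{0<..}"]) (auto simp: hom)
  moreover have "((\<lambda>t. t * f l) has_derivative (\<lambda>h. h * f l)) (at (1::real))" by (auto intro!: derivative_eq_intros)
  ultimately have "frechet_derivative f (at l) \<circ> (\<lambda>h. h *\<^sub>R l) = (\<lambda>h. h * f l)" by (rule has_derivative_unique)
  from fun_cong[OF this, of 1] have fl: "frechet_derivative f (at l) l = f l" by simp
  have lin: "linear (frechet_derivative f (at l))" by (rule has_derivative_linear[OF D])
  have "l = (\<Sum>j\<in>UNIV. l $ j *\<^sub>R axis j 1)"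
    using basis_expansion[of l] by (simp add: scalar_mult_eq_scaleR)
  then have "frechet_derivative f (at l) l = (\<Sum>j\<in>UNIV. frechet_derivative f (at l) (l $ j *\<^sub>R axis j 1))"
    using linear_sum[OF lin, of "\<lambda>j. l $ j *\<^sub>R axis j 1" UNIV] by simp
  then show ?thesis
    unfolding fl by (simp add: partial_deriv_def linear_cmul[OF lin] mult.commute)
qed

lemma prod_eigenvalues_le:
  fixes f :: "real ^ 'n::finite \<Rightarrow> real"
  assumes s: "structural_conditions \<Gamma> f \<gamma>" and l: "l \<in> \<Gamma>" and pos: "\<And>i. l $ i > 0"
  shows "\<gamma> * (\<Prod>i\<in>UNIV. l $ i) \<le> f l ^ CARD('n)"
proof -
  define n where "n = CARD('n)"
  have n: "n \<ge> 1" by (simp add: n_def Suc_leI)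
  have pd: "partial_deriv f j l > 0" for j
    using s l by (auto simp: structural_conditions_def)
  have g: "\<gamma> \<le> (\<Prod>j\<in>UNIV. partial_deriv f j l)" and f0: "f l > 0"
    using s l by (auto simp: structural_conditions_def)
  define P where "P = (\<Prod>j\<in>UNIV. partial_deriv f j l * l $ j)"
  have P0: "P > 0" unfolding P_def using pd pos by (intro prod_pos) auto
  have "P powr (1 / real n) \<le> (\<Sum>j\<in>UNIV. partial_deriv f j l * l $ j / real n)"
    unfolding P_def n_def using pd pos by (intro arith_geom_mean) (auto intro: less_imp_le)
  also have "\<dots> = f l / real n"
    by (simp add: sum_divide_distrib[symmetric] Euler_homogeneous[OF s l])
  \<comment> \<open>Dropping the factor 1/n here only affects the constant.\<close>
  also have "\<dots> \<le> f l" using f0 n by (simp add: divide_le_eq)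
  finally have "(P powr (1 / real n)) ^ n \<le> f l ^ n" by (intro power_mono) auto
  also have "(P powr (1 / real n)) ^ n = P"
    using P0 n by (simp add: powr_realpow[symmetric] powr_powr)
  finally have "P \<le> f l ^ n" .
  moreover have "\<gamma> * (\<Prod>i\<in>UNIV. l $ i) \<le> P"
    unfolding P_def prod.distrib using g pos by (intro mult_right_mono prod_nonneg) (auto intro: less_imp_le)
  ultimately show ?thesis by (simp add: n_def)
qed

lemma sum_eigenvalues_pos:
  assumes "structural_conditions \<Gamma> f \<gamma>" and "l \<in> \<Gamma>"
  shows "(\<Sum>i\<in>UNIV. l $ i) > 0"
proof -
  have "elem_sym 1 l > 0" using assms by (auto simp: structural_conditions_def Gamma_cone_def)
  moreover have "elem_sym 1 l = (\<Sum>i\<in>UNIV. l $ i)"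
  proof -
    have "{S. S \<subseteq> (UNIV :: 'a set) \<and> card S = 1} = (\<lambda>i. {i}) ` UNIV"
      by (auto simp: card_1_singleton_iff)
    then show ?thesis unfolding elem_sym_def by (simp add: sum.reindex)
  qed
  ultimately show ?thesis by simp
qed

section \<open>Negation of functions, and bounds uniform over compact sets\<close>

lemma frechet_derivative_cong_open:
  assumes "open U" "x \<in> U" "\<And>y. y \<in> U \<Longrightarrow> f y = g y"
  shows "frechet_derivative f (at x) = frechet_derivative g (at x)"
proof -
  have "(f has_derivative D) (at x) \<longleftrightarrow> (g has_derivative D) (at x)" for D
    using has_derivative_transform_within_open[of f D x UNIV U g] has_derivative_transform_within_open[of g D x UNIV U f] assms
    by auto
  then show ?thesis by (simp add: frechet_derivative_def)
qed

lemma Ck_on_cong: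
  assumes U: "open U" and "\<And>y. y \<in> U \<Longrightarrow> f y = g y" and "Ck_on k f U"
  shows "Ck_on k g U"
  using assms(2,3)
proof (induction k arbitrary: f g)
  case 0
  then show ?case by (simp cong: continuous_on_cong)
next
  case (Suc k)
  have "g differentiable (at x)" if "x \<in> U" for x
  proof -
    have "f differentiable (at x)" using Suc that by simp
    then show ?thesis
      unfolding differentiable_def
      using has_derivative_transform_within_open[OF _ U that] Suc(2) by blast
  qed
  moreover have "Ck_on k (\<lambda>x. frechet_derivative g (at x) v) U" for v
  proof (rule Suc.IH)
    show "Ck_on k (\<lambda>x. frechet_derivative f (at x) v) U" using Suc(3) by simp
    show "frechet_derivative f (at y) v = frechet_derivative g (at y) v" if "y \<in> U" for y
      using frechet_derivative_cong_open[OF U that Suc(2)] by simp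
  qed
  ultimately show ?case by simp
qed

text \<open>Together with \<open>dd_minus\<close> this lets the contact-set argument for minima be
  applied to -u at a maximum of u.\<close>

lemma Ck_on_minus:
  assumes U: "open U" and "Ck_on k f U"
  shows "Ck_on k (\<lambda>x. - f x) U"
  using assms(2)
proof (induction k arbitrary: f)
  case 0
  then show ?case by (simp add: continuous_on_minus)
next
  case (Suc k)
  have D: "frechet_derivative (\<lambda>x. - f x) (at x) v = - frechet_derivative f (at x) v" if "x \<in> U" for x v
  proof -
    have "(f has_derivative frechet_derivative f (at x)) (at x)"
      using Suc(2) that by (simp add: frechet_derivative_works)
    then have "((\<lambda>x. - f x) has_derivative (\<lambda>v. - frechet_derivative f (at x) v)) (at x)"
      by (rule has_derivative_minus)
    from frechet_derivative_at[OF this] show ?thesis by metis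
  qed
  have "Ck_on k (\<lambda>x. - frechet_derivative f (at x) v) U" for v
    using Suc by simp
  then have "Ck_on k (\<lambda>x. frechet_derivative (\<lambda>x. - f x) (at x) v) U" for v
    by (rule Ck_on_cong[OF U, rotated]) (simp add: D)
  then show ?case using Suc(2) by simp
qed

lemma dd_minus:
  assumes u: "Ck_on 2 u U" and U: "open U" and y: "y \<in> U"
  shows "dd1 (\<lambda>x. - u x) y v = - dd1 u y v" and "dd2 (\<lambda>x. - u x) y v w = - dd2 u y v w"
proof -
  have d1: "dd1 (\<lambda>x. - u x) y v = - dd1 u y v" if "y \<in> U" for y v
    using frechet_derivative_at[OF has_derivative_minus[OF dd1_has_derivative[OF u that]]]
    unfolding dd1_def by metis
  show "dd1 (\<lambda>x. - u x) y v = - dd1 u y v" by (rule d1[OF y])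
  have "((\<lambda>z. - dd1 u z w) has_derivative (\<lambda>v. - dd2 u y v w)) (at y)"
    by (rule has_derivative_minus[OF dd2_has_derivative[OF u y]])
  then have "((\<lambda>z. dd1 (\<lambda>x. - u x) z w) has_derivative (\<lambda>v. - dd2 u y v w)) (at y)"
    by (rule has_derivative_transform_within_open[OF _ U y]) (simp add: d1)
  from frechet_derivative_at[OF this] show "dd2 (\<lambda>x. - u x) y v w = - dd2 u y v w"
    unfolding dd2_def by metis
qed

text \<open>A linear map is controlled by its values on the finitely many standard basis vectors, so
  continuity in y for each fixed vector suffices for a uniform bound.\<close>

lemma linear_family_bound:
  fixes F :: "'a::topological_space \<Rightarrow> real ^ 'm::finite \<Rightarrow> 'b::real_normed_vector"
  assumes K: "compact K" and lin: "\<And>y. y \<in> K \<Longrightarrow> linear (F y)" and c: "\<And>v. continuous_on K (\<lambda>y. F y v)"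
  obtains C where "C \<ge> 0" "\<And>y v. y \<in> K \<Longrightarrow> norm (F y v) \<le> C * norm v"
proof -
  have "\<exists>C\<ge>0. \<forall>y\<in>K. norm (F y v) \<le> C" for v
  proof -
    have "bounded ((\<lambda>y. F y v) ` K)" by (intro compact_imp_bounded compact_continuous_image c K)
    then obtain B where "\<forall>y\<in>K. norm (F y v) \<le> B" by (auto simp: bounded_iff)
    then show ?thesis by (intro exI[of _ "max B 0"]) (auto simp: le_max_iff_disj)
  qed
  then obtain C where C: "\<And>v. C v \<ge> 0" "\<And>v y. y \<in> K \<Longrightarrow> norm (F y v) \<le> C v" by metis
  show ?thesis
  proof (rule that[of "\<Sum>k\<in>UNIV. C (axis k 1)"])
    show "0 \<le> (\<Sum>k\<in>UNIV. C (axis k 1))" by (intro sum_nonneg C)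
    fix y and v :: "real ^ 'm" assume y: "y \<in> K"
    have "v = (\<Sum>k\<in>UNIV. v $ k *\<^sub>R axis k 1)"
      using basis_expansion[of v] by (simp add: scalar_mult_eq_scaleR)
    then have "F y v = (\<Sum>k\<in>UNIV. F y (v $ k *\<^sub>R axis k 1))"
      using linear_sum[OF lin[OF y], of "\<lambda>k. v $ k *\<^sub>R axis k 1" UNIV] by simp
    also have "\<dots> = (\<Sum>k\<in>UNIV. v $ k *\<^sub>R F y (axis k 1))" by (simp add: linear_cmul[OF lin[OF y]])
    also have "norm \<dots> \<le> (\<Sum>k\<in>UNIV. norm v * C (axis k 1))"
      by (intro sum_norm_le) (auto intro!: mult_mono C y component_le_norm_cart)
    finally show "norm (F y v) \<le> (\<Sum>k\<in>UNIV. C (axis k 1)) * norm v"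
      by (simp add: sum_distrib_left[symmetric] mult.commute)
  qed
qed

lemma bilinear_family_bound:
  fixes F :: "'a::topological_space \<Rightarrow> real ^ 'm::finite \<Rightarrow> real ^ 'm \<Rightarrow> 'b::real_normed_vector"
  assumes K: "compact K" and lin: "\<And>y. y \<in> K \<Longrightarrow> bilinear (F y)" and c: "\<And>v w. continuous_on K (\<lambda>y. F y v w)"
  obtains C where "C \<ge> 0" "\<And>y v w. y \<in> K \<Longrightarrow> norm (F y v w) \<le> C * norm v * norm w"
proof -
  have "\<exists>C\<ge>0. \<forall>y\<in>K. \<forall>w. norm (F y v w) \<le> C * norm w" for v
    using linear_family_bound[OF K, of "\<lambda>y. F y v"] lin c by (metis bilinear_def)
  then obtain C where C: "\<And>v. C v \<ge> 0" "\<And>v y w. y \<in> K \<Longrightarrow> norm (F y v w) \<le> C v * norm w" by metis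
  show ?thesis
  proof (rule that[of "\<Sum>k\<in>UNIV. C (axis k 1)"])
    show "0 \<le> (\<Sum>k\<in>UNIV. C (axis k 1))" by (intro sum_nonneg C)
    fix y and v w :: "real ^ 'm" assume y: "y \<in> K"
    have l: "linear (\<lambda>v. F y v w)" using lin[OF y] by (simp add: bilinear_def)
    have "v = (\<Sum>k\<in>UNIV. v $ k *\<^sub>R axis k 1)"
      using basis_expansion[of v] by (simp add: scalar_mult_eq_scaleR)
    then have "F y v w = (\<Sum>k\<in>UNIV. F y (v $ k *\<^sub>R axis k 1) w)"
      using linear_sum[OF l, of "\<lambda>k. v $ k *\<^sub>R axis k 1" UNIV] by simp
    also have "\<dots> = (\<Sum>k\<in>UNIV. v $ k *\<^sub>R F y (axis k 1) w)" using linear_cmul[OF l] by simp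
    also have "norm \<dots> \<le> (\<Sum>k\<in>UNIV. norm v * (C (axis k 1) * norm w))"
      by (intro sum_norm_le) (auto intro!: mult_mono C y component_le_norm_cart)
    finally show "norm (F y v w) \<le> (\<Sum>k\<in>UNIV. C (axis k 1)) * norm v * norm w"
      by (simp add: sum_distrib_left[symmetric] sum_distrib_right[symmetric] mult.commute mult.left_commute)
  qed
qed

lemma Ck_on_1_continuous: "Ck_on 1 f U \<Longrightarrow> continuous_on U f"
  by (intro continuous_at_imp_continuous_on ballI has_derivative_continuous) (rule Ck_on_1_D(1))

section \<open>Geometric constants and the Jacobian on contact sets\<close>

context local_hermitian
begin

text \<open>The estimates on contact sets see the geometry only through these four numbers, which
  makes them uniform in the centre of the ball inside K.\<close>

definition bounds :: "'n coords set \<Rightarrow> real \<Rightarrow> real \<Rightarrow> real \<Rightarrow> real \<Rightarrow> bool" where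
  "bounds K m \<Lambda> CJ CE \<longleftrightarrow> K \<subseteq> U \<and> m > 0 \<and> \<Lambda> > 0 \<and> CJ \<ge> 0 \<and> CE \<ge> 0 \<and>
     (\<forall>y\<in>K. \<forall>v. m * (norm v)\<^sup>2 \<le> g y v v \<and> g y v v \<le> \<Lambda> * (norm v)\<^sup>2 \<and>
        norm (J y v) \<le> CJ * norm v \<and> norm (E y v) \<le> CE * (norm v)\<^sup>2)"

lemma continuous_g: "continuous_on U (\<lambda>y. g y v w)"
  by (rule Ck_on_1_continuous[OF g_C1])

lemma continuous_J: "continuous_on U (\<lambda>y. J y v)"
  by (rule Ck_on_1_continuous[OF J_C1])

lemma bounds_exist:
  assumes K: "compact K" "K \<subseteq> U"
  obtains m \<Lambda> CJ CE where "bounds K m \<Lambda> CJ CE"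
proof -
  have pt: "hermitian_point (J y) (g y)" if "y \<in> K" for y using point that K by auto
  obtain CJ where CJ: "CJ \<ge> 0" "\<And>y v. y \<in> K \<Longrightarrow> norm (J y v) \<le> CJ * norm v"
    using linear_family_bound[OF K(1), of J] hermitian_point.J_linear[OF pt] continuous_on_subset[OF continuous_J K(2)]
    by blast
  obtain G where G: "G \<ge> 0" "\<And>y v w. y \<in> K \<Longrightarrow> norm (g y v w) \<le> G * norm v * norm w"
    using bilinear_family_bound[OF K(1), of g] hermitian_point.g_bilinear[OF pt] continuous_on_subset[OF continuous_g K(2)]
    by blast
  obtain CD where CD: "CD \<ge> 0" "\<And>y v w. y \<in> K \<Longrightarrow> norm (DJ y v w) \<le> CD * norm v * norm w"
  proof (rule bilinear_family_bound[OF K(1), of DJ])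
    show "bilinear (DJ y)" if "y \<in> K" for y
      using DJ_linear_left DJ_linear_right that K by (auto simp: bilinear_def)
    show "continuous_on K (\<lambda>y. DJ y v w)" for v w
      unfolding DJ_def using continuous_on_subset[OF Ck_on_1_D(2)[OF J_C1] K(2)] .
  qed blast
  have E: "norm (E y v) \<le> (2 * CD * CJ) * (norm v)\<^sup>2" if y: "y \<in> K" for y v
  proof -
    have "norm (E y v) \<le> norm (DJ y (J y v) v) + norm (DJ y v (J y v))"
      unfolding E_def by (rule norm_triangle_ineq4)
    also have "\<dots> \<le> CD * norm (J y v) * norm v + CD * norm v * norm (J y v)"
      by (intro add_mono CD y)
    also have "\<dots> = (2 * CD * norm v) * norm (J y v)" by (simp add: algebra_simps)
    also have "\<dots> \<le> (2 * CD * norm v) * (CJ * norm v)"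
      using CD CJ y by (intro mult_left_mono) auto
    finally show ?thesis by (simp add: power2_eq_square algebra_simps)
  qed
  have "\<exists>m>0. \<forall>y\<in>K. \<forall>v. m * (norm v)\<^sup>2 \<le> g y v v"
  proof (cases "K = {}")
    case False
    define S where "S = K \<times> sphere (0 :: 'n coords) 1"
    have S: "compact S" unfolding S_def by (intro compact_Times K compact_sphere)
    have ne: "S \<noteq> {}" using False norm_axis_1 by (force simp: S_def)
    \<comment> \<open>Only continuity in y for fixed vectors is given; expanding in the standard
      basis yields joint continuity on K times the unit sphere, and m is the minimum of g(v,v) over
      this compact set.\<close>
    have "continuous_on S (\<lambda>p. \<Sum>i\<in>UNIV. \<Sum>j\<in>UNIV. snd p $ i * snd p $ j * g (fst p) (axis i 1) (axis j 1))"
    proof (intro continuous_intros)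
      fix i j :: "'n + 'n"
      show "continuous_on S (\<lambda>p. g (fst p) (axis i 1) (axis j 1))"
        by (rule continuous_on_compose2[OF continuous_g[of "axis i 1" "axis j 1"]])
          (use K in \<open>auto simp: S_def intro: continuous_intros\<close>)
    qed
    then have "continuous_on S (\<lambda>p. g (fst p) (snd p) (snd p))"
      by (rule continuous_on_cong[THEN iffD1, rotated 2])
        (use bilinear_expand[OF hermitian_point.g_bilinear[OF pt]] in \<open>auto simp: S_def\<close>)
    then obtain q where q: "q \<in> S" "\<And>p. p \<in> S \<Longrightarrow> g (fst q) (snd q) (snd q) \<le> g (fst p) (snd p) (snd p)"
      using continuous_attains_inf[OF S ne] by blast
    define m where "m = g (fst q) (snd q) (snd q)"
    have m: "m > 0" unfolding m_def using q(1) by (intro hermitian_point.g_pos[OF pt]) (auto simp: S_def)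
    have "m * (norm v)\<^sup>2 \<le> g y v v" if y: "y \<in> K" for y v
    proof (cases "v = 0")
      case False
      have "m \<le> g y ((1 / norm v) *\<^sub>R v) ((1 / norm v) *\<^sub>R v)"
        using q(2)[of "(y, (1 / norm v) *\<^sub>R v)"] y False by (simp add: m_def S_def)
      also have "\<dots> = g y v v / (norm v)\<^sup>2"
        by (simp add: hermitian_point.g_linear[OF pt[OF y]] power2_eq_square)
      finally show ?thesis using False by (simp add: pos_le_divide_eq)
    qed (simp add: hermitian_point.g_linear[OF pt[OF y]])
    then show ?thesis using m by blast
  qed (simp add: exI[of _ 1])
  then obtain m where m: "m > 0" "\<And>y v. y \<in> K \<Longrightarrow> m * (norm v)\<^sup>2 \<le> g y v v" by blast
  \<comment> \<open>The 1 added to G guarantees a positive upper constant.\<close>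
  have gu: "g y v v \<le> (G + 1) * (norm v)\<^sup>2" if y: "y \<in> K" for y v
  proof -
    have "g y v v \<le> G * norm v * norm v" using G(2)[OF y, of v v] by simp
    then show ?thesis by (simp add: power2_eq_square algebra_simps) (smt (verit) mult_nonneg_nonneg norm_ge_zero)
  qed
  have "bounds K m (G + 1) CJ (2 * CD * CJ)"
    unfolding bounds_def using K m G(1) CJ CD(1) E gu by auto
  then show ?thesis by (rule that)
qed

lemma frame_norm_le:
  assumes b: "bounds K m \<Lambda> CJ CE" and y: "y \<in> K" and f: "frame y f"
  shows "m * (norm (f a))\<^sup>2 \<le> 1"
proof -
  have "m * (norm (f a))\<^sup>2 \<le> g y (f a) (f a)" using b y by (simp add: bounds_def)
  then show ?thesis using f by (simp add: frame_def)
qed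

text \<open>The left-hand side is the coefficient of |x|^2 in the error terms of
  \<open>contact_error\<close>, with 3 eps r from the gradient bound in \<open>contact_set\<close>.
  Since frame vectors satisfy |x|^2 <= 1/m, the bound m/2 makes the error at most 1/2.\<close>

definition small :: "real \<Rightarrow> real \<Rightarrow> real \<Rightarrow> real \<Rightarrow> real \<Rightarrow> bool" where
  "small m CJ CE r \<epsilon> \<longleftrightarrow> \<epsilon> > 0 \<and> \<epsilon> * (1 + CJ\<^sup>2) + 3 * \<epsilon> * r * CE / 2 \<le> m / 2"

lemma small_exists:
  assumes "m > 0" "CE \<ge> 0" "r > 0"
  shows "\<exists>\<epsilon>. small m CJ CE r \<epsilon>"
proof -
  define s where "s = (1 + CJ\<^sup>2) + 3 * r * CE / 2"
  have s: "s > 0" using assms by (simp add: s_def add_pos_nonneg)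
  have "k * (1 + CJ\<^sup>2) + 3 * k * r * CE / 2 = k * s" for k
    by (simp add: s_def algebra_simps)
  then have "m / (2 * s) * (1 + CJ\<^sup>2) + 3 * (m / (2 * s)) * r * CE / 2 = m / (2 * s) * s" .
  also have "\<dots> = m / 2" using s by simp
  finally show ?thesis using s assms unfolding small_def by (intro exI[of _ "m / (2 * s)"]) auto
qed

text \<open>The Hessian of u + eps |x - x0|^2, positive semidefinite on the contact set.\<close>

definition Hf :: "('n coords \<Rightarrow> real) \<Rightarrow> real \<Rightarrow> 'n coords \<Rightarrow> 'n coords \<Rightarrow> 'n coords \<Rightarrow> real" where
  "Hf u \<epsilon> y v w = dd2 u y v w + 2 * \<epsilon> * (v \<bullet> w)"

lemma Hf_form:
  assumes u: "Ck_on 2 u U" and y: "y \<in> U"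
  shows "bilinear (Hf u \<epsilon> y)" "Hf u \<epsilon> y v w = Hf u \<epsilon> y w v"
    "form_matrix (Hf u \<epsilon> y) = hess_matrix u y + (2 * \<epsilon>) *\<^sub>R mat 1"
  unfolding bilinear_def Hf_def
  by (auto intro!: linearI simp: linear_add[OF linear_dd2_right[OF u open_U y]] linear_cmul[OF linear_dd2_right[OF u open_U y]]
       linear_add[OF linear_dd2_left[OF u y]] linear_cmul[OF linear_dd2_left[OF u y]] dd2_symmetric[OF u open_U y, of v w]
       inner_add_left inner_add_right inner_commute form_matrix_def hess_matrix_def vec_eq_iff mat_def
       dd2_symmetric[OF u open_U y, of "axis _ 1" "axis _ 1"] inner_axis_axis algebra_simps)

text \<open>On the contact set the first-order and \<open>\<epsilon>\<close>-terms of \<open>B\<close> are absorbed by half of \<open>g\<close>.\<close>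

lemma contact_error:
  assumes b: "bounds K m \<Lambda> CJ CE" and sub: "cball x0 r \<subseteq> K" and s: "small m CJ CE r \<epsilon>" and r: "r > 0"
    and y: "y \<in> contact_set u x0 r \<epsilon>" and f: "frame y f"
  shows "\<epsilon> * ((norm (f (Inl i)))\<^sup>2 + (norm (f (Inr i)))\<^sup>2) + \<bar>dd1 u y (E y (f (Inl i)))\<bar> / 2 \<le> 1 / 2"
proof -
  have yK: "y \<in> K" using y sub by (auto simp: contact_set_def)
  define x where "x = f (Inl i)"
  have fr: "f (Inr i) = J y x" using f by (simp add: frame_def x_def)
  have \<epsilon>: "\<epsilon> > 0" using s by (simp add: small_def)
  have "(norm (J y x))\<^sup>2 \<le> (CJ * norm x)\<^sup>2" using b yK by (intro power_mono) (auto simp: bounds_def)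
  then have 1: "(norm x)\<^sup>2 + (norm (J y x))\<^sup>2 \<le> (1 + CJ\<^sup>2) * (norm x)\<^sup>2" by (simp add: power_mult_distrib algebra_simps)
  have "\<bar>dd1 u y (E y x)\<bar> \<le> 3 * \<epsilon> * r * norm (E y x)" using y by (simp add: contact_set_def)
  also have "\<dots> \<le> 3 * \<epsilon> * r * (CE * (norm x)\<^sup>2)" using b yK \<epsilon> r by (intro mult_left_mono) (auto simp: bounds_def)
  finally have 2: "\<bar>dd1 u y (E y x)\<bar> \<le> 3 * \<epsilon> * r * CE * (norm x)\<^sup>2" by (simp add: algebra_simps)
  have "\<epsilon> * ((norm x)\<^sup>2 + (norm (J y x))\<^sup>2) + \<bar>dd1 u y (E y x)\<bar> / 2 \<le>
      \<epsilon> * ((1 + CJ\<^sup>2) * (norm x)\<^sup>2) + 3 * \<epsilon> * r * CE * (norm x)\<^sup>2 / 2"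
    using 1 2 \<epsilon> by (intro add_mono mult_left_mono divide_right_mono) auto
  also have "\<dots> = (\<epsilon> * (1 + CJ\<^sup>2) + 3 * \<epsilon> * r * CE / 2) * (norm x)\<^sup>2" by (simp add: algebra_simps)
  also have "\<dots> \<le> (m / 2) * (norm x)\<^sup>2" using s by (intro mult_right_mono) (auto simp: small_def)
  also have "\<dots> \<le> 1 / 2" using frame_norm_le[OF b yK f, of "Inl i"] by (simp add: x_def)
  finally show ?thesis by (simp add: x_def[symmetric] fr)
qed

lemma det_bound_frame:
  assumes u: "Ck_on 2 u U" and b: "bounds K m \<Lambda> CJ CE" and sub: "cball x0 r \<subseteq> K"
    and y: "y \<in> contact_set u x0 r \<epsilon>" and f: "frame y f" and c: "\<And>a. Hf u \<epsilon> y (f a) (f a) \<le> c a"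
  shows "\<bar>det (hess_matrix u y + (2 * \<epsilon>) *\<^sub>R mat 1)\<bar> \<le>
    (fact CARD('n + 'n))\<^sup>2 * \<Lambda> ^ CARD('n + 'n) * (\<Prod>a\<in>UNIV. c a)"
proof -
  have yK: "y \<in> K" and yU: "y \<in> U" using y sub b by (auto simp: contact_set_def bounds_def)
  interpret hermitian_point "J y" "g y" by (rule point[OF yU])
  show ?thesis
    unfolding Hf_form(3)[OF u yU, symmetric]
  proof (rule abs_det_le_frame[where f=f and g="g y"])
    show "Hf u \<epsilon> y v v \<ge> 0" for v
      using y by (simp add: Hf_def contact_set_def power2_norm_eq_inner)
    show "g y (axis i 1) (axis i 1) \<le> \<Lambda>" for i
    proof -
      have "g y (axis i 1) (axis i 1) \<le> \<Lambda> * (norm (axis i 1 :: 'n coords))\<^sup>2"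
        using b yK unfolding bounds_def by blast
      then show ?thesis by simp
    qed
  qed (use Hf_form[OF u yU] g_bilinear g_sym g_nonneg f c in \<open>auto simp: frame_def\<close>)
qed

lemma prod_sum_type: "(\<Prod>a\<in>(UNIV :: ('a::finite + 'a) set). F a) = (\<Prod>i\<in>UNIV. F (Inl i) * F (Inr i))"
proof -
  have "(\<Prod>a\<in>(UNIV :: ('a + 'a) set). F a) = prod F (UNIV <+> UNIV)" by simp
  also have "\<dots> = prod F (range Inl) * prod F (range Inr)"
    unfolding Plus_def by (rule prod.union_disjoint) auto
  also have "\<dots> = (\<Prod>i\<in>UNIV. F (Inl i)) * (\<Prod>i\<in>UNIV. F (Inr i))"
    by (simp add: prod.reindex)
  finally show ?thesis by (simp add: prod.distrib)
qed

text \<open>By \<open>contact_error\<close>, d i is at least 1/2 plus half the sum of the two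
  nonnegative values of \<open>Hf\<close> on x_i and J x_i. Hence d i > 0 and both values are at
  most 2 d i. Each d i bounds two diagonal entries, which produces 4^n and the square of the
  product.\<close>

lemma det_bound_at_min:
  assumes u: "Ck_on 2 u U" and b: "bounds K m \<Lambda> CJ CE" and sub: "cball x0 r \<subseteq> K"
    and s: "small m CJ CE r \<epsilon>" and r: "r > 0"
    and y: "y \<in> contact_set u x0 r \<epsilon>" and l: "eigen u y l"
  shows "l $ i > 0" and "\<bar>det (hess_matrix u y + (2 * \<epsilon>) *\<^sub>R mat 1)\<bar> \<le>
    (fact CARD('n + 'n))\<^sup>2 * \<Lambda> ^ CARD('n + 'n) * 4 ^ CARD('n) * (\<Prod>i\<in>UNIV. l $ i)\<^sup>2"
proof -
  have yU: "y \<in> U" using y sub b by (auto simp: contact_set_def bounds_def)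
  obtain f d where f: "frame y f"
    and d: "\<And>i. d i = 1 + (dd2 u y (f (Inl i)) (f (Inl i)) + dd2 u y (f (Inr i)) (f (Inr i)) + dd1 u y (E y (f (Inl i)))) / 2"
    and dl: "(\<Prod>i\<in>UNIV. d i) = (\<Prod>i\<in>UNIV. l $ i)" "range d = range (\<lambda>i. l $ i)"
    by (rule exists_frame[OF u yU l], rule that, assumption+)
  have H0: "Hf u \<epsilon> y v v \<ge> 0" for v
    using y by (simp add: Hf_def contact_set_def power2_norm_eq_inner)
  have di: "1/2 + (Hf u \<epsilon> y (f (Inl i)) (f (Inl i)) + Hf u \<epsilon> y (f (Inr i)) (f (Inr i))) / 2 \<le> d i" for i
    using contact_error[OF b sub s r y f, of i, unfolded power2_norm_eq_inner distrib_left]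
      abs_ge_minus_self[of "dd1 u y (E y (f (Inl i)))"]
    unfolding d Hf_def mult.assoc by argo
  have "d j > 0" for j using di[of j] H0[of "f (Inl j)"] H0[of "f (Inr j)"] by argo
  moreover have "\<exists>j. l $ i = d j" using dl(2) by (metis (mono_tags, lifting) image_iff rangeI)
  ultimately show "l $ i > 0" by auto
  have "\<bar>det (hess_matrix u y + (2 * \<epsilon>) *\<^sub>R mat 1)\<bar> \<le>
    (fact CARD('n + 'n))\<^sup>2 * \<Lambda> ^ CARD('n + 'n) * (\<Prod>a\<in>UNIV. case_sum (\<lambda>i. 2 * d i) (\<lambda>i. 2 * d i) a)"
  proof (rule det_bound_frame[OF u b sub y f])
    show "Hf u \<epsilon> y (f a) (f a) \<le> case_sum (\<lambda>i. 2 * d i) (\<lambda>i. 2 * d i) a" for a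
      using di[of "case_sum id id a"] H0[of "f (Inl (case_sum id id a))"] H0[of "f (Inr (case_sum id id a))"]
      by (cases a) (auto simp: field_simps)
  qed
  also have "(\<Prod>a\<in>UNIV. case_sum (\<lambda>i. 2 * d i) (\<lambda>i. 2 * d i) a) = 4 ^ CARD('n) * (\<Prod>i\<in>UNIV. d i)\<^sup>2"
    unfolding prod_sum_type by (simp add: prod.distrib power2_eq_square)
  finally show "\<bar>det (hess_matrix u y + (2 * \<epsilon>) *\<^sub>R mat 1)\<bar> \<le>
    (fact CARD('n + 'n))\<^sup>2 * \<Lambda> ^ CARD('n + 'n) * 4 ^ CARD('n) * (\<Prod>i\<in>UNIV. l $ i)\<^sup>2"
    by (simp add: dl mult.assoc)
qed

text \<open>With -u in place of u, \<open>contact_error\<close> gives an upper bound 3/2 for every d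
  i. As the sum of the d i is positive, no single one can be very negative either, and this bounds
  the Hessian of -u from above.\<close>

lemma det_bound_at_max:
  assumes u: "Ck_on 2 u U" and b: "bounds K m \<Lambda> CJ CE" and sub: "cball x0 r \<subseteq> K"
    and s: "small m CJ CE r \<epsilon>" and r: "r > 0"
    and y: "y \<in> contact_set (\<lambda>x. - u x) x0 r \<epsilon>" and l: "eigen u y l" "(\<Sum>i\<in>UNIV. l $ i) > 0"
  shows "\<bar>det (hess_matrix (\<lambda>x. - u x) y + (2 * \<epsilon>) *\<^sub>R mat 1)\<bar> \<le>
    (fact CARD('n + 'n))\<^sup>2 * \<Lambda> ^ CARD('n + 'n) * (3 * real CARD('n)) ^ CARD('n + 'n)"
proof -
  have yU: "y \<in> U" using y sub b by (auto simp: contact_set_def bounds_def)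
  have mu: "Ck_on 2 (\<lambda>x. - u x) U" by (rule Ck_on_minus[OF open_U u])
  obtain f d where f: "frame y f"
    and d: "\<And>i. d i = 1 + (dd2 u y (f (Inl i)) (f (Inl i)) + dd2 u y (f (Inr i)) (f (Inr i)) + dd1 u y (E y (f (Inl i)))) / 2"
    and dl: "(\<Sum>i\<in>UNIV. d i) = (\<Sum>i\<in>UNIV. l $ i)"
    by (rule exists_frame[OF u yU l(1)], rule that, assumption+)
  define H where "H = Hf (\<lambda>x. - u x) \<epsilon> y"
  have H0: "H v v \<ge> 0" for v
    using y by (simp add: H_def Hf_def contact_set_def power2_norm_eq_inner)
  have di: "d i \<le> 3/2 - (H (f (Inl i)) (f (Inl i)) + H (f (Inr i)) (f (Inr i))) / 2" for i
    using contact_error[OF b sub s r y f, of i, unfolded power2_norm_eq_inner distrib_left dd_minus[OF u open_U yU]]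
      abs_ge_self[of "dd1 u y (E y (f (Inl i)))"]
    unfolding d H_def Hf_def dd_minus[OF u open_U yU] abs_minus_cancel mult.assoc by argo
  have d3: "d i \<le> 3/2" for i using di[of i] H0[of "f (Inl i)"] H0[of "f (Inr i)"] by argo
  \<comment> \<open>From 0 < d i + (n - 1) 3/2 and the upper bound \<open>di\<close>: half the sum
    of the two Hessian values is less than 3/2 + (n - 1) 3/2 = 3n/2.\<close>
  have hi: "H (f (Inl i)) (f (Inl i)) + H (f (Inr i)) (f (Inr i)) \<le> 3 * real CARD('n)" for i
  proof -
    have "0 < d i + (\<Sum>j\<in>UNIV - {i}. d j)" using l(2) dl sum.remove[of UNIV i d] by simp
    also have "(\<Sum>j\<in>UNIV - {i}. d j) \<le> of_nat (card (UNIV - {i})) * (3/2)"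
      by (rule sum_bounded_above) (use d3 in auto)
    also have "real (card (UNIV - {i})) = real CARD('n) - 1" by (simp add: card_Diff_singleton of_nat_diff Suc_leI)
    finally show ?thesis using di[of i] by (simp add: field_simps)
  qed
  have "\<bar>det (hess_matrix (\<lambda>x. - u x) y + (2 * \<epsilon>) *\<^sub>R mat 1)\<bar> \<le>
    (fact CARD('n + 'n))\<^sup>2 * \<Lambda> ^ CARD('n + 'n) * (\<Prod>a\<in>(UNIV :: ('n + 'n) set). 3 * real CARD('n))"
  proof (rule det_bound_frame[OF mu b sub y f])
    show "Hf (\<lambda>x. - u x) \<epsilon> y (f a) (f a) \<le> 3 * real CARD('n)" for a
      using hi[of "case_sum id id a"] H0[of "f (Inl (case_sum id id a))"] H0[of "f (Inr (case_sum id id a))"]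
      by (cases a) (auto simp: H_def[symmetric])
  qed
  then show ?thesis by simp
qed

end

section \<open>Volume of sublevel sets around an extremum\<close>

context local_hermitian
begin

text \<open>The ball of slopes has volume V, the Jacobian is at most C2 on the contact set, and the
  contact set lies in the sublevel set. So the latter has measure at least V / C2, a number chosen
  before x0 and u.\<close>

lemma sublevel_measure_at_max:
  assumes b: "bounds K m \<Lambda> CJ CE" and s: "small m CJ CE r \<epsilon>" and r: "r > 0"
  shows "\<exists>c>0. \<forall>x0 u. cball x0 r \<subseteq> K \<longrightarrow> Ck_on 2 u U \<longrightarrow> (\<forall>x\<in>cball x0 r. u x \<le> u x0) \<longrightarrow>
    (\<forall>y\<in>cball x0 r. \<exists>l. eigen u y l \<and> (\<Sum>i\<in>UNIV. l $ i) > 0) \<longrightarrow>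
    ennreal c \<le> emeasure lborel {y \<in> cball x0 r. - u y \<le> - u x0 + \<epsilon> * r\<^sup>2}"
proof -
  define C2 where "C2 = (fact CARD('n + 'n))\<^sup>2 * \<Lambda> ^ CARD('n + 'n) * (3 * real CARD('n)) ^ CARD('n + 'n)"
  have C2: "C2 > 0" using b by (simp add: C2_def bounds_def)
  have \<epsilon>: "\<epsilon> > 0" using s by (simp add: small_def)
  define V where "V = measure lborel (ball (0 :: 'n coords) (\<epsilon> * r))"
  have V: "V > 0" unfolding V_def using \<epsilon> r by (intro content_ball_pos) simp
  have V': "emeasure lborel (ball (0 :: 'n coords) (\<epsilon> * r)) = ennreal V"
    unfolding V_def by (rule emeasure_eq_ennreal_measure) (use emeasure_lborel_ball_finite in \<open>auto simp: top.not_eq_extremum\<close>)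
  show ?thesis
  proof (intro exI[of _ "V / C2"] conjI allI impI)
    show "V / C2 > 0" using V C2 by simp
    fix x0 u
    assume sub: "cball x0 r \<subseteq> K" and u: "Ck_on 2 u U" and mx: "\<forall>x\<in>cball x0 r. u x \<le> u x0"
      and l: "\<forall>y\<in>cball x0 r. \<exists>l. eigen u y l \<and> (\<Sum>i\<in>UNIV. l $ i) > 0"
    define S where "S = {y \<in> cball x0 r. - u y \<le> - u x0 + \<epsilon> * r\<^sup>2}"
    have subU: "cball x0 r \<subseteq> U" using sub b by (auto simp: bounds_def)
    have S: "S \<in> sets borel"
      unfolding S_def by (intro borel_closed closed_sublevel_cball[OF _ _ subU] continuous_intros continuous_on_Ck_on_2[OF u])
    have "ennreal V \<le> (\<integral>\<^sup>+x. ennreal (indicator (contact_set (\<lambda>x. - u x) x0 r \<epsilon>) x *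
        \<bar>det (hess_matrix (\<lambda>x. - u x) x + (2 * \<epsilon>) *\<^sub>R mat 1)\<bar>) \<partial>lborel)"
      unfolding V'[symmetric] using mx
      by (intro abp_contact_set[OF Ck_on_minus[OF open_U u] open_U subU r \<epsilon>]) auto
    also have "\<dots> \<le> (\<integral>\<^sup>+x. ennreal C2 * indicator S x \<partial>lborel)"
    proof (intro nn_integral_mono)
      fix x :: "'n coords"
      show "ennreal (indicator (contact_set (\<lambda>x. - u x) x0 r \<epsilon>) x *
        \<bar>det (hess_matrix (\<lambda>x. - u x) x + (2 * \<epsilon>) *\<^sub>R mat 1)\<bar>) \<le> ennreal C2 * indicator S x"
      proof (cases "x \<in> contact_set (\<lambda>x. - u x) x0 r \<epsilon>")
        case True
        then have xS: "x \<in> S" and "x \<in> cball x0 r" by (auto simp: contact_set_def S_def)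
        then obtain k where k: "eigen u x k" "(\<Sum>i\<in>UNIV. k $ i) > 0" using l by blast
        show ?thesis
          using det_bound_at_max[OF u b sub s r True k] True xS by (simp add: C2_def ennreal_leI)
      qed simp
    qed
    also have "\<dots> = ennreal C2 * emeasure lborel S" using S by (simp add: nn_integral_cmult_indicator)
    finally have le: "ennreal V \<le> ennreal C2 * emeasure lborel S" .
    have "emeasure lborel S \<le> emeasure lborel (cball x0 r)"
      by (rule emeasure_mono) (auto simp: S_def)
    then have "emeasure lborel S \<noteq> \<infinity>"
      using emeasure_lborel_cball_finite[of x0 r] by (auto simp: top_unique)
    then obtain t where t: "t \<ge> 0" "emeasure lborel S = ennreal t" by (cases "emeasure lborel S") auto
    have "V \<le> C2 * t" using le t C2 by (simp add: t(2) ennreal_mult[symmetric])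
    then have "V / C2 \<le> t" using C2 by (simp add: pos_divide_le_eq mult.commute)
    then show "ennreal (V / C2) \<le> emeasure lborel {y \<in> cball x0 r. - u y \<le> - u x0 + \<epsilon> * r\<^sup>2}"
      unfolding S_def[symmetric] t(2) by (rule ennreal_leI)
  qed
qed

text \<open>
  The bound on \<open>\<integral> \<bar>F\<bar>\<^sup>p e\<^sup>2\<^sup>n\<^sup>F\<close> makes \<open>e\<^sup>2\<^sup>n\<^sup>F\<close> uniformly integrable, so the sublevel
  set on which it has a definite integral cannot be small.
\<close>

lemma sublevel_measure_at_min:
  assumes b: "bounds K m \<Lambda> CJ CE" and s: "small m CJ CE r \<epsilon>" and r: "r > 0"
    and p: "p > 0" and \<gamma>: "\<gamma> > 0" and K': "K' \<ge> 0"
  shows "\<exists>c>0. \<forall>x0 u \<Gamma> f F. cball x0 r \<subseteq> K \<longrightarrow> Ck_on 2 u U \<longrightarrow> (\<forall>x\<in>cball x0 r. u x0 \<le> u x) \<longrightarrow>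
    structural_conditions \<Gamma> f \<gamma> \<longrightarrow> continuous_on U F \<longrightarrow>
    (\<forall>y\<in>cball x0 r. \<exists>l. eigen u y l \<and> l \<in> \<Gamma> \<and> f l = exp (F y)) \<longrightarrow>
    (\<integral>\<^sup>+y\<in>cball x0 r. ennreal ((1 + \<bar>F y\<bar> powr p) * exp (2 * real CARD('n) * F y)) \<partial>lborel) \<le> ennreal K' \<longrightarrow>
    ennreal c \<le> emeasure lborel {y \<in> cball x0 r. u y \<le> u x0 + \<epsilon> * r\<^sup>2}"
proof -
  define n where "n = real CARD('n)"
  have n: "n \<ge> 0" by (simp add: n_def)
  define C1 where "C1 = (fact CARD('n + 'n))\<^sup>2 * \<Lambda> ^ CARD('n + 'n) * 4 ^ CARD('n) / \<gamma>\<^sup>2"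
  have C1: "C1 > 0" using b \<gamma> by (simp add: C1_def bounds_def)
  have \<epsilon>: "\<epsilon> > 0" using s by (simp add: small_def)
  define V where "V = measure lborel (ball (0 :: 'n coords) (\<epsilon> * r))"
  have V: "V > 0" unfolding V_def using \<epsilon> r by (intro content_ball_pos) simp
  have V': "emeasure lborel (ball (0 :: 'n coords) (\<epsilon> * r)) = ennreal V"
    unfolding V_def by (rule emeasure_eq_ennreal_measure) (use emeasure_lborel_ball_finite in \<open>auto simp: top.not_eq_extremum\<close>)
  \<comment> \<open>Chosen so that the region F > M contributes at most C1 K' / M^p <= V/2; the
    summand 1 keeps the base of the power positive when K' = 0.\<close>
  define M where "M = (2 * C1 * K' / V + 1) powr (1 / p)"
  have X: "2 * C1 * K' / V + 1 > 0" using C1 K' V by (intro add_nonneg_pos) auto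
  have M: "M > 0" using X unfolding M_def by (metis powr_gt_zero less_irrefl)
  have Mp: "M powr p = 2 * C1 * K' / V + 1" using X p by (simp add: M_def powr_powr)
  have small: "C1 * K' / M powr p \<le> V / 2"
  proof -
    have "C1 * K' / (2 * C1 * K' / V + 1) \<le> V / 2"
      using X V C1 K' by (simp add: pos_divide_le_eq) (simp add: field_simps)
    then show ?thesis by (simp add: Mp)
  qed
  define e where "e = exp (2 * n * M)"
  \<comment> \<open>The other half of V must come from the sublevel set, where the truncated
    Jacobian is at most C1 e.\<close>
  define c where "c = V / (2 * C1 * e)"
  show ?thesis
  proof (intro exI[of _ c] conjI allI impI)
    show "c > 0" using V C1 by (simp add: c_def e_def)
    fix x0 u \<Gamma> f F
    assume sub: "cball x0 r \<subseteq> K" and u: "Ck_on 2 u U" and mn: "\<forall>x\<in>cball x0 r. u x0 \<le> u x"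
      and st: "structural_conditions \<Gamma> f \<gamma>" and F: "continuous_on U F"
      and l: "\<forall>y\<in>cball x0 r. \<exists>l. eigen u y l \<and> l \<in> \<Gamma> \<and> f l = exp (F y)"
      and en: "(\<integral>\<^sup>+y\<in>cball x0 r. ennreal ((1 + \<bar>F y\<bar> powr p) * exp (2 * real CARD('n) * F y)) \<partial>lborel) \<le> ennreal K'"
    define S where "S = {y \<in> cball x0 r. u y \<le> u x0 + \<epsilon> * r\<^sup>2}"
    have subU: "cball x0 r \<subseteq> U" using sub b by (auto simp: bounds_def)
    have S: "S \<in> sets borel"
      unfolding S_def by (intro borel_closed closed_sublevel_cball[OF _ _ subU] continuous_intros continuous_on_Ck_on_2[OF u])
    define G where "G y = (1 + \<bar>F y\<bar> powr p) * exp (2 * n * F y)" for y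
    have G0: "G y \<ge> 0" for y by (simp add: G_def)
    have Gm: "(\<lambda>y. ennreal (G y) * indicator (cball x0 r) y) \<in> borel_measurable borel"
    proof -
      have "continuous_on (cball x0 r) G"
        unfolding G_def using p by (intro continuous_intros continuous_on_powr' continuous_on_subset[OF F subU]) auto
      from borel_measurable_continuous_on_indicator[OF _ this]
      have "(\<lambda>y. ennreal (indicator (cball x0 r) y *\<^sub>R G y)) \<in> borel_measurable borel" by simp
      moreover have "ennreal (indicator (cball x0 r) y *\<^sub>R G y) = ennreal (G y) * indicator (cball x0 r) y" for y
        by (simp add: indicator_def)
      ultimately show ?thesis by simp
    qed
    \<comment> \<open>Truncation at height M: where F <= M the exponential is at most
      \<open>e\<close>, and where F > M the factor |F|^p / M^p is at least 1, so that the
      exponential is charged to the entropy.\<close>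
    have dominated: "exp (2 * n * F y) \<le> e + G y / M powr p" for y
    proof (cases "F y \<le> M")
      case True
      then have "exp (2 * n * F y) \<le> e" using n by (simp add: e_def mult_left_mono)
      then show ?thesis using G0[of y] M by (simp add: add_increasing2)
    next
      case False
      then have "M powr p \<le> 1 + \<bar>F y\<bar> powr p" using M p powr_mono2[of p M "\<bar>F y\<bar>"] by simp
      then have "M powr p * exp (2 * n * F y) \<le> G y" unfolding G_def by (intro mult_right_mono) auto
      then have "exp (2 * n * F y) \<le> G y / M powr p" using M by (simp add: pos_le_divide_eq mult.commute)
      then show ?thesis by (simp add: e_def add_increasing)
    qed
    have "ennreal V \<le> (\<integral>\<^sup>+x. ennreal (indicator (contact_set u x0 r \<epsilon>) x *
        \<bar>det (hess_matrix u x + (2 * \<epsilon>) *\<^sub>R mat 1)\<bar>) \<partial>lborel)"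
      unfolding V'[symmetric] using mn by (intro abp_contact_set[OF u open_U subU r \<epsilon>]) auto
    also have "\<dots> \<le> (\<integral>\<^sup>+x. ennreal (C1 * e) * indicator S x + ennreal (C1 / M powr p) * (ennreal (G x) * indicator (cball x0 r) x) \<partial>lborel)"
    proof (intro nn_integral_mono)
      fix x :: "'n coords"
      show "ennreal (indicator (contact_set u x0 r \<epsilon>) x * \<bar>det (hess_matrix u x + (2 * \<epsilon>) *\<^sub>R mat 1)\<bar>) \<le>
          ennreal (C1 * e) * indicator S x + ennreal (C1 / M powr p) * (ennreal (G x) * indicator (cball x0 r) x)"
      proof (cases "x \<in> contact_set u x0 r \<epsilon>")
        case True
        then have xS: "x \<in> S" and xc: "x \<in> cball x0 r" by (auto simp: contact_set_def S_def)
        then obtain k where k: "eigen u x k" "k \<in> \<Gamma>" "f k = exp (F x)" using l by blast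
        have kpos: "k $ i > 0" for i by (rule det_bound_at_min(1)[OF u b sub s r True k(1)])
        have "\<gamma> * (\<Prod>i\<in>UNIV. k $ i) \<le> exp (F x) ^ CARD('n)"
          using prod_eigenvalues_le[OF st k(2) kpos] k(3) by simp
        \<comment> \<open>The determinant bound contains the square of the product of eigenvalues;
          squaring turns e^(nF) into the weight e^(2nF) of the entropy norm.\<close>
        then have "(\<gamma> * (\<Prod>i\<in>UNIV. k $ i))\<^sup>2 \<le> (exp (F x) ^ CARD('n))\<^sup>2"
          using \<gamma> kpos by (intro power_mono mult_nonneg_nonneg prod_nonneg) (auto intro: less_imp_le)
        also have "(exp (F x) ^ CARD('n))\<^sup>2 = exp (2 * n * F x)"
          by (simp add: n_def exp_of_nat_mult[symmetric] exp_double[symmetric] algebra_simps)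
        finally have kk: "(\<Prod>i\<in>UNIV. k $ i)\<^sup>2 \<le> exp (2 * n * F x) / \<gamma>\<^sup>2"
          using \<gamma> by (simp add: power_mult_distrib pos_le_divide_eq mult.commute)
        have "\<bar>det (hess_matrix u x + (2 * \<epsilon>) *\<^sub>R mat 1)\<bar> \<le>
            (fact CARD('n + 'n))\<^sup>2 * \<Lambda> ^ CARD('n + 'n) * 4 ^ CARD('n) * (\<Prod>i\<in>UNIV. k $ i)\<^sup>2"
          by (rule det_bound_at_min(2)[OF u b sub s r True k(1)])
        also have "\<dots> \<le> (fact CARD('n + 'n))\<^sup>2 * \<Lambda> ^ CARD('n + 'n) * 4 ^ CARD('n) * (exp (2 * n * F x) / \<gamma>\<^sup>2)"
          using b by (intro mult_left_mono kk) (auto simp: bounds_def)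
        also have "\<dots> = C1 * exp (2 * n * F x)" by (simp add: C1_def)
        also have "\<dots> \<le> C1 * (e + G x / M powr p)" using C1 dominated by (intro mult_left_mono) auto
        finally have "\<bar>det (hess_matrix u x + (2 * \<epsilon>) *\<^sub>R mat 1)\<bar> \<le> C1 * e + C1 / M powr p * G x"
          by (simp add: algebra_simps)
        then have "ennreal \<bar>det (hess_matrix u x + (2 * \<epsilon>) *\<^sub>R mat 1)\<bar> \<le> ennreal (C1 * e + C1 / M powr p * G x)"
          by (rule ennreal_leI)
        also have "\<dots> = ennreal (C1 * e) + ennreal (C1 / M powr p) * ennreal (G x)"
          using C1 M G0[of x] by (simp add: e_def ennreal_plus ennreal_mult[symmetric])
        finally show ?thesis using True xS xc by simp
      qed simp
    qed
    also have "\<dots> = ennreal (C1 * e) * emeasure lborel S + ennreal (C1 / M powr p) * (\<integral>\<^sup>+x. ennreal (G x) * indicator (cball x0 r) x \<partial>lborel)"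
      using S Gm by (subst nn_integral_add) (auto simp: nn_integral_cmult)
    also have "\<dots> \<le> ennreal (C1 * e) * emeasure lborel S + ennreal (C1 / M powr p) * ennreal K'"
      using en by (intro add_left_mono mult_left_mono) (auto simp: G_def n_def)
    also have "ennreal (C1 / M powr p) * ennreal K' = ennreal (C1 * K' / M powr p)"
      using C1 M K' by (simp add: ennreal_mult[symmetric])
    also have "\<dots> \<le> ennreal (V / 2)" by (rule ennreal_leI[OF small])
    finally have le: "ennreal V \<le> ennreal (C1 * e) * emeasure lborel S + ennreal (V / 2)"
      by (simp add: add_left_mono)
    have "emeasure lborel S \<le> emeasure lborel (cball x0 r)"
      by (rule emeasure_mono) (auto simp: S_def)
    then have "emeasure lborel S \<noteq> \<infinity>"
      using emeasure_lborel_cball_finite[of x0 r] by (auto simp: top_unique)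
    then obtain t where t: "t \<ge> 0" "emeasure lborel S = ennreal t" by (cases "emeasure lborel S") auto
    have "ennreal V \<le> ennreal (C1 * e * t + V / 2)"
      using le t C1 V by (simp add: t(2) ennreal_mult[symmetric] ennreal_plus[symmetric] e_def del: ennreal_plus)
    then have "V \<le> C1 * e * t + V / 2"
      using t C1 V by (subst (asm) ennreal_le_iff) (auto simp: e_def)
    then have "c \<le> t" using C1 by (simp add: c_def e_def field_simps)
    then show "ennreal c \<le> emeasure lborel {y \<in> cball x0 r. u y \<le> u x0 + \<epsilon> * r\<^sup>2}"
      unfolding S_def[symmetric] t(2) by (rule ennreal_leI)
  qed
qed

end

section \<open>Integration by parts and a Poincare inequality\<close>

text \<open>Difference quotients of G along v have integral zero by translation invariance. The mean
  value theorem bounds them by M and they vanish outside one fixed ball, so dominated convergence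
  passes to the limit G', which is measurable for the same reason.\<close>

lemma integral_directional_derivative_eq_0:
  fixes G G' :: "'a::euclidean_space \<Rightarrow> real"
  assumes cont: "continuous_on UNIV G" and supp: "\<And>x. x \<notin> cball z R \<Longrightarrow> G x = 0"
    and der: "\<And>x. ((\<lambda>t. G (x + t *\<^sub>R v)) has_real_derivative G' x) (at 0)"
    and bd: "\<And>x. \<bar>G' x\<bar> \<le> M"
  shows "integrable lborel G'" and "integral\<^sup>L lborel G' = 0"
proof -
  define q where "q k x = (G (x + (1 / real (Suc k)) *\<^sub>R v) - G x) * real (Suc k)" for k x
  have Gm [measurable]: "G \<in> borel_measurable borel" by (rule borel_measurable_continuous_onI[OF cont])
  have Gi: "integrable lborel G"
  proof -
    have "integrable lborel (\<lambda>x. indicator (cball z R) x *\<^sub>R G x)"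
      using borel_integrable_compact[of "cball z R" G] cont continuous_on_subset by auto
    moreover have "(\<lambda>x. indicator (cball z R) x *\<^sub>R G x) = G"
      using supp by (auto simp: indicator_def fun_eq_iff)
    ultimately show ?thesis by (simp only:)
  qed
  have trans: "integral\<^sup>L lborel (\<lambda>x. G (x + c)) = integral\<^sup>L lborel G" "integrable lborel (\<lambda>x. G (x + c))" for c
  proof -
    have "integral\<^sup>L (distr lborel borel ((+) c)) G = integral\<^sup>L lborel (\<lambda>x. G (c + x))"
      by (rule integral_distr) auto
    then show "integral\<^sup>L lborel (\<lambda>x. G (x + c)) = integral\<^sup>L lborel G"
      by (simp add: lborel_distr_plus add.commute)
    have "integrable (distr lborel borel ((+) c)) G \<longleftrightarrow> integrable lborel (\<lambda>x. G (c + x))"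
      by (rule integrable_distr_eq) auto
    then show "integrable lborel (\<lambda>x. G (x + c))" using Gi by (simp add: lborel_distr_plus add.commute)
  qed
  have qi: "integral\<^sup>L lborel (q k) = 0" for k
    unfolding q_def using trans Gi by simp
  have qm [measurable]: "q k \<in> borel_measurable borel" for k unfolding q_def by measurable
  have lim: "(\<lambda>k. q k x) \<longlonglongrightarrow> G' x" for x
  proof -
    have "((\<lambda>t. (G (x + (0 + t) *\<^sub>R v) - G (x + 0 *\<^sub>R v)) / t) \<longlongrightarrow> G' x) (at 0)"
      using der[of x] unfolding DERIV_def by simp
    moreover have "filterlim (\<lambda>k. 1 / real (Suc k)) (at 0) sequentially"
      unfolding filterlim_at using LIMSEQ_Suc[OF lim_1_over_n[where 'a=real]] by auto
    ultimately have "(\<lambda>k. (G (x + (0 + 1 / real (Suc k)) *\<^sub>R v) - G (x + 0 *\<^sub>R v)) / (1 / real (Suc k))) \<longlonglongrightarrow> G' x"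
      by (rule filterlim_compose)
    then show ?thesis by (simp add: q_def)
  qed
  have G'm [measurable]: "G' \<in> borel_measurable borel"
    by (rule borel_measurable_LIMSEQ_real[OF lim qm])
  have der': "((\<lambda>t. G (x + t *\<^sub>R v)) has_real_derivative G' (x + t *\<^sub>R v)) (at t)" for x t
  proof -
    have "((\<lambda>s. G (x + t *\<^sub>R v + s *\<^sub>R v)) has_real_derivative G' (x + t *\<^sub>R v)) (at 0)" by (rule der)
    then have "((\<lambda>s. G (x + (t + s) *\<^sub>R v)) has_real_derivative G' (x + t *\<^sub>R v)) (at 0)"
      by (simp add: scaleR_add_left add.assoc)
    then show ?thesis using DERIV_at_within_shift[of "\<lambda>s. G (x + s *\<^sub>R v)" "G' (x + t *\<^sub>R v)" t 0 UNIV] by simp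
  qed
  have qb: "\<bar>q k x\<bar> \<le> M" for k x
  proof -
    have "0 < 1 / real (Suc k)" by simp
    from MVT2[OF this, of "\<lambda>t. G (x + t *\<^sub>R v)" "\<lambda>t. G' (x + t *\<^sub>R v)"] der'
    obtain s where "G (x + (1 / real (Suc k)) *\<^sub>R v) - G (x + 0 *\<^sub>R v) = (1 / real (Suc k) - 0) * G' (x + s *\<^sub>R v)" by blast
    then have "q k x = G' (x + s *\<^sub>R v)" by (simp add: q_def)
    then show ?thesis using bd by simp
  qed
  have M: "M \<ge> 0" using bd[of 0] by linarith
  \<comment> \<open>All increments have length at most |v|, so enlarging the ball by |v| works for
    every k at once.\<close>
  have q0: "q k x = 0" if "x \<notin> cball z (R + norm v)" for k x
  proof -
    have d: "dist z x > R + norm v" using that by simp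
    have "norm ((1 / real (Suc k)) *\<^sub>R v) \<le> norm v" by (simp add: divide_le_eq mult_le_cancel_left1)
    moreover have "dist z x \<le> dist z (x + (1 / real (Suc k)) *\<^sub>R v) + norm ((1 / real (Suc k)) *\<^sub>R v)"
      using dist_triangle[of z x "x + (1 / real (Suc k)) *\<^sub>R v"] by (simp add: dist_norm)
    ultimately have "dist z (x + (1 / real (Suc k)) *\<^sub>R v) > R" using d by linarith
    moreover have "dist z x > R" using d norm_ge_zero[of v] by linarith
    ultimately show ?thesis using supp[of x] supp[of "x + (1 / real (Suc k)) *\<^sub>R v"] by (simp add: q_def)
  qed
  have dom: "integrable lborel (\<lambda>x. M * indicator (cball z (R + norm v)) x)"
    using emeasure_lborel_cball_finite[of z "R + norm v"] by (auto simp: integrable_mult_right)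
  have ae: "AE x in lborel. norm (q k x) \<le> M * indicator (cball z (R + norm v)) x" for k
  proof (rule AE_I2)
    fix x show "norm (q k x) \<le> M * indicator (cball z (R + norm v)) x"
      using qb[of k x] q0[of x k] M by (cases "x \<in> cball z (R + norm v)") auto
  qed
  show "integrable lborel G'"
    by (rule integrable_dominated_convergence[where s=q, OF _ _ dom _ ae]) (use lim in auto)
  have "(\<lambda>k. integral\<^sup>L lborel (q k)) \<longlonglongrightarrow> integral\<^sup>L lborel G'"
    by (rule integral_dominated_convergence[where s=q, OF _ _ dom _ ae]) (use lim in auto)
  then have "(\<lambda>k::nat. 0) \<longlonglongrightarrow> integral\<^sup>L lborel G'" by (simp only: qi)
  from LIMSEQ_unique[OF this tendsto_const] show "integral\<^sup>L lborel G' = 0" .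
qed

section \<open>A Poincare inequality for two level sets in a ball\<close>

lemma nn_integral_lborel_affine:
  fixes f :: "'a::euclidean_space \<Rightarrow> ennreal"
  assumes [measurable]: "f \<in> borel_measurable borel" and c: "c \<noteq> 0"
  shows "(\<integral>\<^sup>+x. f (t + c *\<^sub>R x) \<partial>lborel) = ennreal (1 / \<bar>c\<bar> ^ DIM('a)) * (\<integral>\<^sup>+x. f x \<partial>lborel)"
proof -
  have "(\<integral>\<^sup>+x. f x \<partial>lborel) = (\<integral>\<^sup>+x. f x \<partial>density (distr lborel borel (\<lambda>x. t + c *\<^sub>R x)) (\<lambda>_. \<bar>c\<bar> ^ DIM('a)))"
    using lborel_affine[OF c, of t] by simp
  also have "\<dots> = ennreal (\<bar>c\<bar> ^ DIM('a)) * (\<integral>\<^sup>+x. f (t + c *\<^sub>R x) \<partial>lborel)"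
    by (subst nn_integral_density) (auto simp: nn_integral_cmult nn_integral_distr)
  finally show ?thesis
    using c by (simp add: mult.assoc[symmetric] ennreal_mult[symmetric])
qed

text \<open>The fundamental theorem of calculus along the segment, which has length at most 2r and
  stays in the ball by convexity. The indicator of the ball in the integrand makes it Borel on the
  whole space, as needed for interchanging integrals later.\<close>

lemma segment_increment_le:
  fixes w :: "'a::euclidean_space \<Rightarrow> real" and D :: "'a \<Rightarrow> 'a"
  assumes der: "\<And>y. y \<in> ball z r \<Longrightarrow> (w has_derivative (\<lambda>h. D y \<bullet> h)) (at y)"
    and D: "continuous_on (ball z r) D" and x: "x \<in> ball z r" and y: "y \<in> ball z r"
  shows "ennreal \<bar>w y - w x\<bar> \<le>
    (\<integral>\<^sup>+\<tau>. indicator {0..1} \<tau> * (ennreal (2 * r) * (indicator (ball z r) (x + \<tau> *\<^sub>R (y - x)) * ennreal (norm (D (x + \<tau> *\<^sub>R (y - x)))))) \<partial>lborel)"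
proof -
  define c where "c \<tau> = x + \<tau> *\<^sub>R (y - x)" for \<tau> :: real
  have c_in: "c \<tau> \<in> ball z r" if "0 \<le> \<tau>" "\<tau> \<le> 1" for \<tau>
  proof -
    have "(1 - \<tau>) *\<^sub>R x + \<tau> *\<^sub>R y \<in> ball z r" using x y that convexD[OF convex_ball] by fastforce
    then show ?thesis by (simp add: c_def algebra_simps)
  qed
  define f where "f \<tau> = D (c \<tau>) \<bullet> (y - x)" for \<tau>
  have cd: "(c has_derivative (\<lambda>h. h *\<^sub>R (y - x))) (at \<tau>)" for \<tau>
    unfolding c_def by (auto intro!: derivative_eq_intros)
  have d: "((\<lambda>\<tau>. w (c \<tau>)) has_real_derivative f \<tau>) (at \<tau>)" if "0 \<le> \<tau>" "\<tau> \<le> 1" for \<tau>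
  proof -
    have "(w \<circ> c has_derivative (\<lambda>h. D (c \<tau>) \<bullet> h) \<circ> (\<lambda>h. h *\<^sub>R (y - x))) (at \<tau>)"
      by (rule diff_chain_at[OF cd der[OF c_in[OF that]]])
    moreover have "(\<lambda>h. D (c \<tau>) \<bullet> h) \<circ> (\<lambda>h. h *\<^sub>R (y - x)) = (*) (f \<tau>)"
      by (auto simp: f_def fun_eq_iff)
    ultimately show ?thesis by (simp add: has_field_derivative_def o_def)
  qed
  have fc: "isCont f \<tau>" if "0 \<le> \<tau>" "\<tau> \<le> 1" for \<tau>
  proof -
    have "isCont D (c \<tau>)" using D c_in[OF that] continuous_on_eq_continuous_at open_ball by blast
    then have "isCont (\<lambda>\<tau>. D (c \<tau>)) \<tau>"
      using isCont_o2[OF has_derivative_continuous[OF cd]] by blast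
    then show ?thesis unfolding f_def by (intro continuous_intros)
  qed
  have "(\<integral>\<tau>. f \<tau> * indicator {0..1} \<tau> \<partial>lborel) = w (c 1) - w (c 0)"
    by (rule integral_FTC_Icc_real) (use d fc in auto)
  moreover have fi: "integrable lborel (\<lambda>\<tau>. f \<tau> * indicator {0..1} \<tau>)"
    using borel_integrable_atLeastAtMost[of 0 1 f] fc by auto
  ultimately have "ennreal \<bar>w y - w x\<bar> \<le> (\<integral>\<^sup>+\<tau>. ennreal (norm (f \<tau> * indicator {0..1} \<tau>)) \<partial>lborel)"
    using integral_norm_bound_ennreal[OF fi] by (simp add: c_def)
  also have "\<dots> \<le> (\<integral>\<^sup>+\<tau>. indicator {0..1} \<tau> * (ennreal (2 * r) * (indicator (ball z r) (c \<tau>) * ennreal (norm (D (c \<tau>))))) \<partial>lborel)"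
  proof (rule nn_integral_mono)
    fix \<tau> :: real
    show "ennreal (norm (f \<tau> * indicator {0..1} \<tau>)) \<le> indicator {0..1} \<tau> * (ennreal (2 * r) * (indicator (ball z r) (c \<tau>) * ennreal (norm (D (c \<tau>)))))"
    proof (cases "0 \<le> \<tau> \<and> \<tau> \<le> 1")
      case True
      have "norm (y - x) \<le> 2 * r" using x y dist_triangle[of y x z] by (simp add: dist_norm norm_minus_commute)
      then have "\<bar>f \<tau>\<bar> \<le> norm (D (c \<tau>)) * (2 * r)"
        unfolding f_def by (intro order_trans[OF Cauchy_Schwarz_ineq2 mult_left_mono]) auto
      then have "ennreal \<bar>f \<tau>\<bar> \<le> ennreal (2 * r) * ennreal (norm (D (c \<tau>)))"
      proof -
        have "r \<ge> 0" using x zero_le_dist[of z x] by (simp del: zero_le_dist)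
        then show ?thesis
          using \<open>\<bar>f \<tau>\<bar> \<le> norm (D (c \<tau>)) * (2 * r)\<close> by (subst ennreal_mult'[symmetric]) (auto intro!: ennreal_leI simp: mult.commute)
      qed
      then show ?thesis using True c_in[of \<tau>] by simp
    qed simp
  qed
  finally show ?thesis by (simp add: c_def)
qed

text \<open>
  Substituting along segments: for \<open>\<tau> \<le> 1/2\<close> the map \<open>x \<mapsto> x + \<tau>(y - x)\<close> contracts volume by at
  most \<open>2\<^sup>-\<^sup>d\<close>, for \<open>\<tau> \<ge> 1/2\<close> the same holds for \<open>y \<mapsto> x + \<tau>(y - x)\<close>.
\<close>

lemma poincare_levels:
  fixes w :: "'a::euclidean_space \<Rightarrow> real" and D :: "'a \<Rightarrow> 'a"
  assumes der: "\<And>y. y \<in> ball z r \<Longrightarrow> (w has_derivative (\<lambda>h. D y \<bullet> h)) (at y)"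
    and D: "continuous_on (ball z r) D" and st: "s \<le> t"
    and S: "S \<in> sets borel" "S \<subseteq> ball z r" "\<And>y. y \<in> S \<Longrightarrow> w y \<le> s"
    and T: "T \<in> sets borel" "T \<subseteq> ball z r" "\<And>y. y \<in> T \<Longrightarrow> w y \<ge> t"
  shows "ennreal (t - s) * emeasure lborel S * emeasure lborel T \<le>
    ennreal (2 * r) * ennreal (2 ^ DIM('a)) * emeasure lborel (ball z r) * (\<integral>\<^sup>+y\<in>ball z r. ennreal (norm (D y)) \<partial>lborel)"
proof -
  let ?B = "ball z r"
  define h where "h y = ennreal (2 * r) * (indicator ?B y * ennreal (norm (D y)))" for y
  have hm [measurable]: "h \<in> borel_measurable borel"
  proof -
    have "(\<lambda>y. indicator ?B y *\<^sub>R norm (D y)) \<in> borel_measurable borel"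
      by (rule borel_measurable_continuous_on_indicator) (use D in \<open>auto intro: continuous_intros\<close>)
    then have 1: "(\<lambda>y. ennreal (indicator ?B y *\<^sub>R norm (D y))) \<in> borel_measurable borel" by simp
    have 2: "h = (\<lambda>y. ennreal (2 * r) * ennreal (indicator ?B y *\<^sub>R norm (D y)))"
      by (simp add: h_def indicator_def fun_eq_iff)
    show ?thesis unfolding 2 using 1 by measurable
  qed
  have [measurable]: "?B \<in> sets borel" by simp
  note [measurable] = S(1) T(1)
  define P where "P = (\<integral>\<^sup>+y. h y \<partial>lborel)"
  define b where "b = emeasure lborel ?B"
  define N where "N = ennreal (2 ^ DIM('a))"
  have aff: "(\<integral>\<^sup>+x. h (a + c *\<^sub>R x) \<partial>lborel) \<le> N * P" if c: "c \<ge> 1/2" for a c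
  proof -
    have "(\<integral>\<^sup>+x. h (a + c *\<^sub>R x) \<partial>lborel) = ennreal (1 / \<bar>c\<bar> ^ DIM('a)) * P"
      unfolding P_def using c by (intro nn_integral_lborel_affine) auto
    also have "\<dots> \<le> N * P"
    proof -
      have "1 / \<bar>c\<bar> ^ DIM('a) = (1 / c) ^ DIM('a)" using c by (simp add: power_one_over)
      also have "\<dots> \<le> 2 ^ DIM('a)" using c by (intro power_mono) (auto simp: divide_le_eq)
      finally show ?thesis unfolding N_def by (intro mult_right_mono ennreal_leI) auto
    qed
    finally show ?thesis .
  qed
  have half: "(\<integral>\<^sup>+x. \<integral>\<^sup>+y. indicator S x * (indicator T y * h (x + \<tau> *\<^sub>R (y - x))) \<partial>lborel \<partial>lborel) \<le> N * P * b" if "0 \<le> \<tau>" "\<tau> \<le> 1" for \<tau>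
  proof (cases "\<tau> \<ge> 1/2")
    case True
    have "(\<integral>\<^sup>+x. \<integral>\<^sup>+y. indicator S x * (indicator T y * h (x + \<tau> *\<^sub>R (y - x))) \<partial>lborel \<partial>lborel) \<le>
      (\<integral>\<^sup>+x. indicator ?B x * (N * P) \<partial>lborel)"
    proof (rule nn_integral_mono)
      fix x
      have "(\<integral>\<^sup>+y. indicator S x * (indicator T y * h (x + \<tau> *\<^sub>R (y - x))) \<partial>lborel) \<le>
         (\<integral>\<^sup>+y. indicator ?B x * h ((x - \<tau> *\<^sub>R x) + \<tau> *\<^sub>R y) \<partial>lborel)"
        using S(2) by (intro nn_integral_mono) (auto simp: indicator_def algebra_simps)
      also have "\<dots> = indicator ?B x * (\<integral>\<^sup>+y. h ((x - \<tau> *\<^sub>R x) + \<tau> *\<^sub>R y) \<partial>lborel)"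
        by (rule nn_integral_cmult) measurable
      also have "\<dots> \<le> indicator ?B x * (N * P)" by (intro mult_left_mono aff True) auto
      finally show "(\<integral>\<^sup>+y. indicator S x * (indicator T y * h (x + \<tau> *\<^sub>R (y - x))) \<partial>lborel) \<le> indicator ?B x * (N * P)" .
    qed
    also have "\<dots> = N * P * b" by (subst nn_integral_multc) (auto simp: b_def mult.commute)
    finally show ?thesis .
  next
    case False
    have "(\<integral>\<^sup>+x. \<integral>\<^sup>+y. indicator S x * (indicator T y * h (x + \<tau> *\<^sub>R (y - x))) \<partial>lborel \<partial>lborel) =
      (\<integral>\<^sup>+y. \<integral>\<^sup>+x. indicator S x * (indicator T y * h (x + \<tau> *\<^sub>R (y - x))) \<partial>lborel \<partial>lborel)"
      by (rule lborel_pair.Fubini'[symmetric]) measurable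
    also have "\<dots> \<le> (\<integral>\<^sup>+y. indicator ?B y * (N * P) \<partial>lborel)"
    proof (rule nn_integral_mono)
      fix y
      have "(\<integral>\<^sup>+x. indicator S x * (indicator T y * h (x + \<tau> *\<^sub>R (y - x))) \<partial>lborel) \<le>
         (\<integral>\<^sup>+x. indicator ?B y * h (\<tau> *\<^sub>R y + (1 - \<tau>) *\<^sub>R x) \<partial>lborel)"
        using T(2) by (intro nn_integral_mono) (auto simp: indicator_def algebra_simps)
      also have "\<dots> = indicator ?B y * (\<integral>\<^sup>+x. h (\<tau> *\<^sub>R y + (1 - \<tau>) *\<^sub>R x) \<partial>lborel)"
        by (rule nn_integral_cmult) measurable
      also have "\<dots> \<le> indicator ?B y * (N * P)" using False by (intro mult_left_mono aff) auto
      finally show "(\<integral>\<^sup>+x. indicator S x * (indicator T y * h (x + \<tau> *\<^sub>R (y - x))) \<partial>lborel) \<le> indicator ?B y * (N * P)" .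
    qed
    also have "\<dots> = N * P * b" by (subst nn_integral_multc) (auto simp: b_def mult.commute)
    finally show ?thesis .
  qed
  have inS: "(\<integral>\<^sup>+x. indicator S x * k \<partial>lborel) = k * emeasure lborel S" for k
    by (subst nn_integral_multc) (auto simp: mult.commute)
  have inT: "(\<integral>\<^sup>+y. indicator S x * (indicator T y * ennreal (t - s)) \<partial>lborel) = indicator S x * (ennreal (t - s) * emeasure lborel T)" for x
    by (subst nn_integral_cmult, simp, subst nn_integral_multc) (auto simp: mult.commute)
  \<comment> \<open>The inequality t - s <= w y - w x is integrated over x in S and y in T; then the
    integral over the segment parameter is moved outside, where \<open>half\<close> bounds each
    slice.\<close>
  have "ennreal (t - s) * emeasure lborel S * emeasure lborel T =
      (\<integral>\<^sup>+x. \<integral>\<^sup>+y. indicator S x * (indicator T y * ennreal (t - s)) \<partial>lborel \<partial>lborel)"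
    unfolding inT inS by (simp only: mult.commute mult.left_commute)
  also have "\<dots> \<le> (\<integral>\<^sup>+x. \<integral>\<^sup>+y. \<integral>\<^sup>+\<tau>. indicator {0..1} \<tau> * (indicator S x * (indicator T y * h (x + \<tau> *\<^sub>R (y - x)))) \<partial>lborel \<partial>lborel \<partial>lborel)"
  proof (intro nn_integral_mono)
    fix x y
    show "indicator S x * (indicator T y * ennreal (t - s)) \<le>
      (\<integral>\<^sup>+\<tau>. indicator {0..1} \<tau> * (indicator S x * (indicator T y * h (x + \<tau> *\<^sub>R (y - x)))) \<partial>lborel)"
    proof (cases "x \<in> S \<and> y \<in> T")
      case True
      then have xy: "x \<in> ?B" "y \<in> ?B" "t - s \<le> \<bar>w y - w x\<bar>"
        using S(2) T(2) S(3)[of x] T(3)[of y] abs_ge_self[of "w y - w x"] by (blast, blast, linarith)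
      have "ennreal (t - s) \<le> ennreal \<bar>w y - w x\<bar>" using xy(3) by (rule ennreal_leI)
      also note segment_increment_le[OF der D xy(1,2)]
      finally show ?thesis using True by (simp add: h_def)
    qed (auto simp: indicator_def)
  qed
  also have "\<dots> = (\<integral>\<^sup>+x. \<integral>\<^sup>+\<tau>. \<integral>\<^sup>+y. indicator {0..1} \<tau> * (indicator S x * (indicator T y * h (x + \<tau> *\<^sub>R (y - x)))) \<partial>lborel \<partial>lborel \<partial>lborel)"
    by (intro nn_integral_cong lborel_pair.Fubini'[symmetric]) measurable
  also have "\<dots> = (\<integral>\<^sup>+\<tau>. \<integral>\<^sup>+x. \<integral>\<^sup>+y. indicator {0..1} \<tau> * (indicator S x * (indicator T y * h (x + \<tau> *\<^sub>R (y - x)))) \<partial>lborel \<partial>lborel \<partial>lborel)"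
    by (rule lborel_pair.Fubini'[symmetric]) measurable
  also have "\<dots> = (\<integral>\<^sup>+\<tau>. indicator {0..1} \<tau> * (\<integral>\<^sup>+x. \<integral>\<^sup>+y. indicator S x * (indicator T y * h (x + \<tau> *\<^sub>R (y - x))) \<partial>lborel \<partial>lborel) \<partial>lborel)"
    by (intro nn_integral_cong) (simp add: nn_integral_cmult)
  also have "\<dots> \<le> (\<integral>\<^sup>+\<tau>. indicator {0..1::real} \<tau> * (N * P * b) \<partial>lborel)"
  proof (rule nn_integral_mono)
    fix \<tau> :: real
    show "indicator {0..1} \<tau> * (\<integral>\<^sup>+x. \<integral>\<^sup>+y. indicator S x * (indicator T y * h (x + \<tau> *\<^sub>R (y - x))) \<partial>lborel \<partial>lborel) \<le>
        indicator {0..1} \<tau> * (N * P * b)"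
      using half[of \<tau>] by (cases "0 \<le> \<tau> \<and> \<tau> \<le> 1") auto
  qed
  also have "\<dots> = N * P * b" by (subst nn_integral_multc) auto
  finally have "ennreal (t - s) * emeasure lborel S * emeasure lborel T \<le> N * P * b" .
  moreover have "P = ennreal (2 * r) * (\<integral>\<^sup>+y\<in>?B. ennreal (norm (D y)) \<partial>lborel)"
  proof -
    have "(\<lambda>y. indicator ?B y *\<^sub>R norm (D y)) \<in> borel_measurable borel"
      by (rule borel_measurable_continuous_on_indicator) (use D in \<open>auto intro: continuous_intros\<close>)
    then have 1: "(\<lambda>y. ennreal (indicator ?B y *\<^sub>R norm (D y))) \<in> borel_measurable borel" by simp
    have 2: "ennreal (indicator ?B y *\<^sub>R norm (D y)) = indicator ?B y * ennreal (norm (D y))" for y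
      by (simp add: indicator_def)
    show ?thesis
      unfolding P_def h_def using 1 unfolding 2 by (subst nn_integral_cmult) (simp_all add: mult.commute)
  qed
  ultimately show ?thesis by (simp only: N_def b_def mult.commute mult.left_commute)
qed

lemma matrix_inv_eqI:
  fixes A P :: "real ^ 'm::finite ^ 'm"
  assumes "A ** P = mat 1" and "P ** A = mat 1"
  shows "matrix_inv A = P"
proof -
  have "A ** matrix_inv A = mat 1 \<and> matrix_inv A ** A = mat 1"
    unfolding matrix_inv_def by (rule someI[of _ P]) (use assms in simp)
  then show ?thesis using assms by (metis matrix_mul_assoc matrix_mul_lid matrix_mul_rid)
qed

definition grad :: "(real ^ 'm::finite \<Rightarrow> real) \<Rightarrow> real ^ 'm \<Rightarrow> real ^ 'm" where
  "grad u y = (\<chi> j. dd1 u y (axis j 1))"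

lemma dd1_eq_grad: "Ck_on 2 u U \<Longrightarrow> y \<in> U \<Longrightarrow> dd1 u y h = grad u y \<bullet> h"
  using linear_expand[OF linear_dd1[of u U y], of h] by (simp add: grad_def inner_vec_def mult.commute)

section \<open>The inverse metric and the trace inequality\<close>

context local_hermitian
begin

text \<open>The coefficients g^{ij} of the inverse metric, the principal part of the second-order
  operator that \<open>trace_lower_bound\<close> concerns.\<close>

definition a :: "'n coords \<Rightarrow> real ^ ('n + 'n) ^ ('n + 'n)" where
  "a y = matrix_inv (form_matrix (g y))"

lemma frame_exists:
  assumes y: "y \<in> U"
  shows "\<exists>f. frame y f"
proof -
  interpret hermitian_point "J y" "g y" by (rule point[OF y])
  obtain x :: "'n \<Rightarrow> 'n coords" and d where
    x: "\<And>i j. g y (x i) (x j) = (if i = j then 1 else 0)" "\<And>i j. g y (x i) (J y (x j)) = 0"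
    by (rule exists_eigenframe[OF g_bilinear g_sym g_J], rule that, assumption+)
  have x': "g y (J y (x i)) (x j) = 0" for i j using g_sym x(2) by metis
  have "g y (case_sum x (J y \<circ> x) c) (case_sum x (J y \<circ> x) b) = (if c = b then 1 else 0)" for c b
    by (cases c; cases b) (simp_all add: x x' g_J)
  then have "frame y (case_sum x (J y \<circ> x))" by (simp add: frame_def)
  then show ?thesis by (rule exI[of "frame y"])
qed

text \<open>Orthonormality reads F G F^T = 1 for the matrix F with the frame vectors as rows, hence
  G^{-1} = F^T F. This converts traces over a frame into coordinate expressions with coefficients
  \<open>a\<close>.\<close>

lemma a_frame:
  assumes y: "y \<in> U" and f: "frame y f"
  shows "a y = (\<chi> i j. \<Sum>b\<in>UNIV. f b $ i * f b $ j)"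
    and "form_matrix (g y) ** a y = mat 1" and "a y ** form_matrix (g y) = mat 1"
proof -
  interpret hermitian_point "J y" "g y" by (rule point[OF y])
  define F :: "real ^ ('n + 'n) ^ ('n + 'n)" where "F = (\<chi> i j. f i $ j)"
  have "F ** form_matrix (g y) ** transpose F = mat 1"
    unfolding F_def form_matrix_frame[OF g_bilinear, symmetric] using f by (simp add: frame_def mat_def vec_eq_iff)
  then have "F ** (form_matrix (g y) ** transpose F) = mat 1" by (simp only: matrix_mul_assoc)
  then have "(form_matrix (g y) ** transpose F) ** F = mat 1" by (rule iffD1[OF matrix_left_right_inverse])
  then have 1: "form_matrix (g y) ** (transpose F ** F) = mat 1" by (simp only: matrix_mul_assoc)
  then have 2: "(transpose F ** F) ** form_matrix (g y) = mat 1" by (rule iffD1[OF matrix_left_right_inverse])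
  have a: "a y = transpose F ** F" unfolding a_def by (rule matrix_inv_eqI[OF 1 2])
  show "form_matrix (g y) ** a y = mat 1" "a y ** form_matrix (g y) = mat 1" using 1 2 a by auto
  show "a y = (\<chi> i j. \<Sum>b\<in>UNIV. f b $ i * f b $ j)"
    unfolding a by (simp add: F_def transpose_def matrix_matrix_mult_def)
qed

lemma a_inverse: "y \<in> U \<Longrightarrow> form_matrix (g y) ** a y = mat 1" "y \<in> U \<Longrightarrow> a y ** form_matrix (g y) = mat 1"
  using a_frame frame_exists by blast+

lemma a_bound:
  assumes b: "bounds K m \<Lambda> CJ CE" and y: "y \<in> K"
  shows "\<bar>a y $ i $ j\<bar> \<le> real CARD('n + 'n) / m"
proof -
  have yU: "y \<in> U" using b y by (auto simp: bounds_def)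
  obtain f where f: "frame y f" using frame_exists[OF yU] by blast
  have m: "m > 0" using b by (simp add: bounds_def)
  have "\<bar>a y $ i $ j\<bar> \<le> (\<Sum>c\<in>UNIV. \<bar>f c $ i * f c $ j\<bar>)"
    unfolding a_frame(1)[OF yU f] by (simp add: sum_abs)
  also have "\<dots> \<le> (\<Sum>c\<in>(UNIV :: ('n + 'n) set). 1 / m)"
  proof (rule sum_mono)
    fix c
    have "\<bar>f c $ i * f c $ j\<bar> \<le> norm (f c) * norm (f c)"
      unfolding abs_mult by (intro mult_mono component_le_norm_cart) auto
    also have "\<dots> \<le> 1 / m"
      using frame_norm_le[OF b y f, of c] m by (simp add: pos_le_divide_eq power2_eq_square mult.commute)
    finally show "\<bar>f c $ i * f c $ j\<bar> \<le> 1 / m" .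
  qed
  finally show ?thesis by simp
qed

text \<open>The resolvent identity for G_y^{-1} - G_x^{-1}. With the bound on \<open>a\<close> it
  yields continuity, and after division by the increment the derivative \<open>Da\<close>, avoiding
  cofactor formulas.\<close>

lemma a_diff:
  assumes x: "x \<in> U" and y: "y \<in> U"
  shows "a y $ i $ j - a x $ i $ j = - (\<Sum>l\<in>UNIV. \<Sum>k\<in>UNIV. a y $ i $ k * (g y (axis k 1) (axis l 1) - g x (axis k 1) (axis l 1)) * a x $ l $ j)"
proof -
  have "a y ** (form_matrix (g y) - form_matrix (g x)) ** a x = a y ** form_matrix (g y) ** a x - a y ** (form_matrix (g x) ** a x)"
    by (simp add: matrix_diff_ldistrib matrix_diff_rdistrib matrix_mul_assoc)
  also have "\<dots> = a x - a y" using a_inverse x y by simp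
  finally have "(a y ** (form_matrix (g y) - form_matrix (g x)) ** a x) $ i $ j = a x $ i $ j - a y $ i $ j" by simp
  moreover have "(a y ** (form_matrix (g y) - form_matrix (g x)) ** a x) $ i $ j =
    (\<Sum>l\<in>UNIV. \<Sum>k\<in>UNIV. a y $ i $ k * (g y (axis k 1) (axis l 1) - g x (axis k 1) (axis l 1)) * a x $ l $ j)"
    by (simp add: matrix_matrix_mult_def form_matrix_def sum_distrib_right)
  ultimately show ?thesis by linarith
qed

lemma continuous_a: "continuous_on U (\<lambda>y. a y $ i $ j)"
proof (intro continuous_at_imp_continuous_on ballI)
  fix x assume x: "x \<in> U"
  obtain e where e: "e > 0" "cball x e \<subseteq> U" using open_U x open_contains_cball by blast
  obtain m \<Lambda> CJ CE where b: "bounds (cball x e) m \<Lambda> CJ CE" using bounds_exist[OF compact_cball e(2)] .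
  have m: "m > 0" using b by (simp add: bounds_def)
  define M where "M = real CARD('n + 'n) / m"
  have M: "M \<ge> 0" using m by (simp add: M_def)
  have "((\<lambda>y. \<Sum>l\<in>UNIV. \<Sum>k\<in>UNIV. M * \<bar>g y (axis k 1) (axis l 1) - g x (axis k 1) (axis l 1)\<bar> * M) \<longlongrightarrow> 0) (at x)"
  proof (intro tendsto_null_sum)
    fix k l
    have "isCont (\<lambda>y. g y (axis k 1) (axis l 1)) x"
      using continuous_g x open_U continuous_on_eq_continuous_at by blast
    then have "((\<lambda>y. M * \<bar>g y (axis k 1) (axis l 1) - g x (axis k 1) (axis l 1)\<bar> * M) \<longlongrightarrow> M * \<bar>g x (axis k 1) (axis l 1) - g x (axis k 1) (axis l 1)\<bar> * M) (at x)"
      unfolding isCont_def by (intro tendsto_intros)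
    then show "((\<lambda>y. M * \<bar>g y (axis k 1) (axis l 1) - g x (axis k 1) (axis l 1)\<bar> * M) \<longlongrightarrow> 0) (at x)" by simp
  qed
  moreover have "\<forall>\<^sub>F y in at x. norm (a y $ i $ j - a x $ i $ j) \<le>
     (\<Sum>l\<in>UNIV. \<Sum>k\<in>UNIV. M * \<bar>g y (axis k 1) (axis l 1) - g x (axis k 1) (axis l 1)\<bar> * M)"
  proof -
    have "\<forall>\<^sub>F y in at x. y \<in> ball x e" using e(1) by (intro eventually_at_in_open') auto
    then show ?thesis
    proof eventually_elim
      case (elim y)
      then have y: "y \<in> cball x e" "y \<in> U" using e by auto
      have xc: "x \<in> cball x e" using e by simp
      show ?case
        unfolding a_diff[OF x y(2)] real_norm_def abs_minus_cancel
        by (intro order_trans[OF sum_abs] sum_mono)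
          (auto simp: abs_mult intro!: mult_mono mult_nonneg_nonneg a_bound[OF b, folded M_def] y xc M)
    qed
  qed
  ultimately have "((\<lambda>y. a y $ i $ j - a x $ i $ j) \<longlongrightarrow> 0) (at x)" by (rule Lim_null_comparison[rotated])
  then show "isCont (\<lambda>y. a y $ i $ j) x" unfolding isCont_def by (rule LIM_zero_cancel)
qed

definition Da :: "'n coords \<Rightarrow> 'n coords \<Rightarrow> 'n + 'n \<Rightarrow> 'n + 'n \<Rightarrow> real" where
  "Da x v i j = - (\<Sum>l\<in>UNIV. \<Sum>k\<in>UNIV. a x $ i $ k * frechet_derivative (\<lambda>z. g z (axis k 1) (axis l 1)) (at x) v * a x $ l $ j)"

lemma continuous_Da: "continuous_on U (\<lambda>y. Da y v i j)"
  unfolding Da_def by (intro continuous_intros continuous_a Ck_on_1_D(2)[OF g_C1])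

lemma a_has_derivative:
  assumes x: "x \<in> U"
  shows "((\<lambda>t. a (x + t *\<^sub>R v) $ i $ j) has_real_derivative Da x v i j) (at 0)"
proof -
  have line: "((\<lambda>t. x + t *\<^sub>R v) \<longlongrightarrow> x) (at (0::real))" by (auto intro!: tendsto_eq_intros)
  have inU: "\<forall>\<^sub>F t in at (0::real). x + t *\<^sub>R v \<in> U"
    using topological_tendstoD[OF line open_U x] .
  have ta: "((\<lambda>t. a (x + t *\<^sub>R v) $ i $ k) \<longlongrightarrow> a x $ i $ k) (at 0)" for k
  proof -
    have "isCont (\<lambda>y. a y $ i $ k) x" using continuous_a x open_U continuous_on_eq_continuous_at by blast
    then show ?thesis by (rule isCont_tendsto_compose[OF _ line])
  qed
  have tg: "((\<lambda>t. (g (x + t *\<^sub>R v) (axis k 1) (axis l 1) - g x (axis k 1) (axis l 1)) / t) \<longlongrightarrow>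
      frechet_derivative (\<lambda>z. g z (axis k 1) (axis l 1)) (at x) v) (at 0)" for k l
  proof -
    define G' where "G' = frechet_derivative (\<lambda>z. g z (axis k 1) (axis l 1)) (at x)"
    have G: "((\<lambda>z. g z (axis k 1) (axis l 1)) has_derivative G') (at (x + 0 *\<^sub>R v))"
      using Ck_on_1_D(1)[OF g_C1 x] by (simp add: G'_def)
    have 1: "((\<lambda>t. x + t *\<^sub>R v) has_derivative (\<lambda>h. h *\<^sub>R v)) (at (0::real))" by (auto intro!: derivative_eq_intros)
    have "((\<lambda>z. g z (axis k 1) (axis l 1)) \<circ> (\<lambda>t. x + t *\<^sub>R v) has_derivative G' \<circ> (\<lambda>h. h *\<^sub>R v)) (at 0)"
      by (rule diff_chain_at[OF 1 G])
    moreover have "G' \<circ> (\<lambda>h. h *\<^sub>R v) = (*) (G' v)"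
      using linear_cmul[OF has_derivative_linear[OF G]] by auto
    ultimately have "((\<lambda>t. g (x + t *\<^sub>R v) (axis k 1) (axis l 1)) has_real_derivative G' v) (at 0)"
      by (simp add: has_field_derivative_def o_def)
    then show ?thesis by (simp add: DERIV_def G'_def)
  qed
  have "((\<lambda>t. - (\<Sum>l\<in>UNIV. \<Sum>k\<in>UNIV. a (x + t *\<^sub>R v) $ i $ k *
      ((g (x + t *\<^sub>R v) (axis k 1) (axis l 1) - g x (axis k 1) (axis l 1)) / t) * a x $ l $ j)) \<longlongrightarrow> Da x v i j) (at 0)"
    unfolding Da_def
    by (intro tendsto_minus tendsto_sum tendsto_mult tendsto_const ta tg)
  then have "((\<lambda>t. (a (x + t *\<^sub>R v) $ i $ j - a x $ i $ j) / t) \<longlongrightarrow> Da x v i j) (at 0)"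
    by (rule Lim_transform_eventually)
      (use inU in \<open>eventually_elim, simp add: a_diff[OF x] sum_divide_distrib minus_divide_left\<close>)
  then show ?thesis by (simp add: DERIV_def)
qed

text \<open>Cauchy-Schwarz for g applied to p and q = a p: here g q p = |p|^2, g q q is the
  quadratic form of \<open>a\<close> at p, and g p p is at most \<Lambda> |p|^2.\<close>

lemma a_elliptic:
  assumes b: "bounds K m \<Lambda> CJ CE" and y: "y \<in> K"
  shows "(norm p)\<^sup>2 \<le> \<Lambda> * (\<Sum>i\<in>UNIV. \<Sum>j\<in>UNIV. a y $ i $ j * p $ i * p $ j)"
proof -
  have yU: "y \<in> U" using b y by (auto simp: bounds_def)
  interpret hermitian_point "J y" "g y" by (rule point[OF yU])
  define q where "q = a y *v p"
  have gv: "g y v w = w \<bullet> (form_matrix (g y) *v v)" for v w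
  proof -
    have "w \<bullet> (form_matrix (g y) *v v) = (\<Sum>j\<in>UNIV. \<Sum>i\<in>UNIV. w $ j * (g y (axis j 1) (axis i 1) * v $ i))"
      by (simp add: inner_vec_def matrix_vector_mult_def form_matrix_def sum_distrib_left)
    also have "\<dots> = (\<Sum>i\<in>UNIV. \<Sum>j\<in>UNIV. v $ i * w $ j * g y (axis i 1) (axis j 1))"
      by (subst sum.swap, intro sum.cong refl) (subst g_sym, simp)
    finally show ?thesis unfolding bilinear_expand[OF g_bilinear, of v w] ..
  qed
  have Gq: "form_matrix (g y) *v q = p"
    using a_inverse(1)[OF yU] by (simp add: q_def matrix_vector_mul_assoc)
  have qq: "g y q q = (\<Sum>i\<in>UNIV. \<Sum>j\<in>UNIV. a y $ i $ j * p $ i * p $ j)"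
    unfolding gv Gq by (simp add: q_def inner_vec_def matrix_vector_mult_def sum_distrib_left mult.commute mult.left_commute)
  have "\<bar>g y q p\<bar> \<le> sqrt (g y q q) * sqrt (g y p p)"
    by (rule psd_form_bound[OF g_bilinear g_sym g_nonneg])
  also have "g y q p = (norm p)\<^sup>2" unfolding gv Gq by (simp add: power2_norm_eq_inner)
  finally have "((norm p)\<^sup>2)\<^sup>2 \<le> (sqrt (g y q q) * sqrt (g y p p))\<^sup>2" by (intro power_mono) auto
  also have "\<dots> = g y q q * g y p p" by (simp add: power_mult_distrib g_nonneg)
  also have "\<dots> \<le> g y q q * (\<Lambda> * (norm p)\<^sup>2)" using b y g_nonneg by (intro mult_left_mono) (auto simp: bounds_def)
  finally have "(norm p)\<^sup>2 * (norm p)\<^sup>2 \<le> (\<Lambda> * g y q q) * (norm p)\<^sup>2" by (simp add: power2_eq_square algebra_simps)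
  then have "p \<noteq> 0 \<Longrightarrow> (norm p)\<^sup>2 \<le> \<Lambda> * g y q q" by (elim mult_right_le_imp_le) simp
  then show ?thesis
    unfolding qq[symmetric] by (cases "p = 0") (auto simp: q_def g_linear)
qed

text \<open>The sum of the d i equals n plus half of tr(a D^2 u) and half of du of the summed fields
  \<open>E\<close>; it is positive because the sum of the eigenvalues is.\<close>

lemma trace_lower_bound:
  assumes b: "bounds K m \<Lambda> CJ CE" and y: "y \<in> K" and u: "Ck_on 2 u U"
    and l: "eigen u y l" "(\<Sum>i\<in>UNIV. l $ i) > 0"
  shows "- (\<Sum>i\<in>UNIV. \<Sum>j\<in>UNIV. a y $ i $ j * dd2 u y (axis i 1) (axis j 1)) \<le>
    2 * real CARD('n) + norm (grad u y) * (real CARD('n) * CE / m)"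
proof -
  have yU: "y \<in> U" using b y by (auto simp: bounds_def)
  have m: "m > 0" using b by (simp add: bounds_def)
  obtain f d where f: "frame y f"
    and d: "\<And>i. d i = 1 + (dd2 u y (f (Inl i)) (f (Inl i)) + dd2 u y (f (Inr i)) (f (Inr i)) + dd1 u y (E y (f (Inl i)))) / 2"
    and dl: "(\<Sum>i\<in>UNIV. d i) = (\<Sum>i\<in>UNIV. l $ i)"
    by (rule exists_frame[OF u yU l(1)], rule that, assumption+)
  have bil: "bilinear (dd2 u y)"
    using linear_dd2_left[OF u yU] linear_dd2_right[OF u open_U yU] by (simp add: bilinear_def)
  have tr: "(\<Sum>c\<in>UNIV. dd2 u y (f c) (f c)) = (\<Sum>i\<in>UNIV. \<Sum>j\<in>UNIV. a y $ i $ j * dd2 u y (axis i 1) (axis j 1))"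
  proof -
    have "(\<Sum>c\<in>UNIV. dd2 u y (f c) (f c)) = (\<Sum>c\<in>UNIV. \<Sum>i\<in>UNIV. \<Sum>j\<in>UNIV. f c $ i * f c $ j * dd2 u y (axis i 1) (axis j 1))"
      by (intro sum.cong refl bilinear_expand[OF bil])
    also have "\<dots> = (\<Sum>i\<in>UNIV. \<Sum>c\<in>UNIV. \<Sum>j\<in>UNIV. f c $ i * f c $ j * dd2 u y (axis i 1) (axis j 1))"
      by (rule sum.swap)
    also have "\<dots> = (\<Sum>i\<in>UNIV. \<Sum>j\<in>UNIV. \<Sum>c\<in>UNIV. f c $ i * f c $ j * dd2 u y (axis i 1) (axis j 1))"
      by (intro sum.cong refl sum.swap)
    finally show ?thesis by (simp add: a_frame(1)[OF yU f] sum_distrib_right)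
  qed
  have sp: "(\<Sum>c\<in>UNIV. F c) = (\<Sum>i\<in>UNIV. F (Inl i) + F (Inr i))" for F :: "'n + 'n \<Rightarrow> real"
  proof -
    have "(\<Sum>c\<in>(UNIV :: ('n + 'n) set). F c) = sum F (UNIV <+> UNIV)" by simp
    also have "\<dots> = sum F (range Inl) + sum F (range Inr)"
      unfolding Plus_def by (rule sum.union_disjoint) auto
    also have "\<dots> = (\<Sum>i\<in>UNIV. F (Inl i)) + (\<Sum>i\<in>UNIV. F (Inr i))"
      by (simp add: sum.reindex)
    finally show ?thesis by (simp add: sum.distrib)
  qed
  define e where "e = (\<Sum>i\<in>UNIV. E y (f (Inl i)))"
  have "norm e \<le> (\<Sum>i\<in>(UNIV :: 'n set). CE / m)"
    unfolding e_def
  proof (rule sum_norm_le)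
    fix i :: 'n
    have "norm (E y (f (Inl i))) \<le> CE * (norm (f (Inl i)))\<^sup>2" using b y by (simp add: bounds_def)
    also have "\<dots> \<le> CE * (1 / m)"
      using frame_norm_le[OF b y f, of "Inl i"] m b
      by (intro mult_left_mono) (auto simp: pos_le_divide_eq mult.commute bounds_def)
    finally show "norm (E y (f (Inl i))) \<le> CE / m" by simp
  qed
  then have e: "norm e \<le> real CARD('n) * CE / m" by simp
  have "0 < (\<Sum>i\<in>UNIV. d i)" using l(2) dl by simp
  also have "(\<Sum>i\<in>UNIV. d i) = real CARD('n) + ((\<Sum>c\<in>UNIV. dd2 u y (f c) (f c)) + dd1 u y e) / 2"
    unfolding sp d e_def linear_sum[OF linear_dd1[OF u yU]]
    by (simp add: sum.distrib sum_divide_distrib[symmetric] add_divide_distrib)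
  finally have "- (\<Sum>c\<in>UNIV. dd2 u y (f c) (f c)) \<le> 2 * real CARD('n) + dd1 u y e" by argo
  also have "dd1 u y e \<le> norm (grad u y) * norm e"
    unfolding dd1_eq_grad[OF u yU] by (rule norm_cauchy_schwarz)
  also have "\<dots> \<le> norm (grad u y) * (real CARD('n) * CE / m)" by (intro mult_left_mono e) auto
  finally show ?thesis unfolding tr by simp
qed

end

text \<open>Squaring the truncation makes the cut-off function below differentiable across the
  boundary of its support, where the quotient is at most |h|.\<close>

lemma max0_square_has_derivative:
  "((\<lambda>s. (max 0 s)\<^sup>2) has_real_derivative 2 * max 0 s) (at s)" for s :: real
proof -
  consider "s > 0" | "s < 0" | "s = 0" by linarith
  then show ?thesis
  proof cases
    case 1
    have "((\<lambda>s. s\<^sup>2) has_real_derivative 2 * s) (at s)" by (auto intro!: derivative_eq_intros)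
    then have "((\<lambda>s. (max 0 s)\<^sup>2) has_real_derivative 2 * s) (at s)"
      by (rule has_field_derivative_transform_within_open[of _ _ _ "{0<..}"]) (use 1 in auto)
    then show ?thesis using 1 by simp
  next
    case 2
    have "((\<lambda>s. 0) has_real_derivative 0) (at s)" by simp
    then have "((\<lambda>s. (max 0 s)\<^sup>2) has_real_derivative 0) (at s)"
      by (rule has_field_derivative_transform_within_open[of _ _ _ "{..<0}"]) (use 2 in auto)
    then show ?thesis using 2 by simp
  next
    case 3
    have "((\<lambda>h. (max 0 h)\<^sup>2 / h) \<longlongrightarrow> 0) (at (0::real))"
    proof (rule Lim_null_comparison)
      show "\<forall>\<^sub>F h in at 0. norm ((max 0 h)\<^sup>2 / h) \<le> \<bar>h\<bar>"
        by (auto intro!: eventuallyI simp: max_def power2_eq_square)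
      show "((\<lambda>h. \<bar>h\<bar>) \<longlongrightarrow> 0) (at (0::real))" by (auto intro!: tendsto_eq_intros)
    qed
    then show ?thesis using 3 by (simp add: DERIV_def)
  qed
qed

context local_hermitian
begin

text \<open>
  Testing \<open>tr(a D\<^sup>2u) \<ge> - C(1 + \<bar>Du\<bar>)\<close> against \<open>\<zeta>\<^sup>2/(1 - u)\<close> bounds \<open>D log(1 - u)\<close> in \<open>L\<^sup>2\<close>.
\<close>

lemma log_gradient_bound:
  assumes b: "bounds K m \<Lambda> CJ CE" and K: "compact K" and sub: "cball z R \<subseteq> K" and R: "0 < R'" "R' < R"
  shows "\<exists>C\<ge>0. \<forall>u. Ck_on 2 u U \<longrightarrow> (\<forall>y\<in>U. u y \<le> 0) \<longrightarrow>
     (\<forall>y\<in>cball z R. \<exists>l. eigen u y l \<and> (\<Sum>i\<in>UNIV. l $ i) > 0) \<longrightarrow>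
     (\<integral>\<^sup>+y\<in>ball z R'. ennreal ((norm (grad u y) / (1 - u y))\<^sup>2) \<partial>lborel) \<le> ennreal C"
proof -
  define \<zeta> where "\<zeta> y = max 0 (R\<^sup>2 - (norm (y - z))\<^sup>2)" for y :: "'n coords"
  define N where "N = real CARD('n + 'n)"
  have N: "N > 0" by (simp add: N_def)
  have R0: "R > 0" using R by simp
  have m: "m > 0" "\<Lambda> > 0" "CE \<ge> 0" and KU: "K \<subseteq> U" using b by (auto simp: bounds_def)
  have cU: "cball z R \<subseteq> U" using sub KU by blast
  have \<zeta>0: "\<zeta> y \<ge> 0" and \<zeta>R: "\<zeta> y \<le> R\<^sup>2" for y by (auto simp: \<zeta>_def)
  have \<zeta>out: "\<zeta> y = 0" if "y \<notin> cball z R" for y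
  proof -
    have "R < norm (y - z)" using that by (simp add: dist_norm norm_minus_commute)
    then have "R\<^sup>2 \<le> (norm (y - z))\<^sup>2" using R0 by (intro power_mono) auto
    then show ?thesis by (simp add: \<zeta>_def)
  qed
  have \<zeta>c: "continuous_on S \<zeta>" for S unfolding \<zeta>_def by (intro continuous_intros)
  have \<zeta>d: "((\<lambda>t. (\<zeta> (y + t *\<^sub>R v))\<^sup>2) has_real_derivative - 4 * \<zeta> y * ((y - z) \<bullet> v)) (at 0)" for y v
  proof -
    have 1: "((\<lambda>t. R\<^sup>2 - (norm (y + t *\<^sub>R v - z))\<^sup>2) has_real_derivative - 2 * ((y - z) \<bullet> v)) (at 0)"
    proof -
      have e: "R\<^sup>2 - (norm (y + t *\<^sub>R v - z))\<^sup>2 = R\<^sup>2 - ((y - z) \<bullet> (y - z) + 2 * t * ((y - z) \<bullet> v) + t\<^sup>2 * (v \<bullet> v))" for t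
      proof -
        have "y + t *\<^sub>R v - z = (y - z) + t *\<^sub>R v" by simp
        then show ?thesis
          by (simp only: power2_norm_eq_inner) (simp add: inner_add_left inner_add_right inner_commute power2_eq_square algebra_simps)
      qed
      show ?thesis unfolding e by (auto intro!: derivative_eq_intros)
    qed
    show ?thesis
      using DERIV_chain2[OF max0_square_has_derivative 1] by (simp add: \<zeta>_def mult.assoc)
  qed
  have "\<exists>B. \<forall>y\<in>K. \<bar>Da y (axis i 1) i j\<bar> \<le> B" for i j
  proof -
    have "bounded ((\<lambda>y. Da y (axis i 1) i j) ` K)"
      by (intro compact_imp_bounded compact_continuous_image K continuous_on_subset[OF continuous_Da KU])
    then show ?thesis by (auto simp: bounded_iff)
  qed
  then obtain BD where BD: "\<And>i j y. y \<in> K \<Longrightarrow> \<bar>Da y (axis i 1) i j\<bar> \<le> BD i j" by metis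
  \<comment> \<open>\<open>Cd\<close> bounds the terms linear in p that come from differentiating
    the cut-off and the inverse metric, \<open>Ce\<close> the first-order term of the trace
    inequality, and \<open>C3\<close> is what remains after completing the square.\<close>
  define Cd where "Cd = (\<Sum>i\<in>UNIV. \<Sum>j\<in>UNIV. 4 * R * (N / m) + R\<^sup>2 * BD i j)"
  define Ce where "Ce = real CARD('n) * CE / m"
  define C2 where "C2 = Cd + R\<^sup>2 * Ce"
  define C3 where "C3 = 2 * real CARD('n) * R ^ 4 + C2\<^sup>2 * \<Lambda> / 2"
  have C3: "C3 \<ge> 0" using m by (simp add: C3_def)
  define Vc where "Vc = measure lborel (cball z R)"
  define \<rho> where "\<rho> = R\<^sup>2 - R'\<^sup>2"
  have \<rho>: "\<rho> > 0" using R by (simp add: \<rho>_def power_strict_mono)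
  define C where "C = 2 * \<Lambda> * C3 * Vc / \<rho>\<^sup>2"
  show ?thesis
  proof (intro exI[of _ C] conjI allI impI)
    show "C \<ge> 0" using m C3 by (simp add: C_def Vc_def)
    fix u assume u: "Ck_on 2 u U" and neg: "\<forall>y\<in>U. u y \<le> 0"
      and ev: "\<forall>y\<in>cball z R. \<exists>l. eigen u y l \<and> (\<Sum>i\<in>UNIV. l $ i) > 0"
    define W where "W y = 1 - u y" for y
    have W1: "W y \<ge> 1" if "y \<in> U" for y using neg that by (auto simp: W_def)
    \<comment> \<open>The components of D log(1 - u).\<close>
    define p where "p y j = - dd1 u y (axis j 1) / W y" for y j
    define Q where "Q i y = (\<Sum>j\<in>UNIV. a y $ i $ j * p y j)" for i y
    \<comment> \<open>The derivative of Q i along the i-th axis. The term - p i p j comes from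
      differentiating 1 / W; contracted with \<open>a\<close> it is the negative quadratic term that
      makes the estimate possible.\<close>
    define Q' where "Q' i y = (\<Sum>j\<in>UNIV. Da y (axis i 1) i j * p y j + a y $ i $ j * (- dd2 u y (axis i 1) (axis j 1) / W y - p y i * p y j))" for i y
    \<comment> \<open>The vector field \<zeta>^2 a D log(1 - u), extended by zero outside the chart;
      the sum of the X' i is its divergence and integrates to zero.\<close>
    define X where "X i y = (if y \<in> U then (\<zeta> y)\<^sup>2 * Q i y else 0)" for i y
    define X' where "X' i y = (if y \<in> U then - 4 * \<zeta> y * ((y - z) $ i) * Q i y + (\<zeta> y)\<^sup>2 * Q' i y else 0)" for i y
    have W0: "y \<in> U \<Longrightarrow> W y \<noteq> 0" for y using W1[of y] by auto
    have cW: "continuous_on U W" unfolding W_def by (intro continuous_intros continuous_on_Ck_on_2[OF u])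
    have cp: "continuous_on U (\<lambda>y. p y j)" for j
      unfolding p_def by (intro continuous_intros continuous_on_dd1[OF u] cW) (use W0 in auto)
    have cQ: "continuous_on U (Q i)" for i
      unfolding Q_def by (intro continuous_intros continuous_a cp)
    have cQ': "continuous_on U (Q' i)" for i
      unfolding Q'_def by (intro continuous_intros continuous_a continuous_Da cp continuous_on_dd2[OF u] cW) (use W0 in auto)
    have pd: "((\<lambda>t. p (y + t *\<^sub>R axis i 1) j) has_real_derivative - dd2 u y (axis i 1) (axis j 1) / W y - p y i * p y j) (at 0)"
      if y: "y \<in> U" for y i j
    proof -
      have 1: "((\<lambda>t. dd1 u (y + t *\<^sub>R axis i 1) (axis j 1)) has_real_derivative dd2 u y (axis i 1) (axis j 1)) (at 0)"
        using dd2_has_real_derivative[OF u, of y 0 "axis i 1" "axis j 1"] y by simp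
      have 2: "((\<lambda>t. W (y + t *\<^sub>R axis i 1)) has_real_derivative - dd1 u y (axis i 1)) (at 0)"
        unfolding W_def using dd1_has_real_derivative[OF u, of y 0 "axis i 1"] y by (auto intro!: derivative_eq_intros)
      have "((\<lambda>t. - dd1 u (y + t *\<^sub>R axis i 1) (axis j 1) / W (y + t *\<^sub>R axis i 1)) has_real_derivative
          ((- dd2 u y (axis i 1) (axis j 1)) * W (y + 0 *\<^sub>R axis i 1) - (- dd1 u (y + 0 *\<^sub>R axis i 1) (axis j 1)) * (- dd1 u y (axis i 1))) /
            (W (y + 0 *\<^sub>R axis i 1) * W (y + 0 *\<^sub>R axis i 1))) (at 0)"
        by (intro DERIV_divide DERIV_minus 1 2) (use W0[OF y] in simp)
      moreover have "((- dd2 u y (axis i 1) (axis j 1)) * W (y + 0 *\<^sub>R axis i 1) - (- dd1 u (y + 0 *\<^sub>R axis i 1) (axis j 1)) * (- dd1 u y (axis i 1))) /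
            (W (y + 0 *\<^sub>R axis i 1) * W (y + 0 *\<^sub>R axis i 1)) = - dd2 u y (axis i 1) (axis j 1) / W y - p y i * p y j"
        using W0[OF y] by (simp add: p_def diff_divide_distrib mult.commute)
      ultimately show ?thesis unfolding p_def by metis
    qed
    have Qd: "((\<lambda>t. Q i (y + t *\<^sub>R axis i 1)) has_real_derivative Q' i y) (at 0)" if y: "y \<in> U" for y i
    proof -
      have "((\<lambda>t. \<Sum>j\<in>UNIV. a (y + t *\<^sub>R axis i 1) $ i $ j * p (y + t *\<^sub>R axis i 1) j) has_real_derivative
         (\<Sum>j\<in>UNIV. Da y (axis i 1) i j * p (y + 0 *\<^sub>R axis i 1) j + (- dd2 u y (axis i 1) (axis j 1) / W y - p y i * p y j) * a (y + 0 *\<^sub>R axis i 1) $ i $ j)) (at 0)"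
        by (intro DERIV_sum DERIV_mult a_has_derivative pd y)
      then show ?thesis by (simp add: Q_def Q'_def mult.commute)
    qed
    have line: "((\<lambda>t. y + t *\<^sub>R v) \<longlongrightarrow> y) (nhds (0::real))" for y v :: "'n coords"
      by (auto intro!: tendsto_eq_intros filterlim_ident)
    have Xd: "((\<lambda>t. X i (y + t *\<^sub>R axis i 1)) has_real_derivative X' i y) (at 0)" for y i
    proof (cases "y \<in> U")
      case True
      have "((\<lambda>t. (\<zeta> (y + t *\<^sub>R axis i 1))\<^sup>2 * Q i (y + t *\<^sub>R axis i 1)) has_real_derivative
          - 4 * \<zeta> y * ((y - z) \<bullet> axis i 1) * Q i (y + 0 *\<^sub>R axis i 1) + Q' i y * (\<zeta> (y + 0 *\<^sub>R axis i 1))\<^sup>2) (at 0)"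
        by (rule DERIV_mult[OF \<zeta>d Qd[OF True]])
      then have 1: "((\<lambda>t. (\<zeta> (y + t *\<^sub>R axis i 1))\<^sup>2 * Q i (y + t *\<^sub>R axis i 1)) has_real_derivative X' i y) (at 0)"
        using True by (simp add: X'_def inner_axis mult.commute)
      have "\<forall>\<^sub>F t in nhds 0. y + t *\<^sub>R axis i 1 \<in> U" using topological_tendstoD[OF line open_U True] .
      then have "\<forall>\<^sub>F t in nhds 0. X i (y + t *\<^sub>R axis i 1) = (\<zeta> (y + t *\<^sub>R axis i 1))\<^sup>2 * Q i (y + t *\<^sub>R axis i 1)"
        by eventually_elim (simp add: X_def)
      from DERIV_cong_ev[OF refl this refl] 1 show ?thesis by (rule iffD2)
    next
      case False
      then have yc: "y \<in> - cball z R" using cU by auto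
      have "\<forall>\<^sub>F t in nhds 0. y + t *\<^sub>R axis i 1 \<in> - cball z R"
        using topological_tendstoD[OF line _ yc] by auto
      then have "\<forall>\<^sub>F t in nhds 0. X i (y + t *\<^sub>R axis i 1) = 0"
        by eventually_elim (simp add: X_def \<zeta>out)
      moreover have "((\<lambda>t. 0) has_real_derivative X' i y) (at 0)" using False by (simp add: X'_def)
      ultimately show ?thesis by (subst DERIV_cong_ev[OF refl _ refl])
    qed
    have Xout: "X i y = 0" "X' i y = 0" if "y \<notin> cball z R" for i y using \<zeta>out[OF that] by (simp_all add: X_def X'_def)
    have Xc: "continuous_on UNIV (X i)" for i
    proof -
      have "continuous_on U (\<lambda>y. (\<zeta> y)\<^sup>2 * Q i y)" by (intro continuous_intros \<zeta>c cQ)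
      then have 1: "continuous_on U (X i)" by (rule continuous_on_eq) (simp add: X_def)
      have 2: "continuous_on (- cball z R) (X i)"
        by (rule continuous_on_eq[OF continuous_on_const[of _ 0]]) (use Xout in auto)
      have "continuous_on (U \<union> - cball z R) (X i)" by (rule continuous_on_open_Un[OF open_U _ 1 2]) auto
      moreover have "U \<union> - cball z R = UNIV" using cU by auto
      ultimately show ?thesis by simp
    qed
    have X'b: "\<exists>M. \<forall>y. \<bar>X' i y\<bar> \<le> M" for i
    proof -
      have "continuous_on U (\<lambda>y. - 4 * \<zeta> y * ((y - z) $ i) * Q i y + (\<zeta> y)\<^sup>2 * Q' i y)"
        by (intro continuous_intros \<zeta>c cQ cQ')
      then have "continuous_on U (X' i)" by (rule continuous_on_eq) (simp add: X'_def)
      then have "bounded (X' i ` cball z R)"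
        by (intro compact_imp_bounded compact_continuous_image compact_cball continuous_on_subset[OF _ cU])
      then obtain M where "\<forall>y\<in>cball z R. \<bar>X' i y\<bar> \<le> M" by (auto simp: bounded_iff)
      then have "\<bar>X' i y\<bar> \<le> max M 0" for y using Xout(2)[of y i] by (cases "y \<in> cball z R") (auto simp: le_max_iff_disj)
      then show ?thesis by blast
    qed
    have Xint: "integrable lborel (X' i)" "integral\<^sup>L lborel (X' i) = 0" for i
    proof -
      obtain M where M: "\<And>y. \<bar>X' i y\<bar> \<le> M" using X'b by blast
      show "integrable lborel (X' i)" "integral\<^sup>L lborel (X' i) = 0"
        using integral_directional_derivative_eq_0[OF Xc Xout(1) Xd M] by auto
    qed
    define P where "P y = (\<zeta> y)\<^sup>2 * (norm (grad u y) / W y)\<^sup>2" for y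
    have pg: "(\<chi> j. p y j) = (- 1 / W y) *\<^sub>R grad u y" for y
      by (simp add: p_def grad_def vec_eq_iff)
    have np: "norm (\<chi> j. p y j) = norm (grad u y) / W y" if "y \<in> U" for y
      unfolding pg using W1[OF that] by simp
    have key: "(\<Sum>i\<in>UNIV. X' i y) \<le> C3 - P y / (2 * \<Lambda>)" if y: "y \<in> cball z R" for y
    proof -
      have yU: "y \<in> U" and yK: "y \<in> K" using y cU sub by auto
      define G where "G = norm (grad u y) / W y"
      have G: "G \<ge> 0" using W1[OF yU] by (simp add: G_def)
      have pG: "\<bar>p y j\<bar> \<le> G" for j
        using component_le_norm_cart[of "\<chi> j. p y j" j] np[OF yU] by (simp add: G_def)
      define s where "s = \<zeta> y"
      have s: "s \<ge> 0" "s \<le> R\<^sup>2" using \<zeta>0 \<zeta>R by (auto simp: s_def)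
      have nyz: "norm (y - z) \<le> R" using y by (simp add: dist_norm norm_minus_commute)
      have A: "(\<Sum>i\<in>UNIV. \<Sum>j\<in>UNIV. (- 4 * s * ((y - z) $ i) * a y $ i $ j + s\<^sup>2 * Da y (axis i 1) i j) * p y j) \<le> Cd * (s * G)"
      proof -
        have "(- 4 * s * ((y - z) $ i) * a y $ i $ j + s\<^sup>2 * Da y (axis i 1) i j) * p y j \<le> (4 * R * (N / m) + R\<^sup>2 * BD i j) * (s * G)" for i j
        proof -
          have "\<bar>- 4 * s * ((y - z) $ i) * a y $ i $ j\<bar> = 4 * s * (\<bar>(y - z) $ i\<bar> * \<bar>a y $ i $ j\<bar>)"
            using s by (simp add: abs_mult)
          also have "\<dots> \<le> 4 * s * (R * (N / m))"
            using s R0 nyz component_le_norm_cart[of "y - z" i]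
            by (intro mult_left_mono mult_mono a_bound[OF b yK, folded N_def]) auto
          finally have 1: "\<bar>- 4 * s * ((y - z) $ i) * a y $ i $ j\<bar> \<le> s * (4 * R * (N / m))" by (simp add: algebra_simps)
          have "\<bar>s\<^sup>2 * Da y (axis i 1) i j\<bar> = s * (s * \<bar>Da y (axis i 1) i j\<bar>)"
            using s by (simp add: abs_mult power2_eq_square)
          also have "\<dots> \<le> s * (R\<^sup>2 * BD i j)" using s BD[OF yK] by (intro mult_left_mono mult_mono) auto
          finally have 2: "\<bar>s\<^sup>2 * Da y (axis i 1) i j\<bar> \<le> s * (R\<^sup>2 * BD i j)" .
          have "\<bar>- 4 * s * ((y - z) $ i) * a y $ i $ j + s\<^sup>2 * Da y (axis i 1) i j\<bar> \<le> s * (4 * R * (N / m) + R\<^sup>2 * BD i j)"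
            using 1 2 by (simp add: distrib_left)
          then have "\<bar>(- 4 * s * ((y - z) $ i) * a y $ i $ j + s\<^sup>2 * Da y (axis i 1) i j) * p y j\<bar> \<le> s * (4 * R * (N / m) + R\<^sup>2 * BD i j) * G"
            unfolding abs_mult[of _ "p y j"] using pG[of j] by (intro mult_mono) auto
          then show ?thesis by (simp add: algebra_simps)
        qed
        then have "(\<Sum>i\<in>UNIV. \<Sum>j\<in>UNIV. (- 4 * s * ((y - z) $ i) * a y $ i $ j + s\<^sup>2 * Da y (axis i 1) i j) * p y j) \<le>
            (\<Sum>i\<in>UNIV. \<Sum>j\<in>UNIV. (4 * R * (N / m) + R\<^sup>2 * BD i j) * (s * G))"
          by (intro sum_mono)
        then show ?thesis by (simp add: Cd_def sum_distrib_right)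
      qed
      obtain l where l: "eigen u y l" "(\<Sum>i\<in>UNIV. l $ i) > 0" using ev y by blast
      \<comment> \<open>Since u <= 0 gives W >= 1, division by W does not enlarge the constant 2n,
        and the gradient only enters through the quotient G.\<close>
      have B: "(\<Sum>i\<in>UNIV. \<Sum>j\<in>UNIV. a y $ i $ j * (- dd2 u y (axis i 1) (axis j 1) / W y)) \<le> 2 * real CARD('n) + G * Ce"
      proof -
        have "(\<Sum>i\<in>UNIV. \<Sum>j\<in>UNIV. a y $ i $ j * (- dd2 u y (axis i 1) (axis j 1) / W y)) =
            (- (\<Sum>i\<in>UNIV. \<Sum>j\<in>UNIV. a y $ i $ j * dd2 u y (axis i 1) (axis j 1))) / W y"
          by (simp add: sum_divide_distrib sum_negf)
        also have "\<dots> \<le> (2 * real CARD('n) + norm (grad u y) * (real CARD('n) * CE / m)) / W y"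
          using W1[OF yU] by (intro divide_right_mono trace_lower_bound[OF b yK u l]) auto
        also have "\<dots> = 2 * real CARD('n) / W y + G * Ce" by (simp add: add_divide_distrib G_def Ce_def)
        also have "\<dots> \<le> 2 * real CARD('n) + G * Ce" using W1[OF yU] by (simp add: divide_le_eq mult_le_cancel_left1)
        finally show ?thesis .
      qed
      have E: "G\<^sup>2 / \<Lambda> \<le> (\<Sum>i\<in>UNIV. \<Sum>j\<in>UNIV. a y $ i $ j * (p y i * p y j))"
      proof (rule mult_imp_div_pos_le[OF m(2)])
        have "G\<^sup>2 \<le> \<Lambda> * (\<Sum>i\<in>UNIV. \<Sum>j\<in>UNIV. a y $ i $ j * (p y i * p y j))"
          using a_elliptic[OF b yK, of "\<chi> j. p y j"] np[OF yU] by (simp add: G_def mult.assoc)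
        then show "G\<^sup>2 \<le> (\<Sum>i\<in>UNIV. \<Sum>j\<in>UNIV. a y $ i $ j * (p y i * p y j)) * \<Lambda>"
          by (subst mult.commute)
      qed
      have "(\<Sum>i\<in>UNIV. X' i y) =
         (\<Sum>i\<in>UNIV. \<Sum>j\<in>UNIV. (- 4 * s * ((y - z) $ i) * a y $ i $ j + s\<^sup>2 * Da y (axis i 1) i j) * p y j) +
         s\<^sup>2 * (\<Sum>i\<in>UNIV. \<Sum>j\<in>UNIV. a y $ i $ j * (- dd2 u y (axis i 1) (axis j 1) / W y)) -
         s\<^sup>2 * (\<Sum>i\<in>UNIV. \<Sum>j\<in>UNIV. a y $ i $ j * (p y i * p y j))"
        unfolding X'_def Q_def Q'_def s_def[symmetric] sum_distrib_left
          sum.distrib[symmetric] sum_subtractf[symmetric]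
        by (simp only: yU if_True sum_distrib_left sum.distrib[symmetric] sum_subtractf[symmetric])
          (intro sum.cong refl, simp add: algebra_simps)
      also have "\<dots> \<le> Cd * (s * G) + s\<^sup>2 * (2 * real CARD('n) + G * Ce) - s\<^sup>2 * (G\<^sup>2 / \<Lambda>)"
        using A B E by (intro diff_mono add_mono mult_left_mono) auto
      also have "\<dots> \<le> C2 * (s * G) + 2 * real CARD('n) * R ^ 4 - (s * G)\<^sup>2 / \<Lambda>"
      proof -
        have "s\<^sup>2 \<le> (R\<^sup>2)\<^sup>2" using s by (intro power_mono) auto
        then have "2 * real CARD('n) * s\<^sup>2 \<le> 2 * real CARD('n) * R ^ 4" by (intro mult_left_mono) (auto simp: power_mult[symmetric])
        moreover have "s * s * (G * Ce) \<le> R\<^sup>2 * s * (G * Ce)"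
          using s G m by (intro mult_right_mono) (auto simp: Ce_def)
        moreover have "s\<^sup>2 * (2 * real CARD('n) + G * Ce) = 2 * real CARD('n) * s\<^sup>2 + s * s * (G * Ce)"
          by (simp add: power2_eq_square algebra_simps)
        moreover have "C2 * (s * G) = Cd * (s * G) + R\<^sup>2 * s * (G * Ce)"
          by (simp add: C2_def algebra_simps)
        moreover have "s\<^sup>2 * (G\<^sup>2 / \<Lambda>) = (s * G)\<^sup>2 / \<Lambda>" by (simp add: power_mult_distrib)
        ultimately show ?thesis by linarith
      qed
      also have "\<dots> \<le> C3 - (s * G)\<^sup>2 / (2 * \<Lambda>)"
      proof -
        \<comment> \<open>Completing the square absorbs the linear term into half of the quadratic
          one.\<close>
        have "0 \<le> (s * G - C2 * \<Lambda>)\<^sup>2 / (2 * \<Lambda>)" using m by simp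
        also have "\<dots> = (s * G)\<^sup>2 / (2 * \<Lambda>) - C2 * (s * G) + C2\<^sup>2 * \<Lambda> / 2"
          using m by (simp add: power2_eq_square field_simps)
        finally have "C2 * (s * G) \<le> (s * G)\<^sup>2 / (2 * \<Lambda>) + C2\<^sup>2 * \<Lambda> / 2" by simp
        moreover have "(s * G)\<^sup>2 / \<Lambda> = (s * G)\<^sup>2 / (2 * \<Lambda>) + (s * G)\<^sup>2 / (2 * \<Lambda>)" by simp
        ultimately show ?thesis unfolding C3_def by linarith
      qed
      finally show ?thesis by (simp only: P_def s_def G_def power_mult_distrib)
    qed
    define Pi where "Pi y = indicator (cball z R) y *\<^sub>R P y" for y
    have cg: "continuous_on U (grad u)" unfolding grad_def
      by (intro continuous_on_vec_lambda continuous_on_dd1[OF u])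
    have cP: "continuous_on (cball z R) P"
      unfolding P_def by (intro continuous_intros \<zeta>c continuous_on_subset[OF cg cU] continuous_on_subset[OF cW cU]) (use W0 cU in auto)
    have Pint: "integrable lborel Pi" unfolding Pi_def
      by (rule borel_integrable_compact[OF compact_cball cP])
    have P0: "P y \<ge> 0" for y by (simp add: P_def)
    have Vint: "integrable lborel (\<lambda>y. C3 * indicator (cball z R) y)"
      using emeasure_lborel_cball_finite[of z R] by (auto simp: integrable_mult_right)
    have "0 = integral\<^sup>L lborel (\<lambda>y. \<Sum>i\<in>UNIV. X' i y)"
      using Xint by (subst Bochner_Integration.integral_sum) auto
    also have "\<dots> \<le> integral\<^sup>L lborel (\<lambda>y. C3 * indicator (cball z R) y - Pi y / (2 * \<Lambda>))"
    proof (rule integral_mono)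
      fix y
      show "(\<Sum>i\<in>UNIV. X' i y) \<le> C3 * indicator (cball z R) y - Pi y / (2 * \<Lambda>)"
        using key[of y] Xout(2)[of y] by (cases "y \<in> cball z R") (auto simp: Pi_def)
    qed (use Xint Pint Vint in auto)
    also have "\<dots> = C3 * Vc - integral\<^sup>L lborel Pi / (2 * \<Lambda>)"
      using Pint Vint by (simp add: Vc_def)
    finally have Ple: "integral\<^sup>L lborel Pi \<le> 2 * \<Lambda> * C3 * Vc" using m by (simp add: field_simps)
    have "(\<integral>\<^sup>+y\<in>ball z R'. ennreal ((norm (grad u y) / (1 - u y))\<^sup>2) \<partial>lborel) \<le> (\<integral>\<^sup>+y. ennreal (Pi y / \<rho>\<^sup>2) \<partial>lborel)"
    proof (rule nn_integral_mono)
      fix y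
      show "ennreal ((norm (grad u y) / (1 - u y))\<^sup>2) * indicator (ball z R') y \<le> ennreal (Pi y / \<rho>\<^sup>2)"
      proof (cases "y \<in> ball z R'")
        case True
        then have yc: "y \<in> cball z R" using R by auto
        have "norm (y - z) \<le> R'" using True by (simp add: dist_norm norm_minus_commute)
        then have "(norm (y - z))\<^sup>2 \<le> R'\<^sup>2" by (intro power_mono) auto
        \<comment> \<open>On the smaller ball the cut-off is at least \<rho>, so the weight can be
          removed at the cost of dividing by \<rho>^2.\<close>
        then have "\<rho> \<le> \<zeta> y" by (simp add: \<zeta>_def \<rho>_def)
        then have "\<rho>\<^sup>2 \<le> (\<zeta> y)\<^sup>2" using \<rho> by (intro power_mono) auto
        then have "\<rho>\<^sup>2 * (norm (grad u y) / W y)\<^sup>2 \<le> P y" unfolding P_def by (intro mult_right_mono) auto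
        then have "(norm (grad u y) / W y)\<^sup>2 \<le> P y / \<rho>\<^sup>2" using \<rho> by (simp add: pos_le_divide_eq mult.commute)
        then show ?thesis using True yc by (simp add: Pi_def W_def ennreal_leI)
      qed simp
    qed
    also have "\<dots> = ennreal (integral\<^sup>L lborel (\<lambda>y. Pi y / \<rho>\<^sup>2))"
    proof (rule nn_integral_eq_integral)
      show "integrable lborel (\<lambda>y. Pi y / \<rho>\<^sup>2)" using Pint by simp
      show "AE y in lborel. 0 \<le> Pi y / \<rho>\<^sup>2" using P0 by (simp add: Pi_def)
    qed
    also have "integral\<^sup>L lborel (\<lambda>y. Pi y / \<rho>\<^sup>2) \<le> C"
      using Ple \<rho> by (simp add: C_def divide_right_mono)
    finally show "(\<integral>\<^sup>+y\<in>ball z R'. ennreal ((norm (grad u y) / (1 - u y))\<^sup>2) \<partial>lborel) \<le> ennreal C"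
      by (simp add: ennreal_leI)
  qed
qed

end

section \<open>The volume measure\<close>

locale almost_hermitian_manifold =
  fixes X :: "'a topology" and A :: "('a, 'n::finite) chart set"
    and J :: "('a, 'n) endo_field" and g :: "('a, 'n) bilin_field"
  assumes manifold: "compact_connected_manifold X A"
    and J_acs: "almost_complex_structure A J" and g_ahm: "almost_hermitian_metric A J g"
begin

lemma chart: "c \<in> A \<Longrightarrow> is_chart X c"
  using manifold by (simp add: compact_connected_manifold_def smooth_atlas_def)

lemma openin_dom: "c \<in> A \<Longrightarrow> openin X (chart_dom c)"
  and open_img: "c \<in> A \<Longrightarrow> open (chart_img c)"
  using chart by (simp_all add: is_chart_def)

lemma dom_subset: "c \<in> A \<Longrightarrow> chart_dom c \<subseteq> topspace X"
  using openin_dom openin_subset by blast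

lemma inj_chart: "c \<in> A \<Longrightarrow> inj_on (chart_map c) (chart_dom c)"
  using chart[of c] dom_subset[of c]
  by (auto simp: is_chart_def homeomorphic_map_def inf.absorb2)

lemma inv_map [simp]: "c \<in> A \<Longrightarrow> x \<in> chart_dom c \<Longrightarrow> chart_inv c (chart_map c x) = x"
  using inj_chart by (simp add: chart_inv_def)

lemma map_inv [simp]: "y \<in> chart_img c \<Longrightarrow> chart_map c (chart_inv c y) = y"
  unfolding chart_inv_def chart_img_def by (rule f_inv_into_f)

lemma inv_mem: "y \<in> chart_img c \<Longrightarrow> chart_inv c y \<in> chart_dom c"
  unfolding chart_inv_def chart_img_def by (rule inv_into_into)

lemma map_mem: "x \<in> chart_dom c \<Longrightarrow> chart_map c x \<in> chart_img c"
  by (simp add: chart_img_def)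

lemma open_map_image:
  assumes c: "c \<in> A" and U: "openin X U" "U \<subseteq> chart_dom c"
  shows "open (chart_map c ` U)"
proof -
  have "openin (subtopology X (chart_dom c)) U"
    using U by (metis openin_subtopology_Int2 inf.absorb_iff2 inf_commute)
  then have "openin (top_of_set (chart_img c)) (chart_map c ` U)"
    using chart[OF c] homeomorphic_imp_open_map unfolding is_chart_def open_map_def by blast
  then show ?thesis using open_img[OF c] openin_open_trans by blast
qed

lemma open_map_vimage:
  assumes c: "c \<in> A" and V: "open V"
  shows "openin X {x \<in> chart_dom c. chart_map c x \<in> V}"
proof -
  have "continuous_map (subtopology X (chart_dom c)) (top_of_set (chart_img c)) (chart_map c)"
    using chart[OF c] homeomorphic_imp_continuous_map unfolding is_chart_def by blast
  then have "continuous_map (subtopology X (chart_dom c)) euclidean (chart_map c)"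
    using continuous_map_into_fulltopology by blast
  then have "openin (subtopology X (chart_dom c)) {x \<in> topspace (subtopology X (chart_dom c)). chart_map c x \<in> V}"
    using V by (intro openin_continuous_map_preimage) auto
  moreover have "{x \<in> topspace (subtopology X (chart_dom c)). chart_map c x \<in> V} = {x \<in> chart_dom c. chart_map c x \<in> V}"
    using dom_subset[OF c] by auto
  ultimately show ?thesis using openin_trans_full[OF _ openin_dom[OF c]] by simp
qed

lemma cover: "x \<in> topspace X \<Longrightarrow> \<exists>c\<in>A. x \<in> chart_dom c"
  using manifold by (auto simp: compact_connected_manifold_def smooth_atlas_def)

lemma local_hermitian_chart:
  assumes c: "c \<in> A"
  shows "local_hermitian (chart_img c) (J c) (g c)"
proof (rule local_hermitian.intro)
  show "open (chart_img c)" by (rule open_img[OF c])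
  have R: "riemannian_metric A g" and gJ: "\<And>y v w. y \<in> chart_img c \<Longrightarrow> g c y (J c y v) (J c y w) = g c y v w"
    using g_ahm c by (auto simp: almost_hermitian_metric_def)
  show "Ck_on 1 (\<lambda>y. J c y v) (chart_img c)" for v
    using J_acs c by (intro smooth_on_Ck_on) (simp add: almost_complex_structure_def)
  show "Ck_on 1 (\<lambda>y. g c y v w) (chart_img c)" for v w
    using R c by (intro smooth_on_Ck_on) (simp add: riemannian_metric_def)
  show "hermitian_point (J c y) (g c y)" if y: "y \<in> chart_img c" for y
  proof (rule hermitian_point.intro)
    show "linear (J c y)" using J_acs c y by (simp add: almost_complex_structure_def)
    show "J c y (J c y v) = - v" for v using J_acs c y by (simp add: almost_complex_structure_def)
    show "bilinear (g c y)" using R c y by (simp add: riemannian_metric_def)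
    show "g c y v w = g c y w v" for v w using R c y unfolding riemannian_metric_def by blast
    show "0 < g c y v v" if "v \<noteq> 0" for v using R c y that by (simp add: riemannian_metric_def)
    show "g c y (J c y v) (J c y w) = g c y v w" for v w by (rule gJ[OF y])
  qed
qed

section \<open>Borel sets of the manifold and of the charts\<close>

abbreviation BX :: "'a measure" where "BX \<equiv> sigma (topspace X) {U. openin X U}"

lemma sets_BX: "sets BX = sigma_sets (topspace X) {U. openin X U}" and space_BX: "space BX = topspace X"
  by (auto intro!: sets_measure_of space_measure_of dest: openin_subset)

lemma openin_BX: "openin X U \<Longrightarrow> U \<in> sets BX"
  unfolding sets_BX by (rule sigma_sets.Basic) simp

lemma dom_BX: "c \<in> A \<Longrightarrow> chart_dom c \<in> sets BX"
  by (rule openin_BX[OF openin_dom])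

lemma map_image_eq_vimage:
  assumes c: "c \<in> A" and B: "B \<subseteq> chart_dom c"
  shows "chart_map c ` B = chart_inv c -` B \<inter> chart_img c"
proof (intro equalityI subsetI)
  fix y assume "y \<in> chart_map c ` B"
  then obtain x where "x \<in> B" "y = chart_map c x" by blast
  then show "y \<in> chart_inv c -` B \<inter> chart_img c" using c B map_mem[of x c] by auto
next
  fix y assume y: "y \<in> chart_inv c -` B \<inter> chart_img c"
  then have "chart_map c (chart_inv c y) = y" by simp
  then show "y \<in> chart_map c ` B" using y by (metis IntD1 imageI vimageD)
qed

lemma measurable_chart_inv:
  assumes c: "c \<in> A"
  shows "chart_inv c \<in> measurable (restrict_space lborel (chart_img c)) BX"
proof (rule measurable_measure_of)
  show "chart_inv c \<in> space (restrict_space lborel (chart_img c)) \<rightarrow> topspace X"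
    using inv_mem[of _ c] dom_subset[OF c] by (auto simp: space_restrict_space)
  fix U assume "U \<in> {U. openin X U}"
  then have U: "openin X (U \<inter> chart_dom c)" using openin_dom[OF c] by auto
  have "chart_inv c -` U \<inter> space (restrict_space lborel (chart_img c)) = chart_map c ` (U \<inter> chart_dom c)"
    unfolding map_image_eq_vimage[OF c Int_lower2] using inv_mem[of _ c] by (auto simp: space_restrict_space)
  moreover have "open (chart_map c ` (U \<inter> chart_dom c))" using open_map_image[OF c U] by simp
  ultimately show "chart_inv c -` U \<inter> space (restrict_space lborel (chart_img c)) \<in> sets (restrict_space lborel (chart_img c))"
    using open_img[OF c] by (auto simp: sets_restrict_space_iff map_mem)
qed (auto dest: openin_subset)

lemma map_image_borel:
  assumes c: "c \<in> A" and B: "B \<in> sets BX" "B \<subseteq> chart_dom c"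
  shows "chart_map c ` B \<in> sets borel"
proof -
  have "chart_inv c -` B \<inter> space (restrict_space lborel (chart_img c)) \<in> sets (restrict_space lborel (chart_img c))"
    by (rule measurable_sets[OF measurable_chart_inv[OF c] B(1)])
  then show ?thesis
    using open_img[OF c] map_image_eq_vimage[OF c B(2)]
    by (simp add: space_restrict_space sets_restrict_space_iff)
qed

lemma sets_restrict_BX:
  assumes "c \<in> A"
  shows "S \<in> sets (restrict_space BX (chart_dom c)) \<longleftrightarrow> S \<subseteq> chart_dom c \<and> S \<in> sets BX"
proof (rule sets_restrict_space_iff)
  show "chart_dom c \<inter> space BX \<in> sets BX"
    unfolding space_BX using dom_BX[OF assms] dom_subset[OF assms] by (simp only: Int_absorb2)
qed

lemma measurable_chart_map:
  assumes c: "c \<in> A"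
  shows "chart_map c \<in> borel_measurable (restrict_space BX (chart_dom c))"
proof (rule borel_measurableI)
  fix V :: "'n coords set" assume "open V"
  have "chart_map c -` V \<inter> space (restrict_space BX (chart_dom c)) = {x \<in> chart_dom c. chart_map c x \<in> V}"
    using dom_subset[OF c] by (auto simp: space_restrict_space space_BX)
  moreover have "{x \<in> chart_dom c. chart_map c x \<in> V} \<in> sets BX"
    by (rule openin_BX[OF open_map_vimage[OF c \<open>open V\<close>]])
  ultimately show "chart_map c -` V \<inter> space (restrict_space BX (chart_dom c)) \<in> sets (restrict_space BX (chart_dom c))"
    unfolding sets_restrict_BX[OF c] by auto
qed

lemma inv_image_BX:
  assumes c: "c \<in> A" and S: "S \<in> sets borel" "S \<subseteq> chart_img c"
  shows "chart_inv c ` S \<in> sets BX" and "chart_inv c ` S \<subseteq> chart_dom c" and "chart_map c ` (chart_inv c ` S) = S"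
proof -
  show sub: "chart_inv c ` S \<subseteq> chart_dom c" using S inv_mem[of _ c] by auto
  show "chart_map c ` (chart_inv c ` S) = S" using S by (force simp: image_image)
  have "chart_inv c ` S = chart_map c -` S \<inter> space (restrict_space BX (chart_dom c))"
  proof (intro equalityI subsetI)
    fix x assume "x \<in> chart_inv c ` S"
    then obtain y where "y \<in> S" "x = chart_inv c y" by blast
    then show "x \<in> chart_map c -` S \<inter> space (restrict_space BX (chart_dom c))"
      using S(2) inv_mem[of y c] dom_subset[OF c] by (auto simp: space_restrict_space space_BX)
  next
    fix x assume "x \<in> chart_map c -` S \<inter> space (restrict_space BX (chart_dom c))"
    then have "x \<in> chart_dom c" "chart_map c x \<in> S" by (auto simp: space_restrict_space)
    then show "x \<in> chart_inv c ` S" using inv_map[OF c, of x] by (metis imageI)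
  qed
  also have "\<dots> \<in> sets (restrict_space BX (chart_dom c))"
    by (rule measurable_sets[OF measurable_chart_map[OF c] S(1)])
  finally show "chart_inv c ` S \<in> sets BX"
    unfolding sets_restrict_BX[OF c] by auto
qed

section \<open>The density of the volume form and the gluing of the chart measures\<close>

definition dens :: "('a, 'n) chart \<Rightarrow> 'n coords \<Rightarrow> real" where
  "dens c y = \<bar>top_power (assoc_form J g c y)\<bar>"

lemma hermitian_point_chart: "c \<in> A \<Longrightarrow> y \<in> chart_img c \<Longrightarrow> hermitian_point (J c y) (g c y)"
  using local_hermitian_chart local_hermitian.point by blast

lemma dens_pos:
  assumes "c \<in> A" "y \<in> chart_img c"
  shows "dens c y > 0"
proof -
  interpret hermitian_point "J c y" "g c y" by (rule hermitian_point_chart[OF assms])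
  have "assoc_form J g c y = omega" by (simp add: fun_eq_iff assoc_form_def omega_def)
  then show ?thesis using top_power_omega_nonzero by (simp add: dens_def)
qed

lemma continuous_dens:
  assumes c: "c \<in> A"
  shows "continuous_on (chart_img c) (dens c)"
proof -
  interpret local_hermitian "chart_img c" "J c" "g c" by (rule local_hermitian_chart[OF c])
  have *: "continuous_on (chart_img c) (\<lambda>y. assoc_form J g c y v w)" for v w
  proof -
    have "continuous_on (chart_img c) (\<lambda>y. \<Sum>k\<in>UNIV. J c y v $ k * g c y (axis k 1) w)"
      using continuous_J continuous_g by (intro continuous_intros) auto
    then show ?thesis
    proof (rule continuous_on_eq)
      fix y assume "y \<in> chart_img c"
      then interpret hermitian_point "J c y" "g c y" by (rule hermitian_point_chart[OF c])
      have "linear (\<lambda>v. g c y v w)" using g_bilinear by (simp add: bilinear_def)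
      from linear_expand[OF this, of "J c y v"]
      show "(\<Sum>k\<in>UNIV. J c y v $ k * g c y (axis k 1) w) = assoc_form J g c y v w" by (simp add: assoc_form_def)
    qed
  qed
  show ?thesis unfolding dens_def top_power_def by (intro continuous_intros *) auto
qed

definition T' :: "('a, 'n) chart \<Rightarrow> ('a, 'n) chart \<Rightarrow> 'n coords \<Rightarrow> 'n coords \<Rightarrow> 'n coords" where
  "T' c c' y = frechet_derivative (transition c c') (at y)"

definition overlap :: "('a, 'n) chart \<Rightarrow> ('a, 'n) chart \<Rightarrow> 'n coords set" where
  "overlap c c' = chart_map c ` (chart_dom c \<inter> chart_dom c')"

text \<open>The differential of the transition map intertwines both J and g, hence pulls the
  associated form of one chart back to that of the other; by \<open>top_power_compose\<close> the
  densities then differ by its Jacobian.\<close>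

lemma transition_facts:
  assumes c: "c \<in> A" "c' \<in> A"
  shows "open (overlap c c')"
    and "y \<in> overlap c c' \<Longrightarrow> (transition c c' has_derivative T' c c' y) (at y)"
    and "continuous_on (overlap c c') (\<lambda>y. det (matrix (T' c c' y)))"
    and "y \<in> overlap c c' \<Longrightarrow> dens c y = \<bar>det (matrix (T' c c' y))\<bar> * dens c' (transition c c' y)"
    and "x \<in> chart_dom c \<Longrightarrow> transition c c' (chart_map c x) = chart_map c' x"
proof -
  show W: "open (overlap c c')" unfolding overlap_def using c by (intro open_map_image openin_Int openin_dom) auto
  have "smooth_on (transition c c') (overlap c c')"
    unfolding overlap_def using manifold c by (simp add: compact_connected_manifold_def smooth_atlas_def)
  then have C1: "Ck_on 1 (transition c c') (overlap c c')" by (simp add: smooth_on_def)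
  show D: "(transition c c' has_derivative T' c c' y) (at y)" if "y \<in> overlap c c'" for y
    unfolding T'_def by (rule Ck_on_1_D(1)[OF C1 that])
  have "continuous_on (overlap c c') (\<lambda>y. T' c c' y v)" for v
    unfolding T'_def by (rule Ck_on_1_D(2)[OF C1])
  then have "continuous_on (overlap c c') (\<lambda>y. T' c c' y v $ i)" for v i by (intro continuous_intros)
  then show "continuous_on (overlap c c') (\<lambda>y. det (matrix (T' c c' y)))"
    unfolding det_def matrix_def
    by (auto intro!: continuous_on_sum continuous_on_mult continuous_on_prod continuous_on_const)
  show tr: "transition c c' (chart_map c x) = chart_map c' x" if "x \<in> chart_dom c" for x
    using that c by (simp add: transition_def)
  show "dens c y = \<bar>det (matrix (T' c c' y))\<bar> * dens c' (transition c c' y)" if y: "y \<in> overlap c c'"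
  proof -
    obtain x where x: "x \<in> chart_dom c" "x \<in> chart_dom c'" "y = chart_map c x" using y by (auto simp: overlap_def)
    have yt: "transition c c' y = chart_map c' x" using tr x by simp
    have y': "chart_map c' x \<in> chart_img c'" using x by (simp add: map_mem)
    interpret P: hermitian_point "J c' (chart_map c' x)" "g c' (chart_map c' x)"
      by (rule hermitian_point_chart[OF c(2) y'])
    have lin: "linear (T' c c' y)" by (rule has_derivative_linear[OF D[OF y]])
    have "assoc_form J g c y v w = P.omega (T' c c' y v) (T' c c' y w)" for v w
    proof -
      have "J c' (chart_map c' x) (T' c c' y v) = T' c c' y (J c y v)"
        using J_acs c x unfolding almost_complex_structure_def T'_def by (auto simp: Let_def)
      moreover have "g c' (chart_map c' x) (T' c c' y v) (T' c c' y w) = g c y v w" for v w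
        using g_ahm c x unfolding almost_hermitian_metric_def riemannian_metric_def T'_def by (auto simp: Let_def)
      ultimately show ?thesis by (simp add: assoc_form_def P.omega_def)
    qed
    then have "assoc_form J g c y = (\<lambda>v w. P.omega (T' c c' y v) (T' c c' y w))" by (simp add: fun_eq_iff)
    then have "top_power (assoc_form J g c y) = det (matrix (T' c c' y)) * top_power P.omega"
      using top_power_compose[OF P.omega_bilinear lin] by simp
    moreover have "P.omega = assoc_form J g c' (chart_map c' x)" by (simp add: fun_eq_iff assoc_form_def P.omega_def)
    ultimately show ?thesis by (simp add: dens_def abs_mult yt)
  qed
qed

definition chart_vol :: "('a, 'n) chart \<Rightarrow> 'a set \<Rightarrow> ennreal" where
  "chart_vol c B = (\<integral>\<^sup>+y\<in>chart_map c ` B. ennreal (dens c y) \<partial>lborel)"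

lemma dens_measurable:
  assumes c: "c \<in> A"
  shows "(\<lambda>y. ennreal (indicator (chart_img c) y * dens c y)) \<in> borel_measurable borel"
  using borel_measurable_continuous_on_indicator[OF _ continuous_dens[OF c]] open_img[OF c] by simp

text \<open>The change of variables inequality for the transition map, whose Jacobian combines with
  the density of c' into that of c. Exchanging the charts gives equality in
  \<open>chart_vol_eq\<close>.\<close>

lemma chart_vol_le:
  assumes c: "c \<in> A" "c' \<in> A" and B: "B \<in> sets BX" "B \<subseteq> chart_dom c" "B \<subseteq> chart_dom c'"
  shows "chart_vol c' B \<le> chart_vol c B"
proof -
  let ?W = "overlap c c'"
  define S where "S = chart_map c ` B"
  have SW: "S \<subseteq> ?W" using B by (auto simp: S_def overlap_def)
  have S: "S \<in> sets borel" unfolding S_def by (rule map_image_borel[OF c(1) B(1,2)])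
  have TS: "transition c c' ` S = chart_map c' ` B"
    using B transition_facts(5)[OF c] by (force simp: S_def image_image subset_iff)
  have B': "chart_map c' ` B \<in> sets borel" by (rule map_image_borel[OF c(2) B(1,3)])
  have B'img: "chart_map c' ` B \<subseteq> chart_img c'" using B by (auto simp: map_mem)
  define \<rho> where "\<rho> y = ennreal (indicator (chart_img c') y * dens c' y)" for y
  have \<rho>: "\<rho> \<in> borel_measurable borel" unfolding \<rho>_def by (rule dens_measurable[OF c(2)])
  have cont: "continuous_on S (transition c c')"
    using SW transition_facts(2)[OF c] by (intro continuous_at_imp_continuous_on ballI has_derivative_continuous) blast
  have "chart_vol c' B = (\<integral>\<^sup>+y\<in>transition c c' ` S. \<rho> y \<partial>lborel)"
    unfolding chart_vol_def TS using B'img by (intro nn_integral_cong) (auto simp: \<rho>_def indicator_def)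
  also have "\<dots> \<le> (\<integral>\<^sup>+x\<in>S. \<rho> (transition c c' x) * ennreal \<bar>det (matrix (T' c c' x))\<bar> \<partial>lborel)"
  proof (rule nn_integral_image_le[OF S _ _ _ _ \<rho>])
    show "transition c c' ` S \<in> sets borel" using B' by (simp add: TS)
    show "transition c c' \<in> borel_measurable (restrict_space borel S)"
      by (rule borel_measurable_continuous_on_restrict[OF cont])
    show "(transition c c' has_derivative T' c c' x) (at x within S)" if "x \<in> S" for x
      using transition_facts(2)[OF c] SW that has_derivative_at_withinI by blast
    have "continuous_on S (\<lambda>x. \<bar>det (matrix (T' c c' x))\<bar>)"
      by (intro continuous_intros continuous_on_subset[OF transition_facts(3)[OF c] SW])
    from borel_measurable_continuous_on_indicator[OF S this]
    show "(\<lambda>x. indicator S x * \<bar>det (matrix (T' c c' x))\<bar>) \<in> borel_measurable borel" by simp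
  qed
  also have "\<dots> = chart_vol c B"
    unfolding chart_vol_def S_def[symmetric]
  proof (intro nn_integral_cong)
    fix x
    show "\<rho> (transition c c' x) * ennreal \<bar>det (matrix (T' c c' x))\<bar> * indicator S x = ennreal (dens c x) * indicator S x"
    proof (cases "x \<in> S")
      case True
      have "transition c c' x \<in> chart_img c'" using True TS B'img by blast
      then have 1: "\<rho> (transition c c' x) = ennreal (dens c' (transition c c' x))" by (simp add: \<rho>_def)
      have 2: "dens c x = \<bar>det (matrix (T' c c' x))\<bar> * dens c' (transition c c' x)"
        using transition_facts(4)[OF c] True SW by blast
      have "dens c' (transition c c' x) \<ge> 0" by (simp add: dens_def)
      then show ?thesis unfolding 1 2 by (subst ennreal_mult) (simp_all add: mult.commute)
    qed simp
  qed
  finally show ?thesis .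
qed

lemma chart_vol_eq:
  assumes "c \<in> A" "c' \<in> A" and "B \<in> sets BX" "B \<subseteq> chart_dom c" "B \<subseteq> chart_dom c'"
  shows "chart_vol c' B = chart_vol c B"
  using chart_vol_le[OF assms] chart_vol_le[OF assms(2,1,3,5,4)] by (rule antisym)

text \<open>The volume transported from one chart: a measure on all of X, concentrated on the chart
  domain.\<close>

definition chart_measure :: "('a, 'n) chart \<Rightarrow> 'a measure" where
  "chart_measure c = distr (density (restrict_space lborel (chart_img c)) (\<lambda>y. ennreal (dens c y))) BX (chart_inv c)"

lemma chart_measure_facts:
  assumes c: "c \<in> A"
  shows "sets (chart_measure c) = sets BX"
    and "B \<in> sets BX \<Longrightarrow> emeasure (chart_measure c) B = chart_vol c (B \<inter> chart_dom c)"
    and "G \<in> borel_measurable BX \<Longrightarrow> (\<integral>\<^sup>+x. G x \<partial>chart_measure c) = (\<integral>\<^sup>+y\<in>chart_img c. G (chart_inv c y) * ennreal (dens c y) \<partial>lborel)"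
proof -
  show sets: "sets (chart_measure c) = sets BX" by (simp add: chart_measure_def)
  have img: "chart_img c \<in> sets borel" using open_img[OF c] by simp
  have dm: "(\<lambda>y. ennreal (dens c y)) \<in> borel_measurable (restrict_space lborel (chart_img c))"
  proof -
    have sr: "sets (restrict_space lborel (chart_img c)) = sets (restrict_space borel (chart_img c))"
      by (rule sets_restrict_space_cong) simp
    have "dens c \<in> borel_measurable (restrict_space lborel (chart_img c))"
      unfolding measurable_cong_sets[OF sr refl]
      by (rule borel_measurable_continuous_on_restrict[OF continuous_dens[OF c]])
    then show ?thesis by (rule measurable_compose[OF _ measurable_ennreal])
  qed
  have im: "chart_inv c \<in> measurable (density (restrict_space lborel (chart_img c)) (\<lambda>y. ennreal (dens c y))) BX"
    using measurable_chart_inv[OF c] by simp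
  show G: "(\<integral>\<^sup>+x. G x \<partial>chart_measure c) = (\<integral>\<^sup>+y\<in>chart_img c. G (chart_inv c y) * ennreal (dens c y) \<partial>lborel)"
    if G: "G \<in> borel_measurable BX" for G
  proof -
    have Gi: "(\<lambda>y. G (chart_inv c y)) \<in> borel_measurable (restrict_space lborel (chart_img c))"
      by (rule measurable_compose[OF measurable_chart_inv[OF c] G])
    have "(\<integral>\<^sup>+x. G x \<partial>chart_measure c) = (\<integral>\<^sup>+y. G (chart_inv c y) \<partial>density (restrict_space lborel (chart_img c)) (\<lambda>y. ennreal (dens c y)))"
      unfolding chart_measure_def using im G by (subst nn_integral_distr) auto
    also have "\<dots> = (\<integral>\<^sup>+y. ennreal (dens c y) * G (chart_inv c y) \<partial>restrict_space lborel (chart_img c))"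
      by (rule nn_integral_density[OF dm Gi])
    also have "\<dots> = (\<integral>\<^sup>+y\<in>chart_img c. ennreal (dens c y) * G (chart_inv c y) \<partial>lborel)"
      using img by (subst nn_integral_restrict_space) auto
    finally show ?thesis by (simp add: mult.commute)
  qed
  show "emeasure (chart_measure c) B = chart_vol c (B \<inter> chart_dom c)" if B: "B \<in> sets BX"
  proof -
    have "emeasure (chart_measure c) B = (\<integral>\<^sup>+x. indicator B x \<partial>chart_measure c)"
      using B sets by simp
    also have "\<dots> = (\<integral>\<^sup>+y\<in>chart_img c. indicator B (chart_inv c y) * ennreal (dens c y) \<partial>lborel)"
      by (rule G) (use B in simp)
    also have "\<dots> = chart_vol c (B \<inter> chart_dom c)"
      unfolding chart_vol_def map_image_eq_vimage[OF c Int_lower2]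
      by (intro nn_integral_cong) (auto simp: indicator_def inv_mem)
    finally show ?thesis .
  qed
qed

lemma finite_subatlas:
  obtains cs :: "('a, 'n) chart list" where "set cs \<subseteq> A" "(\<Union>c\<in>set cs. chart_dom c) = topspace X"
proof -
  have "compact_space X" using manifold by (simp add: compact_connected_manifold_def)
  moreover have "\<forall>U\<in>chart_dom ` A. openin X U" using openin_dom by auto
  moreover have "topspace X \<subseteq> \<Union> (chart_dom ` A)" using cover by auto
  ultimately obtain F where F: "finite F" "F \<subseteq> chart_dom ` A" "topspace X \<subseteq> \<Union> F"
    unfolding compact_space_alt by metis
  then obtain C where C: "C \<subseteq> A" "finite C" "F = chart_dom ` C" by (meson finite_subset_image)
  obtain cs where "set cs = C" using finite_list[OF C(2)] by blast
  then have "set cs \<subseteq> A" "(\<Union>c\<in>set cs. chart_dom c) = topspace X"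
    using C F dom_subset by blast+
  then show ?thesis by (rule that)
qed

definition is_volume :: "'a measure \<Rightarrow> bool" where
  "is_volume M \<longleftrightarrow> sets M = sets BX \<and>
     (\<forall>c\<in>A. \<forall>B\<in>sets M. B \<subseteq> chart_dom c \<longrightarrow> emeasure M B = chart_vol c B)"

text \<open>The volume measure is a definite description, so nothing is known about it before this.
  X is cut into finitely many disjoint Borel pieces, each inside one chart domain. Additivity over
  the pieces forces the values of a volume; conversely the sum of the chart measures on the pieces
  is one, and agrees with every other chart by \<open>chart_vol_eq\<close>.\<close>

lemma exists_unique_volume: "\<exists>!M. is_volume M"
proof -
  obtain cs where cs: "set cs \<subseteq> A" "(\<Union>c\<in>set cs. chart_dom c) = topspace X" by (rule finite_subatlas)
  define N where "N = length cs"
  \<comment> \<open>The points for which the k-th chart is the first one in the list that contains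
    them.\<close>
  define D where "D k = chart_dom (cs ! k) - (\<Union>j<k. chart_dom (cs ! j))" for k
  have csA: "cs ! k \<in> A" if "k < N" for k using cs that by (auto simp: N_def)
  have DB: "D k \<in> sets BX" if "k < N" for k
    unfolding D_def using that by (intro sets.Diff sets.finite_UN dom_BX csA) auto
  have Dsub: "D k \<subseteq> chart_dom (cs ! k)" for k by (auto simp: D_def)
  have disj: "disjoint_family_on D {..<N}"
    unfolding disjoint_family_on_def D_def by (metis (no_types, lifting) Diff_iff Int_emptyI UN_iff lessThan_iff linorder_neqE_nat)
  have DU: "(\<Union>k<N. D k) = topspace X"
  proof
    show "(\<Union>k<N. D k) \<subseteq> topspace X" using Dsub csA dom_subset by blast
    show "topspace X \<subseteq> (\<Union>k<N. D k)"
    proof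
      fix x assume "x \<in> topspace X"
      then have "\<exists>k. k < N \<and> x \<in> chart_dom (cs ! k)" using cs(2) by (metis N_def UN_E in_set_conv_nth)
      then obtain k where "k < N" "x \<in> chart_dom (cs ! k)" "\<And>j. j < k \<Longrightarrow> \<not> (j < N \<and> x \<in> chart_dom (cs ! j))"
        using exists_least_iff[of "\<lambda>k. k < N \<and> x \<in> chart_dom (cs ! k)"] by blast
      then show "x \<in> (\<Union>k<N. D k)" by (auto simp: D_def)
    qed
  qed
  have split: "emeasure M B = (\<Sum>k<N. emeasure M (B \<inter> D k))" if "sets M = sets BX" "B \<in> sets BX" for M and B
  proof -
    have "B = (\<Union>k<N. B \<inter> D k)" using DU sets.sets_into_space[OF that(2)] by (auto simp: space_BX)
    moreover have "(\<Sum>k<N. emeasure M (B \<inter> D k)) = emeasure M (\<Union>k<N. B \<inter> D k)"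
    proof (rule sum_emeasure)
      show "disjoint_family_on (\<lambda>k. B \<inter> D k) {..<N}" using disj unfolding disjoint_family_on_def by blast
    qed (use that DB in auto)
    ultimately show ?thesis by simp
  qed
  have uniq: "emeasure M B = (\<Sum>k<N. chart_vol (cs ! k) (B \<inter> D k))" if M: "is_volume M" and B: "B \<in> sets BX" for M B
  proof -
    have "sets M = sets BX" using M by (simp add: is_volume_def)
    from split[OF this B] have "emeasure M B = (\<Sum>k<N. emeasure M (B \<inter> D k))" .
    also have "\<dots> = (\<Sum>k<N. chart_vol (cs ! k) (B \<inter> D k))"
      using M B DB csA Dsub by (intro sum.cong) (auto simp: is_volume_def le_infI2)
    finally show ?thesis .
  qed
  define M where "M = measure_of (topspace X) (sets BX) (\<lambda>B. \<Sum>k<N. emeasure (chart_measure (cs ! k)) (B \<inter> D k))"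
  have Pow: "sets BX \<subseteq> Pow (topspace X)" using sets.space_closed[of BX] unfolding space_BX .
  have "sets M = sigma_sets (topspace X) (sets BX)" unfolding M_def by (rule sets_measure_of[OF Pow])
  also have "\<dots> = sets BX" using sets.sigma_sets_eq[of BX] unfolding space_BX .
  finally have setsM: "sets M = sets BX" .
  have eM: "emeasure M B = (\<Sum>k<N. emeasure (chart_measure (cs ! k)) (B \<inter> D k))" if "B \<in> sets BX" for B
  proof (rule emeasure_measure_of[OF M_def])
    show "sets BX \<subseteq> Pow (topspace X)" by (rule Pow)
    show "B \<in> sets M" using that setsM by simp
    show "positive (sets M) (\<lambda>B. \<Sum>k<N. emeasure (chart_measure (cs ! k)) (B \<inter> D k))" by (simp add: positive_def)
    show "countably_additive (sets M) (\<lambda>B. \<Sum>k<N. emeasure (chart_measure (cs ! k)) (B \<inter> D k))"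
    proof (rule countably_additiveI)
      fix E :: "nat \<Rightarrow> 'a set" assume E: "range E \<subseteq> sets M" "disjoint_family E"
      have "(\<Sum>i. \<Sum>k<N. emeasure (chart_measure (cs ! k)) (E i \<inter> D k)) = (\<Sum>k<N. \<Sum>i. emeasure (chart_measure (cs ! k)) (E i \<inter> D k))"
        by (rule suminf_sum) simp
      also have "\<dots> = (\<Sum>k<N. emeasure (chart_measure (cs ! k)) (\<Union>i. E i \<inter> D k))"
      proof (intro sum.cong refl suminf_emeasure)
        fix k assume "k \<in> {..<N}"
        then show "range (\<lambda>i. E i \<inter> D k) \<subseteq> sets (chart_measure (cs ! k))"
          using E DB csA setsM by (auto simp: chart_measure_facts(1))
        show "disjoint_family (\<lambda>i. E i \<inter> D k)" using E(2) by (auto simp: disjoint_family_on_def)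
      qed
      finally show "(\<Sum>i. \<Sum>k<N. emeasure (chart_measure (cs ! k)) (E i \<inter> D k)) =
        (\<Sum>k<N. emeasure (chart_measure (cs ! k)) ((\<Union>i. E i) \<inter> D k))" by simp
    qed
  qed
  have volM: "is_volume M"
    unfolding is_volume_def
  proof (intro conjI ballI impI)
    show "sets M = sets BX" by (rule setsM)
    fix c B assume c: "c \<in> A" and B: "B \<in> sets M" "B \<subseteq> chart_dom c"
    then have BB: "B \<in> sets BX" using setsM by simp
    have "emeasure M B = (\<Sum>k<N. emeasure (chart_measure c) (B \<inter> D k))"
      unfolding eM[OF BB]
    proof (intro sum.cong refl)
      fix k assume "k \<in> {..<N}"
      then have k: "k < N" by simp
      have BD: "B \<inter> D k \<in> sets BX" using BB DB[OF k] by simp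
      have "emeasure (chart_measure (cs ! k)) (B \<inter> D k) = chart_vol (cs ! k) (B \<inter> D k)"
        using chart_measure_facts(2)[OF csA[OF k] BD] Dsub[of k] by (simp add: Int_absorb2 le_infI2)
      also have "\<dots> = chart_vol c (B \<inter> D k)"
        using Dsub[of k] B(2) by (intro chart_vol_eq c csA k BD) auto
      also have "\<dots> = emeasure (chart_measure c) (B \<inter> D k)"
        using chart_measure_facts(2)[OF c BD] B(2) by (simp add: Int_absorb2 le_infI1)
      finally show "emeasure (chart_measure (cs ! k)) (B \<inter> D k) = emeasure (chart_measure c) (B \<inter> D k)" .
    qed
    also have "\<dots> = emeasure (chart_measure c) B"
      by (rule split[symmetric]) (use c BB in \<open>auto simp: chart_measure_facts(1)\<close>)
    also have "\<dots> = chart_vol c B" using chart_measure_facts(2)[OF c BB] B(2) by (simp add: Int_absorb2)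
    finally show "emeasure M B = chart_vol c B" .
  qed
  have "M' = M" if "is_volume M'" for M'
  proof (rule measure_eqI)
    show "sets M' = sets M" using that setsM by (simp add: is_volume_def)
    fix B assume "B \<in> sets M'"
    then have "B \<in> sets BX" using that by (simp add: is_volume_def)
    then show "emeasure M' B = emeasure M B" using uniq[OF that] uniq[OF volM] by simp
  qed
  with volM show ?thesis by (rule ex1I)
qed

definition vol :: "'a measure" where "vol = volume_measure X A J g"

lemma is_volume_vol: "is_volume vol"
proof -
  have "vol = (THE M. is_volume M)"
    unfolding vol_def volume_measure_def is_volume_def chart_vol_def dens_def ..
  then show ?thesis using theI'[OF exists_unique_volume] by simp
qed

lemma sets_vol: "sets vol = sets BX" and space_vol: "space vol = topspace X"
  and emeasure_vol: "c \<in> A \<Longrightarrow> B \<in> sets BX \<Longrightarrow> B \<subseteq> chart_dom c \<Longrightarrow> emeasure vol B = chart_vol c B"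
proof -
  show s: "sets vol = sets BX" using is_volume_vol by (simp add: is_volume_def)
  show "space vol = topspace X" using sets_eq_imp_space_eq[OF s] by (simp add: space_BX)
  show "c \<in> A \<Longrightarrow> B \<in> sets BX \<Longrightarrow> B \<subseteq> chart_dom c \<Longrightarrow> emeasure vol B = chart_vol c B"
    using is_volume_vol by (simp add: is_volume_def)
qed

text \<open>The chart measure is \<open>vol\<close> restricted to the chart domain, and dropping the
  restriction only increases the integral. This carries the entropy bound from X to coordinate
  balls.\<close>

lemma nn_integral_chart_le:
  assumes c: "c \<in> A" and G: "G \<in> borel_measurable BX"
  shows "(\<integral>\<^sup>+y\<in>chart_img c. G (chart_inv c y) * ennreal (dens c y) \<partial>lborel) \<le> (\<integral>\<^sup>+x. G x \<partial>vol)"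
proof -
  have G': "G \<in> borel_measurable vol" unfolding measurable_cong_sets[OF sets_vol refl] by (rule G)
  have d: "chart_dom c \<in> sets vol" using dom_BX[OF c] sets_vol by simp
  have "chart_measure c = density vol (indicator (chart_dom c))"
  proof (rule measure_eqI)
    show "sets (chart_measure c) = sets (density vol (indicator (chart_dom c)))"
      by (simp add: chart_measure_facts(1)[OF c] sets_vol)
    fix B assume "B \<in> sets (chart_measure c)"
    then have B: "B \<in> sets BX" by (simp add: chart_measure_facts(1)[OF c])
    have BD: "B \<inter> chart_dom c \<in> sets BX" using B dom_BX[OF c] by simp
    have "emeasure (density vol (indicator (chart_dom c))) B = (\<integral>\<^sup>+x. indicator (chart_dom c) x * indicator B x \<partial>vol)"
      using B d sets_vol by (subst emeasure_density) auto
    also have "\<dots> = (\<integral>\<^sup>+x. indicator (B \<inter> chart_dom c) x \<partial>vol)"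
      by (intro nn_integral_cong) (auto simp: indicator_def)
    also have "\<dots> = emeasure vol (B \<inter> chart_dom c)" using BD sets_vol by simp
    also have "\<dots> = emeasure (chart_measure c) B"
      using emeasure_vol[OF c BD] chart_measure_facts(2)[OF c B] by simp
    finally show "emeasure (chart_measure c) B = emeasure (density vol (indicator (chart_dom c))) B" by simp
  qed
  then have "(\<integral>\<^sup>+x. G x \<partial>chart_measure c) = (\<integral>\<^sup>+x. indicator (chart_dom c) x * G x \<partial>vol)"
    using d G' by (simp add: nn_integral_density)
  also have "\<dots> \<le> (\<integral>\<^sup>+x. G x \<partial>vol)" by (intro nn_integral_mono) (auto simp: indicator_def)
  finally show ?thesis by (simp add: chart_measure_facts(3)[OF c G])
qed

lemma smooth_function_measurable:
  assumes u: "smooth_function A u"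
  shows "u \<in> borel_measurable BX" and "continuous_map X euclideanreal u"
proof -
  have op: "openin X {x \<in> topspace X. u x \<in> V}" if V: "open V" for V
  proof -
    have "openin X {x \<in> chart_dom c. u x \<in> V}" if c: "c \<in> A" for c
    proof -
      have "continuous_on (chart_img c) (u \<circ> chart_inv c)"
        using u c smooth_on_Ck_on[of _ _ 0] by (force simp: smooth_function_def)
      then have "open ((u \<circ> chart_inv c) -` V \<inter> chart_img c)"
        using V open_img[OF c] continuous_on_open_vimage by blast
      from open_map_vimage[OF c this] have "openin X {x \<in> chart_dom c. chart_map c x \<in> (u \<circ> chart_inv c) -` V \<inter> chart_img c}" .
      moreover have "{x \<in> chart_dom c. chart_map c x \<in> (u \<circ> chart_inv c) -` V \<inter> chart_img c} = {x \<in> chart_dom c. u x \<in> V}"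
        using c by (auto simp: map_mem)
      ultimately show ?thesis by simp
    qed
    then have "openin X (\<Union>c\<in>A. {x \<in> chart_dom c. u x \<in> V})" by blast
    moreover have "(\<Union>c\<in>A. {x \<in> chart_dom c. u x \<in> V}) = {x \<in> topspace X. u x \<in> V}"
      using cover dom_subset by blast
    ultimately show ?thesis by simp
  qed
  show "continuous_map X euclideanreal u" unfolding continuous_map_def using op by auto
  show "u \<in> borel_measurable BX"
  proof (rule borel_measurableI)
    fix V :: "real set" assume "open V"
    have "u -` V \<inter> space BX = {x \<in> topspace X. u x \<in> V}" by (auto simp: space_BX)
    then show "u -` V \<inter> space BX \<in> sets BX" using openin_BX[OF op[OF \<open>open V\<close>]] by simp
  qed
qed

end

section \<open>The global estimate\<close>

context almost_hermitian_manifold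
begin

text \<open>What remains of the equation when f and F are forgotten: a sign and the positivity of
  the trace. The estimate at the maximum and the propagation between balls use just this.\<close>

definition adm :: "('a \<Rightarrow> real) \<Rightarrow> bool" where
  "adm \<phi> \<longleftrightarrow> smooth_function A \<phi> \<and> (\<forall>x\<in>topspace X. \<phi> x \<le> 0) \<and>
     (\<forall>c\<in>A. \<forall>y\<in>chart_img c. \<exists>l. local_hermitian.eigen (J c) (g c) (\<phi> \<circ> chart_inv c) y l \<and> (\<Sum>i\<in>UNIV. l $ i) > 0)"

text \<open>A triple consists of chart, centre and radius. The sets \<open>Ub\<close> will cover X,
  while volumes are measured in the doubled balls \<open>Vb\<close>, which contain every ball of
  radius r around a point of \<open>Ub\<close>.\<close>

definition Ub :: "('a, 'n) chart \<times> 'n coords \<times> real \<Rightarrow> 'a set" where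
  "Ub k = chart_inv (fst k) ` ball (fst (snd k)) (snd (snd k))"

definition Vb :: "('a, 'n) chart \<times> 'n coords \<times> real \<Rightarrow> 'a set" where
  "Vb k = chart_inv (fst k) ` ball (fst (snd k)) (2 * snd (snd k))"

text \<open>The factor 4 leaves room for all estimates: the Poincare inequality on radius 2r, the
  cut-off on radius 3r, and geometric bounds on the compact ball of radius 4r.\<close>

definition admissible_ball :: "('a, 'n) chart \<times> 'n coords \<times> real \<Rightarrow> bool" where
  "admissible_ball k \<longleftrightarrow> fst k \<in> A \<and> snd (snd k) > 0 \<and> cball (fst (snd k)) (4 * snd (snd k)) \<subseteq> chart_img (fst k)"

lemma Ck_on_chart:
  assumes "smooth_function A u" "c \<in> A"
  shows "Ck_on k (u \<circ> chart_inv c) (chart_img c)"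
  using assms by (simp add: smooth_function_def smooth_on_Ck_on)

lemma eigen_of_eigenvalue_vector:
  assumes \<phi>: "smooth_function A \<phi>" and c: "c \<in> A" and y: "y \<in> chart_img c"
    and l: "eigenvalue_vector (T10 (J c y)) (h_endo J g \<phi> c y) l"
  shows "local_hermitian.eigen (J c) (g c) (\<phi> \<circ> chart_inv c) y l"
proof -
  let ?u = "\<phi> \<circ> chart_inv c"
  interpret L: local_hermitian "chart_img c" "J c" "g c" by (rule local_hermitian_chart[OF c])
  interpret P: hermitian_point_form "J c y" "g c y" "ext_deriv (L.\<alpha> ?u) y"
    by (rule L.hermitian_point_form_\<alpha>[OF Ck_on_chart[OF \<phi> c] y])
  have 1: "J_d J \<phi> c = L.\<alpha> ?u" by (simp add: fun_eq_iff J_d_def L.\<alpha>_def dd1_def)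
  have 2: "assoc_form J g c y = P.omega" by (simp add: fun_eq_iff assoc_form_def P.omega_def)
  have "h_endo J g \<phi> c y = P.h"
    by (rule ext) (simp only: h_endo_def P.h_def omega_phi_def P.omega_c_def i_ddbar_def 1 2)
  then show ?thesis using l by (simp add: L.eigen_def)
qed

lemma dens_bounds:
  assumes k: "admissible_ball (c, z, r)"
  obtains \<delta> \<Delta> where "\<delta> > 0" "\<Delta> > 0"
    "\<And>S. S \<in> sets borel \<Longrightarrow> S \<subseteq> cball z (4 * r) \<Longrightarrow> ennreal \<delta> * emeasure lborel S \<le> emeasure vol (chart_inv c ` S)"
    "\<And>S. S \<in> sets borel \<Longrightarrow> S \<subseteq> cball z (4 * r) \<Longrightarrow> emeasure vol (chart_inv c ` S) \<le> ennreal \<Delta> * emeasure lborel S"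
    "\<And>y. y \<in> cball z (4 * r) \<Longrightarrow> \<delta> \<le> dens c y"
proof -
  have c: "c \<in> A" and r: "r > 0" and sub: "cball z (4 * r) \<subseteq> chart_img c" using k by (auto simp: admissible_ball_def)
  have cont: "continuous_on (cball z (4 * r)) (dens c)" by (rule continuous_on_subset[OF continuous_dens[OF c] sub])
  have ne: "cball z (4 * r) \<noteq> {}" using r by simp
  obtain y1 where y1: "y1 \<in> cball z (4 * r)" "\<And>y. y \<in> cball z (4 * r) \<Longrightarrow> dens c y1 \<le> dens c y"
    using continuous_attains_inf[OF compact_cball ne cont] by blast
  obtain y2 where y2: "y2 \<in> cball z (4 * r)" "\<And>y. y \<in> cball z (4 * r) \<Longrightarrow> dens c y \<le> dens c y2"
    using continuous_attains_sup[OF compact_cball ne cont] by blast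
  have vol: "emeasure vol (chart_inv c ` S) = (\<integral>\<^sup>+y\<in>S. ennreal (dens c y) \<partial>lborel)"
    if "S \<in> sets borel" "S \<subseteq> cball z (4 * r)" for S
    using inv_image_BX[OF c that(1)] that(2) sub emeasure_vol[OF c, of "chart_inv c ` S"]
    by (simp add: chart_vol_def)
  show ?thesis
  proof (rule that[of "dens c y1" "dens c y2"])
    show "dens c y1 > 0" "dens c y2 > 0" using dens_pos[OF c] y1 y2 sub by auto
    fix S :: "'n coords set" assume S: "S \<in> sets borel" "S \<subseteq> cball z (4 * r)"
    have "ennreal (dens c y1) * emeasure lborel S = (\<integral>\<^sup>+y\<in>S. ennreal (dens c y1) \<partial>lborel)"
      using S by (simp add: nn_integral_cmult_indicator)
    also have "\<dots> \<le> (\<integral>\<^sup>+y\<in>S. ennreal (dens c y) \<partial>lborel)"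
      using y1(2) S by (intro nn_integral_mono) (auto simp: indicator_def intro!: ennreal_leI)
    finally show "ennreal (dens c y1) * emeasure lborel S \<le> emeasure vol (chart_inv c ` S)" using vol[OF S] by simp
    have "(\<integral>\<^sup>+y\<in>S. ennreal (dens c y) \<partial>lborel) \<le> (\<integral>\<^sup>+y\<in>S. ennreal (dens c y2) \<partial>lborel)"
      using y2(2) S by (intro nn_integral_mono) (auto simp: indicator_def intro!: ennreal_leI)
    also have "\<dots> = ennreal (dens c y2) * emeasure lborel S"
      using S by (simp add: nn_integral_cmult_indicator)
    finally show "emeasure vol (chart_inv c ` S) \<le> ennreal (dens c y2) * emeasure lborel S" using vol[OF S] by simp
  qed (use y1(2) in auto)
qed

lemma ball_chart:
  assumes k: "admissible_ball (c, z, r)"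
  shows "openin X (Ub (c, z, r))" "openin X (Vb (c, z, r))" "Ub (c, z, r) \<subseteq> Vb (c, z, r)" "Vb (c, z, r) \<subseteq> chart_dom c"
    "emeasure vol (Vb (c, z, r)) < \<infinity>"
proof -
  have c: "c \<in> A" and r: "r > 0" and sub: "cball z (4 * r) \<subseteq> chart_img c" using k by (auto simp: admissible_ball_def)
  have op: "openin X (chart_inv c ` ball z t)" if t: "t \<le> 4 * r" for t
  proof -
    have ts: "ball z t \<subseteq> chart_img c" using t sub by auto
    have "chart_inv c ` ball z t = {x \<in> chart_dom c. chart_map c x \<in> ball z t}"
    proof (intro equalityI subsetI)
      fix x assume "x \<in> chart_inv c ` ball z t"
      then obtain y where "y \<in> ball z t" "x = chart_inv c y" by blast
      then show "x \<in> {x \<in> chart_dom c. chart_map c x \<in> ball z t}" using ts inv_mem[of y c] by auto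
    next
      fix x assume x: "x \<in> {x \<in> chart_dom c. chart_map c x \<in> ball z t}"
      then have "x = chart_inv c (chart_map c x)" using c by simp
      then show "x \<in> chart_inv c ` ball z t" using x by blast
    qed
    then show ?thesis using open_map_vimage[OF c open_ball] by simp
  qed
  show "openin X (Ub (c, z, r))" "openin X (Vb (c, z, r))" using op r by (simp_all add: Ub_def Vb_def)
  show "Ub (c, z, r) \<subseteq> Vb (c, z, r)" using r by (auto simp: Ub_def Vb_def)
  have s2: "ball z (2 * r) \<subseteq> cball z (4 * r)" using r by (simp add: subset_eq)
  show "Vb (c, z, r) \<subseteq> chart_dom c" using s2 sub inv_mem[of _ c] by (auto simp: Vb_def)
  obtain \<delta> \<Delta> where \<Delta>: "\<Delta> > 0" "\<And>S. S \<in> sets borel \<Longrightarrow> S \<subseteq> cball z (4 * r) \<Longrightarrow> emeasure vol (chart_inv c ` S) \<le> ennreal \<Delta> * emeasure lborel S"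
    using dens_bounds[OF k] by metis
  have "emeasure vol (Vb (c, z, r)) \<le> ennreal \<Delta> * emeasure lborel (ball z (2 * r))"
    using \<Delta>(2)[OF _ s2] by (simp add: Vb_def)
  also have "\<dots> < \<infinity>" using emeasure_lborel_ball_finite[of z "2 * r"] by (simp add: ennreal_mult_less_top)
  finally show "emeasure vol (Vb (c, z, r)) < \<infinity>" .
qed

lemma measurable_sublevels:
  assumes "smooth_function A \<phi>" "openin X V"
  shows "{x \<in> V. \<phi> x \<le> s} \<in> sets vol" "{x \<in> V. s \<le> \<phi> x} \<in> sets vol"
proof -
  have m: "\<phi> \<in> borel_measurable vol"
    unfolding measurable_cong_sets[OF sets_vol refl] by (rule smooth_function_measurable[OF assms(1)])
  have V: "V \<in> sets vol" "V \<subseteq> space vol" using openin_BX[OF assms(2)] openin_subset[OF assms(2)] by (auto simp: sets_vol space_vol)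
  have "{x \<in> V. \<phi> x \<le> s} = V \<inter> {x \<in> space vol. \<phi> x \<le> s}" "{x \<in> V. s \<le> \<phi> x} = V \<inter> {x \<in> space vol. s \<le> \<phi> x}" using V by auto
  moreover have "{x \<in> space vol. \<phi> x \<le> s} \<in> sets vol" "{x \<in> space vol. s \<le> \<phi> x} \<in> sets vol" using m by measurable
  ultimately show "{x \<in> V. \<phi> x \<le> s} \<in> sets vol" "{x \<in> V. s \<le> \<phi> x} \<in> sets vol" using V(1) by auto
qed

lemma adm_chart:
  assumes "adm \<phi>" "c \<in> A"
  shows "Ck_on 2 (\<phi> \<circ> chart_inv c) (chart_img c)" "\<And>y. y \<in> chart_img c \<Longrightarrow> (\<phi> \<circ> chart_inv c) y \<le> 0"
    "\<And>y. y \<in> chart_img c \<Longrightarrow> \<exists>l. local_hermitian.eigen (J c) (g c) (\<phi> \<circ> chart_inv c) y l \<and> (\<Sum>i\<in>UNIV. l $ i) > 0"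
  using assms Ck_on_chart[of \<phi> c 2] inv_mem[of _ c] dom_subset[of c] by (auto simp: adm_def)

text \<open>
  Propagation inside a ball: the logarithmic gradient bound and the Poincare inequality show that
  \<open>1 - \<phi>\<close> is large only on a small set once it is bounded on a set of definite measure.
\<close>

lemma large_set_small:
  assumes k: "admissible_ball k" and c0: "c0 > 0" and \<eta>: "\<eta> > 0"
  shows "\<exists>s. \<forall>\<phi>. adm \<phi> \<longrightarrow> ennreal c0 \<le> emeasure vol {x \<in> Vb k. - \<phi> x \<le> s0} \<longrightarrow>
    emeasure vol {x \<in> Vb k. s \<le> - \<phi> x} \<le> ennreal \<eta>"
proof -
  obtain c z r where kk: "k = (c, z, r)" by (cases k)
  have c: "c \<in> A" and r: "r > 0" and sub: "cball z (4 * r) \<subseteq> chart_img c" using k kk by (auto simp: admissible_ball_def)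
  interpret L: local_hermitian "chart_img c" "J c" "g c" by (rule local_hermitian_chart[OF c])
  obtain \<delta> \<Delta> where \<Delta>: "\<Delta> > 0" "\<And>S. S \<in> sets borel \<Longrightarrow> S \<subseteq> cball z (4 * r) \<Longrightarrow> emeasure vol (chart_inv c ` S) \<le> ennreal \<Delta> * emeasure lborel S"
    using dens_bounds[OF k[unfolded kk]] by metis
  obtain m \<Lambda> CJ CE where b: "L.bounds (cball z (4 * r)) m \<Lambda> CJ CE" using L.bounds_exist[OF compact_cball sub] .
  have "cball z (3 * r) \<subseteq> cball z (4 * r)" "0 < 2 * r" "2 * r < 3 * r" using r by auto
  from L.log_gradient_bound[OF b compact_cball this] obtain C where C: "C \<ge> 0"
    "\<And>u. Ck_on 2 u (chart_img c) \<Longrightarrow> (\<forall>y\<in>chart_img c. u y \<le> 0) \<Longrightarrow>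
       (\<forall>y\<in>cball z (3 * r). \<exists>l. L.eigen u y l \<and> (\<Sum>i\<in>UNIV. l $ i) > 0) \<Longrightarrow>
       (\<integral>\<^sup>+y\<in>ball z (2 * r). ennreal ((norm (grad u y) / (1 - u y))\<^sup>2) \<partial>lborel) \<le> ennreal C"
    by blast
  let ?B = "ball z (2 * r)"
  define VB where "VB = measure lborel ?B"
  have VB: "emeasure lborel ?B = ennreal VB"
    unfolding VB_def by (rule emeasure_eq_ennreal_measure) (use emeasure_lborel_ball_finite in \<open>auto simp: top.not_eq_extremum\<close>)
  have VB0: "VB \<ge> 0" by (simp add: VB_def)
  \<comment> \<open>The level s0 may be negative; truncating it keeps 1 + s1 positive for the
    logarithm.\<close>
  define s1 where "s1 = max s0 0"
  \<comment> \<open>The right-hand side of \<open>poincare_levels\<close> on the ball of radius 2r,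
    with VB + C bounding the L1 norm of the logarithmic gradient.\<close>
  define Q where "Q = (2 * (2 * r)) * 2 ^ DIM('n coords) * VB * (VB + C)"
  have Q: "Q \<ge> 0" using r VB0 C by (simp add: Q_def)
  \<comment> \<open>The gap between the logarithmic levels. \<Delta> enters twice: the volume bound
    c0 gives Lebesgue measure at least c0 / \<Delta> for S, and the measure of T is multiplied by
    \<Delta> to become a volume.\<close>
  define L0 where "L0 = Q * \<Delta>\<^sup>2 / (c0 * \<eta>) + 1"
  have L0: "L0 > 0" using Q \<Delta> c0 \<eta> by (simp add: L0_def add_nonneg_pos)
  define s where "s = exp (ln (1 + s1) + L0) - 1"
  have ls: "ln (1 + s) - ln (1 + s1) = L0" by (simp add: s_def)
  have s0: "1 + s > 0" "1 + s1 > 0" by (auto simp: s_def s1_def)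
  show ?thesis
  proof (intro exI[of _ s] allI impI)
    fix \<phi> assume a: "adm \<phi>" and big: "ennreal c0 \<le> emeasure vol {x \<in> Vb k. - \<phi> x \<le> s0}"
    define u where "u = \<phi> \<circ> chart_inv c"
    have u: "Ck_on 2 u (chart_img c)" "\<And>y. y \<in> chart_img c \<Longrightarrow> u y \<le> 0"
      "\<And>y. y \<in> chart_img c \<Longrightarrow> \<exists>l. L.eigen u y l \<and> (\<Sum>i\<in>UNIV. l $ i) > 0"
      using adm_chart[OF a c] by (simp_all add: u_def)
    have BU: "?B \<subseteq> chart_img c" using sub r by (auto simp: subset_eq)
    have B4: "?B \<subseteq> cball z (4 * r)" using r by (auto simp: subset_eq)
    define w where "w y = ln (1 - u y)" for y
    define D where "D y = (- 1 / (1 - u y)) *\<^sub>R grad u y" for y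
    have pos: "1 - u y > 0" if "y \<in> ?B" for y using u(2)[of y] BU that by force
    have der: "(w has_derivative (\<lambda>h. D y \<bullet> h)) (at y)" if y: "y \<in> ?B" for y
    proof -
      have "((\<lambda>y. 1 - u y) has_derivative (\<lambda>h. - (grad u y \<bullet> h))) (at y)"
        using dd1_has_derivative[OF u(1), of y] y BU dd1_eq_grad[OF u(1), of y]
        by (auto intro!: derivative_eq_intros simp: subset_eq)
      from DERIV_compose_FDERIV[OF DERIV_ln_divide[OF pos[OF y]] this]
      show ?thesis by (simp add: w_def[abs_def] D_def mult.commute)
    qed
    have contu: "continuous_on ?B u" by (rule continuous_on_subset[OF continuous_on_Ck_on_2[OF u(1)] BU])
    have contg: "continuous_on ?B (grad u)"
      unfolding grad_def by (intro continuous_on_vec_lambda continuous_on_subset[OF continuous_on_dd1[OF u(1)] BU])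
    have Dc: "continuous_on ?B D"
      unfolding D_def by (intro continuous_intros contu contg) (use pos in force)
    define S where "S = {y \<in> ?B. - u y \<le> s0}"
    define T where "T = {y \<in> ?B. s \<le> - u y}"
    have Seq: "{x \<in> Vb k. - \<phi> x \<le> s0} = chart_inv c ` S" and Teq: "{x \<in> Vb k. s \<le> - \<phi> x} = chart_inv c ` T"
      by (auto simp: Vb_def kk S_def T_def u_def)
    have meas: "{y \<in> ?B. - u y \<in> I} \<in> sets borel" if "closed I" for I
    proof -
      have "continuous_on ?B (\<lambda>y. - u y)" by (intro continuous_intros contu)
      then have "(\<lambda>y. - u y) \<in> borel_measurable (restrict_space borel ?B)" by (rule borel_measurable_continuous_on_restrict)
      from measurable_sets[OF this, of I] that
      have "(\<lambda>y. - u y) -` I \<inter> ?B \<in> sets (restrict_space borel ?B)" by (simp add: space_restrict_space)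
      then have "(\<lambda>y. - u y) -` I \<inter> ?B \<in> sets borel" by (simp add: sets_restrict_space_iff)
      moreover have "(\<lambda>y. - u y) -` I \<inter> ?B = {y \<in> ?B. - u y \<in> I}" by auto
      ultimately show ?thesis by simp
    qed
    have S: "S \<in> sets borel" "S \<subseteq> ?B" and T: "T \<in> sets borel" "T \<subseteq> ?B"
      using meas[of "{..s0}"] meas[of "{s..}"] by (auto simp: S_def T_def)
    have lvl: "ennreal (ln (1 + s) - ln (1 + s1)) * emeasure lborel S * emeasure lborel T \<le>
      ennreal (2 * (2 * r)) * ennreal (2 ^ DIM('n coords)) * emeasure lborel ?B * (\<integral>\<^sup>+y\<in>?B. ennreal (norm (D y)) \<partial>lborel)"
    proof (rule poincare_levels[OF der Dc _ S _ T])
      show "ln (1 + s1) \<le> ln (1 + s)" using ls L0 by simp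
      show "w y \<le> ln (1 + s1)" if "y \<in> S" for y
        unfolding w_def using that pos[of y] s0 S(2) by (intro ln_mono) (auto simp: S_def s1_def)
      show "ln (1 + s) \<le> w y" if "y \<in> T" for y
        unfolding w_def using that pos[of y] s0 T(2) by (intro ln_mono) (auto simp: T_def)
    qed
    have "(\<integral>\<^sup>+y\<in>?B. ennreal (norm (D y)) \<partial>lborel) \<le> (\<integral>\<^sup>+y. indicator ?B y + ennreal ((norm (grad u y) / (1 - u y))\<^sup>2) * indicator ?B y \<partial>lborel)"
    proof (rule nn_integral_mono)
      fix y
      show "ennreal (norm (D y)) * indicator ?B y \<le> indicator ?B y + ennreal ((norm (grad u y) / (1 - u y))\<^sup>2) * indicator ?B y"
      proof (cases "y \<in> ?B")
        case True
        \<comment> \<open>The L2 bound passes to L1 through t <= 1 + t^2, at the cost of the volume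
          \<open>VB\<close>.\<close>
        define t where "t = norm (grad u y) / (1 - u y)"
        have "norm (D y) = t" using pos[OF True] by (simp add: D_def t_def)
        moreover have "0 \<le> (t - 1)\<^sup>2" by simp
        then have "t \<le> 1 + t\<^sup>2" unfolding power2_diff by (smt (verit) zero_le_power2 power_one mult_1_right)
        then have "ennreal t \<le> 1 + ennreal (t\<^sup>2)" by (metis ennreal_1 ennreal_leI ennreal_plus zero_le_one zero_le_power2)
        ultimately show ?thesis using True by (simp add: t_def)
      qed simp
    qed
    also have "\<dots> = ennreal VB + (\<integral>\<^sup>+y\<in>?B. ennreal ((norm (grad u y) / (1 - u y))\<^sup>2) \<partial>lborel)"
    proof (subst nn_integral_add)
      have "continuous_on ?B (\<lambda>y. (norm (grad u y) / (1 - u y))\<^sup>2)"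
        by (intro continuous_intros contg contu) (use pos in force)
      then have "(\<lambda>y. indicator ?B y *\<^sub>R (norm (grad u y) / (1 - u y))\<^sup>2) \<in> borel_measurable borel"
        by (intro borel_measurable_continuous_on_indicator) auto
      then have "(\<lambda>y. ennreal (indicator ?B y *\<^sub>R (norm (grad u y) / (1 - u y))\<^sup>2)) \<in> borel_measurable borel"
        by (rule measurable_compose[OF _ measurable_ennreal])
      moreover have "(\<lambda>y. ennreal (indicator ?B y *\<^sub>R (norm (grad u y) / (1 - u y))\<^sup>2)) = (\<lambda>y. ennreal ((norm (grad u y) / (1 - u y))\<^sup>2) * indicator ?B y)"
        by (simp add: fun_eq_iff indicator_def)
      ultimately show "(\<lambda>y. ennreal ((norm (grad u y) / (1 - u y))\<^sup>2) * indicator ?B y) \<in> borel_measurable lborel"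
        unfolding measurable_lborel2 by (simp only:)
    qed (auto simp: VB[symmetric] intro!: borel_measurable_indicator)
    also have "\<dots> \<le> ennreal VB + ennreal C"
    proof (rule add_left_mono, rule C(2)[OF u(1)])
      show "\<forall>y\<in>chart_img c. u y \<le> 0" using u(2) by blast
      have "cball z (3 * r) \<subseteq> chart_img c" using sub r by (force simp: subset_eq)
      then show "\<forall>y\<in>cball z (3 * r). \<exists>l. L.eigen u y l \<and> (\<Sum>i\<in>UNIV. l $ i) > 0" using u(3) by blast
    qed
    finally have DI: "(\<integral>\<^sup>+y\<in>?B. ennreal (norm (D y)) \<partial>lborel) \<le> ennreal (VB + C)" using VB0 C by (simp add: ennreal_plus)
    have fin: "\<exists>t\<ge>0. emeasure lborel Y = ennreal t" if "Y \<subseteq> ?B" for Y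
    proof -
      have "emeasure lborel Y \<le> emeasure lborel ?B" using that by (intro emeasure_mono) auto
      then have "emeasure lborel Y \<noteq> \<infinity>" by (auto simp: VB top_unique)
      then show ?thesis by (cases "emeasure lborel Y") auto
    qed
    obtain a1 where a1: "a1 \<ge> 0" "emeasure lborel S = ennreal a1" using fin[OF S(2)] by blast
    obtain a2 where a2: "a2 \<ge> 0" "emeasure lborel T = ennreal a2" using fin[OF T(2)] by blast
    have "ennreal c0 \<le> ennreal \<Delta> * ennreal a1"
      using big \<Delta>(2)[OF S(1)] S(2) B4 unfolding Seq a1(2) by (meson order_trans)
    then have c1: "c0 \<le> \<Delta> * a1" using \<Delta>(1) a1(1) by (simp add: ennreal_mult[symmetric])
    have "ennreal (L0 * a1 * a2) \<le> ennreal Q"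
    proof -
      have "ennreal (L0 * a1 * a2) = ennreal (ln (1 + s) - ln (1 + s1)) * emeasure lborel S * emeasure lborel T"
        unfolding ls a1(2) a2(2) using L0 a1 a2 by (simp add: ennreal_mult)
      also note lvl
      also have "ennreal (2 * (2 * r)) * ennreal (2 ^ DIM('n coords)) * emeasure lborel ?B * (\<integral>\<^sup>+y\<in>?B. ennreal (norm (D y)) \<partial>lborel) \<le>
          ennreal (2 * (2 * r)) * ennreal (2 ^ DIM('n coords)) * ennreal VB * ennreal (VB + C)"
        unfolding VB by (intro mult_left_mono DI) auto
      also have "\<dots> = ennreal Q" unfolding Q_def using r VB0 C by (simp add: ennreal_mult)
      finally show ?thesis .
    qed
    then have le: "L0 * a1 * a2 \<le> Q" using Q by (simp add: ennreal_le_iff)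
    have "\<Delta> * a2 \<le> \<eta>"
    proof -
      have "(L0 * (c0 / \<Delta>)) * a2 \<le> (L0 * a1) * a2"
        using c1 \<Delta>(1) L0 a2(1) by (intro mult_right_mono mult_left_mono) (auto simp: pos_divide_le_eq mult.commute)
      then have 1: "L0 * (c0 / \<Delta>) * a2 \<le> Q" using le by simp
      have "Q * \<Delta>\<^sup>2 / (c0 * \<eta>) \<le> L0" by (simp add: L0_def)
      then have "Q * \<Delta>\<^sup>2 \<le> L0 * (c0 * \<eta>)" using c0 \<eta> by (simp add: pos_divide_le_eq)
      then have "Q * \<Delta> \<le> L0 * (c0 / \<Delta>) * \<eta>" using \<Delta>(1) by (simp add: field_simps power2_eq_square)
      moreover have "(L0 * (c0 / \<Delta>)) * (\<Delta> * a2) \<le> Q * \<Delta>"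
        using mult_right_mono[OF 1, of \<Delta>] \<Delta>(1) by (simp add: mult.commute mult.left_commute)
      ultimately have "(L0 * (c0 / \<Delta>)) * (\<Delta> * a2) \<le> (L0 * (c0 / \<Delta>)) * \<eta>" by linarith
      moreover have "L0 * (c0 / \<Delta>) > 0" using L0 c0 \<Delta>(1) by simp
      ultimately show ?thesis by (rule mult_left_le_imp_le)
    qed
    have "emeasure vol (chart_inv c ` T) \<le> ennreal \<Delta> * ennreal a2"
      using \<Delta>(2)[OF T(1)] T(2) B4 unfolding a2(2) by blast
    also have "\<dots> \<le> ennreal \<eta>" using \<open>\<Delta> * a2 \<le> \<eta>\<close> \<Delta>(1) a2(1) by (simp add: ennreal_mult[symmetric] ennreal_leI)
    finally show "emeasure vol {x \<in> Vb k. s \<le> - \<phi> x} \<le> ennreal \<eta>" unfolding Teq .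
  qed
qed

text \<open>A zero of an admissible function is a maximum, so \<open>sublevel_measure_at_max\<close>
  applies on the ball of radius r around it; the lower bound of the density turns Lebesgue measure
  into volume. The height eps r^2 plays the part of the 1 in the overview.\<close>

lemma small_set_at_max:
  assumes k: "admissible_ball k"
  shows "\<exists>c0>0. \<exists>s0. \<forall>\<phi>. adm \<phi> \<longrightarrow> (\<exists>x0\<in>Ub k. \<phi> x0 = 0) \<longrightarrow> ennreal c0 \<le> emeasure vol {x \<in> Vb k. - \<phi> x \<le> s0}"
proof -
  obtain c z r where kk: "k = (c, z, r)" by (cases k)
  have c: "c \<in> A" and r: "r > 0" and sub: "cball z (4 * r) \<subseteq> chart_img c" using k kk by (auto simp: admissible_ball_def)
  interpret L: local_hermitian "chart_img c" "J c" "g c" by (rule local_hermitian_chart[OF c])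
  obtain \<delta> \<Delta> where \<delta>: "\<delta> > 0" "\<And>S. S \<in> sets borel \<Longrightarrow> S \<subseteq> cball z (4 * r) \<Longrightarrow> ennreal \<delta> * emeasure lborel S \<le> emeasure vol (chart_inv c ` S)"
    using dens_bounds[OF k[unfolded kk]] by metis
  obtain m \<Lambda> CJ CE where b: "L.bounds (cball z (4 * r)) m \<Lambda> CJ CE" using L.bounds_exist[OF compact_cball sub] .
  obtain \<epsilon> where \<epsilon>: "L.small m CJ CE r \<epsilon>" using L.small_exists[of m CE r CJ] b r by (auto simp: L.bounds_def)
  obtain c2 where c2: "c2 > 0" "\<And>x0 u. cball x0 r \<subseteq> cball z (4 * r) \<Longrightarrow> Ck_on 2 u (chart_img c) \<Longrightarrow> (\<forall>x\<in>cball x0 r. u x \<le> u x0) \<Longrightarrow>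
    (\<forall>y\<in>cball x0 r. \<exists>l. L.eigen u y l \<and> (\<Sum>i\<in>UNIV. l $ i) > 0) \<Longrightarrow>
    ennreal c2 \<le> emeasure lborel {y \<in> cball x0 r. - u y \<le> - u x0 + \<epsilon> * r\<^sup>2}"
    using L.sublevel_measure_at_max[OF b \<epsilon> r] by blast
  show ?thesis
  proof (rule exI[of _ "\<delta> * c2"], rule conjI, goal_cases pos bound)
    case pos
    show ?case using \<delta> c2 by simp
  next
    case bound
    show ?case
    proof (rule exI[of _ "\<epsilon> * r\<^sup>2"], intro allI impI)
    fix \<phi> assume a: "adm \<phi>" and "\<exists>x0\<in>Ub k. \<phi> x0 = 0"
    then obtain y0 where y0: "y0 \<in> ball z r" "\<phi> (chart_inv c y0) = 0" by (auto simp: Ub_def kk)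
    define u where "u = \<phi> \<circ> chart_inv c"
    have u: "Ck_on 2 u (chart_img c)" "\<And>y. y \<in> chart_img c \<Longrightarrow> u y \<le> 0"
      "\<And>y. y \<in> chart_img c \<Longrightarrow> \<exists>l. L.eigen u y l \<and> (\<Sum>i\<in>UNIV. l $ i) > 0"
      using adm_chart[OF a c] by (simp_all add: u_def)
    have u0: "u y0 = 0" using y0 by (simp add: u_def)
    have c2r: "cball y0 r \<subseteq> ball z (2 * r)"
    proof
      fix y assume "y \<in> cball y0 r"
      then show "y \<in> ball z (2 * r)" using y0(1) dist_triangle[of z y y0] by simp
    qed
    then have c4: "cball y0 r \<subseteq> cball z (4 * r)" using r by (auto simp: subset_eq)
    then have cU: "cball y0 r \<subseteq> chart_img c" using sub by blast
    define S where "S = {y \<in> cball y0 r. - u y \<le> - u y0 + \<epsilon> * r\<^sup>2}"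
    have S: "S \<in> sets borel"
      unfolding S_def by (intro borel_closed closed_sublevel_cball[OF _ _ cU] continuous_intros continuous_on_Ck_on_2[OF u(1)])
    have "ennreal c2 \<le> emeasure lborel S"
      unfolding S_def using u cU u0 by (intro c2(2)[OF c4 u(1)]) (auto simp: subset_eq)
    then have "ennreal (\<delta> * c2) \<le> ennreal \<delta> * emeasure lborel S"
      using \<delta> c2 by (simp add: ennreal_mult mult_left_mono)
    also have "\<dots> \<le> emeasure vol (chart_inv c ` S)" using c4 by (intro \<delta>(2)[OF S]) (auto simp: S_def)
    also have "\<dots> \<le> emeasure vol {x \<in> Vb k. - \<phi> x \<le> \<epsilon> * r\<^sup>2}"
    proof (rule emeasure_mono)
      show "chart_inv c ` S \<subseteq> {x \<in> Vb k. - \<phi> x \<le> \<epsilon> * r\<^sup>2}" using c2r u0 by (force simp: S_def Vb_def kk u_def)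
      have sm: "smooth_function A \<phi>" using a by (simp add: adm_def)
      have "{x \<in> Vb k. - \<phi> x \<le> \<epsilon> * r\<^sup>2} = {x \<in> Vb k. - (\<epsilon> * r\<^sup>2) \<le> \<phi> x}" by auto
      then show "{x \<in> Vb k. - \<phi> x \<le> \<epsilon> * r\<^sup>2} \<in> sets vol"
        using measurable_sublevels(2)[OF sm] ball_chart(2)[OF k[unfolded kk]] kk by simp
    qed
    finally show "ennreal (\<delta> * c2) \<le> emeasure vol {x \<in> Vb k. - \<phi> x \<le> \<epsilon> * r\<^sup>2}" .
    qed
  qed
qed

end

context almost_hermitian_manifold
begin

lemma sublevel_at_min:
  assumes k: "admissible_ball k" and p: "p > 0" and \<gamma>: "\<gamma> > 0" and K: "K > 0"
  shows "\<exists>c1>0. \<exists>t. \<forall>\<phi> \<Gamma> f F. adm \<phi> \<longrightarrow> structural_conditions \<Gamma> f \<gamma> \<longrightarrow> smooth_function A F \<longrightarrow>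
    entropy_norm X A J g p F \<le> ennreal K \<longrightarrow> solves_equation A J g \<Gamma> f F \<phi> \<longrightarrow>
    (\<forall>x1\<in>Ub k. (\<forall>x\<in>topspace X. \<phi> x1 \<le> \<phi> x) \<longrightarrow> ennreal c1 \<le> emeasure vol {x \<in> Vb k. \<phi> x \<le> \<phi> x1 + t})"
proof -
  obtain c z r where kk: "k = (c, z, r)" by (cases k)
  have c: "c \<in> A" and r: "r > 0" and sub: "cball z (4 * r) \<subseteq> chart_img c" using k kk by (auto simp: admissible_ball_def)
  interpret L: local_hermitian "chart_img c" "J c" "g c" by (rule local_hermitian_chart[OF c])
  obtain \<delta> \<Delta> where \<delta>: "\<delta> > 0" "\<And>S. S \<in> sets borel \<Longrightarrow> S \<subseteq> cball z (4 * r) \<Longrightarrow> ennreal \<delta> * emeasure lborel S \<le> emeasure vol (chart_inv c ` S)"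
    "\<And>y. y \<in> cball z (4 * r) \<Longrightarrow> \<delta> \<le> dens c y"
    using dens_bounds[OF k[unfolded kk]] by metis
  obtain m \<Lambda> CJ CE where b: "L.bounds (cball z (4 * r)) m \<Lambda> CJ CE" using L.bounds_exist[OF compact_cball sub] .
  obtain \<epsilon> where \<epsilon>: "L.small m CJ CE r \<epsilon>" using L.small_exists[of m CE r CJ] b r by (auto simp: L.bounds_def)
  \<comment> \<open>The density is at least \<delta> on the ball, so the entropy with respect to
    Lebesgue measure in the chart is at most K / \<delta>.\<close>
  have K': "K / \<delta> \<ge> 0" using K \<delta> by simp
  obtain c2 where c2: "c2 > 0" "\<And>x0 u \<Gamma> f F. cball x0 r \<subseteq> cball z (4 * r) \<Longrightarrow> Ck_on 2 u (chart_img c) \<Longrightarrow> (\<forall>x\<in>cball x0 r. u x0 \<le> u x) \<Longrightarrow>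
    structural_conditions \<Gamma> f \<gamma> \<Longrightarrow> continuous_on (chart_img c) F \<Longrightarrow>
    (\<forall>y\<in>cball x0 r. \<exists>l. L.eigen u y l \<and> l \<in> \<Gamma> \<and> f l = exp (F y)) \<Longrightarrow>
    (\<integral>\<^sup>+y\<in>cball x0 r. ennreal ((1 + \<bar>F y\<bar> powr p) * exp (2 * real CARD('n) * F y)) \<partial>lborel) \<le> ennreal (K / \<delta>) \<Longrightarrow>
    ennreal c2 \<le> emeasure lborel {y \<in> cball x0 r. u y \<le> u x0 + \<epsilon> * r\<^sup>2}"
    using L.sublevel_measure_at_min[OF b \<epsilon> r p \<gamma> K'] by blast
  show ?thesis
  proof (rule exI[of _ "\<delta> * c2"], rule conjI, goal_cases pos bound)
    case pos
    show ?case using \<delta> c2 by simp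
  next
    case bound
    show ?case
    proof (rule exI[of _ "\<epsilon> * r\<^sup>2"], intro allI impI ballI)
      fix \<phi> \<Gamma> f F x1
      assume a: "adm \<phi>" and st: "structural_conditions \<Gamma> f \<gamma>" and F: "smooth_function A F"
        and en: "entropy_norm X A J g p F \<le> ennreal K" and eq: "solves_equation A J g \<Gamma> f F \<phi>"
        and x1: "x1 \<in> Ub k" and mn: "\<forall>x\<in>topspace X. \<phi> x1 \<le> \<phi> x"
      obtain y0 where y0: "y0 \<in> ball z r" "x1 = chart_inv c y0" using x1 by (auto simp: Ub_def kk)
      define u where "u = \<phi> \<circ> chart_inv c"
      define H where "H = F \<circ> chart_inv c"
      have sm: "smooth_function A \<phi>" using a by (simp add: adm_def)
      have u: "Ck_on 2 u (chart_img c)" using adm_chart[OF a c] by (simp add: u_def)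
      have inX: "chart_inv c y \<in> topspace X" if "y \<in> chart_img c" for y
        using inv_mem[OF that] dom_subset[OF c] by blast
      have c2r: "cball y0 r \<subseteq> ball z (2 * r)"
      proof
        fix y assume "y \<in> cball y0 r"
        then show "y \<in> ball z (2 * r)" using y0(1) dist_triangle[of z y y0] by simp
      qed
      then have c4: "cball y0 r \<subseteq> cball z (4 * r)" using r by (auto simp: subset_eq)
      then have cU: "cball y0 r \<subseteq> chart_img c" using sub by blast
      define S where "S = {y \<in> cball y0 r. u y \<le> u y0 + \<epsilon> * r\<^sup>2}"
      have S: "S \<in> sets borel"
        unfolding S_def by (intro borel_closed closed_sublevel_cball[OF _ _ cU] continuous_intros continuous_on_Ck_on_2[OF u])
      have cH: "continuous_on (chart_img c) H" using Ck_on_chart[OF F c, of 0] by (simp add: H_def)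
      define G where "G x = ennreal ((1 + \<bar>F x\<bar> powr p) * exp (2 * real CARD('n) * F x))" for x
      have Gm: "G \<in> borel_measurable BX"
      proof -
        note [measurable] = smooth_function_measurable(1)[OF F]
        show ?thesis unfolding G_def by measurable
      qed
      have ent: "(\<integral>\<^sup>+y\<in>cball y0 r. ennreal ((1 + \<bar>H y\<bar> powr p) * exp (2 * real CARD('n) * H y)) \<partial>lborel) \<le> ennreal (K / \<delta>)"
      proof -
        have "ennreal \<delta> * (\<integral>\<^sup>+y\<in>cball y0 r. ennreal ((1 + \<bar>H y\<bar> powr p) * exp (2 * real CARD('n) * H y)) \<partial>lborel) =
           (\<integral>\<^sup>+y\<in>cball y0 r. ennreal \<delta> * G (chart_inv c y) \<partial>lborel)"
        proof -
          have "continuous_on (cball y0 r) (\<lambda>y. (1 + \<bar>H y\<bar> powr p) * exp (2 * real CARD('n) * H y))"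
            using p by (intro continuous_intros continuous_on_powr' continuous_on_subset[OF cH cU]) auto
          then have "(\<lambda>y. indicator (cball y0 r) y *\<^sub>R ((1 + \<bar>H y\<bar> powr p) * exp (2 * real CARD('n) * H y))) \<in> borel_measurable borel"
            by (intro borel_measurable_continuous_on_indicator) auto
          then have "(\<lambda>y. ennreal (indicator (cball y0 r) y *\<^sub>R ((1 + \<bar>H y\<bar> powr p) * exp (2 * real CARD('n) * H y)))) \<in> borel_measurable borel"
            by (rule measurable_compose[OF _ measurable_ennreal])
          moreover have "(\<lambda>y. ennreal (indicator (cball y0 r) y *\<^sub>R ((1 + \<bar>H y\<bar> powr p) * exp (2 * real CARD('n) * H y)))) =
              (\<lambda>y. G (chart_inv c y) * indicator (cball y0 r) y)"
            by (simp add: fun_eq_iff indicator_def G_def H_def)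
          ultimately have "(\<lambda>y. G (chart_inv c y) * indicator (cball y0 r) y) \<in> borel_measurable lborel"
            unfolding measurable_lborel2 by (simp only:)
          then have "(\<integral>\<^sup>+y. ennreal \<delta> * (G (chart_inv c y) * indicator (cball y0 r) y) \<partial>lborel) =
             ennreal \<delta> * (\<integral>\<^sup>+y. G (chart_inv c y) * indicator (cball y0 r) y \<partial>lborel)"
            by (rule nn_integral_cmult)
          then show ?thesis by (simp add: G_def H_def mult.assoc)
        qed
        also have "\<dots> \<le> (\<integral>\<^sup>+y\<in>chart_img c. G (chart_inv c y) * ennreal (dens c y) \<partial>lborel)"
        proof (rule nn_integral_mono)
          fix y
          show "ennreal \<delta> * G (chart_inv c y) * indicator (cball y0 r) y \<le> G (chart_inv c y) * ennreal (dens c y) * indicator (chart_img c) y"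
          proof (cases "y \<in> cball y0 r")
            case True
            then have "y \<in> chart_img c" "\<delta> \<le> dens c y" using cU c4 \<delta>(3) by blast+
            then show ?thesis using True by (simp add: mult.commute[of "ennreal \<delta>"] mult_left_mono ennreal_leI)
          qed simp
        qed
        also have "\<dots> \<le> (\<integral>\<^sup>+x. G x \<partial>vol)" by (rule nn_integral_chart_le[OF c Gm])
        also have "\<dots> \<le> ennreal K" using en by (simp add: entropy_norm_def G_def vol_def)
        finally have 1: "ennreal \<delta> * (\<integral>\<^sup>+y\<in>cball y0 r. ennreal ((1 + \<bar>H y\<bar> powr p) * exp (2 * real CARD('n) * H y)) \<partial>lborel) \<le> ennreal K" .
        have "ennreal (1 / \<delta>) * (ennreal \<delta> * Z) = Z" for Z
          using \<delta>(1) by (simp add: mult.assoc[symmetric] ennreal_mult[symmetric])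
        moreover have "ennreal (1 / \<delta>) * ennreal K = ennreal (K / \<delta>)" using \<delta>(1) K by (simp add: ennreal_mult[symmetric])
        ultimately show ?thesis using mult_left_mono[OF 1, of "ennreal (1 / \<delta>)"] by simp
      qed
      have eig: "\<forall>y\<in>cball y0 r. \<exists>l. L.eigen u y l \<and> l \<in> \<Gamma> \<and> f l = exp (H y)"
      proof
        fix y assume "y \<in> cball y0 r"
        then have y: "y \<in> chart_img c" using cU by blast
        obtain l where "eigenvalue_vector (T10 (J c (chart_map c (chart_inv c y)))) (h_endo J g \<phi> c (chart_map c (chart_inv c y))) l"
          "l \<in> \<Gamma>" "f l = exp (F (chart_inv c y))"
          using eq c inv_mem[OF y] unfolding solves_equation_def by blast
        then show "\<exists>l. L.eigen u y l \<and> l \<in> \<Gamma> \<and> f l = exp (H y)"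
          using eigen_of_eigenvalue_vector[OF sm c y] y by (auto simp: u_def H_def)
      qed
      have "ennreal c2 \<le> emeasure lborel S"
        unfolding S_def
      proof (rule c2(2)[OF c4 u _ st cH eig ent])
        show "\<forall>x\<in>cball y0 r. u y0 \<le> u x" using mn cU inX y0(2) by (auto simp: u_def subset_eq)
      qed
      then have "ennreal (\<delta> * c2) \<le> ennreal \<delta> * emeasure lborel S"
        using \<delta> c2 by (simp add: ennreal_mult mult_left_mono)
      also have "\<dots> \<le> emeasure vol (chart_inv c ` S)" using c4 by (intro \<delta>(2)[OF S]) (auto simp: S_def)
      also have "\<dots> \<le> emeasure vol {x \<in> Vb k. \<phi> x \<le> \<phi> x1 + \<epsilon> * r\<^sup>2}"
      proof (rule emeasure_mono)
        show "chart_inv c ` S \<subseteq> {x \<in> Vb k. \<phi> x \<le> \<phi> x1 + \<epsilon> * r\<^sup>2}" using c2r y0(2) by (force simp: S_def Vb_def kk u_def)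
        show "{x \<in> Vb k. \<phi> x \<le> \<phi> x1 + \<epsilon> * r\<^sup>2} \<in> sets vol"
          using measurable_sublevels(1)[OF sm] ball_chart(2)[OF k[unfolded kk]] kk by simp
      qed
      finally show "ennreal (\<delta> * c2) \<le> emeasure vol {x \<in> Vb k. \<phi> x \<le> \<phi> x1 + \<epsilon> * r\<^sup>2}" .
    qed
  qed
qed

section \<open>Propagation through overlapping balls and the final bound\<close>

lemma vol_open_pos:
  assumes k: "admissible_ball k" and W: "openin X W" "W \<subseteq> Vb k" "W \<noteq> {}"
  shows "\<exists>q>0. emeasure vol W = ennreal q"
proof -
  obtain c z r where kk: "k = (c, z, r)" by (cases k)
  have c: "c \<in> A" using k kk by (auto simp: admissible_ball_def)
  have Wd: "W \<subseteq> chart_dom c" using ball_chart(4)[OF k[unfolded kk]] W(2) kk by auto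
  have o: "open (chart_map c ` W)" by (rule open_map_image[OF c W(1) Wd])
  have WBX: "W \<in> sets BX" by (rule openin_BX[OF W(1)])
  have sub: "chart_map c ` W \<subseteq> chart_img c" using Wd by (auto simp: map_mem)
  have "emeasure vol W \<le> emeasure vol (Vb k)"
    using W ball_chart(2)[OF k[unfolded kk]] kk by (intro emeasure_mono) (auto simp: sets_vol intro: openin_BX)
  then have fin: "emeasure vol W \<noteq> \<infinity>" using ball_chart(5)[OF k[unfolded kk]] kk by (auto simp: top_unique)
  have "emeasure vol W \<noteq> 0"
  proof
    assume "emeasure vol W = 0"
    then have "(\<integral>\<^sup>+y. ennreal (dens c y) * indicator (chart_map c ` W) y \<partial>lborel) = 0"
      using emeasure_vol[OF c WBX Wd] by (simp add: chart_vol_def)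
    moreover have meas: "(\<lambda>y. ennreal (dens c y) * indicator (chart_map c ` W) y) \<in> borel_measurable lborel"
    proof -
      have [measurable]: "(\<lambda>y. ennreal (indicator (chart_img c) y * dens c y)) \<in> borel_measurable borel" by (rule dens_measurable[OF c])
      have [measurable]: "chart_map c ` W \<in> sets borel" using o by simp
      have "(\<lambda>y. ennreal (indicator (chart_img c) y * dens c y) * indicator (chart_map c ` W) y) \<in> borel_measurable lborel" by measurable
      moreover have "(\<lambda>y. ennreal (indicator (chart_img c) y * dens c y) * indicator (chart_map c ` W) y) = (\<lambda>y. ennreal (dens c y) * indicator (chart_map c ` W) y)"
        using sub by (auto simp: fun_eq_iff indicator_def)
      ultimately show ?thesis by (simp only:)
    qed
    ultimately have "AE y in lborel. ennreal (dens c y) * indicator (chart_map c ` W) y = 0"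
      by (simp only: nn_integral_0_iff_AE)
    then have "AE y in lborel. y \<notin> chart_map c ` W"
    proof eventually_elim
      case (elim y)
      show ?case
      proof
        assume y: "y \<in> chart_map c ` W"
        then have "dens c y > 0" using sub dens_pos[OF c] by blast
        then show False using elim y by simp
      qed
    qed
    then have "emeasure lborel (chart_map c ` W) = 0"
      using o AE_iff_measurable[of "chart_map c ` W" lborel "\<lambda>y. y \<notin> chart_map c ` W"] by simp
    then show False using open_not_negligible[OF o] W(3) o by (simp add: negligible_iff_null_sets null_sets_completionI null_setsI)
  qed
  then show ?thesis using fin by (cases "emeasure vol W") (auto simp: less_le intro!: exI)
qed

text \<open>The property that travels from ball to ball: a maximum in the ball k0 keeps every
  admissible function bounded below on a definite portion of the ball k, with constants independent
  of the function.\<close>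

definition spread :: "('a, 'n) chart \<times> 'n coords \<times> real \<Rightarrow> ('a, 'n) chart \<times> 'n coords \<times> real \<Rightarrow> bool" where
  "spread k0 k \<longleftrightarrow> (\<exists>c0>0. \<exists>s0. \<forall>\<phi>. adm \<phi> \<longrightarrow> (\<exists>x0\<in>Ub k0. \<phi> x0 = 0) \<longrightarrow> ennreal c0 \<le> emeasure vol {x \<in> Vb k. - \<phi> x \<le> s0})"

lemma spread_small:
  assumes k: "admissible_ball k" and s: "spread k0 k" and \<eta>: "\<eta> > 0"
  shows "\<exists>s. \<forall>\<phi>. adm \<phi> \<longrightarrow> (\<exists>x0\<in>Ub k0. \<phi> x0 = 0) \<longrightarrow> emeasure vol {x \<in> Vb k. s \<le> - \<phi> x} \<le> ennreal \<eta>"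
proof -
  obtain c0 s0 where c0: "c0 > 0" "\<And>\<phi>. adm \<phi> \<Longrightarrow> (\<exists>x0\<in>Ub k0. \<phi> x0 = 0) \<Longrightarrow> ennreal c0 \<le> emeasure vol {x \<in> Vb k. - \<phi> x \<le> s0}"
    using s unfolding spread_def by blast
  show ?thesis using large_set_small[OF k c0(1) \<eta>, of s0] c0(2) by blast
qed

text \<open>Let q be the volume of the overlap. Making the set where -\<phi> is large have volume at
  most q/2 in the first ball leaves at least half of the overlap on which -\<phi> is bounded, and
  this part lies in the second ball.\<close>

lemma spread_step:
  assumes k: "admissible_ball k" "admissible_ball k'" and s: "spread k0 k" and ne: "Ub k \<inter> Ub k' \<noteq> {}"
  shows "spread k0 k'"
proof -
  define W where "W = Ub k \<inter> Ub k'"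
  have ok: "openin X (Ub k)" "openin X (Vb k)" "Ub k \<subseteq> Vb k" using ball_chart[of "fst k" "fst (snd k)" "snd (snd k)"] k(1) by auto
  have ok': "openin X (Ub k')" "openin X (Vb k')" "Ub k' \<subseteq> Vb k'" using ball_chart[of "fst k'" "fst (snd k')" "snd (snd k')"] k(2) by auto
  have W: "openin X W" "W \<subseteq> Vb k" "W \<subseteq> Vb k'" using ok ok' by (auto simp: W_def)
  obtain q where q: "q > 0" "emeasure vol W = ennreal q" using vol_open_pos[OF k(1) W(1,2)] ne by (auto simp: W_def)
  obtain t where t: "\<And>\<phi>. adm \<phi> \<Longrightarrow> (\<exists>x0\<in>Ub k0. \<phi> x0 = 0) \<Longrightarrow> emeasure vol {x \<in> Vb k. t \<le> - \<phi> x} \<le> ennreal (q / 2)"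
    using spread_small[OF k(1) s, of "q / 2"] q by auto
  show ?thesis
    unfolding spread_def
  proof (rule exI[of _ "q / 2"], rule conjI, goal_cases pos bound)
    case pos
    show ?case using q by simp
  next
    case bound
    show ?case
    proof (rule exI[of _ t], intro allI impI)
      fix \<phi> assume a: "adm \<phi>" and z: "\<exists>x0\<in>Ub k0. \<phi> x0 = 0"
      have sm: "smooth_function A \<phi>" using a by (simp add: adm_def)
      have sets: "{x \<in> Vb k. t \<le> - \<phi> x} \<in> sets vol" "{x \<in> Vb k'. - \<phi> x \<le> t} \<in> sets vol"
      proof -
        have "{x \<in> Vb k. t \<le> - \<phi> x} = {x \<in> Vb k. \<phi> x \<le> - t}" "{x \<in> Vb k'. - \<phi> x \<le> t} = {x \<in> Vb k'. - t \<le> \<phi> x}" by auto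
        then show "{x \<in> Vb k. t \<le> - \<phi> x} \<in> sets vol" "{x \<in> Vb k'. - \<phi> x \<le> t} \<in> sets vol"
          using measurable_sublevels[OF sm] ok(2) ok'(2) by simp_all
      qed
      have "ennreal q = emeasure vol W" using q by simp
      also have "\<dots> \<le> emeasure vol ({x \<in> Vb k. t \<le> - \<phi> x} \<union> {x \<in> Vb k'. - \<phi> x \<le> t})"
        using W sets by (intro emeasure_mono) auto
      also have "\<dots> \<le> emeasure vol {x \<in> Vb k. t \<le> - \<phi> x} + emeasure vol {x \<in> Vb k'. - \<phi> x \<le> t}"
        by (rule emeasure_subadditive[OF sets])
      also have "\<dots> \<le> ennreal (q / 2) + emeasure vol {x \<in> Vb k'. - \<phi> x \<le> t}"
        by (intro add_right_mono t a z)
      finally have le: "ennreal q \<le> ennreal (q / 2) + emeasure vol {x \<in> Vb k'. - \<phi> x \<le> t}" .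
      show "ennreal (q / 2) \<le> emeasure vol {x \<in> Vb k'. - \<phi> x \<le> t}"
      proof (cases "emeasure vol {x \<in> Vb k'. - \<phi> x \<le> t}")
        case (real e)
        then have "ennreal q \<le> ennreal (q / 2 + e)" using le q by (simp add: ennreal_plus)
        then have "q \<le> q / 2 + e" using real q by (subst (asm) ennreal_le_iff) auto
        then show ?thesis using real by (simp add: ennreal_leI)
      qed simp
    qed
  qed
qed

lemma finite_ball_cover:
  obtains I where "finite I" "\<And>k. k \<in> I \<Longrightarrow> admissible_ball k" "(\<Union>k\<in>I. Ub k) = topspace X"
proof -
  have "\<exists>k. admissible_ball k \<and> x \<in> Ub k" if x: "x \<in> topspace X" for x
  proof -
    obtain c where c: "c \<in> A" "x \<in> chart_dom c" using cover[OF x] by blast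
    obtain e where e: "e > 0" "cball (chart_map c x) e \<subseteq> chart_img c"
      using open_img[OF c(1)] map_mem[OF c(2)] open_contains_cball by blast
    have "admissible_ball (c, chart_map c x, e / 4)" using c e by (simp add: admissible_ball_def)
    moreover have "x \<in> Ub (c, chart_map c x, e / 4)"
      unfolding Ub_def using c e by (auto intro!: image_eqI[of _ _ "chart_map c x"])
    ultimately show ?thesis by blast
  qed
  then obtain K where K: "\<And>x. x \<in> topspace X \<Longrightarrow> admissible_ball (K x) \<and> x \<in> Ub (K x)" by metis
  have op: "openin X (Ub k)" if "admissible_ball k" for k
    using ball_chart(1)[of "fst k" "fst (snd k)" "snd (snd k)"] that by simp
  have "compact_space X" using manifold by (simp add: compact_connected_manifold_def)
  moreover have "\<forall>U\<in>Ub ` K ` topspace X. openin X U" using K op by auto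
  moreover have "topspace X \<subseteq> \<Union> (Ub ` K ` topspace X)" using K by auto
  ultimately obtain F where F: "finite F" "F \<subseteq> Ub ` K ` topspace X" "topspace X \<subseteq> \<Union> F"
    unfolding compact_space_alt by metis
  then obtain I where I: "I \<subseteq> K ` topspace X" "finite I" "F = Ub ` I" by (meson finite_subset_image)
  show ?thesis
  proof (rule that[of I])
    show "admissible_ball k" if "k \<in> I" for k using that I K by auto
    then have "Ub k \<subseteq> topspace X" if "k \<in> I" for k using that op openin_subset by blast
    then show "(\<Union>k\<in>I. Ub k) = topspace X" using F(3) I(3) by blast
  qed (rule I)
qed

text \<open>By \<open>spread_step\<close> the balls that are reached from k0 are disjoint from those
  that are not. Their unions would be two nonempty disjoint open sets covering the connected space
  X; k0 itself is reached by \<open>small_set_at_max\<close>.\<close>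

lemma spread_everywhere:
  assumes I: "\<And>k. k \<in> I \<Longrightarrow> admissible_ball k" "(\<Union>k\<in>I. Ub k) = topspace X" and k0: "k0 \<in> I" and k1: "k1 \<in> I"
  shows "spread k0 k1"
proof -
  have op: "openin X (Ub k)" if "k \<in> I" for k
    using ball_chart(1)[of "fst k" "fst (snd k)" "snd (snd k)"] I(1)[OF that] by simp
  have ne: "Ub k \<noteq> {}" if "k \<in> I" for k using I(1)[OF that] by (auto simp: Ub_def admissible_ball_def)
  define R where "R = {k \<in> I. spread k0 k}"
  have "k0 \<in> R" using k0 small_set_at_max[OF I(1)[OF k0]] by (simp add: R_def spread_def)
  have "R = I"
  proof (rule ccontr)
    assume "R \<noteq> I"
    then obtain k2 where k2: "k2 \<in> I - R" by (auto simp: R_def)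
    define U1 where "U1 = (\<Union>k\<in>R. Ub k)"
    define U2 where "U2 = (\<Union>k\<in>I - R. Ub k)"
    have "openin X U1" "openin X U2" unfolding U1_def U2_def using op by (auto simp: R_def)
    moreover have "topspace X \<subseteq> U1 \<union> U2" using I(2) by (auto simp: U1_def U2_def)
    moreover have "U1 \<inter> U2 = {}"
    proof (rule ccontr)
      assume "U1 \<inter> U2 \<noteq> {}"
      then obtain k k' where "k \<in> R" "k' \<in> I - R" "Ub k \<inter> Ub k' \<noteq> {}"
        unfolding U1_def U2_def by blast
      then have "spread k0 k'" using spread_step[of k k' k0] I(1) by (auto simp: R_def)
      then show False using \<open>k' \<in> I - R\<close> by (auto simp: R_def)
    qed
    moreover have "U1 \<noteq> {}" "U2 \<noteq> {}"
      unfolding U1_def U2_def using \<open>k0 \<in> R\<close> k2 ne[OF k0] ne[of k2] by blast+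
    moreover have "connected_space X" using manifold by (simp add: compact_connected_manifold_def)
    ultimately show False unfolding connected_space_def by blast
  qed
  then show ?thesis using k1 by (auto simp: R_def)
qed

text \<open>If -\<phi> x1 exceeded s + t, the sublevel set at the minimum, of volume at least c1,
  would lie in the set where -\<phi> >= s, of volume at most c1/2. The constants depend on the pair
  of balls, and a finite sum of absolute values dominates all of them.\<close>

lemma oscillation_bound:
  assumes p: "p > 0" and \<gamma>: "\<gamma> > 0" and K: "K > 0"
  shows "\<exists>C\<ge>0. \<forall>\<phi> \<Gamma> f F x0 x1. adm \<phi> \<longrightarrow> structural_conditions \<Gamma> f \<gamma> \<longrightarrow> smooth_function A F \<longrightarrow>
    entropy_norm X A J g p F \<le> ennreal K \<longrightarrow> solves_equation A J g \<Gamma> f F \<phi> \<longrightarrow>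
    x0 \<in> topspace X \<longrightarrow> \<phi> x0 = 0 \<longrightarrow> x1 \<in> topspace X \<longrightarrow> (\<forall>x\<in>topspace X. \<phi> x1 \<le> \<phi> x) \<longrightarrow> - \<phi> x1 \<le> C"
proof -
  obtain I where I: "finite I" "\<And>k. k \<in> I \<Longrightarrow> admissible_ball k" "(\<Union>k\<in>I. Ub k) = topspace X"
    by (rule finite_ball_cover) blast
  have "\<exists>C. \<forall>\<phi> \<Gamma> f F x0 x1. adm \<phi> \<longrightarrow> structural_conditions \<Gamma> f \<gamma> \<longrightarrow> smooth_function A F \<longrightarrow>
    entropy_norm X A J g p F \<le> ennreal K \<longrightarrow> solves_equation A J g \<Gamma> f F \<phi> \<longrightarrow>
    x0 \<in> Ub k0 \<longrightarrow> \<phi> x0 = 0 \<longrightarrow> x1 \<in> Ub k1 \<longrightarrow> (\<forall>x\<in>topspace X. \<phi> x1 \<le> \<phi> x) \<longrightarrow> - \<phi> x1 \<le> C"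
    if k0: "k0 \<in> I" and k1: "k1 \<in> I" for k0 k1
  proof -
    note a1 = I(2)[OF k1]
    obtain c1 t where c1: "c1 > 0" "\<And>\<phi> \<Gamma> f F x1. adm \<phi> \<Longrightarrow> structural_conditions \<Gamma> f \<gamma> \<Longrightarrow> smooth_function A F \<Longrightarrow>
      entropy_norm X A J g p F \<le> ennreal K \<Longrightarrow> solves_equation A J g \<Gamma> f F \<phi> \<Longrightarrow>
      x1 \<in> Ub k1 \<Longrightarrow> (\<forall>x\<in>topspace X. \<phi> x1 \<le> \<phi> x) \<Longrightarrow> ennreal c1 \<le> emeasure vol {x \<in> Vb k1. \<phi> x \<le> \<phi> x1 + t}"
      using sublevel_at_min[OF a1 p \<gamma> K] by blast
    obtain s where s: "\<And>\<phi>. adm \<phi> \<Longrightarrow> (\<exists>x0\<in>Ub k0. \<phi> x0 = 0) \<Longrightarrow> emeasure vol {x \<in> Vb k1. s \<le> - \<phi> x} \<le> ennreal (c1 / 2)"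
      using spread_small[OF a1 spread_everywhere[OF I(2,3) k0 k1], of "c1 / 2"] c1(1) by auto
    show ?thesis
    proof (intro exI[of _ "s + t"] allI impI)
      fix \<phi> \<Gamma> f F x0 x1
      assume h: "adm \<phi>" "structural_conditions \<Gamma> f \<gamma>" "smooth_function A F" "entropy_norm X A J g p F \<le> ennreal K"
        "solves_equation A J g \<Gamma> f F \<phi>" "x0 \<in> Ub k0" "\<phi> x0 = 0" "x1 \<in> Ub k1" "\<forall>x\<in>topspace X. \<phi> x1 \<le> \<phi> x"
      have sm: "smooth_function A \<phi>" using h(1) by (simp add: adm_def)
      have ov: "openin X (Vb k1)" using ball_chart(2)[of "fst k1" "fst (snd k1)" "snd (snd k1)"] a1 by simp
      show "- \<phi> x1 \<le> s + t"
      proof (rule ccontr)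
        assume "\<not> - \<phi> x1 \<le> s + t"
        then have "{x \<in> Vb k1. \<phi> x \<le> \<phi> x1 + t} \<subseteq> {x \<in> Vb k1. s \<le> - \<phi> x}" by auto
        moreover have "{x \<in> Vb k1. s \<le> - \<phi> x} = {x \<in> Vb k1. \<phi> x \<le> - s}" by auto
        ultimately have "emeasure vol {x \<in> Vb k1. \<phi> x \<le> \<phi> x1 + t} \<le> emeasure vol {x \<in> Vb k1. s \<le> - \<phi> x}"
          using measurable_sublevels(1)[OF sm ov] by (intro emeasure_mono) simp_all
        then have "ennreal c1 \<le> ennreal (c1 / 2)"
          using c1(2)[OF h(1-5,8,9)] s[OF h(1)] h(6,7) by (meson order_trans)
        then show False using c1(1) by (simp add: ennreal_le_iff)
      qed
    qed
  qed
  then obtain C where C: "\<And>k0 k1 \<phi> \<Gamma> f F x0 x1. k0 \<in> I \<Longrightarrow> k1 \<in> I \<Longrightarrow> adm \<phi> \<Longrightarrow> structural_conditions \<Gamma> f \<gamma> \<Longrightarrow> smooth_function A F \<Longrightarrow>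
    entropy_norm X A J g p F \<le> ennreal K \<Longrightarrow> solves_equation A J g \<Gamma> f F \<phi> \<Longrightarrow>
    x0 \<in> Ub k0 \<Longrightarrow> \<phi> x0 = 0 \<Longrightarrow> x1 \<in> Ub k1 \<Longrightarrow> (\<forall>x\<in>topspace X. \<phi> x1 \<le> \<phi> x) \<Longrightarrow> - \<phi> x1 \<le> C k0 k1" by metis
  show ?thesis
  proof (intro exI[of _ "\<Sum>k0\<in>I. \<Sum>k1\<in>I. \<bar>C k0 k1\<bar>"] conjI allI impI)
    show "0 \<le> (\<Sum>k0\<in>I. \<Sum>k1\<in>I. \<bar>C k0 k1\<bar>)" by (intro sum_nonneg) auto
    fix \<phi> \<Gamma> f F x0 x1
    assume h: "adm \<phi>" "structural_conditions \<Gamma> f \<gamma>" "smooth_function A F" "entropy_norm X A J g p F \<le> ennreal K"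
        "solves_equation A J g \<Gamma> f F \<phi>" "x0 \<in> topspace X" "\<phi> x0 = 0" "x1 \<in> topspace X" "\<forall>x\<in>topspace X. \<phi> x1 \<le> \<phi> x"
    obtain k0 where k0: "k0 \<in> I" "x0 \<in> Ub k0" using h(6) I(3) by blast
    obtain k1 where k1: "k1 \<in> I" "x1 \<in> Ub k1" using h(8) I(3) by blast
    have "- \<phi> x1 \<le> C k0 k1" by (rule C[OF k0(1) k1(1) h(1-5) k0(2) h(7) k1(2) h(9)])
    also have "\<dots> \<le> \<bar>C k0 k1\<bar>" by simp
    also have "\<dots> \<le> (\<Sum>k1\<in>I. \<bar>C k0 k1\<bar>)" using I(1) k1(1) by (intro member_le_sum) auto
    also have "\<dots> \<le> (\<Sum>k0\<in>I. \<Sum>k1\<in>I. \<bar>C k0 k1\<bar>)"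
      using I(1) k0(1) by (intro member_le_sum[of k0 I "\<lambda>k0. \<Sum>k1\<in>I. \<bar>C k0 k1\<bar>"] sum_nonneg) auto
    finally show "- \<phi> x1 \<le> (\<Sum>k0\<in>I. \<Sum>k1\<in>I. \<bar>C k0 k1\<bar>)" .
  qed
qed

end

theorem theorem5:
  fixes X :: "'a topology"
    and A :: "('a, 'n::finite) chart set"
    and J :: "('a, 'n) endo_field"
    and g :: "('a, 'n) bilin_field"
    and p \<gamma> K :: real
  assumes "compact_connected_manifold X A"
    and "almost_complex_structure A J"
    and "almost_hermitian_metric A J g"
    and "p > 2 * real CARD('n)"
    and "\<gamma> > 0"
    and "K > 0"
  shows "\<exists>C::real. \<forall>(\<Gamma> :: (real ^ 'n) set) f F \<phi>.
           structural_conditions \<Gamma> f \<gamma> \<and>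
           smooth_function A F \<and>
           entropy_norm X A J g p F \<le> ennreal K \<and>
           smooth_function A \<phi> \<and>
           solves_equation A J g \<Gamma> f F \<phi> \<and>
           (SUP x\<in>topspace X. \<phi> x) = 0
           \<longrightarrow> (SUP x\<in>topspace X. \<bar>\<phi> x\<bar>) \<le> C"
proof -
  interpret almost_hermitian_manifold X A J g by unfold_locales fact+
  have p: "p > 0" using assms(4) of_nat_0_le_iff[of "CARD('n)"] by linarith
  obtain C where C: "\<And>\<phi> \<Gamma> f F x0 x1. adm \<phi> \<Longrightarrow> structural_conditions \<Gamma> f \<gamma> \<Longrightarrow> smooth_function A F \<Longrightarrow>
    entropy_norm X A J g p F \<le> ennreal K \<Longrightarrow> solves_equation A J g \<Gamma> f F \<phi> \<Longrightarrow>
    x0 \<in> topspace X \<Longrightarrow> \<phi> x0 = 0 \<Longrightarrow> x1 \<in> topspace X \<Longrightarrow> (\<forall>x\<in>topspace X. \<phi> x1 \<le> \<phi> x) \<Longrightarrow> - \<phi> x1 \<le> C"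
    using oscillation_bound[OF p assms(5,6)] by blast
  show ?thesis
  proof (intro exI[of _ C] allI impI, elim conjE)
    fix \<Gamma> :: "(real ^ 'n) set" and f F \<phi>
    assume st: "structural_conditions \<Gamma> f \<gamma>" and F: "smooth_function A F"
      and en: "entropy_norm X A J g p F \<le> ennreal K" and sm: "smooth_function A \<phi>"
      and eq: "solves_equation A J g \<Gamma> f F \<phi>" and sup: "(SUP x\<in>topspace X. \<phi> x) = 0"
    have ne: "topspace X \<noteq> {}" and "compact_space X" using manifold by (auto simp: compact_connected_manifold_def)
    then have "compactin euclideanreal (\<phi> ` topspace X)"
      using image_compactin[OF _ smooth_function_measurable(2)[OF sm]] by (simp add: compact_space_def)
    then have cpt: "compact (\<phi> ` topspace X)" by simp
    obtain x0 where x0: "x0 \<in> topspace X" "\<And>x. x \<in> topspace X \<Longrightarrow> \<phi> x \<le> \<phi> x0"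
      using compact_attains_sup[OF cpt] ne by auto
    obtain x1 where x1: "x1 \<in> topspace X" "\<And>x. x \<in> topspace X \<Longrightarrow> \<phi> x1 \<le> \<phi> x"
      using compact_attains_inf[OF cpt] ne by auto
    \<comment> \<open>By compactness the supremum is attained, so the normalisation provides a point
      with \<phi> = 0, from which the propagation starts.\<close>
    have "(SUP x\<in>topspace X. \<phi> x) = \<phi> x0" using x0 by (intro cSup_eq_maximum) auto
    then have z: "\<phi> x0 = 0" using sup by simp
    have "adm \<phi>"
      unfolding adm_def
    proof (intro conjI ballI)
      fix c y assume c: "c \<in> A" and y: "y \<in> chart_img c"
      obtain l where l: "eigenvalue_vector (T10 (J c (chart_map c (chart_inv c y)))) (h_endo J g \<phi> c (chart_map c (chart_inv c y))) l" "l \<in> \<Gamma>"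
        using eq c inv_mem[OF y] unfolding solves_equation_def by blast
      then show "\<exists>l. local_hermitian.eigen (J c) (g c) (\<phi> \<circ> chart_inv c) y l \<and> (\<Sum>i\<in>UNIV. l $ i) > 0"
        using eigen_of_eigenvalue_vector[OF sm c y] sum_eigenvalues_pos[OF st] y by auto
    qed (use sm x0 z in auto)
    then have "- \<phi> x1 \<le> C" using C[OF _ st F en eq x0(1) z x1(1)] x1(2) by blast
    show "(SUP x\<in>topspace X. \<bar>\<phi> x\<bar>) \<le> C"
    proof (rule cSUP_least[OF ne])
      fix x assume "x \<in> topspace X"
      then show "\<bar>\<phi> x\<bar> \<le> C" using x0(2)[of x] x1(2)[of x] z \<open>- \<phi> x1 \<le> C\<close> by linarith
    qed
  qed
qed

end
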